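(* Let $T>0$, $d\ge 1$, and let $W=(W^1,\dots,W^d)$ be a $d$-dimensional Gaussian process on $[0,T]$ with a strictly regular kernel $K$. Let $k\ge 1$ and $(i_1,\dots,i_k)\in\{1,\dots,d\}^k$. If $k=2n$ for some $n\in\mathbb{N}$ and $(i_1,\dots,i_{2n})\in E_{2n}$, then the coefficient of $e_{i_1}\otimes e_{i_2}\otimes\cdots\otimes e_{i_k}$ in the expected signature $\mathbb{E}[S(W)_{0,T}]$ of $W$ up to time $T$ equals $$\sum_{\pi\in\Pi_{i_1,\dots,i_{2n}}}\int_{\triangle_{2n}(T)}\ \prod_{(l,j)\in\pi}\left[\int_0^{u_j\wedge u_l}\partial_1K(u_j,r)\,\partial_1K(u_l,r)\,\mathrm{d}r\right]\mathrm{d}u_1\cdots\mathrm{d}u_{2n},$$ where $\triangle_{2n}(T)=\{(u_1,\dots,u_{2n})\in\mathbb{R}^{2n}:0\le u_1<\cdots<u_{2n}\le T\}$. Otherwise (that is, if $k$ is odd, or $k=2n$ and $(i_1,\dots,i_{2n})\notin E_{2n}$) this coefficient is zero.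
   Context: **Strictly regular kernels.** Fix $T>0$ and let $\triangle'=\{(t,s)\in\mathbb{R}^2:0\le s<t\le T\}$. A strictly regular kernel is a (measurable) function $K:\triangle'\to\mathbb{R}$ such that: (K1) for each $r$, $K(\cdot,r)$ is absolutely continuous on $(r,T]$; (K2) $K(r^+,r):=\lim_{t\downarrow r}K(t,r)=0$ for all $r\in[0,T)$; (K3) if $|K|((r,T],r)$ denotes the total variation of $K(\cdot,r)$ on $(r,T]$, then $\int_0^T|K|((r,T],r)^2\,\mathrm{d}r<\infty$. $\partial_1K$ is the derivative of $K$ in its first variable. A (real-valued) Gaussian process with strictly regular kernel $K$ is $W_t=\int_0^tK(t,r)\,\mathrm{d}B_r$, $t\in[0,T]$, with $B$ a standard Brownian motion and the integral in the Itô sense (a continuous modification is used). A $d$-dimensional Gaussian process with strictly regular kernel $K$ is an $\mathbb{R}^d$-valued process whose coordinates are independent and identically distributed copies of such a process. **Pairings.** A pairing of $\{1,\dots,2n\}$ is a set $\pi=\{(a(i),b(i)):i=1,\dots,n\}$ with $a(i)<b(i)$ for all $i$, in which every element of $\{1,\dots,2n\}$ occurs exactly once. $\Pi_{2n}$ is the set of all pairings of $\{1,\dots,2n\}$. $E_{2n}$ is the set of $(i_1,\dots,i_{2n})\in\{1,\dots,d\}^{2n}$ such that for every $c\in\{1,\dots,d\}$ the set $\{j:i_j=c\}$ has an even number of elements. $\Pi_{i_1,\dots,i_{2n}}$ is the set of $\pi\in\Pi_{2n}$ such that $(l,j)\in\pi$ implies $i_l=i_j$. **Signatures.** $e_1,\dots,e_d$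 is the standard basis of $\mathbb{R}^d$. For a continuous path $\gamma:[0,T]\to\mathbb{R}^d$ of bounded variation and $0\le s\le t\le T$, $S(\gamma)_{s,t}=1+\sum_{n\ge1}\int_{s<t_1<\cdots<t_n<t}\mathrm{d}\gamma_{t_1}\otimes\cdots\otimes\mathrm{d}\gamma_{t_n}$, and $S_N(\gamma)_{s,t}$ is its truncation to levels $0,\dots,N$, an element of $T^N(\mathbb{R}^d)=\bigoplus_{k=0}^N(\mathbb{R}^d)^{\otimes k}$. Let $\pi_k$ be the projection to level $k$. $\mathcal{V}^p(T^N(\mathbb{R}^d))$ is the set of continuous $w:\{0\le s\le t\le T\}\to T^N(\mathbb{R}^d)$ with $\pi_0(w)\equiv1$ and $\max_{1\le k\le N}\sup_D(\sum_l|\pi_k(w_{t_{l-1},t_l})|^{p/k})^{k/p}<\infty$, and $\rho^{(N)}_{p\text{-}var}(w^1,w^2)=\max_{1\le k\le N}\sup_D(\sum_l|\pi_k(w^1_{t_{l-1},t_l})-\pi_k(w^2_{t_{l-1},t_l})|^{p/k})^{k/p}$, the suprema being over partitions $D$ of $[0,T]$. By Lyons' extension theorem, a multiplicative $w\in\mathcal{V}^p(T^{\lfloor p\rfloor}(\mathbb{R}^d))$ (i.e. $w_{s,u}\otimes w_{u,t}=w_{s,t}$) has for each $N\ge\lfloor p\rfloor$ a unique multiplicative extension $S_N(w)\in\mathcal{V}^p(T^N(\mathbb{R}^d))$. **Expected signature of a Gaussian process.** Let $X$ be a centred continuous $\mathbb{R}^d$-valued Gaussian process on $[0,T]$ with independent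 components whose covariance $R_X(s,t)=\mathbb{E}[X_s\otimes X_t]$ has finite 2D $\rho$-variation for some $\rho\in[1,2)$, i.e. $\sup\sum_{i,j}|R_X(t_i,t'_j)+R_X(t_{i+1},t'_{j+1})-R_X(t_i,t'_{j+1})-R_X(t_{i+1},t'_j)|^\rho<\infty$ over pairs of partitions of $[0,T]$. (Processes with strictly regular kernels satisfy this with $\rho=1$.) It is a known theorem (Friz–Riedel) that there is a multiplicative process $\mathbf{X}$ with sample paths a.s. in $\mathcal{V}^p(T^{\lfloor p\rfloor}(\mathbb{R}^d))$ for all $p\in(2\rho,4)$ such that for every $\gamma>\rho$ with $\frac1\gamma+\frac1\rho>1$, every $q>2\gamma$ and $N\in\mathbb{N}$, there is a constant $C$ with $$\left\|\rho^{(N)}_{q\text{-}var}\big(S_N(X^{D}),S_N(\mathbf{X})\big)\right\|_{L^r}\le C\,r^{N/2}\sup_{0\le t\le T}\|X^{D}_t-X_t\|_{L^2}^{1-\rho/\gamma}$$ for all $r\ge1$ and every piecewise linear interpolation $X^{D}$ of $X$ along a partition $D$ of $[0,T]$. One writes $S(X)$ for $\mathbf{X}$ together with its extensions to all levels, and the expected signature of $X$ up to time $T$ is $\mathbb{E}[S(X)_{0,T}]$ (expectation taken coefficientwise). *)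

theory Defs
  imports "HOL-Probability.Probability"
begin

section \<open>Strictly regular kernels\<close>

text \<open>
  Finite families of non-overlapping compact subintervals \<open>k = [Inf k, Sup k]\<close> of \<open>S\<close> are written as
  divisions of their union.
\<close>

definition abs_continuous_on :: "real set \<Rightarrow> (real \<Rightarrow> real) \<Rightarrow> bool" where
  "abs_continuous_on S f \<longleftrightarrow>
    (\<forall>\<epsilon>>0. \<exists>\<delta>>0. \<forall>d. d division_of \<Union>d \<and> \<Union>d \<subseteq> S \<and> (\<Sum>k\<in>d. Sup k - Inf k) < \<delta>
      \<longrightarrow> (\<Sum>k\<in>d. \<bar>f (Sup k) - f (Inf k)\<bar>) < \<epsilon>)"

definition total_variation_on :: "real set \<Rightarrow> (real \<Rightarrow> real) \<Rightarrow> ennreal" where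
  "total_variation_on S f =
    (SUP d \<in> {d. d division_of \<Union>d \<and> \<Union>d \<subseteq> S}. \<Sum>k\<in>d. ennreal \<bar>f (Sup k) - f (Inf k)\<bar>)"

text \<open>A kernel is a total function; only its values on the triangle are ever used.\<close>

definition kernel_domain :: "real \<Rightarrow> (real \<times> real) set" where
  "kernel_domain T = {(t, s). 0 \<le> s \<and> s < t \<and> t \<le> T}"

definition strictly_regular_kernel :: "real \<Rightarrow> (real \<Rightarrow> real \<Rightarrow> real) \<Rightarrow> bool" where
  "strictly_regular_kernel T K \<longleftrightarrow>
    (\<lambda>(t, s). K t s) \<in> borel_measurable (restrict_space borel (kernel_domain T)) \<and>
    (\<forall>r\<in>{0..<T}. abs_continuous_on {r<..T} (\<lambda>t. K t r)) \<and>
    (\<forall>r\<in>{0..<T}. ((\<lambda>t. K t r) \<longlongrightarrow> 0) (at_right r)) \<and>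
    (\<integral>\<^sup>+ r\<in>{0..T}. (total_variation_on {r<..T} (\<lambda>t. K t r))\<^sup>2 \<partial>lborel) < \<infinity>"

text \<open>
  The derivative of \<open>K(\<cdot>,r)\<close> exists almost everywhere on \<open>(r,T]\<close>; where it does not exist it is
  set to 0. It is taken within \<open>(r,T]\<close> (one-sided at \<open>T\<close>), so that it does not depend on
  the values of \<open>K\<close> outside the triangle.
\<close>

definition kernel_deriv :: "real \<Rightarrow> (real \<Rightarrow> real \<Rightarrow> real) \<Rightarrow> real \<Rightarrow> real \<Rightarrow> real" where
  "kernel_deriv T K t r =
    (if \<exists>D. ((\<lambda>u. K u r) has_real_derivative D) (at t within {r<..T})
     then THE D. ((\<lambda>u. K u r) has_real_derivative D) (at t within {r<..T})
     else 0)"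

section \<open>Brownian motion and processes with a strictly regular kernel\<close>

definition partitions :: "real \<Rightarrow> real list set" where
  "partitions T = {ts. ts \<noteq> [] \<and> sorted_wrt (<) ts \<and> hd ts = 0 \<and> last ts = T}"

definition brownian_motion :: "'b measure \<Rightarrow> real \<Rightarrow> (real \<Rightarrow> 'b \<Rightarrow> real) \<Rightarrow> bool" where
  "brownian_motion P T B \<longleftrightarrow>
    prob_space P \<and>
    (\<forall>t\<in>{0..T}. B t \<in> borel_measurable P) \<and>
    (AE \<omega> in P. B 0 \<omega> = 0) \<and>
    (AE \<omega> in P. continuous_on {0..T} (\<lambda>t. B t \<omega>)) \<and>
    (\<forall>s t. 0 \<le> s \<and> s < t \<and> t \<le> T \<longrightarrow>
      distributed P lborel (\<lambda>\<omega>. B t \<omega> - B s \<omega>) (normal_density 0 (sqrt (t - s)))) \<and>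
    (\<forall>ts\<in>partitions T. prob_space.indep_vars P (\<lambda>_. borel)
      (\<lambda>l \<omega>. B (ts ! Suc l) \<omega> - B (ts ! l) \<omega>) {..<length ts - 1})"

text \<open>
  \<open>has_ito_integral P B t f Y\<close> says that \<open>Y\<close> is a version of the Ito integral over \<open>[0,t]\<close> of the
  deterministic integrand \<open>f\<close> against \<open>B\<close>: the limit in \<open>L\<^sup>2(P)\<close> of the integrals of
  step functions that converge to \<open>f\<close> in \<open>L\<^sup>2([0,t])\<close>.
\<close>

definition step_function :: "real list \<Rightarrow> (nat \<Rightarrow> real) \<Rightarrow> real \<Rightarrow> real" where
  "step_function ts c r = (\<Sum>l<length ts - 1. c l * indicator {ts ! l <.. ts ! Suc l} r)"

definition step_integral :: "real list \<Rightarrow> (nat \<Rightarrow> real) \<Rightarrow> (real \<Rightarrow> real) \<Rightarrow> real" where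
  "step_integral ts c b = (\<Sum>l<length ts - 1. c l * (b (ts ! Suc l) - b (ts ! l)))"

definition has_ito_integral ::
  "'b measure \<Rightarrow> (real \<Rightarrow> 'b \<Rightarrow> real) \<Rightarrow> real \<Rightarrow> (real \<Rightarrow> real) \<Rightarrow> ('b \<Rightarrow> real) \<Rightarrow> bool" where
  "has_ito_integral P B t f Y \<longleftrightarrow>
    set_borel_measurable lborel {0..<t} f \<and> Y \<in> borel_measurable P \<and>
    (\<exists>ts c. (\<forall>n::nat. ts n \<in> partitions t) \<and>
      (\<lambda>n. \<integral>\<^sup>+ r\<in>{0..<t}. ennreal ((f r - step_function (ts n) (c n) r)\<^sup>2) \<partial>lborel)
        \<longlonglongrightarrow> 0 \<and>
      (\<lambda>n. \<integral>\<^sup>+ \<omega>. ennreal ((Y \<omega> - step_integral (ts n) (c n) (\<lambda>s. B s \<omega>))\<^sup>2) \<partial>P)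
        \<longlonglongrightarrow> 0)"

definition kernel_process ::
  "'b measure \<Rightarrow> real \<Rightarrow> (real \<Rightarrow> real \<Rightarrow> real) \<Rightarrow> (real \<Rightarrow> 'b \<Rightarrow> real) \<Rightarrow> (real \<Rightarrow> 'b \<Rightarrow> real) \<Rightarrow> bool" where
  "kernel_process P T K B V \<longleftrightarrow>
    brownian_motion P T B \<and>
    (\<forall>t\<in>{0..T}. has_ito_integral P B t (K t) (V t)) \<and>
    (AE \<omega> in P. continuous_on {0..T} (\<lambda>t. V t \<omega>))"

text \<open>
  The process \<open>W\<close> on \<open>M\<close> is continuous and its coordinates are independent copies (as processes,
  that is, with respect to the product sigma-algebra over \<open>[0,T]\<close>) of the real-valued process \<open>V\<close>,
  which may live on a different probability space \<open>P\<close>.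
\<close>

definition iid_copies ::
  "'a measure \<Rightarrow> real \<Rightarrow> (real \<Rightarrow> 'a \<Rightarrow> real ^ 'd::finite) \<Rightarrow> 'b measure \<Rightarrow> (real \<Rightarrow> 'b \<Rightarrow> real) \<Rightarrow> bool" where
  "iid_copies M T W P V \<longleftrightarrow>
    prob_space M \<and>
    (AE \<omega> in M. continuous_on {0..T} (\<lambda>t. W t \<omega>)) \<and>
    prob_space.indep_vars M (\<lambda>_. Pi\<^sub>M {0..T} (\<lambda>_. borel))
      (\<lambda>c \<omega>. \<lambda>t\<in>{0..T}. W t \<omega> $ c) UNIV \<and>
    (\<forall>c. distr M (Pi\<^sub>M {0..T} (\<lambda>_. borel)) (\<lambda>\<omega>. \<lambda>t\<in>{0..T}. W t \<omega> $ c) =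
         distr P (Pi\<^sub>M {0..T} (\<lambda>_. borel)) (\<lambda>\<omega>. \<lambda>t\<in>{0..T}. V t \<omega>))"

section \<open>Signatures and rough paths\<close>

text \<open>
  An element of the tensor series over \<open>\<real>\<^sup>d\<close> is given by its coefficients: the word \<open>[i\<^sub>1,\<dots>,i\<^sub>k]\<close>
  is mapped to the coefficient of the tensor product of the basis vectors of index
  \<open>i\<^sub>1,\<dots>,i\<^sub>k\<close>. The truncation at level \<open>N\<close> is expressed by looking only at words of length
  at most \<open>N\<close>.
\<close>

type_synonym 'd tensor = "'d list \<Rightarrow> real"

text \<open>Euclidean norm on level \<open>k\<close>; any other norm on this finite-dimensional space yields the
  same notions up to constants.\<close>

definition level_norm :: "nat \<Rightarrow> 'd::finite tensor \<Rightarrow> real" where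
  "level_norm k a = sqrt (\<Sum>w | length w = k. (a w)\<^sup>2)"

text \<open>Riemann--Stieltjes integrals over \<open>[a,b]\<close>; the gauge is a constant mesh.\<close>

definition has_rs_integral :: "real \<Rightarrow> real \<Rightarrow> (real \<Rightarrow> real) \<Rightarrow> (real \<Rightarrow> real) \<Rightarrow> real \<Rightarrow> bool" where
  "has_rs_integral a b f g I \<longleftrightarrow>
    (\<forall>\<epsilon>>0. \<exists>\<delta>>0. \<forall>D. D tagged_division_of {a..b} \<and> (\<lambda>x. ball x \<delta>) fine D \<longrightarrow>
      \<bar>(\<Sum>(x, k)\<in>D. f x * (g (Sup k) - g (Inf k))) - I\<bar> < \<epsilon>)"

definition rs_integral :: "real \<Rightarrow> real \<Rightarrow> (real \<Rightarrow> real) \<Rightarrow> (real \<Rightarrow> real) \<Rightarrow> real" where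
  "rs_integral a b f g = (THE I. has_rs_integral a b f g I)"

text \<open>
  The iterated integral over \<open>s < t\<^sub>1 < \<dots> < t\<^sub>n < t\<close> is computed from the outside, starting with
  \<open>t\<^sub>n\<close>, so the recursion runs over the reversed word.
\<close>

primrec iterated_integral_rev :: "(real \<Rightarrow> real ^ 'd) \<Rightarrow> real \<Rightarrow> 'd::finite list \<Rightarrow> real \<Rightarrow> real" where
  "iterated_integral_rev \<gamma> s [] t = 1"
| "iterated_integral_rev \<gamma> s (i # w) t =
    rs_integral s t (\<lambda>u. iterated_integral_rev \<gamma> s w u) (\<lambda>u. \<gamma> u $ i)"

definition path_signature :: "(real \<Rightarrow> real ^ 'd) \<Rightarrow> real \<Rightarrow> real \<Rightarrow> 'd::finite tensor" where
  "path_signature \<gamma> s t w = iterated_integral_rev \<gamma> s (rev w) t"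

definition rho_pvar ::
  "real \<Rightarrow> real \<Rightarrow> nat \<Rightarrow> (real \<Rightarrow> real \<Rightarrow> 'd::finite tensor) \<Rightarrow> (real \<Rightarrow> real \<Rightarrow> 'd tensor) \<Rightarrow> ennreal" where
  "rho_pvar T p N x y =
    (SUP k\<in>{1..N}. SUP ts\<in>partitions T. ennreal
      ((\<Sum>l<length ts - 1.
         level_norm k (\<lambda>w. x (ts ! l) (ts ! Suc l) w - y (ts ! l) (ts ! Suc l) w)
           powr (p / real k)) powr (real k / p)))"

definition finite_pvar :: "real \<Rightarrow> real \<Rightarrow> nat \<Rightarrow> (real \<Rightarrow> real \<Rightarrow> 'd::finite tensor) \<Rightarrow> bool" where
  "finite_pvar T p N x \<longleftrightarrow>
    (\<forall>w. length w \<le> N \<longrightarrow>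
      continuous_on {(s, t). 0 \<le> s \<and> s \<le> t \<and> t \<le> T} (\<lambda>(s, t). x s t w)) \<and>
    (\<forall>s t. 0 \<le> s \<and> s \<le> t \<and> t \<le> T \<longrightarrow> x s t [] = 1) \<and>
    rho_pvar T p N x (\<lambda>_ _ _. 0) < \<infinity>"

definition multiplicative :: "real \<Rightarrow> nat \<Rightarrow> (real \<Rightarrow> real \<Rightarrow> 'd tensor) \<Rightarrow> bool" where
  "multiplicative T N x \<longleftrightarrow>
    (\<forall>s u t w. 0 \<le> s \<and> s \<le> u \<and> u \<le> t \<and> t \<le> T \<and> length w \<le> N \<longrightarrow>
      x s t w = (\<Sum>j\<le>length w. x s u (take j w) * x u t (drop j w)))"

section \<open>The signature of a Gaussian process\<close>

definition ennreal_powr :: "ennreal \<Rightarrow> real \<Rightarrow> ennreal" where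
  "ennreal_powr x a = (if x = \<infinity> then \<infinity> else ennreal (enn2real x powr a))"

definition Lr_norm :: "'a measure \<Rightarrow> real \<Rightarrow> ('a \<Rightarrow> ennreal) \<Rightarrow> ennreal" where
  "Lr_norm M r f = ennreal_powr (\<integral>\<^sup>+ \<omega>. ennreal_powr (f \<omega>) r \<partial>M) (1 / r)"

fun pl_interpolation :: "real list \<Rightarrow> (real \<Rightarrow> 'v::real_vector) \<Rightarrow> real \<Rightarrow> 'v" where
  "pl_interpolation (a # b # ts) x t =
    (if t \<le> b then x a + ((t - a) / (b - a)) *\<^sub>R (x b - x a) else pl_interpolation (b # ts) x t)"
| "pl_interpolation [a] x t = x a"
| "pl_interpolation [] x t = 0"

definition covariance ::
  "'a measure \<Rightarrow> (real \<Rightarrow> 'a \<Rightarrow> real ^ 'd::finite) \<Rightarrow> real \<Rightarrow> real \<Rightarrow> real ^ 'd ^ 'd" where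
  "covariance M X s t = (\<chi> i j. \<integral>\<omega>. X s \<omega> $ i * X t \<omega> $ j \<partial>M)"

definition finite_2D_variation :: "real \<Rightarrow> real \<Rightarrow> (real \<Rightarrow> real \<Rightarrow> 'v::real_normed_vector) \<Rightarrow> bool" where
  "finite_2D_variation T \<rho> R \<longleftrightarrow>
    (SUP (ts, ts') \<in> partitions T \<times> partitions T. ennreal
      (\<Sum>i<length ts - 1. \<Sum>j<length ts' - 1.
        norm (R (ts ! i) (ts' ! j) + R (ts ! Suc i) (ts' ! Suc j)
            - R (ts ! i) (ts' ! Suc j) - R (ts ! Suc i) (ts' ! j)) powr \<rho>)) < \<infinity>"

text \<open>
  \<open>gaussian_signature M T X S\<close> says that \<open>S\<close> is the signature of the Gaussian process \<open>X\<close>: the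
  lift of \<open>X\<close> to a rough path, given as a limit of the signatures of piecewise linear
  interpolations, together with its extensions to all levels. For \<open>2\<rho> < p < 4\<close> the levels up to
  the integer part of \<open>p\<close> form the lift; the higher levels are its Lyons extensions
  because they are multiplicative and of finite \<open>p\<close>-variation, which determines them uniquely.
\<close>

definition gaussian_signature ::
  "'a measure \<Rightarrow> real \<Rightarrow> (real \<Rightarrow> 'a \<Rightarrow> real ^ 'd::finite) \<Rightarrow> ('a \<Rightarrow> real \<Rightarrow> real \<Rightarrow> 'd tensor) \<Rightarrow> bool" where
  "gaussian_signature M T X S \<longleftrightarrow>
    (\<forall>s t w. 0 \<le> s \<and> s \<le> t \<and> t \<le> T \<longrightarrow> (\<lambda>\<omega>. S \<omega> s t w) \<in> borel_measurable M) \<and>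
    (\<exists>\<rho>\<in>{1..<2}. finite_2D_variation T \<rho> (covariance M X) \<and>
      (\<forall>p. 2 * \<rho> < p \<and> p < 4 \<longrightarrow>
        (AE \<omega> in M. \<forall>N\<ge>nat \<lfloor>p\<rfloor>. multiplicative T N (S \<omega>) \<and> finite_pvar T p N (S \<omega>))) \<and>
      (\<forall>\<gamma> q N. \<gamma> > \<rho> \<and> 1 / \<gamma> + 1 / \<rho> > 1 \<and> q > 2 * \<gamma> \<longrightarrow>
        (\<exists>C. \<forall>r\<ge>1. \<forall>ts\<in>partitions T.
          Lr_norm M r (\<lambda>\<omega>. rho_pvar T q N
              (path_signature (pl_interpolation ts (\<lambda>t. X t \<omega>))) (S \<omega>))
          \<le> ennreal (C * r powr (real N / 2)) *
            ennreal_powr (SUP t\<in>{0..T}. Lr_norm M 2 (\<lambda>\<omega>.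
              ennreal (norm (pl_interpolation ts (\<lambda>t. X t \<omega>) t - X t \<omega>)))) (1 - \<rho> / \<gamma>))))"

definition expected_signature ::
  "'a measure \<Rightarrow> real \<Rightarrow> ('a \<Rightarrow> real \<Rightarrow> real \<Rightarrow> 'd tensor) \<Rightarrow> 'd tensor" where
  "expected_signature M T S w = (\<integral>\<omega>. S \<omega> 0 T w \<partial>M)"

section \<open>Pairings\<close>

definition pairings :: "nat \<Rightarrow> (nat \<times> nat) set set" where
  "pairings m = {\<pi>. \<pi> \<subseteq> {1..m} \<times> {1..m} \<and> (\<forall>(a, b)\<in>\<pi>. a < b) \<and>
    (\<forall>x\<in>{1..m}. \<exists>!p. p \<in> \<pi> \<and> (x = fst p \<or> x = snd p))}"

text \<open>Index tuples \<open>(i\<^sub>1,\<dots>,i\<^sub>m)\<close> are functions on the naturals of which only the values on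
  \<open>{1..m}\<close> matter.\<close>

definition even_indices :: "nat \<Rightarrow> (nat \<Rightarrow> 'd) set" where
  "even_indices m = {i. \<forall>c. even (card {j\<in>{1..m}. i j = c})}"

definition compatible_pairings :: "nat \<Rightarrow> (nat \<Rightarrow> 'd) \<Rightarrow> (nat \<times> nat) set set" where
  "compatible_pairings m i = {\<pi>\<in>pairings m. \<forall>(l, j)\<in>\<pi>. i l = i j}"

definition index_word :: "nat \<Rightarrow> (nat \<Rightarrow> 'd) \<Rightarrow> 'd list" where
  "index_word k i = map i [1..<Suc k]"

definition time_simplex :: "nat \<Rightarrow> real \<Rightarrow> (nat \<Rightarrow> real) set" where
  "time_simplex m T = {u. (\<forall>j\<in>{1..m}. 0 \<le> u j \<and> u j \<le> T) \<and> strict_mono_on {1..m} u}"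

end

theory Submission
  imports Defs
begin

text \<open>
  The interpolation \<open>W\<^sup>n\<close> of \<open>W\<close> along the uniform grid with \<open>n\<close> cells has a step function as its
  velocity. Its signature coefficient along the word \<open>i\<^sub>1 \<dots> i\<^sub>k\<close> is therefore the Lebesgue integral, over
  the simplex, of the product of the velocities of the coordinates \<open>i\<^sub>1, \<dots>, i\<^sub>k\<close> at the times
  \<open>u\<^sub>1 < \<dots> < u\<^sub>k\<close> (\<open>iterated_integral_eq_simplex_integral\<close>). The velocities are jointly Gaussian and
  centred, so Fubini's theorem and Wick's formula (\<open>wick_formula\<close>) turn its expectation into a sum over
  pairings of integrals of products of covariances. Since the coordinates are independent, only the
  compatible pairings contribute.

  Absolute continuity of \<open>K(\<cdot>,r)\<close> and its limit 0 on the diagonal say that \<open>K(t,r)\<close> is the integral of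
  \<open>\<partial>\<^sub>1K(u,r)\<close> over \<open>r < u \<le> t\<close> (\<open>triangle_deriv_FTC\<close>). By the isometry of the Wiener integral, the
  covariance of the velocities at \<open>u\<close> and \<open>v\<close> is thus the integral over \<open>r\<close> of
  \<open>d\<^sub>n(u,r) d\<^sub>n(v,r)\<close>, where \<open>d\<^sub>n(\<cdot>,r)\<close> arises from \<open>\<partial>\<^sub>1K(\<cdot>,r)\<close> by averaging over the cells of the grid.
  For each \<open>r\<close> these averages converge in \<open>L\<^sup>1\<close> (\<open>cell_average_L1\<close>), with an error of at most twice the total
  variation of \<open>K(\<cdot>,r)\<close>, which is square integrable in \<open>r\<close>. Hence the covariances converge in \<open>L\<^sup>1\<close> of the
  plane to the integral of \<open>\<partial>\<^sub>1K(u,r) \<partial>\<^sub>1K(v,r)\<close> over \<open>r\<close> (\<open>cov_kernel_L1\<close>). That is enough to pass to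
  the limit in the integrals over the simplex: the pairs of a pairing involve disjoint variables, so after
  the indicator of the simplex is bounded by 1, integrals of products over a pairing factorise
  (\<open>tendsto_integral_prod_pairing\<close>).

  It remains to see that the expected coefficients of \<open>W\<^sup>n\<close> converge to the expected coefficient of the
  signature of \<open>W\<close>. The estimate in \<open>gaussian_signature\<close>, taken in \<open>L\<^sup>1\<close>, bounds the distance of the two
  coefficients by a positive power of \<open>sup\<^sub>t \<parallel>W\<^sup>n\<^sub>t - W\<^sub>t\<parallel>\<close> in \<open>L\<^sup>2\<close>. By the isometry again, the
  square of the latter is at most \<open>d\<close> times the integral over \<open>r\<close> of the squared \<open>L\<^sup>1\<close> norm of
  \<open>d\<^sub>n(\<cdot>,r) - \<partial>\<^sub>1K(\<cdot>,r)\<close>, which tends to 0 by the same domination (\<open>L2_error_tendsto\<close>).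
  Finally, if the length of the word is odd or some letter occurs an odd number of times, then there is no
  compatible pairing and the sum is empty.
\<close>

section \<open>Lebesgue differentiation on the line\<close>

text \<open>Where the difference quotients of the primitive do not converge to \<open>g x\<close>, they stay away from it by some
  fixed amount along arbitrarily short intervals at \<open>x\<close>. Vitali's theorem selects disjoint intervals of this
  kind, and Henstock's lemma bounds the sum of their deviations, hence their total length.\<close>
lemma lebesgue_differentiation:
  fixes g :: "real \<Rightarrow> real"
  assumes g: "g integrable_on {a..b}"
  shows "negligible {x\<in>{a<..<b}. \<not> ((\<lambda>t. integral {a..t} g) has_real_derivative g x) (at x)}"
proof -
  define G where "G = (\<lambda>t. integral {a..t} g)"
  have G_diff: "integral {c..d} g = G d - G c" if "a \<le> c" "c \<le> d" "d \<le> b" for c d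
    using Henstock_Kurzweil_Integration.integral_combine[of a c d g] that
      integrable_on_subinterval[OF g, of a d] by (auto simp: G_def)
  define E where "E = (\<lambda>m. {x\<in>{a<..<b}. \<forall>\<delta>>0. \<exists>y. y \<noteq> x \<and> \<bar>y - x\<bar> < \<delta> \<and>
      \<bar>G y - G x - g x * (y - x)\<bar> > inverse (Suc m) * \<bar>y - x\<bar>})"
  have sub: "{x\<in>{a<..<b}. \<not> (G has_real_derivative g x) (at x)} \<subseteq> (\<Union>m. E m)"
  proof (clarsimp)
    fix x assume x: "a < x" "x < b" and nd: "\<not> (G has_real_derivative g x) (at x)"
    have "\<not> (\<forall>e>0. \<exists>d>0. \<forall>y. 0 < \<bar>y - x\<bar> \<and> \<bar>y - x\<bar> < d \<longrightarrow>
        \<bar>(G y - G x) / (y - x) - g x\<bar> < e)"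
      using nd by (simp add: has_field_derivative_iff LIM_def dist_real_def)
    then obtain e where e: "e > 0"
      and bad: "\<And>d. d > 0 \<Longrightarrow> \<exists>y. 0 < \<bar>y - x\<bar> \<and> \<bar>y - x\<bar> < d \<and> \<bar>(G y - G x) / (y - x) - g x\<bar> \<ge> e"
      by (meson not_less)
    obtain m where m: "inverse (Suc m) < e"
      using reals_Archimedean[OF e] by auto
    have "x \<in> E m"
      unfolding E_def
    proof (clarsimp simp: x)
      fix \<delta> :: real assume "\<delta> > 0"
      from bad[OF this] obtain y where y: "0 < \<bar>y - x\<bar>" "\<bar>y - x\<bar> < \<delta>"
        "\<bar>(G y - G x) / (y - x) - g x\<bar> \<ge> e" by auto
      have "(G y - G x) / (y - x) - g x = (G y - G x - g x * (y - x)) / (y - x)"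
        using y by (simp add: field_simps)
      with y m have "\<bar>G y - G x - g x * (y - x)\<bar> / \<bar>y - x\<bar> > inverse (Suc m)"
        by (simp add: abs_divide)
      then have "\<bar>G y - G x - g x * (y - x)\<bar> > inverse (Suc m) * \<bar>y - x\<bar>"
        using y by (subst (asm) pos_less_divide_eq) auto
      with y show "\<exists>y. y \<noteq> x \<and> \<bar>y - x\<bar> < \<delta> \<and> inverse (1 + real m) * \<bar>y - x\<bar> < \<bar>G y - G x - g x * (y - x)\<bar>"
        by auto
    qed
    then show "\<exists>m. x \<in> E m" ..
  qed
  have "negligible (E m)" for m
    unfolding negligible_outer_le
  proof (intro allI impI)
    fix \<epsilon> :: real assume \<epsilon>: "\<epsilon> > 0"
    define \<eta> where "\<eta> = inverse (real (Suc m))"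
    have \<eta>: "\<eta> > 0" by (simp add: \<eta>_def)
    obtain \<gamma> where "gauge \<gamma>" and hen: "\<And>p. \<lbrakk>p tagged_partial_division_of (cbox a b); \<gamma> fine p\<rbrakk> \<Longrightarrow>
             sum (\<lambda>(x,k). norm(measure lborel k *\<^sub>R g x - integral k g)) p < \<epsilon> * \<eta>"
      using Henstock_lemma[of g a b "\<epsilon> * \<eta>"] g \<epsilon> \<eta> by (auto simp: cbox_interval)
    (* Vitali covering is stated for balls, so the interval between x and y is a ball around its centre. *)
    define I where "I = {(x, y). x \<in> {a<..<b} \<and> y \<in> {a<..<b} \<and> y \<noteq> x \<and>
      cball ((x + y) / 2) (\<bar>y - x\<bar> / 2) \<subseteq> \<gamma> x \<and> \<bar>G y - G x - g x * (y - x)\<bar> > \<eta> * \<bar>y - x\<bar>}"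
    define cen rad where "cen = (\<lambda>(x, y). (x + y) / 2 :: real)" and "rad = (\<lambda>(x, y). \<bar>y - x\<bar> / 2 :: real)"
    have cb: "cball (cen (x, y)) (rad (x, y)) = {min x y..max x y}" for x y
      by (auto simp: cen_def rad_def cball_eq_atLeastAtMost min_def max_def abs_if field_simps)
    have pos: "\<And>i. i \<in> I \<Longrightarrow> 0 < rad i"
      by (auto simp: I_def rad_def)
    have cov: "\<exists>i. i \<in> I \<and> x \<in> cball (cen i) (rad i) \<and> rad i < d" if xE: "x \<in> E m" and d: "0 < d" for x d
    proof -
      have "x \<in> {a<..<b}" using that by (auto simp: E_def)
      moreover have "open (\<gamma> x \<inter> {a<..<b})" "x \<in> \<gamma> x"
        using \<open>gauge \<gamma>\<close> by (auto simp: gauge_def)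
      ultimately obtain e where e: "e > 0" "ball x e \<subseteq> \<gamma> x \<inter> {a<..<b}"
        using openE[of "\<gamma> x \<inter> {a<..<b}" x] by auto
      obtain y where y: "y \<noteq> x" "\<bar>y - x\<bar> < min e d" "\<bar>G y - G x - g x * (y - x)\<bar> > \<eta> * \<bar>y - x\<bar>"
      proof -
        have "min e d > 0" using e d by simp
        then show ?thesis using xE that unfolding E_def \<eta>_def by blast
      qed
      have s: "cball (cen (x, y)) (rad (x, y)) \<subseteq> ball x e"
        using y by (auto simp: cb ball_def dist_real_def)
      moreover have "y \<in> cball (cen (x, y)) (rad (x, y))" unfolding cb by auto
      ultimately have "y \<in> {a<..<b}" "cball (cen (x,y)) (rad (x,y)) \<subseteq> \<gamma> x"
        using e by blast+
      with y \<open>x \<in> {a<..<b}\<close> have "(x, y) \<in> I"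
        by (auto simp: I_def cen_def rad_def)
      moreover have "x \<in> cball (cen (x, y)) (rad (x, y))" unfolding cb by auto
      moreover have "rad (x, y) < d" using y by (auto simp: rad_def)
      ultimately show ?thesis by blast
    qed
    obtain C where C: "countable C" "C \<subseteq> I"
      "pairwise (\<lambda>i j. disjnt (cball (cen i) (rad i)) (cball (cen j) (rad j))) C"
      "negligible (E m - (\<Union>i \<in> C. cball (cen i) (rad i)))"
      using Vitali_covering_theorem_cballs[of I rad "E m" cen, OF pos cov] by blast
    have fin: "measure lebesgue (\<Union>i\<in>C'. cball (cen i) (rad i)) \<le> \<epsilon>" if C': "C' \<subseteq> C" "finite C'" for C'
    proof -
      define p where "p = (\<lambda>i. (fst i, cball (cen i) (rad i))) ` C'"
      have inj: "inj_on (\<lambda>i. (fst i, cball (cen i) (rad i))) C'"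
      proof (rule inj_onI)
        fix i j assume ij: "i \<in> C'" "j \<in> C'" "(fst i, cball (cen i) (rad i)) = (fst j, cball (cen j) (rad j))"
        then have "rad i > 0" using pos[of i] C C' by blast
        then have "cen i \<in> cball (cen i) (rad i)" "cen i \<in> cball (cen j) (rad j)"
          using ij by (auto simp: less_imp_le)
        with ij C C' show "i = j"
          unfolding pairwise_def disjnt_def by blast
      qed
      have p1: "p tagged_partial_division_of (cbox a b)"
        unfolding tagged_partial_division_of_def
      proof (intro conjI allI impI)
        show "finite p" using C' by (auto simp: p_def)
      next
        fix x k assume "(x, k) \<in> p"
        then obtain y where i: "(x, y) \<in> I" "k = cball (cen (x,y)) (rad (x,y))"
          using C' C by (force simp: p_def)
        then have k: "k = {min x y..max x y}" by (simp add: cb)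
        show "x \<in> k" "k \<subseteq> cbox a b" "\<exists>a b. k = cbox a b"
          using i(1) unfolding k by (auto simp: I_def cbox_interval)
      next
        fix x1 k1 x2 k2 assume "(x1, k1) \<in> p \<and> (x2, k2) \<in> p \<and> (x1, k1) \<noteq> (x2, k2)"
        then have *: "(x1, k1) \<in> p" "(x2, k2) \<in> p" "(x1, k1) \<noteq> (x2, k2)" by auto
        then obtain i j where "i \<in> C" "j \<in> C" "(x1, k1) = (fst i, cball (cen i) (rad i))" "(x2, k2) = (fst j, cball (cen j) (rad j))"
          using *(1,2) C'(1) unfolding p_def by blast
        with * C have "disjnt k1 k2" by (auto simp: pairwise_def)
        then show "interior k1 \<inter> interior k2 = {}"
          unfolding disjnt_def using interior_subset by blast
      qed
      have p2: "\<gamma> fine p"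
      proof (rule fineI)
        fix x k assume "(x, k) \<in> p"
        then obtain y where i: "(x, y) \<in> I" "k = cball (cen (x,y)) (rad (x,y))"
          using C' C by (force simp: p_def)
        then show "k \<subseteq> \<gamma> x" by (auto simp: I_def cen_def rad_def)
      qed
      (* each selected interval adds at least eta times its length to the Henstock sum *)
      have trm: "\<eta> * measure lborel (cball (cen i) (rad i)) \<le>
          norm (measure lborel (cball (cen i) (rad i)) *\<^sub>R g (fst i) - integral (cball (cen i) (rad i)) g)"
        if "i \<in> C'" for i
      proof -
        obtain x y where i: "i = (x, y)" by force
        have I: "x \<in> {a<..<b}" "y \<in> {a<..<b}" "y \<noteq> x" "\<bar>G y - G x - g x * (y - x)\<bar> > \<eta> * \<bar>y - x\<bar>"
          using that C' C unfolding i by (auto simp: I_def)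
        show ?thesis
        proof (cases "x < y")
          case True
          then have "integral {x..y} g = G y - G x" using I by (intro G_diff) auto
          then show ?thesis using I True by (simp add: i cb min_def max_def abs_if algebra_simps split: if_splits)
        next
          case False
          then have "integral {y..x} g = G x - G y" using I by (intro G_diff) auto
          then show ?thesis using I False by (simp add: i cb min_def max_def abs_if algebra_simps split: if_splits)
        qed
      qed
      have "\<eta> * (\<Sum>i\<in>C'. measure lborel (cball (cen i) (rad i))) \<le> (\<Sum>(x,k)\<in>p. norm(measure lborel k *\<^sub>R g x - integral k g))"
        unfolding p_def sum_distrib_left
        by (subst sum.reindex[OF inj]) (auto intro!: sum_mono trm[simplified])
      also have "\<dots> < \<epsilon> * \<eta>" using hen[OF p1 p2] .
      finally have "(\<Sum>i\<in>C'. measure lborel (cball (cen i) (rad i))) \<le> \<epsilon>" using \<eta> by simp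
      moreover have "measure lebesgue (\<Union>i\<in>C'. cball (cen i) (rad i)) \<le> (\<Sum>i\<in>C'. measure lebesgue (cball (cen i) (rad i)))"
        using C' by (intro measure_UNION_le) auto
      ultimately show ?thesis by simp
    qed
    have D: "\<And>A. A \<in> (\<lambda>i. cball (cen i) (rad i)) ` C \<Longrightarrow> A \<in> lmeasurable" by auto
    have U: "(\<Union>i\<in>C. cball (cen i) (rad i)) \<in> lmeasurable" "measure lebesgue (\<Union>i\<in>C. cball (cen i) (rad i)) \<le> \<epsilon>"
      using fmeasurable_UN_bound[of C "\<lambda>i. cball (cen i) (rad i)" lebesgue \<epsilon>]
            measure_UN_bound[of C "\<lambda>i. cball (cen i) (rad i)" lebesgue \<epsilon>] C(1) fin by auto
    show "\<exists>T. E m \<subseteq> T \<and> T \<in> lmeasurable \<and> measure lebesgue T \<le> \<epsilon>"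
    proof (intro exI conjI)
      let ?U = "(\<Union>i\<in>C. cball (cen i) (rad i))"
      let ?N = "E m - ?U"
      show "E m \<subseteq> ?U \<union> ?N" by auto
      show "?U \<union> ?N \<in> lmeasurable" using U C(4) negligible_imp_measurable by (intro fmeasurable.Un) auto
      have "measure lebesgue (?U \<union> ?N) \<le> measure lebesgue ?U + measure lebesgue ?N"
        using U C(4) negligible_imp_measurable by (intro measure_Un_le) (auto simp: fmeasurable_def)
      then show "measure lebesgue (?U \<union> ?N) \<le> \<epsilon>"
        using U(2) negligible_imp_measure0[OF C(4)] by simp
    qed
  qed
  then have "negligible (\<Union>m. E m)" by (auto intro!: negligible_countable_Union)
  then show ?thesis using sub negligible_subset unfolding G_def by blast
qed

lemma AE_indefinite_integral_has_derivative:
  fixes g :: "real \<Rightarrow> real"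
  assumes g: "integrable lborel g"
  shows "AE x in lborel. x \<in> {a<..<b} \<longrightarrow> ((\<lambda>t. \<integral>u. indicator {a<..t} u * g u \<partial>lborel) has_real_derivative g x) (at x)"
proof -
  have si: "set_integrable lborel {a..t} g" for t
    using g unfolding set_integrable_def by (intro integrable_mult_indicator) auto
  have HK: "g integrable_on {a..b}" using set_borel_integral_eq_integral(1)[OF si] by blast
  have G: "integral {a..t} g = (\<integral>u. indicator {a<..t} u * g u \<partial>lborel)" for t
  proof -
    have "integral {a..t} g = (LINT u:{a..t}|lborel. g u)"
      using set_borel_integral_eq_integral(2)[OF si] by simp
    also have "\<dots> = (\<integral>u. indicator {a<..t} u * g u \<partial>lborel)"
      unfolding set_lebesgue_integral_def
      using AE_lborel_singleton[of a]
      by (intro integral_cong_AE) (use g in \<open>auto simp: indicator_def elim!: eventually_mono\<close>)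
    finally show ?thesis .
  qed
  obtain N where N: "N \<in> null_sets lborel"
    "{x\<in>{a<..<b}. \<not> ((\<lambda>t. integral {a..t} g) has_real_derivative g x) (at x)} \<subseteq> N"
    using lebesgue_differentiation[OF HK] unfolding negligible_iff_null_sets null_sets_completion_iff2 by blast
  show ?thesis
    using AE_not_in[OF N(1)] by (rule eventually_mono) (use N(2) in \<open>auto simp: G\<close>)
qed

section \<open>Absolutely continuous functions of one variable\<close>

text \<open>Families of intervals are coded by their pairs of endpoints: cutting an interval at a point and
  merging families are simpler in this form than with divisions.\<close>
definition nonoverlapping :: "(real \<times> real) set \<Rightarrow> bool" where
  "nonoverlapping D \<longleftrightarrow> finite D \<and> (\<forall>p\<in>D. fst p < snd p) \<and>
    (\<forall>p\<in>D. \<forall>q\<in>D. p \<noteq> q \<longrightarrow> snd p \<le> fst q \<or> snd q \<le> fst p)"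

definition confined :: "(real \<times> real) set \<Rightarrow> real \<Rightarrow> real \<Rightarrow> bool" where
  "confined D x y \<longleftrightarrow> (\<forall>p\<in>D. x \<le> fst p \<and> snd p \<le> y)"

definition variation :: "(real \<Rightarrow> real) \<Rightarrow> real \<Rightarrow> real \<Rightarrow> ennreal" where
  "variation f x y = (SUP D\<in>{D. nonoverlapping D \<and> confined D x y}. \<Sum>p\<in>D. ennreal \<bar>f (snd p) - f (fst p)\<bar>)"

lemma variation_upper: "nonoverlapping D \<Longrightarrow> confined D x y \<Longrightarrow>
   (\<Sum>p\<in>D. ennreal \<bar>f (snd p) - f (fst p)\<bar>) \<le> variation f x y"
  unfolding variation_def by (rule SUP_upper) auto

text \<open>For the variation function \<open>V\<close> of \<open>f\<close>, this half of the additivity makes \<open>V + f\<close> and \<open>V - f\<close> increasing.\<close>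
lemma variation_add_increment_le:
  assumes "x \<le> y" "y \<le> z"
  shows "variation f x y + ennreal \<bar>f z - f y\<bar> \<le> variation f x z"
proof -
  have ne: "{D. nonoverlapping D \<and> confined D x y} \<noteq> {}"
    by (auto intro!: exI[of _ "{}"] simp: nonoverlapping_def confined_def)
  have "(\<Sum>p\<in>D. ennreal \<bar>f (snd p) - f (fst p)\<bar>) + ennreal \<bar>f z - f y\<bar> \<le> variation f x z"
    if D: "nonoverlapping D" "confined D x y" for D
  proof (cases "y = z")
    case True
    then show ?thesis using variation_upper[OF D, of f] by simp
  next
    case False
    have n: "(y, z) \<notin> D" using D False assms by (fastforce simp: confined_def)
    have "nonoverlapping (insert (y, z) D)" "confined (insert (y, z) D) x z"
      using D assms False by (fastforce simp: nonoverlapping_def confined_def)+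
    from variation_upper[OF this, of f] show ?thesis
      using D n by (simp add: nonoverlapping_def add.commute)
  qed
  then show ?thesis
    unfolding variation_def[of f x y] ennreal_SUP_add_left[OF ne, symmetric]
    by (intro SUP_least) auto
qed

text \<open>The bridge to the divisions in which absolute continuity and total variation are expressed.\<close>
lemma nonoverlapping_division:
  assumes D: "nonoverlapping D"
  defines "d \<equiv> (\<lambda>p. {fst p..snd p}) ` D"
  shows "d division_of \<Union>d" and "(\<Sum>k\<in>d. F (Inf k) (Sup k)) = (\<Sum>p\<in>D. F (fst p) (snd p))"
proof -
  have inj: "inj_on (\<lambda>p. {fst p..snd p}) D"
    using D by (auto simp: inj_on_def nonoverlapping_def Icc_eq_Icc prod_eq_iff) 
  show "d division_of \<Union>d"
    unfolding division_of_def
  proof (intro conjI ballI impI)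
    show "finite d" using D by (auto simp: d_def nonoverlapping_def)
    show "\<Union>d = \<Union>d" ..
  next
    fix k assume k: "k \<in> d"
    then show "k \<subseteq> \<Union>d" by auto
    show "k \<noteq> {}" using k D by (force simp: d_def nonoverlapping_def)
    show "\<exists>a b. k = cbox a b" using k by (auto simp: d_def cbox_interval)
  next
    fix k1 k2 assume "k1 \<in> d" "k2 \<in> d" "k1 \<noteq> k2"
    then obtain p q where pq: "p \<in> D" "q \<in> D" "k1 = {fst p..snd p}" "k2 = {fst q..snd q}" "p \<noteq> q"
      by (auto simp: d_def)
    then have "snd p \<le> fst q \<or> snd q \<le> fst p" using D by (auto simp: nonoverlapping_def)
    then show "interior k1 \<inter> interior k2 = {}" unfolding pq by auto
  qed
  show "(\<Sum>k\<in>d. F (Inf k) (Sup k)) = (\<Sum>p\<in>D. F (fst p) (snd p))"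
    unfolding d_def using D
    by (subst sum.reindex[OF inj]) (auto intro!: sum.cong simp: nonoverlapping_def less_imp_le)
qed

text \<open>An interval that contains \<open>y\<close> in its interior is cut there, and its increment is at most the sum of the
  increments of the two pieces.\<close>
lemma variation_subadditive:
  assumes "x \<le> y" "y \<le> z"
  shows "variation f x z \<le> variation f x y + variation f y z"
  unfolding variation_def[of f x z]
proof (rule SUP_least, clarify)
  fix D assume D: "nonoverlapping D" "confined D x z"
  define L R where "L = (\<lambda>p. (fst p, min (snd p) y)) ` {p\<in>D. fst p < y}"
    and "R = (\<lambda>p. (max (fst p) y, snd p)) ` {p\<in>D. y < snd p}"
  have fin: "finite D" using D by (auto simp: nonoverlapping_def)
  have injL: "inj_on (\<lambda>p. (fst p, min (snd p) y)) {p\<in>D. fst p < y}"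
    using D unfolding nonoverlapping_def inj_on_def by (fastforce simp: prod_eq_iff min_def split: if_splits)
  have injR: "inj_on (\<lambda>p. (max (fst p) y, snd p)) {p\<in>D. y < snd p}"
    using D unfolding nonoverlapping_def inj_on_def by (fastforce simp: prod_eq_iff max_def split: if_splits)
  have L: "nonoverlapping L" "confined L x y"
  proof -
    show "confined L x y" using D by (auto simp: L_def confined_def)
    show "nonoverlapping L" unfolding nonoverlapping_def
    proof (intro conjI ballI impI)
      fix p q assume "p \<in> L" "q \<in> L" "p \<noteq> q"
      then obtain p' q' where *: "p' \<in> D" "q' \<in> D" "p' \<noteq> q'" "fst p = fst p'" "fst q = fst q'"
         "snd p = min (snd p') y" "snd q = min (snd q') y" unfolding L_def by fastforce
      then have "snd p' \<le> fst q' \<or> snd q' \<le> fst p'" using D by (auto simp: nonoverlapping_def)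
      then show "snd p \<le> fst q \<or> snd q \<le> fst p" using * by auto
    qed (use D in \<open>auto simp: L_def nonoverlapping_def\<close>)
  qed
  have R: "nonoverlapping R" "confined R y z"
  proof -
    show "confined R y z" using D by (auto simp: R_def confined_def)
    show "nonoverlapping R" unfolding nonoverlapping_def
    proof (intro conjI ballI impI)
      fix p q assume "p \<in> R" "q \<in> R" "p \<noteq> q"
      then obtain p' q' where *: "p' \<in> D" "q' \<in> D" "p' \<noteq> q'" "snd p = snd p'" "snd q = snd q'"
         "fst p = max (fst p') y" "fst q = max (fst q') y" unfolding R_def by fastforce
      then have "snd p' \<le> fst q' \<or> snd q' \<le> fst p'" using D by (auto simp: nonoverlapping_def)
      then show "snd p \<le> fst q \<or> snd q \<le> fst p" using * by auto
    qed (use D in \<open>auto simp: R_def nonoverlapping_def\<close>)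
  qed
  have "(\<Sum>p\<in>D. ennreal \<bar>f (snd p) - f (fst p)\<bar>) \<le>
      (\<Sum>p\<in>D. (if fst p < y then ennreal \<bar>f (min (snd p) y) - f (fst p)\<bar> else 0) +
             (if y < snd p then ennreal \<bar>f (snd p) - f (max (fst p) y)\<bar> else 0))"
    using D by (intro sum_mono) (auto simp: nonoverlapping_def min_def max_def simp flip: ennreal_plus intro!: ennreal_leI)
  also have "\<dots> = (\<Sum>p\<in>L. ennreal \<bar>f (snd p) - f (fst p)\<bar>) + (\<Sum>p\<in>R. ennreal \<bar>f (snd p) - f (fst p)\<bar>)"
    unfolding L_def R_def using fin
    by (simp add: sum.reindex[OF injL] sum.reindex[OF injR] sum.distrib sum.inter_filter del: sum_ennreal)
  also have "\<dots> \<le> variation f x y + variation f y z"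
    by (intro add_mono variation_upper L R)
  finally show "(\<Sum>p\<in>D. ennreal \<bar>f (snd p) - f (fst p)\<bar>) \<le> variation f x y + variation f y z" .
qed

text \<open>Refinement: the variations over the members of a family are approached by the increments of a single
  finer family.\<close>
lemma nonoverlapping_UN:
  assumes D: "nonoverlapping D" and E: "\<And>p. p \<in> D \<Longrightarrow> nonoverlapping (E p) \<and> confined (E p) (fst p) (snd p)"
  shows "nonoverlapping (\<Union>p\<in>D. E p)"
    and "(\<Sum>q\<in>(\<Union>p\<in>D. E p). G q) = (\<Sum>p\<in>D. \<Sum>q\<in>E p. (G q :: 'a::comm_monoid_add))"
proof -
  have disj: "E p \<inter> E q = {}" if "p \<in> D" "q \<in> D" "p \<noteq> q" for p q
    using D E[of p] E[of q] that unfolding nonoverlapping_def confined_def by fastforce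
  show "(\<Sum>q\<in>(\<Union>p\<in>D. E p). G q) = (\<Sum>p\<in>D. \<Sum>q\<in>E p. G q)"
    using D E disj by (intro sum.UNION_disjoint) (auto simp: nonoverlapping_def)
  show "nonoverlapping (\<Union>p\<in>D. E p)"
    unfolding nonoverlapping_def
  proof (intro conjI ballI impI)
    show "finite (\<Union>p\<in>D. E p)" using D E by (auto simp: nonoverlapping_def)
  next
    fix p assume "p \<in> (\<Union>p\<in>D. E p)" then show "fst p < snd p" using E by (auto simp: nonoverlapping_def)
  next
    fix q r assume "q \<in> (\<Union>p\<in>D. E p)" "r \<in> (\<Union>p\<in>D. E p)" "q \<noteq> r"
    then obtain s t where st: "s \<in> D" "t \<in> D" "q \<in> E s" "r \<in> E t" by auto
    show "snd q \<le> fst r \<or> snd r \<le> fst q"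
    proof (cases "s = t")
      case True
      then show ?thesis using E[of s] st \<open>q \<noteq> r\<close> by (auto simp: nonoverlapping_def)
    next
      case False
      then have "snd s \<le> fst t \<or> snd t \<le> fst s" using D st by (auto simp: nonoverlapping_def)
      then show ?thesis using E[of s] E[of t] st by (force simp: confined_def)
    qed
  qed
qed

lemma nonoverlapping_length_le:
  assumes "nonoverlapping D" "confined D x y" "x \<le> y"
  shows "(\<Sum>p\<in>D. snd p - fst p) \<le> y - x"
proof -
  have "(\<Sum>p\<in>D. snd p - fst p) = (\<Sum>p\<in>D. measure lborel {fst p<..<snd p})"
    using assms by (intro sum.cong) (auto simp: nonoverlapping_def less_imp_le)
  also have "\<dots> = measure lborel (\<Union>p\<in>D. {fst p<..<snd p})"
    using assms unfolding nonoverlapping_def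
    by (intro measure_finite_Union[symmetric]) (force simp: disjoint_family_on_def)+
  also have "\<dots> \<le> measure lborel {x..y}"
  proof (rule measure_mono_fmeasurable)
    show "(\<Union>p\<in>D. {fst p<..<snd p}) \<subseteq> {x..y}"
      using assms by (force simp: confined_def)
    show "(\<Union>p\<in>D. {fst p<..<snd p}) \<in> sets lborel"
      using assms by (auto simp: nonoverlapping_def)
    show "{x..y} \<in> fmeasurable lborel"
      by (auto simp: fmeasurable_def emeasure_lborel_Icc_eq)
  qed
  also have "\<dots> = y - x" using assms by simp
  finally show ?thesis .
qed

text \<open>Absolute continuity on \<open>[a, b]\<close>. The last inequality is weak so that it passes to suprema.\<close>
definition ac_on :: "real \<Rightarrow> real \<Rightarrow> (real \<Rightarrow> real) \<Rightarrow> bool" where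
  "ac_on a b f \<longleftrightarrow> (\<forall>\<epsilon>>0. \<exists>\<delta>>0. \<forall>D. nonoverlapping D \<and> confined D a b \<and>
      (\<Sum>p\<in>D. snd p - fst p) < \<delta> \<longrightarrow> (\<Sum>p\<in>D. \<bar>f (snd p) - f (fst p)\<bar>) \<le> \<epsilon>)"

lemma abs_continuous_on_imp_ac_on:
  assumes "abs_continuous_on S f" "{a..b} \<subseteq> S"
  shows "ac_on a b f"
  unfolding ac_on_def
proof (intro allI impI)
  fix \<epsilon> :: real assume "\<epsilon> > 0"
  with assms(1) obtain \<delta> where \<delta>: "\<delta> > 0" "\<And>d. d division_of \<Union>d \<and> \<Union>d \<subseteq> S \<and> (\<Sum>k\<in>d. Sup k - Inf k) < \<delta>
      \<Longrightarrow> (\<Sum>k\<in>d. \<bar>f (Sup k) - f (Inf k)\<bar>) < \<epsilon>"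
    unfolding abs_continuous_on_def by blast
  show "\<exists>\<delta>>0. \<forall>D. nonoverlapping D \<and> confined D a b \<and>
      (\<Sum>p\<in>D. snd p - fst p) < \<delta> \<longrightarrow> (\<Sum>p\<in>D. \<bar>f (snd p) - f (fst p)\<bar>) \<le> \<epsilon>"
  proof (intro exI[of _ \<delta>] conjI allI impI)
    fix D assume D: "nonoverlapping D \<and> confined D a b \<and> (\<Sum>p\<in>D. snd p - fst p) < \<delta>"
    let ?d = "(\<lambda>p. {fst p..snd p}) ` D"
    have "\<Union>?d \<subseteq> S" using D assms(2) by (force simp: confined_def)
    then have "(\<Sum>k\<in>?d. \<bar>f (Sup k) - f (Inf k)\<bar>) < \<epsilon>"
      using D by (intro \<delta>) (auto simp: nonoverlapping_division(1) nonoverlapping_division(2)[where F="\<lambda>x y. y - x"])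
    then show "(\<Sum>p\<in>D. \<bar>f (snd p) - f (fst p)\<bar>) \<le> \<epsilon>"
      using D by (simp add: nonoverlapping_division(2)[where F="\<lambda>x y. \<bar>f y - f x\<bar>"])
  qed (fact \<delta>)
qed

lemma variation_le_total_variation_on:
  assumes "{a..b} \<subseteq> S"
  shows "variation f a b \<le> total_variation_on S f"
  unfolding variation_def
proof (rule SUP_least, clarify)
  fix D assume D: "nonoverlapping D" "confined D a b"
  let ?d = "(\<lambda>p. {fst p..snd p}) ` D"
  have "\<Union>?d \<subseteq> S" using D assms by (force simp: confined_def)
  then have "(\<Sum>k\<in>?d. ennreal \<bar>f (Sup k) - f (Inf k)\<bar>) \<le> total_variation_on S f"
    unfolding total_variation_on_def using nonoverlapping_division(1)[OF D(1)] by (intro SUP_upper) auto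
  then show "(\<Sum>p\<in>D. ennreal \<bar>f (snd p) - f (fst p)\<bar>) \<le> total_variation_on S f"
    using nonoverlapping_division(2)[OF D(1), where F="\<lambda>x y. ennreal \<bar>f y - f x\<bar>"] by simp
qed

text \<open>A sum of suprema that are taken independently of each other is the supremum of the sums. The constant
  \<open>c0\<close> absorbs the terms that the induction has dealt with.\<close>
lemma sum_SUP_le:
  fixes g :: "'a \<Rightarrow> 'b \<Rightarrow> ennreal"
  assumes "finite D" "\<And>p. p \<in> D \<Longrightarrow> A p \<noteq> {}"
    and "\<And>E. (\<And>p. p \<in> D \<Longrightarrow> E p \<in> A p) \<Longrightarrow> c0 + (\<Sum>p\<in>D. g p (E p)) \<le> c"
  shows "c0 + (\<Sum>p\<in>D. SUP E\<in>A p. g p E) \<le> c"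
  using assms
proof (induction D arbitrary: c0 rule: finite_induct)
  case empty
  then show ?case by simp
next
  case (insert p D)
  have "c0 + g p e + (\<Sum>p\<in>D. SUP E\<in>A p. g p E) \<le> c" if "e \<in> A p" for e
  proof (rule insert.IH)
    fix E assume E: "\<And>p. p \<in> D \<Longrightarrow> E p \<in> A p"
    have eq: "(\<Sum>q\<in>D. g q ((E(p := e)) q)) = (\<Sum>q\<in>D. g q (E q))"
      using insert.hyps by (intro sum.cong) auto
    have "c0 + (\<Sum>q\<in>insert p D. g q ((E(p := e)) q)) \<le> c"
      using E that by (intro insert.prems) auto
    moreover have "(\<Sum>q\<in>insert p D. g q ((E(p := e)) q)) = g p e + (\<Sum>q\<in>D. g q (E q))"
      using insert.hyps eq by simp
    ultimately show "c0 + g p e + (\<Sum>p\<in>D. g p (E p)) \<le> c"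
      by (simp only: add.assoc)
  qed (use insert.prems in auto)
  then have "(SUP e\<in>A p. g p e + (c0 + (\<Sum>p\<in>D. SUP E\<in>A p. g p E))) \<le> c"
    by (intro SUP_least) (simp add: ac_simps)
  then have "(SUP e\<in>A p. g p e) + (c0 + (\<Sum>p\<in>D. SUP E\<in>A p. g p E)) \<le> c"
    using insert.prems(1)[of p] by (subst (asm) ennreal_SUP_add_left) auto
  then show ?case
    using insert.hyps by (simp add: ac_simps)
qed

text \<open>The variation function inherits absolute continuity: subfamilies of the members of a short family
  form, all together, a short family again.\<close>
lemma ac_on_sum_variation_le:
  assumes "ac_on a b f" "\<epsilon> > 0"
  shows "\<exists>\<delta>>0. \<forall>D. nonoverlapping D \<and> confined D a b \<and> (\<Sum>p\<in>D. snd p - fst p) < \<delta> \<longrightarrow>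
      (\<Sum>p\<in>D. variation f (fst p) (snd p)) \<le> ennreal \<epsilon>"
proof -
  obtain \<delta> where \<delta>: "\<delta> > 0" "\<And>D. nonoverlapping D \<and> confined D a b \<and>
      (\<Sum>p\<in>D. snd p - fst p) < \<delta> \<Longrightarrow> (\<Sum>p\<in>D. \<bar>f (snd p) - f (fst p)\<bar>) \<le> \<epsilon>"
    using assms unfolding ac_on_def by blast
  have "(\<Sum>p\<in>D. variation f (fst p) (snd p)) \<le> ennreal \<epsilon>"
    if D: "nonoverlapping D" "confined D a b" "(\<Sum>p\<in>D. snd p - fst p) < \<delta>" for D
  proof -
    have "0 + (\<Sum>p\<in>D. SUP E\<in>{E. nonoverlapping E \<and> confined E (fst p) (snd p)}.
        \<Sum>q\<in>E. ennreal \<bar>f (snd q) - f (fst q)\<bar>) \<le> ennreal \<epsilon>"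
    proof (rule sum_SUP_le)
      show "finite D" using D by (auto simp: nonoverlapping_def)
      show "{E. nonoverlapping E \<and> confined E (fst p) (snd p)} \<noteq> {}" for p :: "real \<times> real"
        by (auto intro!: exI[of _ "{}"] simp: nonoverlapping_def confined_def)
    next
      fix E assume "\<And>p. p \<in> D \<Longrightarrow> E p \<in> {E. nonoverlapping E \<and> confined E (fst p) (snd p)}"
      then have E: "\<And>p. p \<in> D \<Longrightarrow> nonoverlapping (E p) \<and> confined (E p) (fst p) (snd p)" by auto
      note U = nonoverlapping_UN[OF D(1) E]
      have "confined (\<Union>p\<in>D. E p) a b"
        using D(2) E by (force simp: confined_def)
      moreover have "(\<Sum>q\<in>(\<Union>p\<in>D. E p). snd q - fst q) < \<delta>"
        unfolding U(2)[of "\<lambda>q. snd q - fst q", simplified]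
        using D E by (intro le_less_trans[OF sum_mono D(3)] nonoverlapping_length_le)
          (auto simp: nonoverlapping_def less_imp_le)
      ultimately have "(\<Sum>q\<in>(\<Union>p\<in>D. E p). \<bar>f (snd q) - f (fst q)\<bar>) \<le> \<epsilon>"
        using U(1) by (intro \<delta>) auto
      then have "(\<Sum>q\<in>(\<Union>p\<in>D. E p). ennreal \<bar>f (snd q) - f (fst q)\<bar>) \<le> ennreal \<epsilon>"
        by (simp add: ennreal_leI)
      then show "0 + (\<Sum>p\<in>D. \<Sum>q\<in>E p. ennreal \<bar>f (snd q) - f (fst q)\<bar>) \<le> ennreal \<epsilon>"
        by (simp only: U(2)[of "\<lambda>q. ennreal \<bar>f (snd q) - f (fst q)\<bar>"] add_0)
    qed
    then show ?thesis by (simp add: variation_def)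
  qed
  with \<delta>(1) show ?thesis by blast
qed

text \<open>Finitely many steps of length \<open>\<delta> / 2\<close> lead from \<open>a\<close> to \<open>b\<close>, and each adds at most 1 to the variation.\<close>
lemma ac_on_variation_finite:
  assumes "ac_on a b f" "a \<le> b"
  shows "variation f a b < \<infinity>"
proof -
  obtain \<delta> where \<delta>: "\<delta> > 0" "\<And>D. nonoverlapping D \<and> confined D a b \<and>
      (\<Sum>p\<in>D. snd p - fst p) < \<delta> \<Longrightarrow> (\<Sum>p\<in>D. variation f (fst p) (snd p)) \<le> ennreal 1"
    using ac_on_sum_variation_le[OF assms(1), of 1] by auto
  have small: "variation f x y \<le> 1" if "a \<le> x" "x < y" "y \<le> b" "y - x < \<delta>" for x y
    using \<delta>(2)[of "{(x, y)}"] that by (auto simp: nonoverlapping_def confined_def)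
  have "\<forall>y. a \<le> y \<and> y \<le> b \<and> y - a \<le> real n * (\<delta> / 2) \<longrightarrow> variation f a y \<le> of_nat n" for n
  proof (induction n)
    case 0
    have "variation f a a = 0"
    proof -
      have "D = {}" if "nonoverlapping D" "confined D a a" for D
        using that by (fastforce simp: nonoverlapping_def confined_def)
      then have "{D. nonoverlapping D \<and> confined D a a} \<subseteq> {{}}" by blast
      then have "variation f a a \<le> (SUP D\<in>{{}}. \<Sum>p\<in>D. ennreal \<bar>f (snd p) - f (fst p)\<bar>)"
        unfolding variation_def by (rule SUP_subset_mono) simp
      then show ?thesis by simp
    qed
    then show ?case by auto
  next
    case (Suc n)
    show ?case
    proof (intro allI impI)
      fix y assume y: "a \<le> y \<and> y \<le> b \<and> y - a \<le> real (Suc n) * (\<delta> / 2)"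
      show "variation f a y \<le> of_nat (Suc n)"
      proof (cases "y - a \<le> real n * (\<delta> / 2)")
        case True
        then have "variation f a y \<le> of_nat n" using Suc.IH y by auto
        also have "\<dots> \<le> of_nat (Suc n)" by simp
        finally show ?thesis .
      next
        case False
        define z where "z = a + real n * (\<delta> / 2)"
        have z: "a \<le> z" "z < y" "y - z < \<delta>" using False \<delta>(1) y by (auto simp: z_def algebra_simps)
        have "variation f a y \<le> variation f a z + variation f z y"
          using z by (intro variation_subadditive) auto
        also have "\<dots> \<le> of_nat n + 1"
          using Suc.IH z y small[of z y] by (intro add_mono) (auto simp: z_def)
        finally show ?thesis by (simp add: add.commute)
      qed
    qed
  qed
  moreover obtain n where "b - a \<le> real n * (\<delta> / 2)"
    using real_arch_simple[of "(b - a) / (\<delta> / 2)"] \<delta>(1) by (auto simp: field_simps)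
  ultimately have "variation f a b \<le> of_nat n" using assms(2) by auto
  also have "\<dots> < \<infinity>" by (simp add: ennreal_of_nat_eq_real_of_nat)
  finally show ?thesis .
qed

text \<open>A Lebesgue null set has open neighbourhoods of small length. Such a neighbourhood is an increasing union
  of finite unions of intervals, on which absolute continuity bounds the Stieltjes measure.\<close>
lemma monotone_ac_null:
  fixes F :: "real \<Rightarrow> real"
  assumes mono: "\<And>x y. x \<le> y \<Longrightarrow> F x \<le> F y" and cont: "continuous_on UNIV F"
    and const: "\<And>x. F (max a (min b x)) = F x" and ac: "ac_on a b F"
    and "a \<le> b" and N: "N \<in> null_sets lborel"
  shows "emeasure (interval_measure F) N = 0"
proof -
  define \<mu> where "\<mu> = interval_measure F"
  have Icc: "emeasure \<mu> {x..y} = ennreal (F y - F x)" if "x \<le> y" for x y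
    unfolding \<mu>_def using that mono cont by (intro emeasure_interval_measure_Icc) auto
  have [measurable_cong, simp]: "sets \<mu> = sets borel" by (simp add: \<mu>_def)
  have Nb: "N \<in> sets borel" using N by auto
  have le: "emeasure \<mu> N \<le> 0 + ennreal \<epsilon>" if "\<epsilon> > 0" for \<epsilon>
  proof -
    obtain \<delta> where \<delta>: "\<delta> > 0" "\<And>D. nonoverlapping D \<and> confined D a b \<and>
      (\<Sum>p\<in>D. snd p - fst p) < \<delta> \<Longrightarrow> (\<Sum>p\<in>D. \<bar>F (snd p) - F (fst p)\<bar>) \<le> \<epsilon>"
      using ac \<open>\<epsilon> > 0\<close> unfolding ac_on_def by blast
    obtain U where U: "open U" "N \<subseteq> U" "emeasure lborel (U - N) < \<delta>"
      using outer_regular_lborel[OF Nb \<delta>(1)] by blast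
    have "emeasure lborel U \<le> emeasure lborel (U - N) + emeasure lborel N"
      using U Nb by (subst plus_emeasure) (auto intro!: emeasure_mono)
    then have Ud: "emeasure lborel U < \<delta>" using U N by (simp add: null_setsD1)
    obtain \<D> where \<D>: "countable \<D>" "\<And>X. X \<in> \<D> \<Longrightarrow> \<exists>a b. X = cbox a b" "\<Union>\<D> = U"
      using open_countable_Union_open_cbox[OF U(1)] by metis
    define A where "A = (\<lambda>n::nat. \<Union>(from_nat_into (insert {} \<D>) ` {..<n}))"
    have rng: "range (from_nat_into (insert {} \<D>)) = insert {} \<D>"
      using \<D>(1) by (intro range_from_nat_into) auto
    have box: "\<exists>a b. X = cbox a b" if "X \<in> insert {} \<D>" for X
      using that \<D>(2) by (metis insert_iff empty_as_interval)
    have UA: "(\<Union>n. A n) = U"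
    proof -
      have "(\<Union>n. A n) = \<Union>(range (from_nat_into (insert {} \<D>)))" unfolding A_def by auto
      then show ?thesis using rng \<D>(3) by simp
    qed
    have An: "A n \<in> sets borel \<and> emeasure \<mu> (A n) \<le> ennreal \<epsilon>" for n
    proof -
      obtain p where p: "p division_of (A n)"
        unfolding A_def
        using elementary_unions_intervals[of "from_nat_into (insert {} \<D>) ` {..<n}"] box rng by blast
      note pD = division_ofD[OF p]
      have k: "k = {Inf k..Sup k} \<and> Inf k \<le> Sup k" if "k \<in> p" for k
        using pD(3,4)[OF that] by (auto simp: cbox_interval)
      have meas: "k \<in> sets borel" if "k \<in> p" for k using pD(4)[OF that] by auto
      have An1: "A n \<in> sets borel" using pD(6) meas pD(1) by (metis sets.finite_Union subsetI)
      (* Clipping at a and b does not change increments of F and yields intervals inside [a, b]. *)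
      define c where "c = (\<lambda>x::real. max a (min b x))"
      define q where "q = {k\<in>p. c (Inf k) < c (Sup k)}"
      define D where "D = (\<lambda>k. (c (Inf k), c (Sup k))) ` q"
      have q: "q \<subseteq> p" "finite q" using pD(1) by (auto simp: q_def)
      have sep: "Sup k \<le> Inf l \<or> Sup l \<le> Inf k" if "k \<in> q" "l \<in> q" "k \<noteq> l" for k l
      proof (rule ccontr)
        assume not: "\<not> ?thesis"
        have lt: "Inf k < Sup k" "Inf l < Sup l" using that by (auto simp: q_def c_def max_def min_def split: if_splits)
        have "interior k = {Inf k<..<Sup k}" "interior l = {Inf l<..<Sup l}"
          using k[of k] k[of l] that q by (metis interior_atLeastAtMost_real subsetD)+
        then have "{max (Inf k) (Inf l)<..<min (Sup k) (Sup l)} \<subseteq> interior k \<inter> interior l"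
          by auto
        also have "\<dots> = {}" using pD(5)[of k l] that q by auto
        finally show False using not lt by auto
      qed
      have cm: "x \<le> y \<Longrightarrow> c x \<le> c y" for x y by (auto simp: c_def)
      have sepc: "c (Sup k) \<le> c (Inf l) \<or> c (Sup l) \<le> c (Inf k)" if "k \<in> q" "l \<in> q" "k \<noteq> l" for k l
        using sep[OF that] cm by auto
      have inj: "inj_on (\<lambda>k. (c (Inf k), c (Sup k))) q"
        using sepc by (force simp: inj_on_def q_def)
      have D: "nonoverlapping D" "confined D a b"
      proof -
        show "confined D a b" using \<open>a \<le> b\<close> by (auto simp: D_def confined_def c_def)
        show "nonoverlapping D" unfolding nonoverlapping_def D_def
          using q sepc by (auto simp: q_def)
      qed
      have "(\<Sum>d\<in>D. snd d - fst d) = (\<Sum>k\<in>q. c (Sup k) - c (Inf k))"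
        unfolding D_def by (subst sum.reindex[OF inj]) auto
      also have "\<dots> \<le> (\<Sum>k\<in>q. Sup k - Inf k)"
        using k q by (intro sum_mono) (force simp: c_def max_def min_def)
      also have "\<dots> \<le> (\<Sum>k\<in>p. Sup k - Inf k)"
        using k q pD(1) by (intro sum_mono2) auto
      also have "\<dots> = (\<Sum>k\<in>p. measure lborel k)"
        using k by (intro sum.cong refl) (metis measure_lborel_Icc)
      also have "\<dots> = (\<Sum>k\<in>p. measure lebesgue k)"
        using meas by (intro sum.cong refl) simp
      also have "\<dots> = measure lborel (A n)"
        using content_division[OF p] p lmeasurable_division[OF p] An1 by simp
      also have "\<dots> < \<delta>"
      proof -
        have "emeasure lborel (A n) \<le> emeasure lborel U"
          using U(1) UA by (intro emeasure_mono) auto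
        then have "emeasure lborel (A n) < \<delta>" using Ud by (rule le_less_trans)
        then show ?thesis using \<delta>(1) by (simp add: measure_def enn2real_less_iff) (metis enn2real_less_iff less_top_ennreal top.not_eq_extremum order_less_trans)
      qed
      finally have "(\<Sum>d\<in>D. \<bar>F (snd d) - F (fst d)\<bar>) \<le> \<epsilon>" using D by (intro \<delta>(2)) auto
      also have "(\<Sum>d\<in>D. \<bar>F (snd d) - F (fst d)\<bar>) = (\<Sum>k\<in>q. \<bar>F (c (Sup k)) - F (c (Inf k))\<bar>)"
        unfolding D_def by (subst sum.reindex[OF inj]) auto
      also have "\<dots> = (\<Sum>k\<in>p. \<bar>F (c (Sup k)) - F (c (Inf k))\<bar>)"
      proof (intro sum.mono_neutral_left)
        show "\<forall>k\<in>p - q. \<bar>F (c (Sup k)) - F (c (Inf k))\<bar> = 0"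
          using k cm by (auto simp: q_def) (metis cm order_antisym_conv not_le)
      qed (use pD(1) q in auto)
      also have "\<dots> = (\<Sum>k\<in>p. F (Sup k) - F (Inf k))"
        using k mono by (intro sum.cong) (auto simp: c_def const)
      finally have *: "(\<Sum>k\<in>p. F (Sup k) - F (Inf k)) \<le> \<epsilon>" .
      have "emeasure \<mu> (A n) = emeasure \<mu> (\<Union>k\<in>p. k)" using pD(6) by simp
      also have "\<dots> \<le> (\<Sum>k\<in>p. emeasure \<mu> k)"
        using pD(1) meas by (intro emeasure_subadditive_finite) auto
      also have "\<dots> = (\<Sum>k\<in>p. ennreal (F (Sup k) - F (Inf k)))"
        using k by (intro sum.cong refl) (metis Icc)
      also have "\<dots> = ennreal (\<Sum>k\<in>p. F (Sup k) - F (Inf k))"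
        using k mono by (intro sum_ennreal) auto
      also have "\<dots> \<le> ennreal \<epsilon>" using * by (rule ennreal_leI)
      finally show ?thesis using pD(6) meas pD(1) by (metis sets.finite_Union subsetI)
    qed
    have inc: "incseq A" unfolding A_def incseq_def by (auto intro: less_le_trans)
    have "emeasure \<mu> N \<le> emeasure \<mu> U" using U by (intro emeasure_mono) auto
    also have "emeasure \<mu> U = (SUP n. emeasure \<mu> (A n))"
      using An inc by (subst SUP_emeasure_incseq) (auto simp: UA)
    also have "\<dots> \<le> ennreal \<epsilon>" using An by (intro SUP_least) auto
    finally show ?thesis by simp
  qed
  have "emeasure \<mu> N \<le> 0"
    by (rule ennreal_le_epsilon) (rule le)
  then show ?thesis by (simp add: \<mu>_def)
qed

lemma ac_on_continuous_on:
  assumes "ac_on a b f"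
  shows "continuous_on {a..b} f"
  unfolding continuous_on_iff
proof (intro ballI allI impI)
  fix x e :: real assume x: "x \<in> {a..b}" and e: "0 < e"
  then obtain \<delta> where \<delta>: "\<delta> > 0" "\<And>D. nonoverlapping D \<and> confined D a b \<and>
      (\<Sum>p\<in>D. snd p - fst p) < \<delta> \<Longrightarrow> (\<Sum>p\<in>D. \<bar>f (snd p) - f (fst p)\<bar>) \<le> e / 2"
    using assms unfolding ac_on_def by (meson half_gt_zero)
  show "\<exists>d>0. \<forall>x'\<in>{a..b}. dist x' x < d \<longrightarrow> dist (f x') (f x) < e"
  proof (intro exI[of _ \<delta>] conjI ballI impI)
    fix y assume y: "y \<in> {a..b}" "dist y x < \<delta>"
    show "dist (f y) (f x) < e"
      using \<delta>(2)[of "{(x, y)}"] \<delta>(2)[of "{(y, x)}"] x y e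
      by (cases x y rule: linorder_cases)
         (auto simp: nonoverlapping_def confined_def dist_real_def abs_minus_commute)
  qed (fact \<delta>)
qed

text \<open>The Stieltjes measure of \<open>F\<close>, continued by constants outside \<open>[a, b]\<close>, is absolutely continuous with
  respect to Lebesgue measure, and the theorem of Radon and Nikodym yields the density.\<close>
lemma monotone_ac_density:
  fixes F :: "real \<Rightarrow> real"
  assumes mono: "\<And>x y. a \<le> x \<Longrightarrow> x \<le> y \<Longrightarrow> y \<le> b \<Longrightarrow> F x \<le> F y" and ac: "ac_on a b F" and ab: "a \<le> b"
  shows "\<exists>g. integrable lborel g \<and> (\<forall>x. 0 \<le> g x) \<and>
    (\<forall>x\<in>{a..b}. F x - F a = (\<integral>u. indicator {a<..x} u * g u \<partial>lborel))"
proof -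
  define G where "G = (\<lambda>x. F (max a (min b x)))"
  have G: "x \<le> y \<Longrightarrow> G x \<le> G y" for x y unfolding G_def using ab by (intro mono) auto
  have GF: "x \<in> {a..b} \<Longrightarrow> G x = F x" for x by (auto simp: G_def)
  have contG: "continuous_on UNIV G"
    unfolding G_def using ab
    by (intro continuous_on_compose2[OF ac_on_continuous_on[OF ac]] continuous_intros) auto
  have "ac_on a b G"
  proof -
    have "(\<Sum>p\<in>D. \<bar>G (snd p) - G (fst p)\<bar>) = (\<Sum>p\<in>D. \<bar>F (snd p) - F (fst p)\<bar>)"
      if D: "confined D a b" "nonoverlapping D" for D
    proof (intro sum.cong refl)
      fix p assume "p \<in> D"
      with D have "fst p \<in> {a..b}" "snd p \<in> {a..b}" by (force simp: confined_def nonoverlapping_def)+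
      then show "\<bar>G (snd p) - G (fst p)\<bar> = \<bar>F (snd p) - F (fst p)\<bar>" by (simp only: GF)
    qed
    note eq = this
    show ?thesis unfolding ac_on_def
    proof (intro allI impI)
      fix \<epsilon> :: real assume "\<epsilon> > 0"
      then obtain \<delta> where \<delta>: "\<delta> > 0" "\<And>D. nonoverlapping D \<and> confined D a b \<and>
          (\<Sum>p\<in>D. snd p - fst p) < \<delta> \<Longrightarrow> (\<Sum>p\<in>D. \<bar>F (snd p) - F (fst p)\<bar>) \<le> \<epsilon>"
        using ac unfolding ac_on_def by blast
      show "\<exists>\<delta>>0. \<forall>D. nonoverlapping D \<and> confined D a b \<and>
          (\<Sum>p\<in>D. snd p - fst p) < \<delta> \<longrightarrow> (\<Sum>p\<in>D. \<bar>G (snd p) - G (fst p)\<bar>) \<le> \<epsilon>"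
      proof (intro exI[of _ \<delta>] conjI allI impI)
        fix D assume D: "nonoverlapping D \<and> confined D a b \<and> (\<Sum>p\<in>D. snd p - fst p) < \<delta>"
        then show "(\<Sum>p\<in>D. \<bar>G (snd p) - G (fst p)\<bar>) \<le> \<epsilon>"
          using \<delta>(2)[OF D] eq[of D] by simp
      qed (fact \<delta>)
    qed
  qed
  then have null: "emeasure (interval_measure G) N = 0" if "N \<in> null_sets lborel" for N
    using G contG ab that by (intro monotone_ac_null[of G a b]) (auto simp: G_def)
  have "absolutely_continuous lborel (interval_measure G)"
    unfolding absolutely_continuous_def using null by (auto intro!: null_setsI)
  then obtain h where h: "h \<in> borel_measurable lborel" "density lborel h = interval_measure G"
    using sigma_finite_measure.Radon_Nikodym[OF sigma_finite_lborel, of "interval_measure G"] by auto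
  have [measurable]: "h \<in> borel_measurable borel" using h(1) by simp
  have Ioc: "(\<integral>\<^sup>+u. h u * indicator {a<..x} u \<partial>lborel) = ennreal (G x - G a)" if "a \<le> x" for x
  proof -
    have "(\<integral>\<^sup>+u. h u * indicator {a<..x} u \<partial>lborel) = emeasure (density lborel h) {a<..x}"
      by (subst emeasure_density) auto
    also have "\<dots> = ennreal (G x - G a)"
      unfolding h(2) using that G contG
      by (intro emeasure_interval_measure_Ioc) (auto simp: continuous_on_eq_continuous_at continuous_at_imp_continuous_within)
    finally show ?thesis .
  qed
  define g where "g = (\<lambda>u. enn2real (h u * indicator {a<..b} u))"
  have [measurable]: "g \<in> borel_measurable borel" unfolding g_def by measurable
  have "AE u in lborel. h u * indicator {a<..b} u \<noteq> \<infinity>"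
    using Ioc[of b] ab by (intro nn_integral_PInf_AE) auto
  then have ae: "AE u in lborel. ennreal (g u) = h u * indicator {a<..b} u"
    unfolding g_def by eventually_elim (auto simp: less_top)
  have nn: "(\<integral>\<^sup>+u. ennreal (indicator {a<..x} u * g u) \<partial>lborel) = ennreal (F x - F a)" if "x \<in> {a..b}" for x
  proof -
    have "(\<integral>\<^sup>+u. ennreal (indicator {a<..x} u * g u) \<partial>lborel) = (\<integral>\<^sup>+u. h u * indicator {a<..x} u \<partial>lborel)"
      using ae by (intro nn_integral_cong_AE, eventually_elim)
        (use that in \<open>auto simp: indicator_def split: if_splits\<close>)
    also have "\<dots> = ennreal (F x - F a)" using that ab by (subst Ioc) (auto simp: GF)
    finally show ?thesis .
  qed
  have g0: "0 \<le> g u" for u by (simp add: g_def)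
  have "(\<integral>\<^sup>+u. ennreal (g u) \<partial>lborel) = (\<integral>\<^sup>+u. ennreal (indicator {a<..b} u * g u) \<partial>lborel)"
    by (intro nn_integral_cong) (auto simp: g_def indicator_def)
  then have int: "integrable lborel g"
    using nn[of b] ab g0 by (intro integrableI_nonneg) auto
  have "F x - F a = (\<integral>u. indicator {a<..x} u * g u \<partial>lborel)" if "x \<in> {a..b}" for x
    using nn[OF that] mono[of a x] that g0
    by (intro integral_eq_nn_integral[THEN trans, symmetric] ) auto
  then show ?thesis using int g0 by blast
qed

text \<open>Let \<open>V\<close> be the variation function of \<open>f\<close>. Then \<open>V + f\<close> and \<open>V - f\<close> are increasing and absolutely
  continuous. Half the difference of their densities is a density of \<open>f\<close>, and half their sum, which has
  the integral \<open>V b - V a\<close>, bounds its absolute value.\<close>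
lemma ac_on_density:
  fixes f :: "real \<Rightarrow> real"
  assumes ac: "ac_on a b f" and ab: "a \<le> b"
  shows "\<exists>g. integrable lborel g \<and> (\<forall>x\<in>{a..b}. f x - f a = (\<integral>u. indicator {a<..x} u * g u \<partial>lborel)) \<and>
     (\<integral>\<^sup>+u. ennreal (indicator {a<..b} u * \<bar>g u\<bar>) \<partial>lborel) \<le> variation f a b"
proof -
  define V where "V = (\<lambda>x. enn2real (variation f a x))"
  have fin: "variation f a x < \<infinity>" if "a \<le> x" "x \<le> b" for x
  proof -
    have "variation f a x \<le> variation f a x + ennreal \<bar>f b - f x\<bar>"
      by (intro add_increasing2) auto
    also have "\<dots> \<le> variation f a b" using that by (intro variation_add_increment_le)
    finally show ?thesis using ac_on_variation_finite[OF ac ab] by (rule le_less_trans)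
  qed
  have V: "ennreal (V x) = variation f a x" if "a \<le> x" "x \<le> b" for x
    using fin[OF that] by (simp add: V_def)
  have V0: "0 \<le> V x" for x by (simp add: V_def)
  have inc: "\<bar>f y - f x\<bar> \<le> V y - V x" if "a \<le> x" "x \<le> y" "y \<le> b" for x y
  proof -
    have "ennreal (V x + \<bar>f y - f x\<bar>) \<le> ennreal (V y)"
      using variation_add_increment_le[of a x y f] that V V0 by simp
    then have "V x + \<bar>f y - f x\<bar> \<le> V y" using V0 by (simp only: ennreal_le_iff)
    then show ?thesis by simp
  qed
  have upper: "ennreal (V y - V x) \<le> variation f x y" if "a \<le> x" "x \<le> y" "y \<le> b" for x y
  proof -
    have "ennreal (V y) \<le> ennreal (V x) + variation f x y"
      using variation_subadditive[of a x y f] that V by simp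
    then show ?thesis using V0 inc[OF that] by (simp add: ennreal_minus[symmetric] ennreal_minus_le_iff)
  qed
  have acs: "ac_on a b (\<lambda>x. V x + s * f x)" if s: "s = 1 \<or> s = -1" for s
    unfolding ac_on_def
  proof (intro allI impI)
    fix \<epsilon> :: real assume "\<epsilon> > 0"
    then obtain \<delta> where \<delta>: "\<delta> > 0" "\<And>D. nonoverlapping D \<and> confined D a b \<and>
      (\<Sum>p\<in>D. snd p - fst p) < \<delta> \<Longrightarrow> (\<Sum>p\<in>D. variation f (fst p) (snd p)) \<le> ennreal (\<epsilon> / 2)"
      using ac_on_sum_variation_le[OF ac, of "\<epsilon> / 2"] by auto
    show "\<exists>\<delta>>0. \<forall>D. nonoverlapping D \<and> confined D a b \<and> (\<Sum>p\<in>D. snd p - fst p) < \<delta> \<longrightarrow>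
        (\<Sum>p\<in>D. \<bar>(V (snd p) + s * f (snd p)) - (V (fst p) + s * f (fst p))\<bar>) \<le> \<epsilon>"
    proof (intro exI[of _ \<delta>] conjI allI impI)
      fix D assume D: "nonoverlapping D \<and> confined D a b \<and> (\<Sum>p\<in>D. snd p - fst p) < \<delta>"
      have p: "a \<le> fst p \<and> fst p \<le> snd p \<and> snd p \<le> b" if "p \<in> D" for p
        using D that by (auto simp: nonoverlapping_def confined_def less_imp_le)
      have "ennreal (\<Sum>p\<in>D. V (snd p) - V (fst p)) = (\<Sum>p\<in>D. ennreal (V (snd p) - V (fst p)))"
        using p inc by (intro sum_ennreal[symmetric]) force
      also have "\<dots> \<le> (\<Sum>p\<in>D. variation f (fst p) (snd p))"
        using p upper by (intro sum_mono) auto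
      also have "\<dots> \<le> ennreal (\<epsilon> / 2)" using D by (intro \<delta>(2)) auto
      finally have le: "(\<Sum>p\<in>D. V (snd p) - V (fst p)) \<le> \<epsilon> / 2"
        using \<open>\<epsilon> > 0\<close> by (simp add: ennreal_le_iff)
      have "(\<Sum>p\<in>D. \<bar>(V (snd p) + s * f (snd p)) - (V (fst p) + s * f (fst p))\<bar>) \<le>
          (\<Sum>p\<in>D. 2 * (V (snd p) - V (fst p)))"
        using p inc s by (intro sum_mono) fastforce
      also have "\<dots> \<le> \<epsilon>" using le unfolding sum_distrib_left[symmetric] by linarith
      finally show "(\<Sum>p\<in>D. \<bar>(V (snd p) + s * f (snd p)) - (V (fst p) + s * f (fst p))\<bar>) \<le> \<epsilon>" .
    qed (fact \<delta>)
  qed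
  obtain g1 where g1: "integrable lborel g1" "\<And>x. 0 \<le> g1 x"
    "\<And>x. x \<in> {a..b} \<Longrightarrow> (V x + 1 * f x) - (V a + 1 * f a) = (\<integral>u. indicator {a<..x} u * g1 u \<partial>lborel)"
    using monotone_ac_density[OF _ acs[of 1] ab] inc by fastforce
  obtain g2 where g2: "integrable lborel g2" "\<And>x. 0 \<le> g2 x"
    "\<And>x. x \<in> {a..b} \<Longrightarrow> (V x + (-1) * f x) - (V a + (-1) * f a) = (\<integral>u. indicator {a<..x} u * g2 u \<partial>lborel)"
    using monotone_ac_density[OF _ acs[of "-1"] ab] inc by fastforce
  define g where "g = (\<lambda>u. (g1 u - g2 u) / 2)"
  have ind: "integrable lborel (\<lambda>u. indicator {a<..x} u * g1 u)" "integrable lborel (\<lambda>u. indicator {a<..x} u * g2 u)" for x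
    using integrable_mult_indicator[of "{a<..x}" lborel g1] integrable_mult_indicator[of "{a<..x}" lborel g2] g1 g2 by auto
  have i1: "integrable lborel g" unfolding g_def using g1 g2 by auto
  have i2: "f x - f a = (\<integral>u. indicator {a<..x} u * g u \<partial>lborel)" if "x \<in> {a..b}" for x
  proof -
    have "(\<integral>u. indicator {a<..x} u * g u \<partial>lborel) =
       (\<integral>u. (indicator {a<..x} u * g1 u - indicator {a<..x} u * g2 u) / 2 \<partial>lborel)"
      by (intro Bochner_Integration.integral_cong) (auto simp: g_def algebra_simps)
    also have "\<dots> = f x - f a" using ind g1(3)[OF that] g2(3)[OF that] by simp
    finally show ?thesis ..
  qed
  have i3: "(\<integral>\<^sup>+u. ennreal (indicator {a<..b} u * \<bar>g u\<bar>) \<partial>lborel) \<le> variation f a b"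
  proof -
    have "(\<integral>\<^sup>+u. ennreal (indicator {a<..b} u * \<bar>g u\<bar>) \<partial>lborel) \<le>
       (\<integral>\<^sup>+u. ennreal ((indicator {a<..b} u * g1 u + indicator {a<..b} u * g2 u) / 2) \<partial>lborel)"
      using g1(2) g2(2) by (intro nn_integral_mono ennreal_leI) (auto simp: g_def indicator_def abs_if)
    also have "\<dots> = ennreal (\<integral>u. (indicator {a<..b} u * g1 u + indicator {a<..b} u * g2 u) / 2 \<partial>lborel)"
      using ind g1(2) g2(2) by (intro nn_integral_eq_integral) auto
    also have "\<dots> = ennreal (V b - V a)"
    proof -
      have "(\<integral>u. indicator {a<..b} u * g1 u \<partial>lborel) = V b + f b - (V a + f a)"
        "(\<integral>u. indicator {a<..b} u * g2 u \<partial>lborel) = V b - f b - (V a - f a)"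
        using g1(3)[of b] g2(3)[of b] ab by simp_all
      moreover have "(\<integral>u. (indicator {a<..b} u * g1 u + indicator {a<..b} u * g2 u) / 2 \<partial>lborel) =
        ((\<integral>u. indicator {a<..b} u * g1 u \<partial>lborel) + (\<integral>u. indicator {a<..b} u * g2 u \<partial>lborel)) / 2"
        using ind by simp
      ultimately have "(\<integral>u. (indicator {a<..b} u * g1 u + indicator {a<..b} u * g2 u) / 2 \<partial>lborel) = V b - V a"
        by (simp only:) (simp add: field_simps)
      then show ?thesis by (rule arg_cong)
    qed
    also have "\<dots> \<le> variation f a b" using ab by (intro upper) auto
    finally show ?thesis .
  qed
  show ?thesis by (intro exI[of _ g] conjI ballI i1 i2 i3)
qed

text \<open>The bound is uniform over the short intervals, also over those close to an endpoint missing from \<open>S\<close>.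
  It keeps the variation bounded when the left end of an interval tends to such an endpoint.\<close>
lemma abs_continuous_on_small_variation:
  assumes "abs_continuous_on S f"
  shows "\<exists>\<delta>>0. \<forall>a b. {a..b} \<subseteq> S \<and> a \<le> b \<and> b - a < \<delta> \<longrightarrow> variation f a b \<le> 1"
proof -
  obtain \<delta> where \<delta>: "\<delta> > 0" "\<And>d. d division_of \<Union>d \<and> \<Union>d \<subseteq> S \<and> (\<Sum>k\<in>d. Sup k - Inf k) < \<delta>
      \<Longrightarrow> (\<Sum>k\<in>d. \<bar>f (Sup k) - f (Inf k)\<bar>) < 1"
    using assms unfolding abs_continuous_on_def by (meson zero_less_one)
  have "variation f a b \<le> 1" if ab: "{a..b} \<subseteq> S" "a \<le> b" "b - a < \<delta>" for a b
    unfolding variation_def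
  proof (rule SUP_least, clarify)
    fix D assume D: "nonoverlapping D" "confined D a b"
    let ?d = "(\<lambda>p. {fst p..snd p}) ` D"
    have "\<Union>?d \<subseteq> S" using D ab by (force simp: confined_def)
    moreover have "(\<Sum>p\<in>D. snd p - fst p) < \<delta>"
      using nonoverlapping_length_le[OF D ab(2)] ab(3) by simp
    ultimately have "(\<Sum>k\<in>?d. \<bar>f (Sup k) - f (Inf k)\<bar>) < 1"
      using D by (intro \<delta>) (auto simp: nonoverlapping_division(1) nonoverlapping_division(2)[where F="\<lambda>x y. y - x"])
    then have "(\<Sum>p\<in>D. \<bar>f (snd p) - f (fst p)\<bar>) \<le> 1"
      using D by (simp add: nonoverlapping_division(2)[where F="\<lambda>x y. \<bar>f y - f x\<bar>"])
    then show "(\<Sum>p\<in>D. ennreal \<bar>f (snd p) - f (fst p)\<bar>) \<le> 1"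
      by (simp add: ennreal_le_1)
  qed
  with \<delta>(1) show ?thesis by blast
qed

text \<open>On \<open>[a, T]\<close> with \<open>r < a\<close> the function has a density, which is almost everywhere its derivative. When \<open>a\<close>
  decreases to \<open>r\<close>, Fatou's lemma preserves the bound by the variation, dominated convergence the integral
  formula, and the constant \<open>f a\<close> tends to 0.\<close>
lemma abs_continuous_on_FTC:
  fixes f \<phi> :: "real \<Rightarrow> real"
  assumes ac: "abs_continuous_on {r<..T} f" and lim: "(f \<longlongrightarrow> 0) (at_right r)" and rT: "r < T"
    and \<phi>[measurable]: "\<phi> \<in> borel_measurable borel"
    and deriv: "\<And>u D. r < u \<Longrightarrow> u < T \<Longrightarrow> (f has_real_derivative D) (at u) \<Longrightarrow> \<phi> u = D"
  shows "(\<integral>\<^sup>+u. ennreal (indicator {r<..T} u * \<bar>\<phi> u\<bar>) \<partial>lborel) \<le> total_variation_on {r<..T} f"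
    and "integrable lborel (\<lambda>u. indicator {r<..T} u * \<phi> u)"
    and "\<And>t. r < t \<Longrightarrow> t \<le> T \<Longrightarrow> f t = (\<integral>u. indicator {r<..t} u * \<phi> u \<partial>lborel)"
proof -
  have comp: "(\<integral>\<^sup>+u. ennreal (indicator {a<..T} u * \<bar>\<phi> u\<bar>) \<partial>lborel) \<le> variation f a T \<and>
      variation f a T < \<infinity> \<and> (\<forall>t\<in>{a..T}. f t - f a = (\<integral>u. indicator {a<..t} u * \<phi> u \<partial>lborel))"
    if a: "r < a" "a < T" for a
  proof -
    have acp: "ac_on a T f" using a by (intro abs_continuous_on_imp_ac_on[OF ac]) auto
    obtain g where g: "integrable lborel g"
      "\<And>x. x \<in> {a..T} \<Longrightarrow> f x - f a = (\<integral>u. indicator {a<..x} u * g u \<partial>lborel)"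
      "(\<integral>\<^sup>+u. ennreal (indicator {a<..T} u * \<bar>g u\<bar>) \<partial>lborel) \<le> variation f a T"
      using ac_on_density[OF acp] a by (auto simp: less_imp_le)
    have ae: "AE x in lborel. x \<in> {a<..T} \<longrightarrow> \<phi> x = g x"
      using AE_indefinite_integral_has_derivative[OF g(1), of a T] AE_lborel_singleton[of T]
    proof eventually_elim
      case (elim x)
      show ?case
      proof
        assume "x \<in> {a<..T}"
        with elim have x: "a < x" "x < T"
          and D: "((\<lambda>t. \<integral>u. indicator {a<..t} u * g u \<partial>lborel) has_real_derivative g x) (at x)" by auto
        have "((\<lambda>t. (\<integral>u. indicator {a<..t} u * g u \<partial>lborel) + f a) has_real_derivative g x) (at x)"
          using DERIV_add[OF D DERIV_const[of "f a"]] by simp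
        then have "(f has_real_derivative g x) (at x)"
          by (rule has_field_derivative_transform_within_open[of _ _ _ "{a<..<T}"])
            (use x in \<open>auto simp: g(2)[symmetric]\<close>)
        then show "\<phi> x = g x" using x a by (intro deriv) auto
      qed
    qed
    have [measurable]: "g \<in> borel_measurable borel" using g(1) by auto
    have "(\<integral>\<^sup>+u. ennreal (indicator {a<..T} u * \<bar>\<phi> u\<bar>) \<partial>lborel) = (\<integral>\<^sup>+u. ennreal (indicator {a<..T} u * \<bar>g u\<bar>) \<partial>lborel)"
      using ae by (intro nn_integral_cong_AE) (auto simp: indicator_def elim!: eventually_mono)
    moreover have "(\<integral>u. indicator {a<..t} u * \<phi> u \<partial>lborel) = (\<integral>u. indicator {a<..t} u * g u \<partial>lborel)" if "t \<in> {a..T}" for t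
      using ae that by (intro integral_cong_AE) (auto simp: indicator_def elim!: eventually_mono)
    ultimately show ?thesis using g(2,3) ac_on_variation_finite[OF acp] a by auto
  qed
  define A where "A = (\<lambda>n::nat. r + (T - r) / real (n + 2))"
  have A: "r < A n" "A n < T" for n
  proof -
    show "r < A n" using rT by (simp add: A_def)
    have "(T - r) / real (n + 2) < T - r"
      using mult_strict_left_mono[of 1 "real (n + 2)" "T - r"] rT by (subst pos_divide_less_eq) auto
    then show "A n < T" unfolding A_def by linarith
  qed
  have Alim: "A \<longlonglongrightarrow> r"
  proof -
    have "(\<lambda>n. r + (T - r) / real (n + 2)) \<longlonglongrightarrow> r + 0"
      by (intro tendsto_add tendsto_const LIMSEQ_ignore_initial_segment lim_const_over_n)
    then show ?thesis by (simp add: A_def)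
  qed
  have Adec: "decseq A" unfolding A_def decseq_def using rT by (auto intro!: divide_left_mono)
  have ind: "(\<lambda>n. indicator {A n<..t} u :: real) \<longlonglongrightarrow> indicator {r<..t} u" for u t
  proof (cases "r < u")
    case True
    then have "eventually (\<lambda>n. A n < u) sequentially" using Alim by (intro order_tendstoD(2))
    then have "eventually (\<lambda>n. indicator {A n<..t} u = (indicator {r<..t} u :: real)) sequentially"
      by (rule eventually_mono) (use True in \<open>auto simp: indicator_def\<close>)
    then show ?thesis by (rule tendsto_eventually)
  next
    case False
    then have "indicator {A n<..t} u = (indicator {r<..t} u :: real)" for n
      using A(1)[of n] by (auto simp: indicator_def)
    then show ?thesis by simp
  qed
  have "(\<integral>\<^sup>+u. ennreal (indicator {r<..T} u * \<bar>\<phi> u\<bar>) \<partial>lborel) \<le>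
      (\<integral>\<^sup>+u. liminf (\<lambda>n. ennreal (indicator {A n<..T} u * \<bar>\<phi> u\<bar>)) \<partial>lborel)"
  proof (intro nn_integral_mono)
    fix u
    have "(\<lambda>n. ennreal (indicator {A n<..T} u * \<bar>\<phi> u\<bar>)) \<longlonglongrightarrow> ennreal (indicator {r<..T} u * \<bar>\<phi> u\<bar>)"
      by (intro tendsto_ennrealI tendsto_mult ind tendsto_const)
    then show "ennreal (indicator {r<..T} u * \<bar>\<phi> u\<bar>) \<le> liminf (\<lambda>n. ennreal (indicator {A n<..T} u * \<bar>\<phi> u\<bar>))"
      using lim_imp_Liminf[OF sequentially_bot] by fastforce
  qed
  also have "\<dots> \<le> liminf (\<lambda>n. \<integral>\<^sup>+u. ennreal (indicator {A n<..T} u * \<bar>\<phi> u\<bar>) \<partial>lborel)"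
    by (intro nn_integral_liminf) measurable
  also have "\<dots> \<le> liminf (\<lambda>n. variation f (A n) T)"
    using comp[OF A] by (intro Liminf_mono) auto
  finally have bound: "(\<integral>\<^sup>+u. ennreal (indicator {r<..T} u * \<bar>\<phi> u\<bar>) \<partial>lborel) \<le> liminf (\<lambda>n. variation f (A n) T)" .
  have "liminf (\<lambda>n. variation f (A n) T) \<le> total_variation_on {r<..T} f"
    by (intro Liminf_le always_eventually allI variation_le_total_variation_on) (auto intro: less_le_trans[OF A(1)])
  with bound show "(\<integral>\<^sup>+u. ennreal (indicator {r<..T} u * \<bar>\<phi> u\<bar>) \<partial>lborel) \<le> total_variation_on {r<..T} f"
    by (rule order_trans)
  show int: "integrable lborel (\<lambda>u. indicator {r<..T} u * \<phi> u)"
  proof (rule integrableI_bounded)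
    obtain \<delta> where \<delta>: "\<delta> > 0" "\<And>a b. {a..b} \<subseteq> {r<..T} \<and> a \<le> b \<and> b - a < \<delta> \<Longrightarrow> variation f a b \<le> 1"
      using abs_continuous_on_small_variation[OF ac] by blast
    define c where "c = r + min (\<delta> / 2) ((T - r) / 2)"
    have c: "r < c" "c < T" "c - r < \<delta>" using rT \<delta>(1) by (auto simp: c_def min_def field_simps)
    have "variation f (A n) T \<le> 1 + variation f c T" if "A n < c" for n
    proof -
      have "variation f (A n) T \<le> variation f (A n) c + variation f c T"
        using that c by (intro variation_subadditive) auto
      also have "\<dots> \<le> 1 + variation f c T"
        using that c A(1)[of n] by (intro add_mono \<delta>(2)) auto
      finally show ?thesis .
    qed
    moreover have "eventually (\<lambda>n. A n < c) sequentially"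
      using Alim c(1) by (intro order_tendstoD(2))
    ultimately have "eventually (\<lambda>n. variation f (A n) T \<le> 1 + variation f c T) sequentially"
      by (auto elim: eventually_mono)
    then have "liminf (\<lambda>n. variation f (A n) T) \<le> 1 + variation f c T"
      by (intro Liminf_le) auto
    also have "\<dots> < \<infinity>" using comp[OF c(1,2)] by simp
    finally have "(\<integral>\<^sup>+u. ennreal (indicator {r<..T} u * \<bar>\<phi> u\<bar>) \<partial>lborel) < \<infinity>"
      using bound by (rule le_less_trans[rotated])
    then show "(\<integral>\<^sup>+u. ennreal (norm (indicator {r<..T} u * \<phi> u)) \<partial>lborel) < \<infinity>"
      by (simp add: abs_mult)
  qed measurable
  fix t assume t: "r < t" "t \<le> T"
  have "(\<lambda>n. \<integral>u. indicator {A n<..t} u * \<phi> u \<partial>lborel) \<longlonglongrightarrow> (\<integral>u. indicator {r<..t} u * \<phi> u \<partial>lborel)"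
  proof (rule integral_dominated_convergence[where w="\<lambda>u. \<bar>indicator {r<..T} u * \<phi> u\<bar>"])
    show "integrable lborel (\<lambda>u. \<bar>indicator {r<..T} u * \<phi> u\<bar>)" using int by (rule integrable_abs)
    show "AE u in lborel. (\<lambda>n. indicator {A n<..t} u * \<phi> u) \<longlonglongrightarrow> indicator {r<..t} u * \<phi> u"
      by (intro AE_I2 tendsto_mult ind tendsto_const)
    show "AE u in lborel. norm (indicator {A n<..t} u * \<phi> u) \<le> \<bar>indicator {r<..T} u * \<phi> u\<bar>" for n
      using A(1)[of n] t by (intro AE_I2) (auto simp: indicator_def)
  qed measurable
  moreover have "(\<lambda>n. \<integral>u. indicator {A n<..t} u * \<phi> u \<partial>lborel) \<longlonglongrightarrow> f t - 0"
  proof -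
    have "(\<lambda>n. f (A n)) \<longlonglongrightarrow> 0"
      using A(1) Alim by (intro filterlim_compose[OF lim]) (auto simp: filterlim_at intro!: always_eventually)
    then have "(\<lambda>n. f t - f (A n)) \<longlonglongrightarrow> f t - 0" by (intro tendsto_intros)
    moreover have "eventually (\<lambda>n. f t - f (A n) = (\<integral>u. indicator {A n<..t} u * \<phi> u \<partial>lborel)) sequentially"
      using order_tendstoD(2)[OF Alim t(1)]
    proof eventually_elim
      case (elim n) then show ?case using comp[OF A, of n] t by auto
    qed
    ultimately show ?thesis by (rule Lim_transform_eventually)
  qed
  ultimately show "f t = (\<integral>u. indicator {r<..t} u * \<phi> u \<partial>lborel)"
    using LIMSEQ_unique by fastforce
qed

section \<open>The derivative of a strictly regular kernel\<close>

lemma kernel_domain_sets: "kernel_domain T \<in> sets borel"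
proof -
  have "kernel_domain T = {p. 0 \<le> snd p} \<inter> {p. snd p < fst p} \<inter> {p. fst p \<le> T}"
    by (auto simp: kernel_domain_def)
  moreover have "{p::real\<times>real. 0 \<le> snd p} \<in> sets borel" "{p::real\<times>real. fst p \<le> T} \<in> sets borel"
    by (intro borel_closed closed_Collect_le continuous_intros)+
  moreover have "{p::real\<times>real. snd p < fst p} \<in> sets borel"
    by (intro borel_open open_Collect_less continuous_intros)
  ultimately show ?thesis by auto
qed

text \<open>Rational test points suffice since \<open>q\<close> is continuous away from \<open>u\<close>. Differentiability of \<open>K(\<cdot>,r)\<close> at \<open>u\<close>
  thus becomes a combination of countably many measurable conditions on \<open>(u, r)\<close>.\<close>
lemma tendsto_within_iff_rational:
  fixes q :: "real \<Rightarrow> real"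
  assumes cont: "continuous_on ({r<..T} - {u}) q"
  shows "(q \<longlongrightarrow> D) (at u within {r<..T}) \<longleftrightarrow>
    (\<forall>m. \<exists>n. \<forall>y::rat. r < of_rat y \<and> of_rat y \<le> T \<and> of_rat y \<noteq> u \<and> \<bar>of_rat y - u\<bar> < inverse (real (Suc n)) \<longrightarrow>
       \<bar>q (of_rat y) - D\<bar> \<le> inverse (real (Suc m)))" (is "?L \<longleftrightarrow> ?R")
proof
  assume L: ?L
  show ?R
  proof
    fix m
    from L have "\<forall>e>0. \<exists>d>0. \<forall>x\<in>{r<..T}. 0 < dist x u \<and> dist x u < d \<longrightarrow> dist (q x) D < e"
      unfolding Lim_within by auto
    then obtain d where d: "d > 0" "\<And>x. x \<in> {r<..T} \<Longrightarrow> 0 < dist x u \<and> dist x u < d \<Longrightarrow> dist (q x) D < inverse (Suc m)"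
      by (metis inverse_positive_iff_positive of_nat_0_less_iff zero_less_Suc)
    obtain n where n: "inverse (real (Suc n)) < d" using reals_Archimedean[OF d(1)] by auto
    have "\<bar>q (of_rat y) - D\<bar> \<le> inverse (real (Suc m))"
      if "r < of_rat y" "of_rat y \<le> T" "of_rat y \<noteq> u" "\<bar>of_rat y - u\<bar> < inverse (real (Suc n))" for y :: rat
      using d(2)[of "of_rat y"] that n by (simp add: dist_real_def)
    then show "\<exists>n. \<forall>y::rat. r < of_rat y \<and> of_rat y \<le> T \<and> of_rat y \<noteq> u \<and> \<bar>of_rat y - u\<bar> < inverse (real (Suc n)) \<longrightarrow>
       \<bar>q (of_rat y) - D\<bar> \<le> inverse (real (Suc m))" by blast
  qed
next
  assume R: ?R
  show ?L unfolding Lim_within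
  proof (intro allI impI)
    fix e :: real assume "e > 0"
    then obtain m where m: "inverse (real (Suc m)) < e" using reals_Archimedean by auto
    obtain n where n: "\<And>y::rat. r < of_rat y \<Longrightarrow> of_rat y \<le> T \<Longrightarrow> of_rat y \<noteq> u \<Longrightarrow> \<bar>of_rat y - u\<bar> < inverse (real (Suc n)) \<Longrightarrow>
       \<bar>q (of_rat y) - D\<bar> \<le> inverse (real (Suc m))"
      using spec[OF R, of m] by blast
    show "\<exists>d>0. \<forall>x\<in>{r<..T}. 0 < dist x u \<and> dist x u < d \<longrightarrow> dist (q x) D < e"
    proof (intro exI[of _ "inverse (real (Suc n))"] conjI ballI impI)
      fix x assume x: "x \<in> {r<..T}" "0 < dist x u \<and> dist x u < inverse (real (Suc n))"
      have "\<bar>q x - D\<bar> \<le> inverse (real (Suc m)) + \<eta>" if "\<eta> > 0" for \<eta>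
      proof -
        have "x \<in> {r<..T} - {u}" using x by auto
        then obtain d where d: "d > 0" "\<And>y. y \<in> {r<..T} - {u} \<Longrightarrow> dist y x < d \<Longrightarrow> dist (q y) (q x) < \<eta>"
          using cont \<open>\<eta> > 0\<close> unfolding continuous_on_iff by meson
        (* A rational point in (lo, x) lies close to x, within the prescribed distance of u, and on the same
           side of u as x. *)
        define lo where "lo = Max {r, x - d, x - (inverse (real (Suc n)) - \<bar>x - u\<bar>), if u < x then u else r}"
        have lo: "lo < x" "r \<le> lo" "x - d \<le> lo" "x - (inverse (real (Suc n)) - \<bar>x - u\<bar>) \<le> lo" "u < x \<Longrightarrow> u \<le> lo"
          using x d(1) by (auto simp: lo_def dist_real_def)
        obtain y :: rat where y: "lo < of_rat y" "of_rat y < x" using of_rat_dense[OF lo(1)] by blast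
        have yu: "of_rat y \<noteq> u" using y lo x by (auto simp: dist_real_def) 
        have "\<bar>q (of_rat y) - D\<bar> \<le> inverse (real (Suc m))" using y lo x yu by (intro n) auto
        moreover have "\<bar>q (of_rat y) - q x\<bar> < \<eta>" using d(2)[of "of_rat y"] y lo x yu by (auto simp: dist_real_def)
        ultimately show ?thesis by linarith
      qed
      then have "\<bar>q x - D\<bar> \<le> inverse (real (Suc m))" by (rule field_le_epsilon)
      then show "dist (q x) D < e" using m by (simp add: dist_real_def)
    qed simp
  qed
qed

text \<open>The extension of \<open>\<partial>\<^sub>1K\<close> by 0 to the plane, so that all integrals can run over the whole line.\<close>
definition triangle_deriv :: "real \<Rightarrow> (real \<Rightarrow> real \<Rightarrow> real) \<Rightarrow> real \<Rightarrow> real \<Rightarrow> real" where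
  "triangle_deriv T K u r = (if 0 \<le> r \<and> r < u \<and> u \<le> T then kernel_deriv T K u r else 0)"

lemma abs_continuous_on_imp_continuous_on:
  assumes "abs_continuous_on {r<..T} f"
  shows "continuous_on {r<..T} f"
proof -
  have "\<exists>e>0. \<forall>y\<in>{r<..T}. dist y x < e \<longrightarrow> dist (f y) (f x) < \<epsilon>" if x: "x \<in> {r<..T}" and "\<epsilon> > 0" for x \<epsilon>
  proof -
    define a where "a = (r + x) / 2"
    have xa: "x \<in> {a..T}" "a < x" "r < a" using x by (auto simp: a_def)
    have "continuous_on {a..T} f"
      using xa by (intro ac_on_continuous_on abs_continuous_on_imp_ac_on[OF assms]) auto
    then obtain e where e: "e > 0" "\<And>y. y \<in> {a..T} \<Longrightarrow> dist y x < e \<Longrightarrow> dist (f y) (f x) < \<epsilon>"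
      unfolding continuous_on_iff using xa(1) \<open>\<epsilon> > 0\<close> by meson
    show ?thesis
      using e xa by (intro exI[of _ "min e (x - a)"]) (auto simp: dist_real_def)
  qed
  then show ?thesis unfolding continuous_on_iff by blast
qed

lemma kernel_deriv_eqI:
  assumes "((\<lambda>t. K t r) has_real_derivative D) (at u within {r<..T})" "r < u" "u \<le> T"
  shows "kernel_deriv T K u r = D"
proof -
  have "at u within {r<..T} \<noteq> bot"
  proof -
    have "at u within {r<..<u} \<noteq> bot" using assms(2) by (simp add: at_within_eq_bot_iff)
    moreover have "at u within {r<..<u} \<le> at u within {r<..T}"
      using assms(3) by (intro at_le) auto
    ultimately show ?thesis by (auto simp: le_bot bot_unique)
  qed
  then have uniq: "E = D" if "((\<lambda>t. K t r) has_real_derivative E) (at u within {r<..T})" for E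
    using that assms(1) unfolding has_field_derivative_iff by (rule tendsto_unique)
  have ex: "\<exists>D. ((\<lambda>t. K t r) has_real_derivative D) (at u within {r<..T})" using assms(1) by blast
  show ?thesis unfolding kernel_deriv_def if_P[OF ex] using assms(1) uniq by (rule the_equality)
qed

text \<open>The only candidate for the derivative is the limit \<open>D\<close> of the difference quotients along one sequence
  of points of \<open>(r, u)\<close> that tends to \<open>u\<close>, and \<open>D\<close> is measurable in \<open>(u, r)\<close>. The predicate \<open>G\<close> says that \<open>D\<close> is
  the derivative, and is measurable because it refers to rational points only.\<close>
lemma triangle_deriv_measurable:
  assumes K: "strictly_regular_kernel T K"
  shows "(\<lambda>(u, r). triangle_deriv T K u r) \<in> borel_measurable (borel \<Otimes>\<^sub>M borel)"
proof -
  define K' where "K' = (\<lambda>p. if p \<in> kernel_domain T then K (fst p) (snd p) else 0)"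
  have "K' \<in> borel_measurable borel"
  proof -
    have "(\<lambda>p. indicator (kernel_domain T) p *\<^sub>R (\<lambda>(t, s). K t s) p) \<in> borel_measurable borel"
      using K kernel_domain_sets[of T] unfolding strictly_regular_kernel_def
      by (subst (asm) borel_measurable_restrict_space_iff) auto
    moreover have "(\<lambda>p. indicator (kernel_domain T) p *\<^sub>R (\<lambda>(t, s). K t s) p) = K'"
      by (auto simp: K'_def indicator_def fun_eq_iff)
    ultimately show ?thesis by simp
  qed
  then have [measurable]: "K' \<in> borel_measurable (borel \<Otimes>\<^sub>M borel)" by (simp add: borel_prod)
  have K'_eq: "0 \<le> r \<Longrightarrow> r < y \<Longrightarrow> y \<le> T \<Longrightarrow> K' (y, r) = K y r" for y r
    by (simp add: K'_def kernel_domain_def)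
  (* Y n (u, r) lies strictly between r and u and tends to u *)
  define Y where "Y = (\<lambda>(n::nat) p. fst p - (fst p - snd p) / real (n + 2))"
  define D where "D = (\<lambda>p. lim (\<lambda>n. (K' (Y n p, snd p) - K' p) / (Y n p - fst p)))"
  have [measurable]: "Y n \<in> borel_measurable (borel \<Otimes>\<^sub>M borel)" for n unfolding Y_def by measurable
  have [measurable]: "D \<in> borel_measurable (borel \<Otimes>\<^sub>M borel)" unfolding D_def by measurable
  define G where "G = (\<lambda>p. \<forall>m::nat. \<exists>n::nat. \<forall>y::rat. snd p < of_rat y \<and> of_rat y \<le> T \<and> of_rat y \<noteq> fst p \<and>
      \<bar>of_rat y - fst p\<bar> < inverse (real (Suc n)) \<longrightarrow>
       \<bar>(K' (of_rat y, snd p) - K' p) / (of_rat y - fst p) - D p\<bar> \<le> inverse (real (Suc m)))"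
  have [measurable]: "Measurable.pred (borel \<Otimes>\<^sub>M borel) G" unfolding G_def by measurable
  have "(\<lambda>(u, r). triangle_deriv T K u r) = (\<lambda>p. if 0 \<le> snd p \<and> snd p < fst p \<and> fst p \<le> T \<and> G p then D p else 0)"
  proof
    fix p :: "real \<times> real"
    obtain u r where p: "p = (u, r)" by force
    show "(\<lambda>(u, r). triangle_deriv T K u r) p = (if 0 \<le> snd p \<and> snd p < fst p \<and> fst p \<le> T \<and> G p then D p else 0)"
    proof (cases "0 \<le> r \<and> r < u \<and> u \<le> T")
      case False
      then show ?thesis by (auto simp: triangle_deriv_def p)
    next
      case True
      define q where "q = (\<lambda>y. (K y r - K u r) / (y - u))"
      have "abs_continuous_on {r<..T} (\<lambda>t. K t r)"
        using K True unfolding strictly_regular_kernel_def by auto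
      then have "continuous_on {r<..T} (\<lambda>t. K t r)" by (rule abs_continuous_on_imp_continuous_on)
      then have contq: "continuous_on ({r<..T} - {u}) q"
        unfolding q_def by (intro continuous_intros) (auto elim: continuous_on_subset)
      have Gq: "G p \<longleftrightarrow> (q \<longlongrightarrow> D p) (at u within {r<..T})"
        unfolding G_def tendsto_within_iff_rational[OF contq]
        using True by (intro all_cong1 ex_cong1 imp_cong refl) (auto simp: p q_def K'_eq)
      have hd: "((\<lambda>t. K t r) has_real_derivative E) (at u within {r<..T}) \<longleftrightarrow> (q \<longlongrightarrow> E) (at u within {r<..T})" for E
        by (simp add: has_field_derivative_iff q_def)
      show ?thesis
      proof (cases "\<exists>E. (q \<longlongrightarrow> E) (at u within {r<..T})")
        case False
        then show ?thesis using Gq True by (auto simp: p triangle_deriv_def kernel_deriv_def hd)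
      next
        case ex: True
        then obtain E where E: "(q \<longlongrightarrow> E) (at u within {r<..T})" by blast
        have "(\<lambda>n. Y n p) \<longlonglongrightarrow> u - 0"
          unfolding Y_def p fst_conv snd_conv
          by (intro tendsto_diff tendsto_const LIMSEQ_ignore_initial_segment[OF lim_const_over_n])
        moreover have Y: "r < Y n p \<and> Y n p < u" for n
        proof -
          have "(u - r) / real (n + 2) < u - r"
            using mult_strict_left_mono[of 1 "real (n + 2)" "u - r"] True by (subst pos_divide_less_eq) auto
          moreover have "(u - r) / real (n + 2) > 0" using True by simp
          ultimately show ?thesis unfolding Y_def p fst_conv snd_conv by linarith
        qed
        ultimately have "filterlim (\<lambda>n. Y n p) (at u within {r<..T}) sequentially"
          using True by (auto simp: filterlim_at intro!: always_eventually) (metis less_le_trans less_imp_le order_less_irrefl)+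
        from filterlim_compose[OF E this] have "(\<lambda>n. q (Y n p)) \<longlonglongrightarrow> E" .
        moreover have "q (Y n p) = (K' (Y n p, snd p) - K' p) / (Y n p - fst p)" for n
          using Y[of n] True by (simp add: q_def p K'_eq)
        ultimately have "D p = E" unfolding D_def by (simp add: limI)
        moreover have "kernel_deriv T K u r = E"
          using E True by (intro kernel_deriv_eqI) (auto simp: hd)
        ultimately show ?thesis using Gq E True by (simp add: p triangle_deriv_def)
      qed
    qed
  qed
  then show ?thesis by simp
qed

lemma triangle_deriv_FTC:
  assumes K: "strictly_regular_kernel T K" and r: "0 \<le> r" "r < T"
  shows "(\<integral>\<^sup>+u. ennreal \<bar>triangle_deriv T K u r\<bar> \<partial>lborel) \<le> total_variation_on {r<..T} (\<lambda>t. K t r)"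
    and "integrable lborel (\<lambda>u. triangle_deriv T K u r)"
    and "\<And>t. 0 \<le> t \<Longrightarrow> t \<le> T \<Longrightarrow> (\<integral>u. indicator {0<..t} u * triangle_deriv T K u r \<partial>lborel) = (if r < t then K t r else 0)"
proof -
  have kdm: "(\<lambda>u. triangle_deriv T K u r) \<in> borel_measurable borel"
    using measurable_compose[OF _ triangle_deriv_measurable[OF K], of "\<lambda>u. (u, r)" borel] by simp
  have ac: "abs_continuous_on {r<..T} (\<lambda>t. K t r)" and lim: "((\<lambda>t. K t r) \<longlongrightarrow> 0) (at_right r)"
    using K r unfolding strictly_regular_kernel_def by auto
  have deriv: "triangle_deriv T K u r = D" if "r < u" "u < T" "((\<lambda>t. K t r) has_real_derivative D) (at u)" for u D
  proof -
    have "kernel_deriv T K u r = D"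
      using that by (intro kernel_deriv_eqI) (auto intro: has_field_derivative_at_within)
    then show ?thesis using that r by (simp add: triangle_deriv_def)
  qed
  have ind: "indicator {r<..T} u * triangle_deriv T K u r = triangle_deriv T K u r" "indicator {r<..T} u * \<bar>triangle_deriv T K u r\<bar> = \<bar>triangle_deriv T K u r\<bar>" for u
    by (auto simp: triangle_deriv_def indicator_def)
  note F = abs_continuous_on_FTC[OF ac lim r(2) kdm deriv]
  from F(1) show "(\<integral>\<^sup>+u. ennreal \<bar>triangle_deriv T K u r\<bar> \<partial>lborel) \<le> total_variation_on {r<..T} (\<lambda>t. K t r)"
    unfolding ind by simp
  from F(2) show "integrable lborel (\<lambda>u. triangle_deriv T K u r)"
    unfolding ind by simp
  fix t :: real assume t: "0 \<le> t" "t \<le> T"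
  show "(\<integral>u. indicator {0<..t} u * triangle_deriv T K u r \<partial>lborel) = (if r < t then K t r else 0)"
  proof (cases "r < t")
    case True
    have "(\<integral>u. indicator {0<..t} u * triangle_deriv T K u r \<partial>lborel) = (\<integral>u. indicator {r<..t} u * triangle_deriv T K u r \<partial>lborel)"
      using r by (intro Bochner_Integration.integral_cong) (auto simp: triangle_deriv_def indicator_def)
    then show ?thesis using True F(3)[of t] t by simp
  next
    case False
    have "(\<integral>u. indicator {0<..t} u * triangle_deriv T K u r \<partial>lborel) = (\<integral>u. 0 \<partial>(lborel :: real measure))"
      using False by (intro Bochner_Integration.integral_cong) (auto simp: triangle_deriv_def indicator_def)
    then show ?thesis using False by simp
  qed
qed

lemma triangle_deriv_L2:
  assumes K: "strictly_regular_kernel T K"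
  shows "(\<integral>\<^sup>+r. (\<integral>\<^sup>+u. ennreal \<bar>triangle_deriv T K u r\<bar> \<partial>lborel)\<^sup>2 \<partial>lborel) < \<infinity>"
proof -
  have "(\<integral>\<^sup>+r. (\<integral>\<^sup>+u. ennreal \<bar>triangle_deriv T K u r\<bar> \<partial>lborel)\<^sup>2 \<partial>lborel) \<le>
    (\<integral>\<^sup>+ r\<in>{0..T}. (total_variation_on {r<..T} (\<lambda>t. K t r))\<^sup>2 \<partial>lborel)"
  proof (rule nn_integral_mono)
    fix r :: real
    show "(\<integral>\<^sup>+u. ennreal \<bar>triangle_deriv T K u r\<bar> \<partial>lborel)\<^sup>2 \<le> (total_variation_on {r<..T} (\<lambda>t. K t r))\<^sup>2 * indicator {0..T} r"
    proof (cases "0 \<le> r \<and> r < T")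
      case True
      then show ?thesis using triangle_deriv_FTC(1)[OF K, of r] by (auto intro!: power_mono)
    next
      case False
      then have "triangle_deriv T K u r = 0" for u by (auto simp: triangle_deriv_def)
      then show ?thesis by simp
    qed
  qed
  also have "\<dots> < \<infinity>" using K by (simp add: strictly_regular_kernel_def)
  finally show ?thesis .
qed

section \<open>Averages over the cells of a uniform grid\<close>

definition grid :: "real \<Rightarrow> nat \<Rightarrow> nat \<Rightarrow> real" where
  "grid T n l = T * real l / real n"

definition cell :: "real \<Rightarrow> nat \<Rightarrow> nat \<Rightarrow> real set" where
  "cell T n l = {grid T n l <.. grid T n (Suc l)}"

text \<open>The conditional expectation of \<open>f\<close> given the cells of the grid, continued by 0 outside \<open>(0, T]\<close>.\<close>
definition cell_average :: "real \<Rightarrow> nat \<Rightarrow> (real \<Rightarrow> real) \<Rightarrow> real \<Rightarrow> real" where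
  "cell_average T n f u =
    (\<Sum>l<n. indicator (cell T n l) u * ((\<integral>v. indicator (cell T n l) v * f v \<partial>lborel) * (real n / T)))"

lemma grid_simps [simp]: "grid T n 0 = 0" "n > 0 \<Longrightarrow> grid T n n = T"
  by (auto simp: grid_def)

lemma grid_Suc_diff: "n > 0 \<Longrightarrow> grid T n (Suc l) - grid T n l = T / real n"
  by (simp add: grid_def field_simps)

lemma grid_mono: "T > 0 \<Longrightarrow> l \<le> m \<Longrightarrow> grid T n l \<le> grid T n m"
  by (auto simp: grid_def intro!: divide_right_mono)

lemma grid_strict_mono: "T > 0 \<Longrightarrow> n > 0 \<Longrightarrow> l < m \<Longrightarrow> grid T n l < grid T n m"
  by (auto simp: grid_def intro!: divide_strict_right_mono)

lemma cell_sets [measurable]: "cell T n l \<in> sets borel"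
  by (simp add: cell_def)

lemma cell_disjoint: "T > 0 \<Longrightarrow> u \<in> cell T n l \<Longrightarrow> u \<in> cell T n m \<Longrightarrow> l = m"
  using grid_mono[of T "Suc l" m n] grid_mono[of T "Suc m" l n]
  by (cases l m rule: linorder_cases) (auto simp: cell_def Suc_le_eq)

lemma cell_subset: "T > 0 \<Longrightarrow> l < n \<Longrightarrow> cell T n l \<subseteq> {0<..T}"
  using grid_mono[of T 0 l n] grid_mono[of T "Suc l" n n]
  by (auto simp: cell_def)

lemma cell_exists:
  assumes "T > 0" "n > 0" "u \<in> {0<..T}"
  shows "\<exists>l<n. u \<in> cell T n l"
proof -
  have "u \<in> {0<..grid T n m} \<Longrightarrow> \<exists>l<m. u \<in> cell T n l" for m
  proof (induction m)
    case 0 then show ?case by simp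
  next
    case (Suc m)
    show ?case
    proof (cases "u \<le> grid T n m")
      case True
      then show ?thesis using Suc less_SucI by fastforce
    next
      case False
      then have "u \<in> cell T n m" using Suc by (auto simp: cell_def)
      then show ?thesis by blast
    qed
  qed
  from this[of n] show ?thesis using assms by simp
qed

lemma sum_cell_indicator:
  assumes "T > 0" "n > 0"
  shows "(\<Sum>l<n. indicator (cell T n l) u :: real) = indicator {0<..T} u"
proof (cases "u \<in> {0<..T}")
  case True
  then obtain l where l: "l < n" "u \<in> cell T n l" using cell_exists assms by blast
  then have "indicator (cell T n m) u = (if m = l then 1 else 0 :: real)" for m
    using cell_disjoint[OF assms(1)] by (auto simp: indicator_def)
  then show ?thesis using l True by simp
next
  case False
  then have "indicator (cell T n m) u = (0 :: real)" if "m < n" for m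
    using cell_subset[OF assms(1) that] by (auto simp: indicator_def)
  then show ?thesis using False by simp
qed

lemma cell_average_eq:
  assumes "T > 0" "u \<in> cell T n l" "l < n"
  shows "cell_average T n f u = (\<integral>v. indicator (cell T n l) v * f v \<partial>lborel) * (real n / T)"
proof -
  have ind: "indicator (cell T n m) u = (if m = l then 1 else 0 :: real)" for m
    using cell_disjoint[OF assms(1)] assms(2) by (auto simp: indicator_def)
  have "cell_average T n f u =
      (\<Sum>m<n. if m = l then (\<integral>v. indicator (cell T n l) v * f v \<partial>lborel) * (real n / T) else 0)"
    unfolding cell_average_def by (intro sum.cong refl) (simp add: ind)
  then show ?thesis using assms(3) by simp
qed

lemma cell_average_measurable [measurable]: "cell_average T n f \<in> borel_measurable borel"
  unfolding cell_average_def by measurable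

lemma emeasure_cell: "T > 0 \<Longrightarrow> n > 0 \<Longrightarrow> emeasure lborel (cell T n l) = ennreal (T / real n)"
  by (simp add: cell_def grid_mono grid_Suc_diff)

text \<open>Averaging is a contraction of \<open>L\<^sup>1\<close>, by the triangle inequality on each cell.\<close>
lemma nn_integral_cell_average_le:
  assumes T: "T > 0" "n > 0" and f[measurable]: "f \<in> borel_measurable borel"
  shows "(\<integral>\<^sup>+u. ennreal \<bar>cell_average T n f u\<bar> \<partial>lborel) \<le> (\<integral>\<^sup>+u. ennreal \<bar>f u\<bar> \<partial>lborel)"
proof -
  define c where "c = (\<lambda>l. \<integral>v. indicator (cell T n l) v * f v \<partial>lborel)"
  have c: "ennreal \<bar>c l\<bar> \<le> (\<integral>\<^sup>+v. indicator (cell T n l) v * ennreal \<bar>f v\<bar> \<partial>lborel)" for l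
  proof -
    have "ennreal (norm (c l)) \<le> (\<integral>\<^sup>+v. ennreal (norm (indicator (cell T n l) v * f v)) \<partial>lborel)"
    proof (cases "integrable lborel (\<lambda>v. indicator (cell T n l) v * f v)")
      case True
      then show ?thesis unfolding c_def by (rule integral_norm_bound_ennreal)
    next
      case False
      then show ?thesis by (simp add: c_def not_integrable_integral_eq)
    qed
    also have "\<dots> = (\<integral>\<^sup>+v. indicator (cell T n l) v * ennreal \<bar>f v\<bar> \<partial>lborel)"
      by (intro nn_integral_cong) (auto simp: indicator_def)
    finally show ?thesis by simp
  qed
  have "(\<integral>\<^sup>+u. ennreal \<bar>cell_average T n f u\<bar> \<partial>lborel) \<le>
     (\<integral>\<^sup>+u. (\<Sum>l<n. indicator (cell T n l) u * ennreal (\<bar>c l\<bar> * (real n / T))) \<partial>lborel)"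
  proof (intro nn_integral_mono)
    fix u
    have "ennreal \<bar>cell_average T n f u\<bar> \<le> ennreal (\<Sum>l<n. indicator (cell T n l) u * (\<bar>c l\<bar> * (real n / T)))"
      unfolding cell_average_def c_def using T
      by (intro ennreal_leI order_trans[OF sum_abs] sum_mono) (auto simp: abs_mult)
    also have "\<dots> = (\<Sum>l<n. indicator (cell T n l) u * ennreal (\<bar>c l\<bar> * (real n / T)))"
    proof -
      have "ennreal (\<Sum>l<n. indicator (cell T n l) u * (\<bar>c l\<bar> * (real n / T))) =
          (\<Sum>l<n. ennreal (indicator (cell T n l) u * (\<bar>c l\<bar> * (real n / T))))"
        using T by (intro sum_ennreal[symmetric]) auto
      then show ?thesis by (simp only:) (intro sum.cong refl, auto simp: indicator_def)
    qed
    finally show "ennreal \<bar>cell_average T n f u\<bar> \<le> \<dots>" .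
  qed
  also have "\<dots> = (\<Sum>l<n. ennreal (\<bar>c l\<bar> * (real n / T)) * emeasure lborel (cell T n l))"
    by (subst nn_integral_sum) (auto simp: nn_integral_multc mult.commute)
  also have "\<dots> = (\<Sum>l<n. ennreal \<bar>c l\<bar>)"
    using T by (intro sum.cong refl) (simp add: emeasure_cell ennreal_mult[symmetric])
  also have "\<dots> \<le> (\<Sum>l<n. \<integral>\<^sup>+v. indicator (cell T n l) v * ennreal \<bar>f v\<bar> \<partial>lborel)"
    by (intro sum_mono c)
  also have "\<dots> = (\<integral>\<^sup>+v. (\<Sum>l<n. indicator (cell T n l) v * ennreal \<bar>f v\<bar>) \<partial>lborel)"
    by (subst nn_integral_sum) auto
  also have "\<dots> \<le> (\<integral>\<^sup>+v. ennreal \<bar>f v\<bar> \<partial>lborel)"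
  proof (intro nn_integral_mono)
    fix v
    have "(\<Sum>l<n. indicator (cell T n l) v * ennreal \<bar>f v\<bar>) = ennreal (\<Sum>l<n. indicator (cell T n l) v) * ennreal \<bar>f v\<bar>"
      by (subst sum_ennreal[symmetric]) (auto simp: sum_distrib_right ennreal_indicator)
    also have "\<dots> \<le> 1 * ennreal \<bar>f v\<bar>"
      unfolding sum_cell_indicator[OF T] by (intro mult_right_mono) (auto simp: indicator_def)
    finally show "(\<Sum>l<n. indicator (cell T n l) v * ennreal \<bar>f v\<bar>) \<le> ennreal \<bar>f v\<bar>" by simp
  qed
  finally show ?thesis .
qed

text \<open>Let \<open>G\<close> be the primitive of \<open>f\<close> and let \<open>a < u \<le> b\<close> be the endpoints of the cell of \<open>u\<close>. The average is
  \<open>(G b - G a) / (b - a)\<close>, which tends to the derivative of \<open>G\<close> at \<open>u\<close> because \<open>u\<close> lies between \<open>a\<close> and \<open>b\<close>.\<close>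
lemma cell_average_tendsto_at:
  assumes T: "T > 0" and f: "integrable lborel f" and u: "u \<in> {0<..T}"
    and D: "((\<lambda>t. \<integral>v. indicator {0<..t} v * f v \<partial>lborel) has_real_derivative f u) (at u)"
  shows "(\<lambda>n. cell_average T (Suc n) f u) \<longlonglongrightarrow> f u"
proof -
  define G where "G = (\<lambda>t. \<integral>v. indicator {0<..t} v * f v \<partial>lborel)"
  have int: "integrable lborel (\<lambda>v. indicator A v * f v)" if "A \<in> sets borel" for A
    using integrable_mult_indicator[of A lborel f] f that by simp
  have Gdiff: "(\<integral>v. indicator {s<..t} v * f v \<partial>lborel) = G t - G s" if "0 \<le> s" "s \<le> t" for s t
  proof -
    have "G t - G s = (\<integral>v. indicator {0<..t} v * f v - indicator {0<..s} v * f v \<partial>lborel)"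
      unfolding G_def using int by (intro Bochner_Integration.integral_diff[symmetric]) auto
    also have "\<dots> = (\<integral>v. indicator {s<..t} v * f v \<partial>lborel)"
      using that by (intro Bochner_Integration.integral_cong) (auto simp: indicator_def)
    finally show ?thesis ..
  qed
  show ?thesis
    unfolding LIMSEQ_iff
  proof (intro allI impI)
    fix e :: real assume e: "e > 0"
    have "((\<lambda>y. (G y - G u) / (y - u)) \<longlongrightarrow> f u) (at u)"
      using D unfolding has_field_derivative_iff G_def .
    then obtain d where d: "d > 0" "\<And>y. y \<noteq> u \<Longrightarrow> \<bar>y - u\<bar> < d \<Longrightarrow> \<bar>(G y - G u) / (y - u) - f u\<bar> < e / 2"
      unfolding LIM_def dist_real_def using half_gt_zero[OF e] by blast
    have d2: "\<bar>G y - G u - f u * (y - u)\<bar> \<le> e / 2 * \<bar>y - u\<bar>" if "\<bar>y - u\<bar> < d" for y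
    proof (cases "y = u")
      case False
      have "(G y - G u) / (y - u) - f u = (G y - G u - f u * (y - u)) / (y - u)"
        using False by (simp add: field_simps)
      then have "\<bar>G y - G u - f u * (y - u)\<bar> / \<bar>y - u\<bar> < e / 2"
        using d(2)[OF False that] by (simp add: abs_divide)
      then show ?thesis using False by (simp add: pos_divide_less_eq less_imp_le)
    qed simp
    obtain N where N: "T / d < real N" using reals_Archimedean2 by blast
    show "\<exists>no. \<forall>n\<ge>no. norm (cell_average T (Suc n) f u - f u) < e"
    proof (intro exI[of _ N] allI impI)
      fix n assume n: "N \<le> n"
      obtain l where l: "l < Suc n" "u \<in> cell T (Suc n) l" using cell_exists[OF T _ u, of "Suc n"] by auto
      define a b where "a = grid T (Suc n) l" and "b = grid T (Suc n) (Suc l)"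
      have ab: "b - a = T / real (Suc n)" "a < u" "u \<le> b" "0 \<le> a"
        using l grid_Suc_diff[of "Suc n" T l] grid_mono[OF T, of 0 l "Suc n"] by (auto simp: a_def b_def cell_def)
      have "T / real (Suc n) < d"
      proof -
        have "T / d < real (Suc n)" using N n by linarith
        then show ?thesis using d(1) by (simp add: field_simps)
      qed
      then have abd: "b - a < d" "b - a > 0" using ab T by auto
      have "cell_average T (Suc n) f u = (G b - G a) * (real (Suc n) / T)"
        unfolding cell_average_eq[OF T l(2) l(1)] using ab Gdiff[of a b] by (simp add: cell_def a_def b_def)
      then have ca: "cell_average T (Suc n) f u = (G b - G a) / (b - a)" unfolding ab(1) by simp
      have "\<bar>G b - G a - f u * (b - a)\<bar> \<le> \<bar>G b - G u - f u * (b - u)\<bar> + \<bar>G a - G u - f u * (a - u)\<bar>"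
        by (simp add: abs_if algebra_simps)
      also have "\<dots> \<le> e / 2 * \<bar>b - u\<bar> + e / 2 * \<bar>a - u\<bar>"
        using ab abd by (intro add_mono d2) auto
      also have "\<dots> = e / 2 * (b - a)" using ab by (simp add: field_simps)
      finally have "\<bar>G b - G a - f u * (b - a)\<bar> \<le> e / 2 * (b - a)" .
      moreover have "(G b - G a) / (b - a) - f u = (G b - G a - f u * (b - a)) / (b - a)"
        using abd by (simp add: field_simps)
      ultimately have "\<bar>(G b - G a) / (b - a) - f u\<bar> \<le> e / 2"
        using abd by (simp add: abs_divide pos_divide_le_eq)
      then show "norm (cell_average T (Suc n) f u - f u) < e" using e by (simp add: ca)
    qed
  qed
qed

text \<open>The averages converge almost everywhere by Lebesgue differentiation, and their \<open>L\<^sup>1\<close> norms do not exceed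
  that of \<open>f\<close>; so Scheffe's lemma applies.\<close>
lemma cell_average_L1:
  assumes T: "T > 0" and f: "integrable lborel f" and supp: "\<And>u. u \<notin> {0<..T} \<Longrightarrow> f u = 0"
  shows "(\<lambda>n. \<integral>\<^sup>+u. ennreal \<bar>cell_average T (Suc n) f u - f u\<bar> \<partial>lborel) \<longlonglongrightarrow> 0"
proof -
  have [measurable]: "f \<in> borel_measurable borel" using f by auto
  have "(\<lambda>n. \<integral>\<^sup>+u. norm (cell_average T (Suc n) f u - f u) \<partial>lborel) \<longlonglongrightarrow> 0"
  proof (rule Scheffe_lemma2[OF _ f])
    show "AE u in lborel. (\<lambda>n. cell_average T (Suc n) f u) \<longlonglongrightarrow> f u"
      using AE_indefinite_integral_has_derivative[OF f, of 0 T] AE_lborel_singleton[of T]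
    proof eventually_elim
      case (elim u)
      show ?case
      proof (cases "u \<in> {0<..T}")
        case True
        then show ?thesis using elim by (intro cell_average_tendsto_at T f) auto
      next
        case False
        then have "indicator (cell T (Suc n) l) u = (0::real)" if "l < Suc n" for n l
          using cell_subset[OF T that] by (auto simp: indicator_def)
        then have "cell_average T (Suc n) f u = 0" for n
          unfolding cell_average_def by (intro sum.neutral) auto
        then show ?thesis using supp[OF False] by simp
      qed
    qed
    show "(\<integral>\<^sup>+u. ennreal (norm (cell_average T (Suc n) f u)) \<partial>lborel) \<le> (\<integral>\<^sup>+u. ennreal (norm (f u)) \<partial>lborel)" for n
      using nn_integral_cell_average_le[OF T, of "Suc n" f] by simp
  qed measurable
  then show ?thesis by simp
qed

section \<open>Covariance densities and their averages\<close>

text \<open>If \<open>g\<close> is not integrable, the right-hand side is infinite. Limits \<open>g\<close> can therefore be compared with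
  their approximations before they are known to be integrable.\<close>
lemma nn_integral_abs_diff_integral_le:
  fixes f g :: "'a \<Rightarrow> real"
  assumes f: "integrable M f" and g[measurable]: "g \<in> borel_measurable M"
  shows "ennreal \<bar>integral\<^sup>L M f - integral\<^sup>L M g\<bar> \<le> (\<integral>\<^sup>+x. ennreal \<bar>f x - g x\<bar> \<partial>M)"
proof (cases "(\<integral>\<^sup>+x. ennreal \<bar>f x - g x\<bar> \<partial>M) = \<infinity>")
  case False
  have [measurable]: "f \<in> borel_measurable M" using f by auto
  have d: "integrable M (\<lambda>x. f x - g x)"
    using False by (intro integrableI_bounded) (auto simp: less_top)
  have "integrable M (\<lambda>x. f x - (f x - g x))" using f d by (rule Bochner_Integration.integrable_diff)
  then have "integrable M g" by simp
  then have "integral\<^sup>L M f - integral\<^sup>L M g = (\<integral>x. f x - g x \<partial>M)" using f by simp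
  then show ?thesis using integral_norm_bound_ennreal[OF d] by simp
qed simp

lemma ennreal_mult_abs: "ennreal \<bar>x * y\<bar> = ennreal \<bar>x\<bar> * ennreal \<bar>y\<bar>"
  by (simp add: abs_mult ennreal_mult)

text \<open>These are the properties of \<open>\<partial>\<^sub>1K\<close>, extended by 0, on which the convergence of the covariances rests.\<close>
locale integrated_kernel =
  fixes T :: real and k :: "real \<Rightarrow> real \<Rightarrow> real"
  assumes T: "T > 0"
    and k_measurable [measurable]: "case_prod k \<in> borel_measurable (borel \<Otimes>\<^sub>M borel)"
    and k_support: "\<And>u r. u \<notin> {0<..T} \<or> r \<notin> {0..<T} \<Longrightarrow> k u r = 0"
    and k_L2: "(\<integral>\<^sup>+r. (\<integral>\<^sup>+u. ennreal \<bar>k u r\<bar> \<partial>lborel)\<^sup>2 \<partial>lborel) < \<infinity>"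
    and k_integrable: "\<And>r. integrable lborel (\<lambda>u. k u r)"
begin

definition k_norm :: "real \<Rightarrow> ennreal" where
  "k_norm r = (\<integral>\<^sup>+u. ennreal \<bar>k u r\<bar> \<partial>lborel)"

lemma k_norm_measurable [measurable]: "k_norm \<in> borel_measurable borel"
  unfolding k_norm_def by measurable

definition avg_kernel :: "nat \<Rightarrow> real \<Rightarrow> real \<Rightarrow> real" where
  "avg_kernel n u r = cell_average T n (\<lambda>v. k v r) u"

lemma avg_kernel_measurable [measurable]: "case_prod (avg_kernel n) \<in> borel_measurable (borel \<Otimes>\<^sub>M borel)"
  unfolding avg_kernel_def cell_average_def by measurable

text \<open>For \<open>\<phi> = \<partial>\<^sub>1K\<close> this is the mixed second derivative of the covariance function of the process with kernel
  \<open>K\<close>; for the averaged kernel it is the covariance of the velocities of an interpolation.\<close>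
definition cov_kernel :: "(real \<Rightarrow> real \<Rightarrow> real) \<Rightarrow> real \<Rightarrow> real \<Rightarrow> real" where
  "cov_kernel \<phi> u v = (\<integral>r. \<phi> u r * \<phi> v r \<partial>lborel)"

lemma cov_kernel_measurable [measurable (raw)]:
  assumes [measurable]: "case_prod \<phi> \<in> borel_measurable (borel \<Otimes>\<^sub>M borel)"
  shows "case_prod (cov_kernel \<phi>) \<in> borel_measurable (borel \<Otimes>\<^sub>M borel)"
  unfolding cov_kernel_def by measurable

text \<open>For fixed \<open>r\<close> the integral of \<open>\<phi> u r * \<phi> v r\<close> over \<open>u\<close> and \<open>v\<close> is a square, by Tonelli's theorem.\<close>
lemma nn_integral_cov_kernel_le:
  assumes [measurable]: "case_prod \<phi> \<in> borel_measurable (borel \<Otimes>\<^sub>M borel)"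
    and le: "\<And>r. (\<integral>\<^sup>+u. ennreal \<bar>\<phi> u r\<bar> \<partial>lborel) \<le> k_norm r"
  shows "(\<integral>\<^sup>+u. \<integral>\<^sup>+v. ennreal \<bar>cov_kernel \<phi> u v\<bar> \<partial>lborel \<partial>lborel) \<le> (\<integral>\<^sup>+r. (k_norm r)\<^sup>2 \<partial>lborel)"
proof -
  have "(\<integral>\<^sup>+u. \<integral>\<^sup>+v. ennreal \<bar>cov_kernel \<phi> u v\<bar> \<partial>lborel \<partial>lborel) \<le>
    (\<integral>\<^sup>+u. \<integral>\<^sup>+v. (\<integral>\<^sup>+r. ennreal \<bar>\<phi> u r\<bar> * ennreal \<bar>\<phi> v r\<bar> \<partial>lborel) \<partial>lborel \<partial>lborel)"
  proof (intro nn_integral_mono)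
    fix u v
    show "ennreal \<bar>cov_kernel \<phi> u v\<bar> \<le> (\<integral>\<^sup>+r. ennreal \<bar>\<phi> u r\<bar> * ennreal \<bar>\<phi> v r\<bar> \<partial>lborel)"
      using nn_integral_abs_diff_integral_le[of lborel "\<lambda>_. 0" "\<lambda>r. \<phi> u r * \<phi> v r"]
      by (simp add: cov_kernel_def ennreal_mult_abs)
  qed
  also have "\<dots> = (\<integral>\<^sup>+u. \<integral>\<^sup>+r. \<integral>\<^sup>+v. ennreal \<bar>\<phi> u r\<bar> * ennreal \<bar>\<phi> v r\<bar> \<partial>lborel \<partial>lborel \<partial>lborel)"
    by (intro nn_integral_cong lborel_pair.Fubini') measurable
  also have "\<dots> = (\<integral>\<^sup>+r. \<integral>\<^sup>+u. \<integral>\<^sup>+v. ennreal \<bar>\<phi> u r\<bar> * ennreal \<bar>\<phi> v r\<bar> \<partial>lborel \<partial>lborel \<partial>lborel)"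
    by (intro lborel_pair.Fubini') measurable
  also have "\<dots> = (\<integral>\<^sup>+r. (\<integral>\<^sup>+u. ennreal \<bar>\<phi> u r\<bar> \<partial>lborel)\<^sup>2 \<partial>lborel)"
    by (simp add: nn_integral_cmult nn_integral_multc power2_eq_square)
  also have "\<dots> \<le> (\<integral>\<^sup>+r. (k_norm r)\<^sup>2 \<partial>lborel)"
    by (intro nn_integral_mono power_mono le) auto
  finally show ?thesis .
qed

lemma avg_kernel_norm_le: "n > 0 \<Longrightarrow> (\<integral>\<^sup>+u. ennreal \<bar>avg_kernel n u r\<bar> \<partial>lborel) \<le> k_norm r"
  unfolding avg_kernel_def k_norm_def using T by (intro nn_integral_cell_average_le) auto

text \<open>The bound depends on \<open>n\<close>, but it is uniform in \<open>u\<close>, and its right-hand side is square integrable in \<open>r\<close>: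
  the covariance of the velocities is defined at all times, not only almost everywhere.\<close>
lemma avg_kernel_le:
  assumes n: "n > 0"
  shows "ennreal \<bar>avg_kernel n u r\<bar> \<le> ennreal (real n / T) * k_norm r"
proof (cases "u \<in> {0<..T}")
  case True
  then obtain l where l: "l < n" "u \<in> cell T n l" using cell_exists[OF T n] by blast
  have "ennreal \<bar>\<integral>v. indicator (cell T n l) v * k v r \<partial>lborel\<bar> \<le> (\<integral>\<^sup>+v. ennreal \<bar>indicator (cell T n l) v * k v r\<bar> \<partial>lborel)"
    using nn_integral_abs_diff_integral_le[of lborel "\<lambda>_. 0" "\<lambda>v. indicator (cell T n l) v * k v r"] by simp
  also have "\<dots> \<le> k_norm r"
    unfolding k_norm_def by (intro nn_integral_mono) (auto simp: indicator_def)
  finally have "ennreal (real n / T) * ennreal \<bar>\<integral>v. indicator (cell T n l) v * k v r \<partial>lborel\<bar> \<le> ennreal (real n / T) * k_norm r"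
    by (rule mult_left_mono) simp
  moreover have "ennreal \<bar>avg_kernel n u r\<bar> = ennreal (real n / T) * ennreal \<bar>\<integral>v. indicator (cell T n l) v * k v r \<partial>lborel\<bar>"
    unfolding avg_kernel_def cell_average_eq[OF T l(2,1)] ennreal_mult_abs using T by (simp add: mult.commute)
  ultimately show ?thesis by simp
next
  case False
  then have "indicator (cell T n l) u = (0::real)" if "l < n" for l
    using cell_subset[OF T that] by (auto simp: indicator_def)
  then have "avg_kernel n u r = 0"
    unfolding avg_kernel_def cell_average_def by (intro sum.neutral) auto
  then show ?thesis by simp
qed

lemma avg_kernel_product_integrable:
  assumes n: "n > 0"
  shows "integrable lborel (\<lambda>r. avg_kernel n u r * avg_kernel n v r)"
proof (rule integrableI_bounded)
  have "(\<integral>\<^sup>+r. ennreal (norm (avg_kernel n u r * avg_kernel n v r)) \<partial>lborel) \<le>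
    (\<integral>\<^sup>+r. ennreal (real n / T) * ennreal (real n / T) * (k_norm r)\<^sup>2 \<partial>lborel)"
  proof (intro nn_integral_mono)
    fix r
    have "ennreal (norm (avg_kernel n u r * avg_kernel n v r)) = ennreal \<bar>avg_kernel n u r\<bar> * ennreal \<bar>avg_kernel n v r\<bar>"
      by (simp add: abs_mult ennreal_mult)
    also have "\<dots> \<le> (ennreal (real n / T) * k_norm r) * (ennreal (real n / T) * k_norm r)"
      by (intro mult_mono avg_kernel_le n) auto
    finally show "ennreal (norm (avg_kernel n u r * avg_kernel n v r)) \<le> ennreal (real n / T) * ennreal (real n / T) * (k_norm r)\<^sup>2"
      by (simp add: power2_eq_square ac_simps)
  qed
  also have "\<dots> = ennreal (real n / T) * ennreal (real n / T) * (\<integral>\<^sup>+r. (k_norm r)\<^sup>2 \<partial>lborel)"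
    by (intro nn_integral_cmult) measurable
  also have "\<dots> < \<infinity>" using k_L2 by (simp add: k_norm_def ennreal_mult_less_top)
  finally show "(\<integral>\<^sup>+r. ennreal (norm (avg_kernel n u r * avg_kernel n v r)) \<partial>lborel) < \<infinity>" .
qed measurable

text \<open>The difference of the products is split as \<open>a b - c d = (a - c) b + c (b - d)\<close>. By Tonelli's theorem each
  part is, for fixed \<open>r\<close>, the product of the error \<open>e r\<close> and a mass of at most \<open>k_norm r\<close>.\<close>
lemma cov_kernel_diff_le:
  assumes n: "n > 0"
  defines "e \<equiv> \<lambda>r. \<integral>\<^sup>+u. ennreal \<bar>avg_kernel n u r - k u r\<bar> \<partial>lborel"
  shows "(\<integral>\<^sup>+u. \<integral>\<^sup>+v. ennreal \<bar>cov_kernel (avg_kernel n) u v - cov_kernel k u v\<bar> \<partial>lborel \<partial>lborel)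
    \<le> (\<integral>\<^sup>+r. 2 * (e r * k_norm r) \<partial>lborel)"
proof -
  let ?a = "\<lambda>u r. ennreal \<bar>avg_kernel n u r - k u r\<bar>"
  let ?F = "\<lambda>u v r. ?a u r * ennreal \<bar>avg_kernel n v r\<bar> + ennreal \<bar>k u r\<bar> * ?a v r"
  have "(\<integral>\<^sup>+u. \<integral>\<^sup>+v. ennreal \<bar>cov_kernel (avg_kernel n) u v - cov_kernel k u v\<bar> \<partial>lborel \<partial>lborel) \<le>
     (\<integral>\<^sup>+u. \<integral>\<^sup>+v. (\<integral>\<^sup>+r. ?F u v r \<partial>lborel) \<partial>lborel \<partial>lborel)"
  proof (intro nn_integral_mono)
    fix u v
    have "ennreal \<bar>cov_kernel (avg_kernel n) u v - cov_kernel k u v\<bar> \<le>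
      (\<integral>\<^sup>+r. ennreal \<bar>avg_kernel n u r * avg_kernel n v r - k u r * k v r\<bar> \<partial>lborel)"
      unfolding cov_kernel_def
      by (intro nn_integral_abs_diff_integral_le avg_kernel_product_integrable n) measurable
    also have "\<dots> \<le> (\<integral>\<^sup>+r. ?F u v r \<partial>lborel)"
    proof (intro nn_integral_mono)
      fix r
      have "avg_kernel n u r * avg_kernel n v r - k u r * k v r =
         (avg_kernel n u r - k u r) * avg_kernel n v r + k u r * (avg_kernel n v r - k v r)" by (simp add: algebra_simps)
      then have "\<bar>avg_kernel n u r * avg_kernel n v r - k u r * k v r\<bar> \<le>
         \<bar>avg_kernel n u r - k u r\<bar> * \<bar>avg_kernel n v r\<bar> + \<bar>k u r\<bar> * \<bar>avg_kernel n v r - k v r\<bar>"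
        by (metis abs_mult abs_triangle_ineq)
      then have "ennreal \<bar>avg_kernel n u r * avg_kernel n v r - k u r * k v r\<bar> \<le>
         ennreal (\<bar>avg_kernel n u r - k u r\<bar> * \<bar>avg_kernel n v r\<bar> + \<bar>k u r\<bar> * \<bar>avg_kernel n v r - k v r\<bar>)"
        by (rule ennreal_leI)
      then show "ennreal \<bar>avg_kernel n u r * avg_kernel n v r - k u r * k v r\<bar> \<le> ?F u v r"
        by (simp add: ennreal_mult)
    qed
    finally show "ennreal \<bar>cov_kernel (avg_kernel n) u v - cov_kernel k u v\<bar> \<le> (\<integral>\<^sup>+r. ?F u v r \<partial>lborel)" .
  qed
  also have "\<dots> = (\<integral>\<^sup>+u. \<integral>\<^sup>+r. \<integral>\<^sup>+v. ?F u v r \<partial>lborel \<partial>lborel \<partial>lborel)"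
    by (intro nn_integral_cong lborel_pair.Fubini') measurable
  also have "\<dots> = (\<integral>\<^sup>+r. \<integral>\<^sup>+u. \<integral>\<^sup>+v. ?F u v r \<partial>lborel \<partial>lborel \<partial>lborel)"
    by (intro lborel_pair.Fubini') measurable
  also have "\<dots> = (\<integral>\<^sup>+r. e r * (\<integral>\<^sup>+v. ennreal \<bar>avg_kernel n v r\<bar> \<partial>lborel) + k_norm r * e r \<partial>lborel)"
    by (simp add: nn_integral_add nn_integral_cmult nn_integral_multc e_def k_norm_def)
  also have "\<dots> \<le> (\<integral>\<^sup>+r. 2 * (e r * k_norm r) \<partial>lborel)"
  proof (intro nn_integral_mono)
    fix r
    have "e r * (\<integral>\<^sup>+v. ennreal \<bar>avg_kernel n v r\<bar> \<partial>lborel) + k_norm r * e r \<le> e r * k_norm r + k_norm r * e r"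
      by (intro add_mono mult_left_mono avg_kernel_norm_le n) auto
    then show "e r * (\<integral>\<^sup>+v. ennreal \<bar>avg_kernel n v r\<bar> \<partial>lborel) + k_norm r * e r \<le> 2 * (e r * k_norm r)"
      by (simp add: mult_2 mult.commute)
  qed
  finally show ?thesis .
qed

lemma avg_kernel_error_tendsto:
  "(\<lambda>n. \<integral>\<^sup>+u. ennreal \<bar>avg_kernel (Suc n) u r - k u r\<bar> \<partial>lborel) \<longlonglongrightarrow> 0"
  unfolding avg_kernel_def using k_support by (intro cell_average_L1 T k_integrable) auto

lemma avg_kernel_error_le:
  assumes "n > 0"
  shows "(\<integral>\<^sup>+u. ennreal \<bar>avg_kernel n u r - k u r\<bar> \<partial>lborel) \<le> 2 * k_norm r"
proof -
  have "(\<integral>\<^sup>+u. ennreal \<bar>avg_kernel n u r - k u r\<bar> \<partial>lborel) \<le>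
      (\<integral>\<^sup>+u. ennreal \<bar>avg_kernel n u r\<bar> + ennreal \<bar>k u r\<bar> \<partial>lborel)"
    by (intro nn_integral_mono) (auto simp: simp flip: ennreal_plus intro!: ennreal_leI)
  also have "\<dots> = (\<integral>\<^sup>+u. ennreal \<bar>avg_kernel n u r\<bar> \<partial>lborel) + k_norm r"
    unfolding k_norm_def by (intro nn_integral_add) measurable
  also have "\<dots> \<le> k_norm r + k_norm r" by (intro add_mono avg_kernel_norm_le assms order_refl)
  finally show ?thesis by (simp add: mult_2)
qed

lemma cov_kernel_L1:
  "(\<lambda>n. \<integral>\<^sup>+u. \<integral>\<^sup>+v. ennreal \<bar>cov_kernel (avg_kernel (Suc n)) u v - cov_kernel k u v\<bar> \<partial>lborel \<partial>lborel) \<longlonglongrightarrow> 0"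
proof -
  define e where "e = (\<lambda>n r. \<integral>\<^sup>+u. ennreal \<bar>avg_kernel (Suc n) u r - k u r\<bar> \<partial>lborel)"
  have [measurable]: "e n \<in> borel_measurable borel" for n unfolding e_def by measurable
  have k_fin: "k_norm r < \<infinity>" for r
    using k_integrable[of r] by (simp add: k_norm_def integrable_iff_bounded)
  have e0: "(\<lambda>n. e n r) \<longlonglongrightarrow> 0" for r unfolding e_def by (rule avg_kernel_error_tendsto)
  have e_le: "e n r \<le> 2 * k_norm r" for n r unfolding e_def by (rule avg_kernel_error_le) simp
  have "(\<lambda>n. \<integral>\<^sup>+r. 2 * (e n r * k_norm r) \<partial>lborel) \<longlonglongrightarrow> (\<integral>\<^sup>+r. 0 \<partial>(lborel :: real measure))"
  proof (rule nn_integral_dominated_convergence[where w="\<lambda>r. 4 * (k_norm r)\<^sup>2"])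
    show "AE r in lborel. 2 * (e n r * k_norm r) \<le> 4 * (k_norm r)\<^sup>2" for n
    proof (intro AE_I2)
      fix r
      have "2 * (e n r * k_norm r) \<le> 2 * ((2 * k_norm r) * k_norm r)"
        by (intro mult_left_mono mult_right_mono e_le) auto
      also have "\<dots> = 4 * (k_norm r)\<^sup>2" by (simp add: power2_eq_square mult.assoc[symmetric])
      finally show "2 * (e n r * k_norm r) \<le> 4 * (k_norm r)\<^sup>2" .
    qed
    show "(\<integral>\<^sup>+r. 4 * (k_norm r)\<^sup>2 \<partial>lborel) < \<infinity>"
      using k_L2 by (simp add: nn_integral_cmult k_norm_def[symmetric] ennreal_mult_less_top)
    show "AE r in lborel. (\<lambda>n. 2 * (e n r * k_norm r)) \<longlonglongrightarrow> 0"
    proof (intro AE_I2)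
      fix r
      have "(\<lambda>n. 2 * (k_norm r * e n r)) \<longlonglongrightarrow> 2 * (k_norm r * 0)"
        using k_fin[of r] by (intro ennreal_tendsto_cmult e0) auto
      then show "(\<lambda>n. 2 * (e n r * k_norm r)) \<longlonglongrightarrow> 0" by (simp add: mult.commute)
    qed
  qed measurable
  then have lim: "(\<lambda>n. \<integral>\<^sup>+r. 2 * (e n r * k_norm r) \<partial>lborel) \<longlonglongrightarrow> 0" by simp
  show ?thesis
    by (rule tendsto_sandwich[OF _ _ tendsto_const lim])
      (use cov_kernel_diff_le in \<open>auto simp: e_def intro!: always_eventually\<close>)
qed

end

section \<open>Pairings\<close>

text \<open>Pairings of any set of indices: this class is closed under the removal of a pair.\<close>
definition pairings_on :: "nat set \<Rightarrow> (nat \<times> nat) set set" where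
  "pairings_on A = {\<pi>. \<pi> \<subseteq> A \<times> A \<and> (\<forall>(a, b)\<in>\<pi>. a < b) \<and>
    (\<forall>x\<in>A. \<exists>!p. p \<in> \<pi> \<and> (x = fst p \<or> x = snd p))}"

lemma pairings_eq: "pairings m = pairings_on {1..m}"
  by (simp add: pairings_def pairings_on_def)

lemma finite_pairings_on: "finite A \<Longrightarrow> finite (pairings_on A)"
  by (rule finite_subset[of _ "Pow (A \<times> A)"]) (auto simp: pairings_on_def)

lemma pairings_onD:
  assumes "\<pi> \<in> pairings_on A" "p \<in> \<pi>"
  shows "fst p \<in> A" "snd p \<in> A" "fst p < snd p"
    "\<And>q. q \<in> \<pi> \<Longrightarrow> q \<noteq> p \<Longrightarrow> {fst p, snd p} \<inter> {fst q, snd q} = {}"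
proof -
  show "fst p \<in> A" "snd p \<in> A" "fst p < snd p"
    using assms by (auto simp: pairings_on_def)
  fix q assume q: "q \<in> \<pi>" "q \<noteq> p"
  show "{fst p, snd p} \<inter> {fst q, snd q} = {}"
  proof (rule ccontr)
    assume "\<not> ?thesis"
    then obtain x where x: "x = fst p \<or> x = snd p" "x = fst q \<or> x = snd q" by auto
    then have "x \<in> A" using assms by (auto simp: pairings_on_def)
    then have "\<exists>!p. p \<in> \<pi> \<and> (x = fst p \<or> x = snd p)" using assms(1) by (auto simp: pairings_on_def)
    with x q assms(2) show False by blast
  qed
qed

lemma pairings_on_cover:
  assumes "\<pi> \<in> pairings_on A"
  shows "A = (\<Union>p\<in>\<pi>. {fst p, snd p})"
proof
  show "A \<subseteq> (\<Union>p\<in>\<pi>. {fst p, snd p})"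
  proof
    fix x assume "x \<in> A"
    then have "\<exists>!p. p \<in> \<pi> \<and> (x = fst p \<or> x = snd p)" using assms by (auto simp: pairings_on_def)
    then show "x \<in> (\<Union>p\<in>\<pi>. {fst p, snd p})" by blast
  qed
  show "(\<Union>p\<in>\<pi>. {fst p, snd p}) \<subseteq> A" using pairings_onD(1,2)[OF assms] by blast
qed

lemma pairings_onI:
  assumes "\<And>p. p \<in> \<pi> \<Longrightarrow> fst p < snd p" "A = (\<Union>p\<in>\<pi>. {fst p, snd p})"
    "\<And>p q. p \<in> \<pi> \<Longrightarrow> q \<in> \<pi> \<Longrightarrow> q \<noteq> p \<Longrightarrow> {fst p, snd p} \<inter> {fst q, snd q} = {}"
  shows "\<pi> \<in> pairings_on A"
  unfolding pairings_on_def
proof (intro CollectI conjI ballI)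
  show "\<pi> \<subseteq> A \<times> A"
  proof
    fix p assume "p \<in> \<pi>"
    then have "fst p \<in> A" "snd p \<in> A" unfolding assms(2) by blast+
    then show "p \<in> A \<times> A" by (cases p) auto
  qed
  show "case p of (a, b) \<Rightarrow> a < b" if "p \<in> \<pi>" for p using assms(1)[OF that] by (simp add: split_beta)
  fix x assume "x \<in> A"
  then obtain p where p: "p \<in> \<pi>" "x = fst p \<or> x = snd p" using assms(2) by auto
  show "\<exists>!p. p \<in> \<pi> \<and> (x = fst p \<or> x = snd p)"
  proof (rule ex1I[of _ p])
    fix q assume "q \<in> \<pi> \<and> (x = fst q \<or> x = snd q)"
    then have "q \<in> \<pi>" "{fst p, snd p} \<inter> {fst q, snd q} \<noteq> {}" using p by auto
    then show "q = p" using assms(3)[OF p(1)] by blast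
  qed (use p in auto)
qed

lemma pairings_on_remove:
  assumes "\<pi> \<in> pairings_on A" "p \<in> \<pi>"
  shows "\<pi> - {p} \<in> pairings_on (A - {fst p, snd p})"
proof (rule pairings_onI)
  show "\<And>q. q \<in> \<pi> - {p} \<Longrightarrow> fst q < snd q" using pairings_onD(3)[OF assms(1)] by auto
  show "A - {fst p, snd p} = (\<Union>q\<in>\<pi> - {p}. {fst q, snd q})"
    using pairings_onD(4)[OF assms] unfolding pairings_on_cover[OF assms(1)] by blast
  show "\<And>q r. q \<in> \<pi> - {p} \<Longrightarrow> r \<in> \<pi> - {p} \<Longrightarrow> r \<noteq> q \<Longrightarrow> {fst q, snd q} \<inter> {fst r, snd r} = {}"
    using pairings_onD(4)[OF assms(1)] by auto
qed

lemma pairings_on_insert: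
  assumes "\<pi> \<in> pairings_on A" "a < b" "a \<notin> A" "b \<notin> A"
  shows "insert (a, b) \<pi> \<in> pairings_on (insert a (insert b A))"
proof (rule pairings_onI)
  show "\<And>p. p \<in> insert (a, b) \<pi> \<Longrightarrow> fst p < snd p"
    using pairings_onD(3)[OF assms(1)] assms(2) by auto
  show "insert a (insert b A) = (\<Union>p\<in>insert (a, b) \<pi>. {fst p, snd p})"
    using pairings_on_cover[OF assms(1)] by auto
  show "\<And>p q. p \<in> insert (a, b) \<pi> \<Longrightarrow> q \<in> insert (a, b) \<pi> \<Longrightarrow> q \<noteq> p \<Longrightarrow> {fst p, snd p} \<inter> {fst q, snd q} = {}"
    using pairings_onD[OF assms(1)] assms(3,4) by (auto; metis)
qed

lemma pairings_on_empty: "pairings_on {} = {{}}"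
  by (auto simp: pairings_on_def)

text \<open>The least element comes first in its pair, its partner \<open>b\<close> is arbitrary, and what is left is a pairing of
  the other elements. Wick's recursion has the same shape.\<close>
lemma sum_pairings_on_rec:
  fixes F :: "(nat \<times> nat) set \<Rightarrow> 'b::comm_monoid_add"
  assumes A: "finite A" and a: "a \<notin> A" "\<And>x. x \<in> A \<Longrightarrow> a < x"
  shows "(\<Sum>\<pi>\<in>pairings_on (insert a A). F \<pi>) = (\<Sum>b\<in>A. \<Sum>\<pi>\<in>pairings_on (A - {b}). F (insert (a, b) \<pi>))"
proof -
  have notin: "(a, b) \<notin> \<pi>" if "\<pi> \<in> pairings_on (A - {b})" for b \<pi>
    using pairings_onD(2)[OF that, of "(a, b)"] by auto
  have eq: "pairings_on (insert a A) = (\<Union>b\<in>A. (\<lambda>\<pi>. insert (a, b) \<pi>) ` pairings_on (A - {b}))"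
  proof (intro equalityI subsetI)
    fix \<pi> assume \<pi>: "\<pi> \<in> pairings_on (insert a A)"
    then obtain p where p: "p \<in> \<pi>" "a = fst p \<or> a = snd p"
      using pairings_on_cover[OF \<pi>] by blast
    have "a = fst p"
    proof (rule ccontr)
      assume "a \<noteq> fst p"
      then have "fst p \<in> A" "fst p < a" using pairings_onD[OF \<pi> p(1)] p by auto
      then show False using a(2) by force
    qed
    define b where "b = snd p"
    have pb: "p = (a, b)" "b \<in> A" using \<open>a = fst p\<close> pairings_onD[OF \<pi> p(1)] by (auto simp: b_def)
    have "insert a A - {a, b} = A - {b}" using a(1) by auto
    then have "\<pi> - {p} \<in> pairings_on (A - {b})" using pairings_on_remove[OF \<pi> p(1)] pb by simp
    moreover have "\<pi> = insert (a, b) (\<pi> - {p})" using p pb by auto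
    ultimately show "\<pi> \<in> (\<Union>b\<in>A. (\<lambda>\<pi>. insert (a, b) \<pi>) ` pairings_on (A - {b}))" using pb by blast
  next
    fix \<pi> assume "\<pi> \<in> (\<Union>b\<in>A. (\<lambda>\<pi>. insert (a, b) \<pi>) ` pairings_on (A - {b}))"
    then obtain b \<pi>' where b: "b \<in> A" "\<pi>' \<in> pairings_on (A - {b})" "\<pi> = insert (a, b) \<pi>'" by auto
    have "insert a (insert b (A - {b})) = insert a A" using b(1) by auto
    then show "\<pi> \<in> pairings_on (insert a A)"
      using pairings_on_insert[OF b(2), of a b] a b by auto
  qed
  have "(\<Sum>\<pi>\<in>pairings_on (insert a A). F \<pi>) = (\<Sum>b\<in>A. sum F ((\<lambda>\<pi>. insert (a, b) \<pi>) ` pairings_on (A - {b})))"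
    unfolding eq
  proof (rule sum.UNION_disjoint)
    show "\<forall>b\<in>A. \<forall>c\<in>A. b \<noteq> c \<longrightarrow> (\<lambda>\<pi>. insert (a, b) \<pi>) ` pairings_on (A - {b}) \<inter> (\<lambda>\<pi>. insert (a, c) \<pi>) ` pairings_on (A - {c}) = {}"
    proof (intro ballI impI equals0I)
      fix b c \<pi> assume bc: "b \<in> A" "c \<in> A" "b \<noteq> c"
        "\<pi> \<in> (\<lambda>\<pi>. insert (a, b) \<pi>) ` pairings_on (A - {b}) \<inter> (\<lambda>\<pi>. insert (a, c) \<pi>) ` pairings_on (A - {c})"
      then have \<pi>: "\<pi> \<in> pairings_on (insert a A)" unfolding eq by blast
      have "(a, b) \<in> \<pi>" "(a, c) \<in> \<pi>" using bc by auto
      with pairings_onD(4)[OF \<pi>, of "(a, b)" "(a, c)"] bc show False by auto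
    qed
  qed (use A finite_pairings_on in auto)
  also have "\<dots> = (\<Sum>b\<in>A. \<Sum>\<pi>\<in>pairings_on (A - {b}). F (insert (a, b) \<pi>))"
  proof (rule sum.cong[OF refl])
    fix b
    have "inj_on (\<lambda>\<pi>. insert (a, b) \<pi>) (pairings_on (A - {b}))"
      using notin by (intro inj_onI) (metis insert_ident)
    then show "sum F ((\<lambda>\<pi>. insert (a, b) \<pi>) ` pairings_on (A - {b})) = (\<Sum>\<pi>\<in>pairings_on (A - {b}). F (insert (a, b) \<pi>))"
      by (subst sum.reindex) auto
  qed
  finally show ?thesis .
qed

text \<open>Each pair lies inside the class \<open>i j = c\<close> or outside it.\<close>
lemma even_card_pairing_class:
  assumes "finite A" "\<pi> \<in> pairings_on A" "\<And>l j. (l, j) \<in> \<pi> \<Longrightarrow> i l = i j"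
  shows "even (card {j\<in>A. i j = c})"
  using assms
proof (induction "card A" arbitrary: A \<pi> rule: less_induct)
  case less
  show ?case
  proof (cases "\<pi> = {}")
    case True
    then have "A = {}" using pairings_on_cover[OF less.prems(2)] by simp
    then show ?thesis by simp
  next
    case False
    then obtain p where p: "p \<in> \<pi>" by auto
    note pD = pairings_onD[OF less.prems(2) p]
    have "card (A - {fst p, snd p}) < card A"
      using pD less.prems(1) by (intro psubset_card_mono) auto
    then have ev: "even (card {j\<in>A - {fst p, snd p}. i j = c})"
      using less.prems by (intro less.hyps[OF _ _ pairings_on_remove[OF less.prems(2) p]]) auto
    have ii: "i (fst p) = i (snd p)" using less.prems(3)[of "fst p" "snd p"] p by simp
    show ?thesis
    proof (cases "i (fst p) = c")
      case True
      have "{j\<in>A. i j = c} = insert (fst p) (insert (snd p) {j\<in>A - {fst p, snd p}. i j = c})"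
        using True ii pD by auto
      then show ?thesis using ev pD(3) less.prems(1) by simp
    next
      case False
      then have "{j\<in>A. i j = c} = {j\<in>A - {fst p, snd p}. i j = c}" using ii by auto
      then show ?thesis using ev by simp
    qed
  qed
qed

lemma even_card_pairings_on:
  assumes "finite A" "\<pi> \<in> pairings_on A"
  shows "even (card A)"
  using even_card_pairing_class[OF assms, of "\<lambda>_. ()" "()"] by simp

text \<open>The factors are exchanged one at a time. Bounding the mixed products by products of sums makes
  the estimate independent of the order of the factors.\<close>
lemma abs_prod_diff_le:
  fixes x y :: "'a \<Rightarrow> real"
  assumes "finite P"
  shows "\<bar>(\<Prod>p\<in>P. x p) - (\<Prod>p\<in>P. y p)\<bar> \<le> (\<Sum>p\<in>P. \<bar>x p - y p\<bar> * (\<Prod>q\<in>P - {p}. \<bar>x q\<bar> + \<bar>y q\<bar>))"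
  using assms
proof (induction P rule: finite_induct)
  case (insert a P)
  have "(\<Prod>p\<in>insert a P. x p) - (\<Prod>p\<in>insert a P. y p) =
     (x a - y a) * (\<Prod>p\<in>P. x p) + y a * ((\<Prod>p\<in>P. x p) - (\<Prod>p\<in>P. y p))"
    using insert by (simp add: algebra_simps)
  then have "\<bar>(\<Prod>p\<in>insert a P. x p) - (\<Prod>p\<in>insert a P. y p)\<bar> \<le>
     \<bar>x a - y a\<bar> * \<bar>\<Prod>p\<in>P. x p\<bar> + \<bar>y a\<bar> * \<bar>(\<Prod>p\<in>P. x p) - (\<Prod>p\<in>P. y p)\<bar>"
    by (metis abs_mult abs_triangle_ineq)
  also have "\<dots> \<le> \<bar>x a - y a\<bar> * (\<Prod>q\<in>P. \<bar>x q\<bar> + \<bar>y q\<bar>) +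
     (\<bar>x a\<bar> + \<bar>y a\<bar>) * (\<Sum>p\<in>P. \<bar>x p - y p\<bar> * (\<Prod>q\<in>P - {p}. \<bar>x q\<bar> + \<bar>y q\<bar>))"
    using insert.IH by (intro add_mono mult_mono) (auto simp: abs_prod intro!: prod_mono sum_nonneg mult_nonneg_nonneg prod_nonneg)
  also have "\<dots> = (\<Sum>p\<in>insert a P. \<bar>x p - y p\<bar> * (\<Prod>q\<in>insert a P - {p}. \<bar>x q\<bar> + \<bar>y q\<bar>))"
  proof -
    have 1: "insert a P - {a} = P" using insert by auto
    have "(\<Prod>q\<in>insert a P - {p}. \<bar>x q\<bar> + \<bar>y q\<bar>) = (\<bar>x a\<bar> + \<bar>y a\<bar>) * (\<Prod>q\<in>P - {p}. \<bar>x q\<bar> + \<bar>y q\<bar>)" if "p \<in> P" for p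
    proof -
      have "insert a P - {p} = insert a (P - {p})" using insert that by auto
      then show ?thesis using insert by simp
    qed
    then show ?thesis using insert 1 by (simp add: sum_distrib_left mult.left_commute)
  qed
  finally show ?case .
qed simp

interpretation lborel_product: product_sigma_finite "\<lambda>_::nat. lborel :: real measure"
  by standard

text \<open>Tonelli's theorem: different pairs involve different variables.\<close>
lemma nn_integral_prod_pairing:
  fixes f :: "nat \<times> nat \<Rightarrow> real \<Rightarrow> real \<Rightarrow> ennreal"
  assumes "finite A" "\<pi> \<in> pairings_on A" "\<And>p. p \<in> \<pi> \<Longrightarrow> case_prod (f p) \<in> borel_measurable (borel \<Otimes>\<^sub>M borel)"
  shows "(\<integral>\<^sup>+u. (\<Prod>p\<in>\<pi>. f p (u (fst p)) (u (snd p))) \<partial>Pi\<^sub>M A (\<lambda>_. lborel)) =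
    (\<Prod>p\<in>\<pi>. \<integral>\<^sup>+x. \<integral>\<^sup>+y. f p x y \<partial>lborel \<partial>lborel)"
  using assms
proof (induction "card A" arbitrary: A \<pi> rule: less_induct)
  case less
  show ?case
  proof (cases "\<pi> = {}")
    case True
    then have "A = {}" using pairings_on_cover[OF less.prems(2)] by simp
    then show ?thesis using True by (simp add: space_PiM PiM_empty)
  next
    case False
    then obtain p where p: "p \<in> \<pi>" by auto
    obtain a b where ab: "p = (a, b)" by force
    note pD = pairings_onD[OF less.prems(2) p, unfolded ab fst_conv snd_conv]
    have fin\<pi>: "finite \<pi>" using less.prems(1,2) finite_subset[of \<pi> "A \<times> A"] by (auto simp: pairings_on_def)
    define A' where "A' = A - {a, b}"
    have A: "A = insert a (insert b A')" "a \<notin> insert b A'" "b \<notin> A'" "finite A'"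
      using pD less.prems(1) by (auto simp: A'_def)
    have \<pi>': "\<pi> - {p} \<in> pairings_on A'" using pairings_on_remove[OF less.prems(2) p] by (simp add: ab A'_def)
    have q: "fst q \<in> A'" "snd q \<in> A'" if "q \<in> \<pi> - {p}" for q
      using pairings_onD[OF \<pi>' that] by auto
    have [measurable]: "case_prod (f q) \<in> borel_measurable (borel \<Otimes>\<^sub>M borel)" if "q \<in> \<pi>" for q
      using less.prems(3)[OF that] .
    have m: "(\<lambda>u. f q (u (fst q)) (u (snd q))) \<in> borel_measurable (Pi\<^sub>M B (\<lambda>_. lborel))"
      if "q \<in> \<pi>" "fst q \<in> B" "snd q \<in> B" for q B
    proof -
      have c: "(\<lambda>u. u i) \<in> borel_measurable (Pi\<^sub>M B (\<lambda>_. lborel))" if "i \<in> B" for i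
        using measurable_component_singleton[OF that, of "\<lambda>_. lborel"] by simp
      have "(\<lambda>u. (u (fst q), u (snd q))) \<in> Pi\<^sub>M B (\<lambda>_. lborel) \<rightarrow>\<^sub>M borel \<Otimes>\<^sub>M borel"
        using that(2,3) by (intro measurable_Pair c)
      from measurable_compose[OF this less.prems(3)[OF that(1)]] show ?thesis by simp
    qed
    define g where "g = (\<lambda>u. \<Prod>q\<in>\<pi> - {p}. f q (u (fst q)) (u (snd q)))"
    have gm: "g \<in> borel_measurable (Pi\<^sub>M A' (\<lambda>_. lborel))"
      unfolding g_def using q by (intro borel_measurable_prod_ennreal m) auto
    have g_upd: "g (u(c := z)) = g u" if c: "c = a \<or> c = b" for u c z
    proof -
      have "c \<noteq> fst q" "c \<noteq> snd q" if "q \<in> \<pi> - {p}" for q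
        using q[OF that] A c by auto
      then show ?thesis unfolding g_def by (intro prod.cong refl) auto
    qed
    have prod_eq: "(\<Prod>q\<in>\<pi>. f q (u (fst q)) (u (snd q))) = f p (u a) (u b) * g u" for u
      unfolding g_def using fin\<pi> p ab by (subst prod.remove[of \<pi> p]) auto
    have FM: "(\<lambda>u. f p (u a) (u b) * g u) \<in> borel_measurable (Pi\<^sub>M A (\<lambda>_. lborel))"
      unfolding g_def using q m[OF p, of A] ab A by (intro borel_measurable_times_ennreal borel_measurable_prod_ennreal m) auto
    have FM2: "(\<lambda>u. (\<integral>\<^sup>+z. f p z (u b) \<partial>lborel) * g u) \<in> borel_measurable (Pi\<^sub>M (insert b A') (\<lambda>_. lborel))"
    proof (intro borel_measurable_times_ennreal)
      show "g \<in> borel_measurable (Pi\<^sub>M (insert b A') (\<lambda>_. lborel))"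
        unfolding g_def using q by (intro borel_measurable_prod_ennreal m) auto
      have "(\<lambda>u. u b) \<in> borel_measurable (Pi\<^sub>M (insert b A') (\<lambda>_. lborel))"
        using measurable_component_singleton[of b "insert b A'" "\<lambda>_. lborel"] by simp
      moreover have "(\<lambda>y. \<integral>\<^sup>+z. f p z y \<partial>lborel) \<in> borel_measurable borel" using p by measurable
      ultimately show "(\<lambda>u. \<integral>\<^sup>+z. f p z (u b) \<partial>lborel) \<in> borel_measurable (Pi\<^sub>M (insert b A') (\<lambda>_. lborel))"
        by (rule measurable_compose)
    qed
    have "(\<integral>\<^sup>+u. (\<Prod>q\<in>\<pi>. f q (u (fst q)) (u (snd q))) \<partial>Pi\<^sub>M A (\<lambda>_. lborel)) =
      (\<integral>\<^sup>+u. f p (u a) (u b) * g u \<partial>Pi\<^sub>M (insert a (insert b A')) (\<lambda>_. lborel))"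
      unfolding prod_eq A(1)[symmetric] ..
    also have "\<dots> = (\<integral>\<^sup>+u. \<integral>\<^sup>+z. f p z (u b) * g u \<partial>lborel \<partial>Pi\<^sub>M (insert b A') (\<lambda>_. lborel))"
      using A FM[unfolded A(1)] by (subst lborel_product.product_nn_integral_insert) (auto simp: g_upd)
    also have "\<dots> = (\<integral>\<^sup>+u. (\<integral>\<^sup>+z. f p z (u b) \<partial>lborel) * g u \<partial>Pi\<^sub>M (insert b A') (\<lambda>_. lborel))"
      using p by (intro nn_integral_cong nn_integral_multc) measurable
    also have "\<dots> = (\<integral>\<^sup>+x. \<integral>\<^sup>+y. (\<integral>\<^sup>+z. f p z y \<partial>lborel) * g x \<partial>lborel \<partial>Pi\<^sub>M A' (\<lambda>_. lborel))"
      using A FM2 by (subst lborel_product.product_nn_integral_insert) (auto simp: g_upd)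
    also have "\<dots> = (\<integral>\<^sup>+x. (\<integral>\<^sup>+y. \<integral>\<^sup>+z. f p z y \<partial>lborel \<partial>lborel) * g x \<partial>Pi\<^sub>M A' (\<lambda>_. lborel))"
      using p by (simp add: nn_integral_multc)
    also have "\<dots> = (\<integral>\<^sup>+y. \<integral>\<^sup>+z. f p z y \<partial>lborel \<partial>lborel) * (\<integral>\<^sup>+x. g x \<partial>Pi\<^sub>M A' (\<lambda>_. lborel))"
      using gm by (intro nn_integral_cmult)
    also have "(\<integral>\<^sup>+x. g x \<partial>Pi\<^sub>M A' (\<lambda>_. lborel)) = (\<Prod>q\<in>\<pi> - {p}. \<integral>\<^sup>+x. \<integral>\<^sup>+y. f q x y \<partial>lborel \<partial>lborel)"
      unfolding g_def using \<pi>' less.prems A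
      by (intro less.hyps) (auto simp: A(1) card_insert_if)
    also have "(\<integral>\<^sup>+y. \<integral>\<^sup>+z. f p z y \<partial>lborel \<partial>lborel) = (\<integral>\<^sup>+x. \<integral>\<^sup>+y. f p x y \<partial>lborel \<partial>lborel)"
      using p by (intro lborel_pair.Fubini') simp
    also have "\<dots> * (\<Prod>q\<in>\<pi> - {p}. \<integral>\<^sup>+x. \<integral>\<^sup>+y. f q x y \<partial>lborel \<partial>lborel) = (\<Prod>p\<in>\<pi>. \<integral>\<^sup>+x. \<integral>\<^sup>+y. f p x y \<partial>lborel \<partial>lborel)"
      using fin\<pi> p by (subst prod.remove[of \<pi> p]) auto
    finally show ?thesis .
  qed
qed

section \<open>Gaussian variables and Wick's formula\<close>

text \<open>Centred Gaussian variables of variance \<open>v\<close>. The description by the characteristic function includes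
  \<open>v = 0\<close> and passes easily to independent sums and to limits.\<close>
definition gaussian_rv :: "'a measure \<Rightarrow> ('a \<Rightarrow> real) \<Rightarrow> real \<Rightarrow> bool" where
  "gaussian_rv M X v \<longleftrightarrow> X \<in> borel_measurable M \<and> 0 \<le> v \<and>
    (\<forall>t. char (distr M borel X) t = complex_of_real (exp (- (v * t\<^sup>2 / 2))))"

lemma char_distr_scale:
  assumes [measurable]: "X \<in> borel_measurable M"
  shows "char (distr M borel (\<lambda>x. a * X x)) t = char (distr M borel X) (a * t)"
  by (simp add: char_def integral_distr mult_ac)

lemma (in prob_space) gaussian_rv_distr:
  assumes X: "gaussian_rv M X v"
  shows "distr M borel X = distr std_normal_distribution borel (\<lambda>x. sqrt v * x)"
proof (rule Levy_uniqueness)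
  have [measurable]: "X \<in> borel_measurable M" using X by (simp add: gaussian_rv_def)
  show "real_distribution (distr M borel X)" by (rule real_distribution_distr) simp
  interpret N: real_distribution std_normal_distribution by (rule real_dist_normal_dist)
  show "real_distribution (distr std_normal_distribution borel (\<lambda>x. sqrt v * x))"
    by (rule N.real_distribution_distr) simp
  show "char (distr M borel X) = char (distr std_normal_distribution borel (\<lambda>x. sqrt v * x))"
  proof
    fix t
    have "char (distr std_normal_distribution borel (\<lambda>x. sqrt v * x)) t =
      char (distr std_normal_distribution borel (\<lambda>x. x)) (sqrt v * t)"
      by (intro char_distr_scale) simp
    also have "distr std_normal_distribution borel (\<lambda>x. x) = std_normal_distribution"
      by (rule distr_id2) simp
    finally show "char (distr M borel X) t = char (distr std_normal_distribution borel (\<lambda>x. sqrt v * x)) t"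
      using X by (simp add: gaussian_rv_def char_std_normal_distribution power_mult_distrib)
  qed
qed

text \<open>The moments of the standard normal distribution: \<open>(m - 1)!!\<close> for even \<open>m\<close>.\<close>
definition gaussian_moment :: "nat \<Rightarrow> real" where
  "gaussian_moment m = (if even m then fact m / (2 ^ (m div 2) * fact (m div 2)) else 0)"

lemma std_normal_moment: "(\<integral>x. x ^ m \<partial>std_normal_distribution) = gaussian_moment m"
  using std_normal_distribution_even_moments(1)[of "m div 2"] integral_std_normal_distribution_moment_odd[of m]
  by (auto simp: gaussian_moment_def)

lemma (in prob_space) gaussian_rv_moments:
  assumes X: "gaussian_rv M X v"
  shows "integrable M (\<lambda>x. X x ^ m)" "(\<integral>x. X x ^ m \<partial>M) = sqrt v ^ m * gaussian_moment m"
proof -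
  have [measurable]: "X \<in> borel_measurable M" using X by (simp add: gaussian_rv_def)
  have "integrable std_normal_distribution (\<lambda>x. (sqrt v * x) ^ m)"
    using integrable_std_normal_distribution_moment[of m] by (simp add: power_mult_distrib)
  then have "integrable (distr M borel X) (\<lambda>x. x ^ m)"
    unfolding gaussian_rv_distr[OF X] by (subst integrable_distr_eq) auto
  then show "integrable M (\<lambda>x. X x ^ m)" by (subst (asm) integrable_distr_eq) auto
  have "(\<integral>x. X x ^ m \<partial>M) = (\<integral>x. x ^ m \<partial>distr M borel X)" by (subst integral_distr) auto
  also have "\<dots> = (\<integral>x. (sqrt v * x) ^ m \<partial>std_normal_distribution)"
    unfolding gaussian_rv_distr[OF X] by (subst integral_distr) auto
  also have "\<dots> = sqrt v ^ m * gaussian_moment m"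
    by (simp add: power_mult_distrib std_normal_moment)
  finally show "(\<integral>x. X x ^ m \<partial>M) = sqrt v ^ m * gaussian_moment m" .
qed

lemma (in prob_space) gaussian_rv_variance:
  assumes "gaussian_rv M X v" shows "(\<integral>x. (X x)\<^sup>2 \<partial>M) = v"
  using gaussian_rv_moments(2)[OF assms, of 2] assms by (simp add: gaussian_moment_def gaussian_rv_def)

lemma gaussian_moment_rec: "gaussian_moment (Suc (Suc m)) = real (Suc m) * gaussian_moment m"
proof (cases "even m")
  case True
  then obtain k where m: "m = 2 * k" using evenE by blast
  have div: "Suc (Suc m) div 2 = Suc k" "m div 2 = k" using m by auto
  have "fact (Suc (Suc m)) = (2 * real (Suc k)) * (real (Suc m) * fact m)"
    by (simp add: m algebra_simps)
  moreover have "(2::real) ^ Suc k * fact (Suc k) = (2 * real (Suc k)) * (2 ^ k * fact k)"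
    by (simp add: algebra_simps)
  ultimately have "fact (Suc (Suc m)) / (2 ^ Suc k * fact (Suc k)) = real (Suc m) * fact m / (2 ^ k * fact k)"
    by (simp only: mult_divide_mult_cancel_left_if) simp
  then show ?thesis using True by (simp add: gaussian_moment_def div del: power_Suc fact_Suc)
qed (simp add: gaussian_moment_def)

lemma abs_mult_power_le:
  fixes x y :: real
  shows "\<bar>x ^ k * y ^ j\<bar> \<le> \<bar>x ^ (k + j)\<bar> + \<bar>y ^ (k + j)\<bar>"
proof (cases "\<bar>x\<bar> \<le> \<bar>y\<bar>")
  case True
  then have "\<bar>x\<bar> ^ k * \<bar>y\<bar> ^ j \<le> \<bar>y\<bar> ^ k * \<bar>y\<bar> ^ j" by (intro mult_right_mono power_mono) auto
  then show ?thesis by (simp add: abs_mult power_abs power_add) (metis add_increasing zero_le_power abs_ge_zero mult_nonneg_nonneg)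
next
  case False
  then have "\<bar>x\<bar> ^ k * \<bar>y\<bar> ^ j \<le> \<bar>x\<bar> ^ k * \<bar>x\<bar> ^ j" by (intro mult_left_mono power_mono) auto
  then show ?thesis by (simp add: abs_mult power_abs power_add) (metis add_increasing2 zero_le_power abs_ge_zero mult_nonneg_nonneg)
qed

lemma polynomial_derivative_at_0:
  assumes "1 \<le> n"
  shows "((\<lambda>s. \<Sum>k\<le>n. a k * s ^ k) has_real_derivative a 1) (at 0)"
proof -
  have "((\<lambda>s. \<Sum>k\<le>n. a k * s ^ k) has_real_derivative (\<Sum>k\<le>n. a k * (real k * 0 ^ (k - Suc 0)))) (at 0)"
    by (auto intro!: derivative_eq_intros sum.cong)
  moreover have "(\<Sum>k\<le>n. a k * (real k * 0 ^ (k - Suc 0))) = (\<Sum>k\<le>n. if k = 1 then a 1 else 0)"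
    by (intro sum.cong refl) (auto simp: power_0_left)
  ultimately show ?thesis using assms by simp
qed

text \<open>The moment of order \<open>m + 1\<close> of \<open>Y + s X\<close> is a polynomial in \<open>s\<close> whose linear coefficient is
  \<open>(m + 1) E(X Y\<^sup>m)\<close>. As \<open>Y + s X\<close> is Gaussian, the same moment is a known function of its variance
  \<open>b + 2 s c + s\<^sup>2 a\<close>, and comparing the derivatives at \<open>s = 0\<close> gives the formula.\<close>
lemma (in prob_space) gaussian_integration_by_parts:
  assumes G: "\<And>s t. gaussian_rv M (\<lambda>x. t * Y x + s * X x) (t\<^sup>2 * b + 2 * (s * t * c) + s\<^sup>2 * a)"
  shows "integrable M (\<lambda>x. X x * Y x ^ m)"
    and "(\<integral>x. X x * Y x ^ m \<partial>M) = real m * c * (\<integral>x. Y x ^ (m - 1) \<partial>M)"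
proof -
  have Y: "gaussian_rv M Y b" using G[of 1 0] by simp
  have X: "gaussian_rv M X a" using G[of 0 1] by simp
  have [measurable]: "X \<in> borel_measurable M" "Y \<in> borel_measurable M" using X Y by (auto simp: gaussian_rv_def)
  have int: "integrable M (\<lambda>x. X x ^ k * Y x ^ j)" for k j
  proof (rule Bochner_Integration.integrable_bound)
    show "integrable M (\<lambda>x. \<bar>X x ^ (k + j)\<bar> + \<bar>Y x ^ (k + j)\<bar>)"
      using gaussian_rv_moments(1)[OF X, of "k + j"] gaussian_rv_moments(1)[OF Y, of "k + j"] by auto
    show "AE x in M. norm (X x ^ k * Y x ^ j) \<le> norm (\<bar>X x ^ (k + j)\<bar> + \<bar>Y x ^ (k + j)\<bar>)"
      using abs_mult_power_le by (intro AE_I2) (simp add: abs_of_nonneg)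
  qed measurable
  from int[of 1 m] show "integrable M (\<lambda>x. X x * Y x ^ m)" by simp
  define E where "E = (\<lambda>k. \<integral>x. X x ^ k * Y x ^ (Suc m - k) \<partial>M)"
  define v where "v = (\<lambda>s. b + 2 * s * c + s\<^sup>2 * a)"
  have poly: "(\<Sum>k\<le>Suc m. real (Suc m choose k) * E k * s ^ k) = sqrt (v s) ^ Suc m * gaussian_moment (Suc m)" for s
  proof -
    have "(\<integral>x. (Y x + s * X x) ^ Suc m \<partial>M) = sqrt (v s) ^ Suc m * gaussian_moment (Suc m)"
      using gaussian_rv_moments(2)[OF G[of 1 s], of "Suc m"] by (simp add: v_def mult.assoc del: power_Suc)
    moreover have "(\<integral>x. (Y x + s * X x) ^ Suc m \<partial>M) =
      (\<integral>x. (\<Sum>k\<le>Suc m. (real (Suc m choose k) * s ^ k) * (X x ^ k * Y x ^ (Suc m - k))) \<partial>M)"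
      by (intro Bochner_Integration.integral_cong refl)
        (subst add.commute, subst binomial_ring, auto simp: power_mult_distrib mult_ac intro!: sum.cong simp del: power_Suc)
    moreover have "\<dots> = (\<Sum>k\<le>Suc m. (real (Suc m choose k) * s ^ k) * E k)"
      unfolding E_def using int by (subst Bochner_Integration.integral_sum) (auto simp del: power_Suc)
    ultimately show ?thesis by (simp add: mult_ac del: power_Suc)
  qed
  have v0: "0 \<le> v s" for s using G[of 1 s] by (simp add: gaussian_rv_def v_def mult.assoc)
  have b0: "0 \<le> b" using Y by (simp add: gaussian_rv_def)
  have D1: "((\<lambda>s. \<Sum>k\<le>Suc m. real (Suc m choose k) * E k * s ^ k) has_real_derivative real (Suc m) * E 1) (at 0)"
    using polynomial_derivative_at_0[of "Suc m" "\<lambda>k. real (Suc m choose k) * E k"] by simp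
  show "(\<integral>x. X x * Y x ^ m \<partial>M) = real m * c * (\<integral>x. Y x ^ (m - 1) \<partial>M)"
  proof (cases "odd m")
    case False
    then have "gaussian_moment (Suc m) = 0" by (simp add: gaussian_moment_def)
    then have "((\<lambda>s. \<Sum>k\<le>Suc m. real (Suc m choose k) * E k * s ^ k) has_real_derivative 0) (at 0)"
      unfolding poly by simp
    then have "real (Suc m) * E 1 = 0" using D1 DERIV_unique by blast
    moreover have "real m * (\<integral>x. Y x ^ (m - 1) \<partial>M) = 0"
      using False gaussian_rv_moments(2)[OF Y, of "m - 1"] by (cases m) (auto simp: gaussian_moment_def)
    ultimately show ?thesis by (auto simp: E_def)
  next
    case True
    then obtain j where m: "m = 2 * j + 1" using oddE by blast
    have "sqrt (v s) ^ Suc m = v s ^ Suc j" for s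
    proof -
      have "sqrt (v s) ^ Suc m = (sqrt (v s) ^ 2) ^ Suc j" unfolding m power_mult[symmetric] by simp
      then show ?thesis using v0[of s] by simp
    qed
    then have eq: "(\<lambda>s. \<Sum>k\<le>Suc m. real (Suc m choose k) * E k * s ^ k) = (\<lambda>s. v s ^ Suc j * gaussian_moment (Suc m))"
      unfolding poly by simp
    have "((\<lambda>s. v s ^ Suc j * gaussian_moment (Suc m)) has_real_derivative
       real (Suc j) * (2 * c) * b ^ j * gaussian_moment (Suc m)) (at 0)"
    proof -
      have dv: "(v has_real_derivative 2 * c) (at 0)"
        unfolding v_def by (auto intro!: derivative_eq_intros)
      show ?thesis
        using DERIV_mult[OF DERIV_power_Suc[OF dv, of j] DERIV_const[of "gaussian_moment (Suc m)"]]
        by (simp add: v_def algebra_simps)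
    qed
    then have "real (Suc m) * E 1 = real (Suc j) * (2 * c) * b ^ j * gaussian_moment (Suc m)"
      using D1 unfolding eq using DERIV_unique by blast
    moreover have "real (Suc m) = 2 * real (Suc j)" by (simp add: m)
    ultimately have "(2 * real (Suc j)) * E 1 = (2 * real (Suc j)) * (c * b ^ j * gaussian_moment (Suc m))"
      by (simp only: mult_ac)
    then have "E 1 = c * b ^ j * gaussian_moment (Suc m)"
      by (subst (asm) mult_left_cancel) auto
    also have "gaussian_moment (Suc m) = real m * gaussian_moment (m - 1)"
      using gaussian_moment_rec[of "m - 1"] by (simp add: m)
    also have "c * b ^ j * (real m * gaussian_moment (m - 1)) = real m * c * (\<integral>x. Y x ^ (m - 1) \<partial>M)"
    proof -
      have "sqrt b ^ (m - 1) = b ^ j" using b0 by (simp add: m power_mult)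
      then show ?thesis using gaussian_rv_moments(2)[OF Y, of "m - 1"] by simp
    qed
    finally show ?thesis by (simp add: E_def)
  qed
qed

text \<open>The alternating sum is an iterated difference of the function \<open>y\<^sup>p\<close>, with one step for each element of
  \<open>J\<close>. Each step lowers the degree by 1. The base point \<open>y\<close> is arbitrary because a step shifts it.\<close>
lemma polarization_aux:
  fixes x :: "'i \<Rightarrow> real"
  assumes "finite J"
  shows "\<forall>y p. p \<le> card J \<longrightarrow> (\<Sum>A\<in>Pow J. (-1) ^ card A * (y + (\<Sum>j\<in>A. x j)) ^ p) =
    (if p = card J then (-1) ^ card J * fact (card J) * (\<Prod>j\<in>J. x j) else 0)"
  using assms
proof (induction J rule: finite_induct)
  case empty
  then show ?case by simp
next
  case (insert a J)
  show ?case
  proof (intro allI impI)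
    fix y :: real and p assume p: "p \<le> card (insert a J)"
    define f where "f = (\<lambda>q. \<Sum>A\<in>Pow J. (-1) ^ card A * (y + (\<Sum>j\<in>A. x j)) ^ q)"
    have inj: "inj_on (insert a) (Pow J)" using insert.hyps by (intro inj_onI) (auto simp: Pow_def; blast)
    have fin: "A \<in> Pow J \<Longrightarrow> finite A \<and> a \<notin> A" for A using insert.hyps finite_subset by auto
    have "(\<Sum>A\<in>Pow (insert a J). (-1) ^ card A * (y + (\<Sum>j\<in>A. x j)) ^ p) =
      f p + (\<Sum>A\<in>insert a ` Pow J. (-1) ^ card A * (y + (\<Sum>j\<in>A. x j)) ^ p)"
      unfolding Pow_insert f_def using insert.hyps by (subst sum.union_disjoint) auto
    also have "(\<Sum>A\<in>insert a ` Pow J. (-1) ^ card A * (y + (\<Sum>j\<in>A. x j)) ^ p) =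
       (\<Sum>A\<in>Pow J. - ((-1) ^ card A * ((y + (\<Sum>j\<in>A. x j)) + x a) ^ p))"
      using fin by (subst sum.reindex[OF inj]) (auto intro!: sum.cong simp: algebra_simps)
    also have "\<dots> = - (\<Sum>A\<in>Pow J. \<Sum>q\<le>p. (real (p choose q) * x a ^ (p - q)) * ((-1) ^ card A * (y + (\<Sum>j\<in>A. x j)) ^ q))"
      unfolding sum_negf[symmetric] binomial_ring sum_distrib_left
      by (simp add: sum_distrib_left sum_negf[symmetric] mult_ac)
    also have "\<dots> = - (\<Sum>q\<le>p. (real (p choose q) * x a ^ (p - q)) * f q)"
      unfolding f_def sum_distrib_left by (subst sum.swap) simp
    also have "(\<Sum>q\<le>p. (real (p choose q) * x a ^ (p - q)) * f q) = f p + (\<Sum>q<p. (real (p choose q) * x a ^ (p - q)) * f q)"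
      by (simp add: lessThan_Suc_atMost[symmetric])
    also have "(\<Sum>q<p. (real (p choose q) * x a ^ (p - q)) * f q) =
      (\<Sum>q<p. if q = card J then (real (p choose q) * x a ^ (p - q)) * ((-1) ^ card J * fact (card J) * (\<Prod>j\<in>J. x j)) else 0)"
    proof (intro sum.cong refl)
      fix q assume "q \<in> {..<p}"
      then have "q \<le> card J" using p insert.hyps by auto
      then have "f q = (if q = card J then (-1) ^ card J * fact (card J) * (\<Prod>j\<in>J. x j) else 0)"
        unfolding f_def using insert.IH by blast
      then show "(real (p choose q) * x a ^ (p - q)) * f q = (if q = card J then (real (p choose q) * x a ^ (p - q)) * ((-1) ^ card J * fact (card J) * (\<Prod>j\<in>J. x j)) else 0)"
        by simp
    qed
    also have "\<dots> = (if p = card (insert a J) then real (p choose card J) * x a * ((-1) ^ card J * fact (card J) * (\<Prod>j\<in>J. x j)) else 0)"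
      using p insert.hyps by (auto simp: less_Suc_eq_le le_Suc_eq)
    finally show "(\<Sum>A\<in>Pow (insert a J). (-1) ^ card A * (y + (\<Sum>j\<in>A. x j)) ^ p) =
      (if p = card (insert a J) then (-1) ^ card (insert a J) * fact (card (insert a J)) * (\<Prod>j\<in>insert a J. x j) else 0)"
      using insert.hyps by (auto simp: algebra_simps)
  qed
qed

text \<open>A product is a combination of powers of partial sums; mixed moments of a Gaussian family thus reduce to
  moments of single Gaussian variables.\<close>
lemma polarization:
  fixes x :: "'i \<Rightarrow> real"
  assumes "finite J"
  shows "(\<Sum>A\<in>Pow J. (-1) ^ card A * (\<Sum>j\<in>A. x j) ^ card J) = (-1) ^ card J * fact (card J) * (\<Prod>j\<in>J. x j)"
  using spec[OF spec[OF polarization_aux[OF assms, of x], of 0], of "card J"] by simp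

text \<open>The derivative of the polarization identity at \<open>x\<close> in the direction \<open>c\<close>.\<close>
lemma polarization_derivative:
  fixes x c :: "'i \<Rightarrow> real"
  assumes J: "finite J"
  shows "(\<Sum>A\<in>Pow J. (-1) ^ card A * (real (card J) * (\<Sum>j\<in>A. c j) * (\<Sum>j\<in>A. x j) ^ (card J - 1))) =
    (-1) ^ card J * fact (card J) * (\<Sum>b\<in>J. c b * (\<Prod>j\<in>J - {b}. x j))"
proof -
  have eq: "(\<lambda>s. \<Sum>A\<in>Pow J. (-1) ^ card A * (\<Sum>j\<in>A. x j + s * c j) ^ card J) =
    (\<lambda>s. (-1) ^ card J * fact (card J) * (\<Prod>j\<in>J. x j + s * c j))"
    by (rule ext) (rule polarization[OF J])
  have "((\<lambda>s. \<Sum>A\<in>Pow J. (-1) ^ card A * (\<Sum>j\<in>A. x j + s * c j) ^ card J) has_real_derivative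
    (\<Sum>A\<in>Pow J. (-1) ^ card A * (real (card J) * (\<Sum>j\<in>A. c j) * (\<Sum>j\<in>A. x j) ^ (card J - 1)))) (at 0)"
    by (auto intro!: derivative_eq_intros sum.cong)
  moreover have "((\<lambda>s. (-1) ^ card J * fact (card J) * (\<Prod>j\<in>J. x j + s * c j)) has_real_derivative
     (-1) ^ card J * fact (card J) * (\<Sum>b\<in>J. c b * (\<Prod>j\<in>J - {b}. x j))) (at 0)"
    by (auto intro!: derivative_eq_intros has_field_derivative_prod sum.cong)
  ultimately show ?thesis unfolding eq using DERIV_unique by blast
qed

definition gaussian_family :: "'a measure \<Rightarrow> 'i set \<Rightarrow> ('i \<Rightarrow> 'a \<Rightarrow> real) \<Rightarrow> ('i \<Rightarrow> 'i \<Rightarrow> real) \<Rightarrow> bool" where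
  "gaussian_family M J X C \<longleftrightarrow> finite J \<and> (\<forall>i j. C i j = C j i) \<and>
    (\<forall>a. gaussian_rv M (\<lambda>x. \<Sum>j\<in>J. a j * X j x) (\<Sum>i\<in>J. \<Sum>j\<in>J. a i * a j * C i j))"

lemma gaussian_family_subset:
  assumes "gaussian_family M J X C" "I \<subseteq> J"
  shows "gaussian_family M I X C"
  unfolding gaussian_family_def
proof (intro conjI allI)
  have J: "finite J" using assms(1) by (simp add: gaussian_family_def)
  show "finite I" using assms by (auto simp: gaussian_family_def finite_subset)
  fix a :: "_ \<Rightarrow> real"
  define a' where "a' = (\<lambda>i. if i \<in> I then a i else 0)"
  have 1: "(\<Sum>j\<in>J. a' j * g j) = (\<Sum>j\<in>I. a j * g j)" for g
    using J assms(2) unfolding a'_def by (intro sum.mono_neutral_cong_right) auto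
  have 2: "(\<Sum>i\<in>J. \<Sum>j\<in>J. a' i * a' j * C i j) = (\<Sum>i\<in>I. \<Sum>j\<in>I. a i * a j * C i j)"
    unfolding mult.assoc sum_distrib_left[symmetric] 1 ..
  then show "gaussian_rv M (\<lambda>x. \<Sum>j\<in>I. a j * X j x) (\<Sum>i\<in>I. \<Sum>j\<in>I. a i * a j * C i j)"
  proof -
    have "gaussian_rv M (\<lambda>x. \<Sum>j\<in>J. a' j * X j x) (\<Sum>i\<in>J. \<Sum>j\<in>J. a' i * a' j * C i j)"
      using assms(1) by (simp add: gaussian_family_def)
    then show ?thesis by (simp only: 2) (simp only: 1)
  qed
qed (use assms in \<open>auto simp: gaussian_family_def\<close>)

lemma gaussian_family_single:
  assumes "gaussian_family M J X C" "j \<in> J"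
  shows "gaussian_rv M (X j) (C j j)"
  using gaussian_family_subset[OF assms(1), of "{j}"] assms(2) unfolding gaussian_family_def
  by (auto dest!: spec[of _ "\<lambda>_. 1"])

lemma abs_prod_le_sum_power:
  fixes x :: "'i \<Rightarrow> real"
  assumes "finite J" "J \<noteq> {}"
  shows "\<bar>\<Prod>j\<in>J. x j\<bar> \<le> (\<Sum>j\<in>J. \<bar>x j ^ card J\<bar>)"
proof -
  obtain i where i: "i \<in> J" "\<And>j. j \<in> J \<Longrightarrow> \<bar>x j\<bar> \<le> \<bar>x i\<bar>"
    using Max_in[of "(\<lambda>j. \<bar>x j\<bar>) ` J"] Max_ge[of "(\<lambda>j. \<bar>x j\<bar>) ` J"] assms by (smt (verit) finite_imageI image_iff image_is_empty imageI)
  have "\<bar>\<Prod>j\<in>J. x j\<bar> \<le> (\<Prod>j\<in>J. \<bar>x i\<bar>)" unfolding abs_prod using i by (intro prod_mono) auto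
  also have "\<dots> = \<bar>x i ^ card J\<bar>" by (simp add: power_abs)
  also have "\<dots> \<le> (\<Sum>j\<in>J. \<bar>x j ^ card J\<bar>)" using i(1) assms by (intro member_le_sum) auto
  finally show ?thesis .
qed

lemma (in prob_space) gaussian_family_integrable_prod:
  assumes "gaussian_family M J X C"
  shows "integrable M (\<lambda>x. \<Prod>j\<in>J. X j x)"
proof (cases "J = {}")
  case False
  have J: "finite J" using assms by (simp add: gaussian_family_def)
  note G = gaussian_family_single[OF assms]
  have [measurable]: "X j \<in> borel_measurable M" if "j \<in> J" for j using G[OF that] by (simp add: gaussian_rv_def)
  show ?thesis
  proof (rule Bochner_Integration.integrable_bound)
    show "integrable M (\<lambda>x. \<Sum>j\<in>J. \<bar>X j x ^ card J\<bar>)"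
      using gaussian_rv_moments(1)[OF G] by auto
    show "AE x in M. norm (\<Prod>j\<in>J. X j x) \<le> norm (\<Sum>j\<in>J. \<bar>X j x ^ card J\<bar>)"
      using abs_prod_le_sum_power[OF J False] by (intro AE_I2) (simp add: abs_of_nonneg sum_nonneg)
  qed measurable
qed simp

text \<open>Polarization replaces the product by powers of the partial sums \<open>Y A\<close>. Integration by parts evaluates the
  moments of \<open>X a\<close> against these powers, and the differentiated polarization identity turns the result
  back into products.\<close>
lemma (in prob_space) wick_recursion:
  assumes fam: "gaussian_family M (insert a J) X C" and a: "a \<notin> J"
  shows "(\<integral>x. X a x * (\<Prod>j\<in>J. X j x) \<partial>M) = (\<Sum>b\<in>J. C a b * (\<integral>x. (\<Prod>j\<in>J - {b}. X j x) \<partial>M))"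
proof -
  have J: "finite J" using fam by (simp add: gaussian_family_def)
  have sym: "C i j = C j i" for i j using fam by (simp add: gaussian_family_def)
  define Y where "Y = (\<lambda>A x. \<Sum>j\<in>A. X j x)"
  have G: "gaussian_rv M (\<lambda>x. t * Y A x + s * X a x)
      (t\<^sup>2 * (\<Sum>i\<in>A. \<Sum>j\<in>A. C i j) + 2 * (s * t * (\<Sum>j\<in>A. C a j)) + s\<^sup>2 * C a a)" if A: "A \<subseteq> J" for A s t
  proof -
    define \<alpha> where "\<alpha> = (\<lambda>i. if i = a then s else t)"
    have fA: "finite A" "a \<notin> A" using A J a finite_subset by auto
    have \<alpha>: "\<alpha> a = s" "\<And>i. i \<in> A \<Longrightarrow> \<alpha> i = t" using fA by (auto simp: \<alpha>_def)
    have "gaussian_family M (insert a A) X C" using A by (intro gaussian_family_subset[OF fam]) auto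
    then have "gaussian_rv M (\<lambda>x. \<Sum>j\<in>insert a A. \<alpha> j * X j x) (\<Sum>i\<in>insert a A. \<Sum>j\<in>insert a A. \<alpha> i * \<alpha> j * C i j)"
      by (simp add: gaussian_family_def)
    moreover have "(\<Sum>j\<in>insert a A. \<alpha> j * X j x) = t * Y A x + s * X a x" for x
      using fA \<alpha> by (simp add: Y_def sum_distrib_left)
    moreover have "(\<Sum>i\<in>insert a A. \<Sum>j\<in>insert a A. \<alpha> i * \<alpha> j * C i j) =
       t\<^sup>2 * (\<Sum>i\<in>A. \<Sum>j\<in>A. C i j) + 2 * (s * t * (\<Sum>j\<in>A. C a j)) + s\<^sup>2 * C a a"
    proof -
      have "(\<Sum>i\<in>A. t * s * C i a) = s * t * (\<Sum>j\<in>A. C a j)"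
        unfolding sum_distrib_left by (intro sum.cong refl) (simp add: sym[of _ a])
      then show ?thesis using fA \<alpha>
        by (simp add: sum.distrib sum_distrib_left power2_eq_square mult_ac)
    qed
    ultimately show ?thesis by simp
  qed
  note P = gaussian_integration_by_parts[OF G]
  let ?m = "card J" and ?K = "(-1) ^ card J * fact (card J) :: real"
  have fin: "finite (Pow J)" using J by simp
  have Yint: "integrable M (\<lambda>x. Y A x ^ p)" if "A \<subseteq> J" for A p
    using gaussian_rv_moments(1)[OF G[OF that, of 1 0]] by simp
  have "?K * (\<integral>x. X a x * (\<Prod>j\<in>J. X j x) \<partial>M) = (\<integral>x. X a x * (?K * (\<Prod>j\<in>J. X j x)) \<partial>M)"
    by (subst integral_mult_right_zero[symmetric]) (simp add: mult_ac)
  also have "\<dots> = (\<integral>x. (\<Sum>A\<in>Pow J. (-1) ^ card A * (X a x * Y A x ^ ?m)) \<partial>M)"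
    unfolding polarization[OF J, symmetric] Y_def by (simp add: sum_distrib_left mult_ac)
  also have "\<dots> = (\<Sum>A\<in>Pow J. (-1) ^ card A * (\<integral>x. X a x * Y A x ^ ?m \<partial>M))"
    using P(1) by (subst Bochner_Integration.integral_sum) auto
  also have "\<dots> = (\<Sum>A\<in>Pow J. (-1) ^ card A * (real ?m * (\<Sum>j\<in>A. C a j) * (\<integral>x. Y A x ^ (?m - 1) \<partial>M)))"
    using P(2) by (intro sum.cong refl) auto
  also have "\<dots> = (\<integral>x. (\<Sum>A\<in>Pow J. (-1) ^ card A * (real ?m * (\<Sum>j\<in>A. C a j) * Y A x ^ (?m - 1))) \<partial>M)"
    using Yint by (subst Bochner_Integration.integral_sum) auto
  also have "\<dots> = (\<integral>x. ?K * (\<Sum>b\<in>J. C a b * (\<Prod>j\<in>J - {b}. X j x)) \<partial>M)"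
    unfolding Y_def polarization_derivative[OF J] ..
  also have "\<dots> = ?K * (\<Sum>b\<in>J. C a b * (\<integral>x. (\<Prod>j\<in>J - {b}. X j x) \<partial>M))"
  proof -
    have "integrable M (\<lambda>x. \<Prod>j\<in>J - {b}. X j x)" for b
      by (rule gaussian_family_integrable_prod[OF gaussian_family_subset[OF fam]]) auto
    then show ?thesis by (subst integral_mult_right_zero, subst Bochner_Integration.integral_sum) auto
  qed
  finally show ?thesis by simp
qed

text \<open>The recursion at the least index matches the recursion for sums over pairings.\<close>
lemma (in prob_space) wick_formula:
  fixes J :: "nat set"
  assumes "gaussian_family M J X C"
  shows "(\<integral>x. (\<Prod>j\<in>J. X j x) \<partial>M) = (\<Sum>\<pi>\<in>pairings_on J. \<Prod>(l, j)\<in>\<pi>. C l j)"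
  using assms
proof (induction "card J" arbitrary: J rule: less_induct)
  case less
  have fin: "finite J" using less.prems by (simp add: gaussian_family_def)
  show ?case
  proof (cases "J = {}")
    case True
    then show ?thesis by (simp add: pairings_on_empty prob_space)
  next
    case False
    define a where "a = Min J"
    define A where "A = J - {a}"
    have aA: "a \<notin> A" "J = insert a A" "finite A" "\<And>x. x \<in> A \<Longrightarrow> a < x"
    proof -
      have aJ: "a \<in> J" unfolding a_def by (rule Min_in[OF fin False])
      have le: "a \<le> x" if "x \<in> J" for x unfolding a_def using fin that by (rule Min_le)
      show "a \<notin> A" "J = insert a A" "finite A" "\<And>x. x \<in> A \<Longrightarrow> a < x"
        using aJ le fin by (auto simp: A_def less_le)
    qed
    have "(\<integral>x. (\<Prod>j\<in>J. X j x) \<partial>M) = (\<integral>x. X a x * (\<Prod>j\<in>A. X j x) \<partial>M)"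
      using aA by simp
    also have "\<dots> = (\<Sum>b\<in>A. C a b * (\<integral>x. (\<Prod>j\<in>A - {b}. X j x) \<partial>M))"
      using less.prems aA by (intro wick_recursion) auto
    also have "\<dots> = (\<Sum>b\<in>A. C a b * (\<Sum>\<pi>\<in>pairings_on (A - {b}). \<Prod>(l, j)\<in>\<pi>. C l j))"
    proof (intro sum.cong refl arg_cong2[where f="(*)"] less.hyps)
      fix b assume "b \<in> A"
      show "card (A - {b}) < card J" using aA card_Diff1_le[of A b] by (simp add: less_Suc_eq_le)
      show "gaussian_family M (A - {b}) X C"
        by (rule gaussian_family_subset[OF less.prems]) (use aA in auto)
    qed
    also have "\<dots> = (\<Sum>b\<in>A. \<Sum>\<pi>\<in>pairings_on (A - {b}). \<Prod>(l, j)\<in>insert (a, b) \<pi>. C l j)"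
    proof (rule sum.cong[OF refl])
      fix b assume b: "b \<in> A"
      have "(\<Prod>(l, j)\<in>insert (a, b) \<pi>. C l j) = C a b * (\<Prod>(l, j)\<in>\<pi>. C l j)" if "\<pi> \<in> pairings_on (A - {b})" for \<pi>
      proof -
        have "(a, b) \<notin> \<pi>" using pairings_onD(2)[OF that, of "(a, b)"] by auto
        moreover have "finite \<pi>" using that aA(3) finite_subset[of \<pi> "(A - {b}) \<times> (A - {b})"] by (auto simp: pairings_on_def)
        ultimately show ?thesis by simp
      qed
      then show "C a b * (\<Sum>\<pi>\<in>pairings_on (A - {b}). \<Prod>(l, j)\<in>\<pi>. C l j) =
        (\<Sum>\<pi>\<in>pairings_on (A - {b}). \<Prod>(l, j)\<in>insert (a, b) \<pi>. C l j)"
        by (simp add: sum_distrib_left)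
    qed
    also have "\<dots> = (\<Sum>\<pi>\<in>pairings_on J. \<Prod>(l, j)\<in>\<pi>. C l j)"
      unfolding aA(2) using aA by (intro sum_pairings_on_rec[symmetric]) auto
    finally show ?thesis .
  qed
qed

section \<open>Wiener integrals\<close>

lemma char_distr_AE_cong:
  assumes "X \<in> borel_measurable M" "Y \<in> borel_measurable M" "AE x in M. X x = Y x"
  shows "char (distr M borel X) t = char (distr M borel Y) t"
  using assms by (simp add: distr_cong_AE[OF refl refl assms(3)])

lemma (in prob_space) char_distributed_normal:
  assumes X: "distributed M lborel X (normal_density 0 \<sigma>)" and \<sigma>: "\<sigma> > 0"
  shows "char (distr M borel X) t = complex_of_real (exp (- (\<sigma>\<^sup>2 * t\<^sup>2 / 2)))"
proof -
  have [measurable]: "X \<in> borel_measurable M" using distributed_measurable[OF X] by simp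
  have "distributed M lborel (\<lambda>x. (X x - 0) / \<sigma>) std_normal_density"
    using X normal_standard_normal_convert[OF \<sigma>, of X 0] by blast
  then have "distributed M lborel (\<lambda>x. X x / \<sigma>) std_normal_density" by simp
  then have "distr M lborel (\<lambda>x. X x / \<sigma>) = std_normal_distribution"
    by (rule distributed_distr_eq_density)
  moreover have "distr M lborel (\<lambda>x. X x / \<sigma>) = distr M borel (\<lambda>x. X x / \<sigma>)"
    by (intro distr_cong) auto
  ultimately have std: "distr M borel (\<lambda>x. X x / \<sigma>) = std_normal_distribution" by simp
  have "char (distr M borel X) t = char (distr M borel (\<lambda>x. \<sigma> * (X x / \<sigma>))) t" using \<sigma> by simp
  also have "\<dots> = char std_normal_distribution (\<sigma> * t)" by (subst char_distr_scale) (auto simp: std)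
  finally show ?thesis by (simp add: char_std_normal_distribution power_mult_distrib)
qed

text \<open>Summation by parts turns values of a Brownian motion into increments, which are independent.\<close>
lemma sum_over_partition:
  fixes b :: "real \<Rightarrow> real"
  assumes "distinct ts" "ts \<noteq> []"
  shows "(\<Sum>s\<in>set ts. c s * (b s - b (hd ts))) =
    (\<Sum>l<length ts - 1. (\<Sum>m\<in>{l<..<length ts}. c (ts ! m)) * (b (ts ! Suc l) - b (ts ! l)))"
proof -
  have "(\<Sum>s\<in>set ts. c s * (b s - b (hd ts))) = (\<Sum>m<length ts. c (ts ! m) * (b (ts ! m) - b (ts ! 0)))"
    using sum.reindex_bij_betw[OF bij_betw_nth[OF assms(1) refl refl], of "\<lambda>s. c s * (b s - b (hd ts))"] assms(2)
    by (simp add: hd_conv_nth)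
  also have "\<dots> = (\<Sum>m<length ts. \<Sum>l<m. c (ts ! m) * (b (ts ! Suc l) - b (ts ! l)))"
    by (intro sum.cong refl) (simp add: sum_distrib_left[symmetric] sum_lessThan_telescope[of "\<lambda>l. b (ts ! l)"])
  also have "\<dots> = (\<Sum>m<length ts. \<Sum>l<length ts - 1. if l < m then c (ts ! m) * (b (ts ! Suc l) - b (ts ! l)) else 0)"
    by (rule sum.cong[OF refl], rule sum.mono_neutral_cong_left) auto
  also have "\<dots> = (\<Sum>l<length ts - 1. \<Sum>m<length ts. if l < m then c (ts ! m) * (b (ts ! Suc l) - b (ts ! l)) else 0)"
    by (rule sum.swap)
  also have "\<dots> = (\<Sum>l<length ts - 1. \<Sum>m\<in>{l<..<length ts}. c (ts ! m) * (b (ts ! Suc l) - b (ts ! l)))"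
    by (rule sum.cong[OF refl], rule sum.mono_neutral_cong_right) auto
  finally show ?thesis by (simp add: sum_distrib_right)
qed

lemma partitions_nth_less:
  assumes "ts \<in> partitions T" "l < m" "m < length ts"
  shows "ts ! l < ts ! m"
  using assms by (auto simp: partitions_def sorted_wrt_iff_nth_less)

lemma partitions_nth_bounds:
  assumes "ts \<in> partitions T" "m < length ts"
  shows "0 \<le> ts ! m" "ts ! m \<le> T"
proof -
  have ne: "ts \<noteq> []" "hd ts = 0" "last ts = T" using assms by (auto simp: partitions_def)
  have "ts ! 0 \<le> ts ! m" using partitions_nth_less[OF assms(1), of 0 m] assms(2) by (cases m) auto
  then show "0 \<le> ts ! m" using ne by (simp add: hd_conv_nth)
  have "ts ! m \<le> ts ! (length ts - 1)"
  proof (cases "m = length ts - 1")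
    case False
    then have "m < length ts - 1" using assms(2) by linarith
    then show ?thesis by (intro less_imp_le partitions_nth_less[OF assms(1)]) (use assms(2) in auto)
  qed simp
  then show "ts ! m \<le> T" using ne by (simp add: last_conv_nth)
qed

text \<open>The step function whose integral against \<open>B\<close> is the sum of \<open>c s * B s\<close> over \<open>s \<in> F\<close>. In this form step
  functions over different sets of points are easily added.\<close>
definition wiener_step :: "real set \<Rightarrow> (real \<Rightarrow> real) \<Rightarrow> real \<Rightarrow> real" where
  "wiener_step F c r = (\<Sum>s\<in>F. c s * indicator {0<..s} r)"

lemma wiener_step_measurable [measurable]: "wiener_step F c \<in> borel_measurable borel"
  unfolding wiener_step_def by measurable

lemma wiener_step_square_integrable:
  assumes "finite F"
  shows "integrable lborel (\<lambda>r. (wiener_step F c r)\<^sup>2)"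
proof -
  have "integrable lborel (\<lambda>r. indicator {0<..s} r * indicator {0<..t} r :: real)" for s t :: real
  proof -
    have "emeasure lborel ({0<..s} \<inter> {0<..t}) \<le> emeasure lborel {0..s}" by (intro emeasure_mono) auto
    also have "\<dots> < \<infinity>" by (simp add: emeasure_lborel_Icc_eq)
    finally have "integrable lborel (\<lambda>r. indicator ({0<..s} \<inter> {0<..t}) r :: real)"
      by (intro integrable_real_indicator) auto
    then show ?thesis by (simp only: indicator_inter_arith)
  qed
  then show ?thesis
    unfolding wiener_step_def power2_eq_square sum_product
    by (auto intro!: Bochner_Integration.integrable_sum simp: mult.assoc mult.left_commute[of "indicator _ _"])
qed

text \<open>Over a partition that contains \<open>F\<close>, the sum is a combination of independent normal increments, and
  \<open>wiener_step F c\<close> is constant on each of the intervals.\<close>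
lemma gaussian_wiener_step:
  assumes B: "brownian_motion P T B" and T: "T > 0" and F: "finite F" "F \<subseteq> {0..T}"
  shows "gaussian_rv P (\<lambda>\<omega>. \<Sum>s\<in>F. c s * B s \<omega>) (\<integral>r. (wiener_step F c r)\<^sup>2 \<partial>lborel)"
proof -
  interpret prob_space P using B by (simp add: brownian_motion_def)
  define c' where "c' = (\<lambda>s. if s \<in> F then c s else 0)"
  define G where "G = F \<union> {0, T}"
  define ts where "ts = sorted_list_of_set G"
  have G: "finite G" "G \<subseteq> {0..T}" "0 \<in> G" "T \<in> G" using F T by (auto simp: G_def)
  have ts: "set ts = G" "distinct ts" "sorted ts" "ts \<noteq> []" using G by (auto simp: ts_def)
  have sw: "sorted_wrt (<) ts" using ts strict_sorted_iff by blast
  have hd: "hd ts = 0"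
  proof -
    have "hd ts \<in> G" using ts hd_in_set by blast
    moreover have "hd ts \<le> 0"
      using sw ts G(3) by (cases ts) (auto simp: less_imp_le)
    ultimately show ?thesis using G(2) by force
  qed
  have last: "last ts = T"
  proof -
    have "last ts \<in> G" using ts last_in_set by blast
    moreover obtain m where "m < length ts" "ts ! m = T" using G(4) ts(1) by (metis in_set_conv_nth)
    then have "T \<le> last ts"
      using ts sorted_nth_mono[OF ts(3), of m "length ts - 1"] by (simp add: last_conv_nth)
    ultimately show ?thesis using G(2) by force
  qed
  have part: "ts \<in> partitions T" using ts sw hd last by (simp add: partitions_def)
  define N where "N = length ts - 1"
  (* the value of the step function on the interval from ts ! l to ts ! Suc l *)
  define \<beta> where "\<beta> = (\<lambda>l. \<Sum>m\<in>{l<..<length ts}. c' (ts ! m))"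
  have eq: "(\<Sum>s\<in>F. c s * (b s - b 0)) = (\<Sum>l<N. \<beta> l * (b (ts ! Suc l) - b (ts ! l)))" for b :: "real \<Rightarrow> real"
  proof -
    have "(\<Sum>s\<in>F. c s * (b s - b 0)) = (\<Sum>s\<in>set ts. c' s * (b s - b (hd ts)))"
      unfolding hd ts(1) c'_def using G by (intro sum.mono_neutral_cong_left) (auto simp: G_def)
    then show ?thesis using sum_over_partition[OF ts(2,4), of c' b] by (simp add: \<beta>_def N_def)
  qed
  have Bm: "B s \<in> borel_measurable P" if "s \<in> {0..T}" for s
    using B that by (simp add: brownian_motion_def)
  have tsm: "ts ! l \<in> {0..T}" if "l \<le> N" for l
  proof -
    have "l < length ts" using that ts(4) by (cases ts) (auto simp: N_def)
    then show ?thesis using partitions_nth_bounds[OF part, of l] by simp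
  qed
  have ts_mono: "ts ! l \<le> ts ! m" if "l \<le> m" "m < length ts" for l m
    using partitions_nth_less[OF part, of l m] that by (cases "l = m") (auto simp: less_imp_le)
  have tsl: "ts ! l < ts ! Suc l" if "l < N" for l
    using partitions_nth_less[OF part, of l "Suc l"] that by (simp add: N_def)
  define I where "I = (\<lambda>l \<omega>. B (ts ! Suc l) \<omega> - B (ts ! l) \<omega>)"
  have Im [measurable]: "I l \<in> borel_measurable P" if "l < N" for l unfolding I_def using that tsm by (intro borel_measurable_diff Bm) auto
  have indep: "indep_vars (\<lambda>_. borel) I {..<N}"
    using B part unfolding brownian_motion_def I_def N_def by blast
  have indep\<beta>: "indep_vars (\<lambda>_. borel) (\<lambda>l \<omega>. \<beta> l * I l \<omega>) {..<N}"
    using indep by (rule indep_vars_compose2) simp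
  have charI: "char (distr P borel (\<lambda>\<omega>. \<beta> l * I l \<omega>)) t = complex_of_real (exp (- ((ts ! Suc l - ts ! l) * (\<beta> l * t)\<^sup>2 / 2)))"
    if l: "l < N" for l t
  proof -
    have "distributed P lborel (I l) (normal_density 0 (sqrt (ts ! Suc l - ts ! l)))"
      using B tsl[OF l] tsm[of l] tsm[of "Suc l"] l unfolding brownian_motion_def I_def by auto
    from char_distributed_normal[OF this, of "\<beta> l * t"] show ?thesis
      using tsl[OF l] l by (subst char_distr_scale) auto
  qed
  define v where "v = (\<Sum>l<N. (\<beta> l)\<^sup>2 * (ts ! Suc l - ts ! l))"
  have meas: "(\<lambda>\<omega>. \<Sum>s\<in>F. c s * B s \<omega>) \<in> borel_measurable P" using F by (intro borel_measurable_sum borel_measurable_times borel_measurable_const Bm) auto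
  have char: "char (distr P borel (\<lambda>\<omega>. \<Sum>s\<in>F. c s * B s \<omega>)) t = complex_of_real (exp (- (v * t\<^sup>2 / 2)))" for t
  proof -
    have ae: "AE \<omega> in P. (\<Sum>s\<in>F. c s * B s \<omega>) = (\<Sum>l<N. \<beta> l * I l \<omega>)"
    proof -
      have "AE \<omega> in P. B 0 \<omega> = 0" using B by (simp add: brownian_motion_def)
      then show ?thesis
      proof eventually_elim
        case (elim \<omega>)
        have "(\<Sum>s\<in>F. c s * B s \<omega>) = (\<Sum>s\<in>F. c s * (B s \<omega> - B 0 \<omega>))" using elim by simp
        then show ?case using eq[of "\<lambda>s. B s \<omega>"] by (simp add: I_def)
      qed
    qed
    have "char (distr P borel (\<lambda>\<omega>. \<Sum>s\<in>F. c s * B s \<omega>)) t = char (distr P borel (\<lambda>\<omega>. \<Sum>l<N. \<beta> l * I l \<omega>)) t"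
      by (intro char_distr_AE_cong meas ae) (auto intro!: borel_measurable_sum)
    also have "\<dots> = (\<Prod>l<N. complex_of_real (exp (- ((ts ! Suc l - ts ! l) * (\<beta> l * t)\<^sup>2 / 2))))"
      using charI by (subst char_distr_sum[OF indep\<beta>]) auto
    also have "\<dots> = complex_of_real (exp (\<Sum>l<N. - ((ts ! Suc l - ts ! l) * (\<beta> l * t)\<^sup>2 / 2)))"
      by (simp add: exp_sum of_real_prod[symmetric] del: of_real_prod)
    also have "(\<Sum>l<N. - ((ts ! Suc l - ts ! l) * (\<beta> l * t)\<^sup>2 / 2)) = - (v * t\<^sup>2 / 2)"
    proof -
      have "(\<Sum>l<N. - ((ts ! Suc l - ts ! l) * (\<beta> l * t)\<^sup>2 / 2)) =
          (\<Sum>l<N. ((\<beta> l)\<^sup>2 * (ts ! Suc l - ts ! l)) * (- (t\<^sup>2 / 2)))"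
        by (intro sum.cong refl) (simp add: power_mult_distrib)
      also have "\<dots> = v * (- (t\<^sup>2 / 2))" unfolding v_def by (rule sum_distrib_right[symmetric])
      finally show ?thesis by simp
    qed
    finally show ?thesis .
  qed
  have step: "wiener_step F c r = (\<Sum>l<N. \<beta> l * indicator {ts ! l<..ts ! Suc l} r)" for r
  proof -
    have "wiener_step F c r = (\<Sum>s\<in>F. c s * (indicator {0<..s} r - indicator {0<..0} r))"
      by (simp add: wiener_step_def)
    also have "\<dots> = (\<Sum>l<N. \<beta> l * (indicator {0<..ts ! Suc l} r - indicator {0<..ts ! l} r))"
      by (rule eq)
    also have "\<dots> = (\<Sum>l<N. \<beta> l * indicator {ts ! l<..ts ! Suc l} r)"
    proof (intro sum.cong refl)
      fix l assume "l \<in> {..<N}"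
      then have "0 \<le> ts ! l" "ts ! l < ts ! Suc l" using tsm[of l] tsl by auto
      then show "\<beta> l * (indicator {0<..ts ! Suc l} r - indicator {0<..ts ! l} r) = \<beta> l * indicator {ts ! l<..ts ! Suc l} r"
        by (auto simp: indicator_def)
    qed
    finally show ?thesis .
  qed
  have sq: "(wiener_step F c r)\<^sup>2 = (\<Sum>l<N. (\<beta> l)\<^sup>2 * indicator {ts ! l<..ts ! Suc l} r)" for r
  proof -
    have disj: "indicator {ts ! l<..ts ! Suc l} r * indicator {ts ! m<..ts ! Suc m} r =
        (if m = l then indicator {ts ! l<..ts ! Suc l} r else 0 :: real)" if "l < N" "m < N" for l m
    proof (cases l m rule: linorder_cases)
      case less
      then have "ts ! Suc l \<le> ts ! m" using ts_mono[of "Suc l" m] that by (simp add: N_def)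
      then show ?thesis using less by (auto simp: indicator_def)
    next
      case greater
      then have "ts ! Suc m \<le> ts ! l" using ts_mono[of "Suc m" l] that by (simp add: N_def)
      then show ?thesis using greater by (auto simp: indicator_def)
    qed (auto simp: indicator_def)
    have "(wiener_step F c r)\<^sup>2 = (\<Sum>l<N. \<Sum>m<N. \<beta> l * \<beta> m * (indicator {ts ! l<..ts ! Suc l} r * indicator {ts ! m<..ts ! Suc m} r))"
      unfolding step power2_eq_square sum_product by (simp add: mult_ac)
    also have "\<dots> = (\<Sum>l<N. \<Sum>m<N. if m = l then (\<beta> l)\<^sup>2 * indicator {ts ! l<..ts ! Suc l} r else 0)"
      using disj by (intro sum.cong refl) (auto simp: power2_eq_square)
    finally show ?thesis by simp
  qed
  have "(\<integral>r. (wiener_step F c r)\<^sup>2 \<partial>lborel) = v"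
    unfolding sq v_def using tsl
    by (subst Bochner_Integration.integral_sum) (auto intro!: sum.cong simp: less_imp_le)
  moreover have "0 \<le> v" unfolding v_def using tsl by (intro sum_nonneg mult_nonneg_nonneg) (auto simp: less_imp_le)
  ultimately show ?thesis unfolding gaussian_rv_def using char meas by simp
qed


text \<open>The Ito integral over \<open>[0, T]\<close> of a deterministic integrand, approximated by step functions with
  arbitrary finite sets of jumps, so that linear combinations stay in the class.\<close>
definition wiener_integral :: "'b measure \<Rightarrow> real \<Rightarrow> (real \<Rightarrow> 'b \<Rightarrow> real) \<Rightarrow> (real \<Rightarrow> real) \<Rightarrow> ('b \<Rightarrow> real) \<Rightarrow> bool" where
  "wiener_integral P T B f Y \<longleftrightarrow> f \<in> borel_measurable borel \<and> Y \<in> borel_measurable P \<and>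
    (\<exists>F c. (\<forall>n::nat. finite (F n) \<and> F n \<subseteq> {0..T}) \<and>
      (\<lambda>n. \<integral>\<^sup>+r. ennreal ((f r - wiener_step (F n) (c n) r)\<^sup>2) \<partial>lborel) \<longlonglongrightarrow> 0 \<and>
      (\<lambda>n. \<integral>\<^sup>+\<omega>. ennreal ((Y \<omega> - (\<Sum>s\<in>F n. c n s * B s \<omega>))\<^sup>2) \<partial>P) \<longlonglongrightarrow> 0)"

lemma tendsto_zero_combination:
  fixes a b :: "nat \<Rightarrow> ennreal"
  assumes "a \<longlonglongrightarrow> 0" "b \<longlonglongrightarrow> 0" "x < \<infinity>" "y < \<infinity>"
  shows "(\<lambda>n. x * a n + y * b n) \<longlonglongrightarrow> 0"
proof -
  have "(\<lambda>n. x * a n + y * b n) \<longlonglongrightarrow> x * 0 + y * 0"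
    using assms by (intro tendsto_add ennreal_tendsto_cmult) auto
  then show ?thesis by simp
qed

lemma nn_integral_square_combination_le:
  fixes f g :: "'x \<Rightarrow> real"
  assumes [measurable]: "f \<in> borel_measurable N" "g \<in> borel_measurable N"
  shows "(\<integral>\<^sup>+x. ennreal ((a * f x + b * g x)\<^sup>2) \<partial>N) \<le>
    ennreal (2 * a\<^sup>2) * (\<integral>\<^sup>+x. ennreal ((f x)\<^sup>2) \<partial>N) + ennreal (2 * b\<^sup>2) * (\<integral>\<^sup>+x. ennreal ((g x)\<^sup>2) \<partial>N)"
proof -
  have "(\<integral>\<^sup>+x. ennreal ((a * f x + b * g x)\<^sup>2) \<partial>N) \<le>
    (\<integral>\<^sup>+x. ennreal (2 * a\<^sup>2) * ennreal ((f x)\<^sup>2) + ennreal (2 * b\<^sup>2) * ennreal ((g x)\<^sup>2) \<partial>N)"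
  proof (intro nn_integral_mono)
    fix x
    have "0 \<le> (a * f x - b * g x)\<^sup>2" by simp
    then have "(a * f x + b * g x)\<^sup>2 \<le> 2 * a\<^sup>2 * (f x)\<^sup>2 + 2 * b\<^sup>2 * (g x)\<^sup>2"
      by (simp add: power2_eq_square algebra_simps)
    then have "ennreal ((a * f x + b * g x)\<^sup>2) \<le> ennreal (2 * a\<^sup>2 * (f x)\<^sup>2 + 2 * b\<^sup>2 * (g x)\<^sup>2)"
      by (rule ennreal_leI)
    then show "ennreal ((a * f x + b * g x)\<^sup>2) \<le> ennreal (2 * a\<^sup>2) * ennreal ((f x)\<^sup>2) + ennreal (2 * b\<^sup>2) * ennreal ((g x)\<^sup>2)"
      by (simp add: ennreal_mult)
  qed
  also have "\<dots> = ennreal (2 * a\<^sup>2) * (\<integral>\<^sup>+x. ennreal ((f x)\<^sup>2) \<partial>N) + ennreal (2 * b\<^sup>2) * (\<integral>\<^sup>+x. ennreal ((g x)\<^sup>2) \<partial>N)"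
    by (simp add: nn_integral_add nn_integral_cmult)
  finally show ?thesis .
qed

lemma wiener_integral_combination:
  assumes Bm: "\<And>s. s \<in> {0..T} \<Longrightarrow> B s \<in> borel_measurable P"
    and f: "wiener_integral P T B f Y" and g: "wiener_integral P T B g Z"
  shows "wiener_integral P T B (\<lambda>r. a * f r + b * g r) (\<lambda>\<omega>. a * Y \<omega> + b * Z \<omega>)"
proof -
  obtain F c where F: "\<And>n. finite (F n) \<and> F n \<subseteq> {0..T}"
      "(\<lambda>n. \<integral>\<^sup>+r. ennreal ((f r - wiener_step (F n) (c n) r)\<^sup>2) \<partial>lborel) \<longlonglongrightarrow> 0"
      "(\<lambda>n::nat. \<integral>\<^sup>+\<omega>. ennreal ((Y \<omega> - (\<Sum>s\<in>F n. c n s * B s \<omega>))\<^sup>2) \<partial>P) \<longlonglongrightarrow> 0"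
    using f unfolding wiener_integral_def by blast
  obtain G d where G: "\<And>n. finite (G n) \<and> G n \<subseteq> {0..T}"
      "(\<lambda>n. \<integral>\<^sup>+r. ennreal ((g r - wiener_step (G n) (d n) r)\<^sup>2) \<partial>lborel) \<longlonglongrightarrow> 0"
      "(\<lambda>n::nat. \<integral>\<^sup>+\<omega>. ennreal ((Z \<omega> - (\<Sum>s\<in>G n. d n s * B s \<omega>))\<^sup>2) \<partial>P) \<longlonglongrightarrow> 0"
    using g unfolding wiener_integral_def by blast
  have [measurable]: "f \<in> borel_measurable borel" "g \<in> borel_measurable borel"
    "Y \<in> borel_measurable P" "Z \<in> borel_measurable P"
    using f g by (auto simp: wiener_integral_def)
  define e where "e = (\<lambda>n s. a * (if s \<in> F n then c n s else 0) + b * (if s \<in> G n then d n s else 0))"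
  have sum: "(\<Sum>s\<in>F n \<union> G n. e n s * h s) = a * (\<Sum>s\<in>F n. c n s * h s) + b * (\<Sum>s\<in>G n. d n s * h s)" for n and h :: "real \<Rightarrow> real"
  proof -
    have "(\<Sum>s\<in>F n \<union> G n. e n s * h s) = a * (\<Sum>s\<in>F n \<union> G n. (if s \<in> F n then c n s else 0) * h s)
        + b * (\<Sum>s\<in>F n \<union> G n. (if s \<in> G n then d n s else 0) * h s)"
      by (simp add: e_def algebra_simps sum.distrib sum_distrib_left)
    moreover have "(\<Sum>s\<in>F n \<union> G n. (if s \<in> F n then c n s else 0) * h s) = (\<Sum>s\<in>F n. c n s * h s)"
      using F(1)[of n] G(1)[of n] by (intro sum.mono_neutral_cong_right) auto
    moreover have "(\<Sum>s\<in>F n \<union> G n. (if s \<in> G n then d n s else 0) * h s) = (\<Sum>s\<in>G n. d n s * h s)"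
      using F(1)[of n] G(1)[of n] by (intro sum.mono_neutral_cong_right) auto
    ultimately show ?thesis by simp
  qed
  have stepsum: "wiener_step (F n \<union> G n) (e n) r = a * wiener_step (F n) (c n) r + b * wiener_step (G n) (d n) r" for n r
    unfolding wiener_step_def by (rule sum)
  have [measurable]: "(\<lambda>\<omega>. \<Sum>s\<in>F n. c n s * B s \<omega>) \<in> borel_measurable P" "(\<lambda>\<omega>. \<Sum>s\<in>G n. d n s * B s \<omega>) \<in> borel_measurable P" for n
    using F(1)[of n] G(1)[of n] by (intro borel_measurable_sum borel_measurable_times borel_measurable_const Bm; auto)+
  show ?thesis unfolding wiener_integral_def
  proof (intro conjI exI[of _ "\<lambda>n. F n \<union> G n"] exI[of _ e] allI)
    show "(\<lambda>n. \<integral>\<^sup>+r. ennreal ((a * f r + b * g r - wiener_step (F n \<union> G n) (e n) r)\<^sup>2) \<partial>lborel) \<longlonglongrightarrow> 0"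
    proof (rule tendsto_sandwich[OF _ _ tendsto_const tendsto_zero_combination[OF F(2) G(2)]])
      show "eventually (\<lambda>n. (\<integral>\<^sup>+r. ennreal ((a * f r + b * g r - wiener_step (F n \<union> G n) (e n) r)\<^sup>2) \<partial>lborel) \<le>
        ennreal (2 * a\<^sup>2) * (\<integral>\<^sup>+r. ennreal ((f r - wiener_step (F n) (c n) r)\<^sup>2) \<partial>lborel) +
        ennreal (2 * b\<^sup>2) * (\<integral>\<^sup>+r. ennreal ((g r - wiener_step (G n) (d n) r)\<^sup>2) \<partial>lborel)) sequentially"
        using nn_integral_square_combination_le[of "\<lambda>r. f r - wiener_step (F n) (c n) r" lborel "\<lambda>r. g r - wiener_step (G n) (d n) r" a b for n]
        by (intro always_eventually allI) (simp add: stepsum algebra_simps)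
    qed auto
    show "(\<lambda>n. \<integral>\<^sup>+\<omega>. ennreal ((a * Y \<omega> + b * Z \<omega> - (\<Sum>s\<in>F n \<union> G n. e n s * B s \<omega>))\<^sup>2) \<partial>P) \<longlonglongrightarrow> 0"
    proof (rule tendsto_sandwich[OF _ _ tendsto_const tendsto_zero_combination[OF F(3) G(3)]])
      show "eventually (\<lambda>n. (\<integral>\<^sup>+\<omega>. ennreal ((a * Y \<omega> + b * Z \<omega> - (\<Sum>s\<in>F n \<union> G n. e n s * B s \<omega>))\<^sup>2) \<partial>P) \<le>
        ennreal (2 * a\<^sup>2) * (\<integral>\<^sup>+\<omega>. ennreal ((Y \<omega> - (\<Sum>s\<in>F n. c n s * B s \<omega>))\<^sup>2) \<partial>P) +
        ennreal (2 * b\<^sup>2) * (\<integral>\<^sup>+\<omega>. ennreal ((Z \<omega> - (\<Sum>s\<in>G n. d n s * B s \<omega>))\<^sup>2) \<partial>P)) sequentially"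
      proof (intro always_eventually allI)
        fix n
        have eq: "a * Y \<omega> + b * Z \<omega> - (\<Sum>s\<in>F n \<union> G n. e n s * B s \<omega>) =
          a * (Y \<omega> - (\<Sum>s\<in>F n. c n s * B s \<omega>)) + b * (Z \<omega> - (\<Sum>s\<in>G n. d n s * B s \<omega>))" for \<omega>
          unfolding sum by (simp add: algebra_simps)
        show "(\<integral>\<^sup>+\<omega>. ennreal ((a * Y \<omega> + b * Z \<omega> - (\<Sum>s\<in>F n \<union> G n. e n s * B s \<omega>))\<^sup>2) \<partial>P) \<le>
          ennreal (2 * a\<^sup>2) * (\<integral>\<^sup>+\<omega>. ennreal ((Y \<omega> - (\<Sum>s\<in>F n. c n s * B s \<omega>))\<^sup>2) \<partial>P) +
          ennreal (2 * b\<^sup>2) * (\<integral>\<^sup>+\<omega>. ennreal ((Z \<omega> - (\<Sum>s\<in>G n. d n s * B s \<omega>))\<^sup>2) \<partial>P)"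
          unfolding eq by (rule nn_integral_square_combination_le) measurable
      qed
    qed auto
  qed (use F(1) G(1) in auto)
qed

lemma wiener_integral_sum:
  assumes Bm: "\<And>s. s \<in> {0..T} \<Longrightarrow> B s \<in> borel_measurable P" and "finite J"
    and "\<And>j. j \<in> J \<Longrightarrow> wiener_integral P T B (f j) (Y j)"
  shows "wiener_integral P T B (\<lambda>r. \<Sum>j\<in>J. a j * f j r) (\<lambda>\<omega>. \<Sum>j\<in>J. a j * Y j \<omega>)"
  using assms(2,3)
proof (induction J rule: finite_induct)
  case empty
  show ?case unfolding wiener_integral_def
    by (auto intro!: exI[of _ "\<lambda>_. {}"] simp: wiener_step_def)
next
  case (insert j J)
  have "wiener_integral P T B (\<lambda>r. a j * f j r + 1 * (\<Sum>j\<in>J. a j * f j r)) (\<lambda>\<omega>. a j * Y j \<omega> + 1 * (\<Sum>j\<in>J. a j * Y j \<omega>))"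
    using insert by (intro wiener_integral_combination Bm) auto
  then show ?case using insert by simp
qed

text \<open>By Young's inequality \<open>\<bar>g\<^sup>2 - f\<^sup>2\<bar> \<le> (1 + 1 / \<eta>) (f - g)\<^sup>2 + \<eta> f\<^sup>2\<close> for every \<open>\<eta> > 0\<close>.\<close>
lemma integral_square_tendsto:
  fixes f :: "real \<Rightarrow> real"
  assumes [measurable]: "f \<in> borel_measurable borel" "\<And>n::nat. g n \<in> borel_measurable borel"
    and g: "\<And>n. integrable lborel (\<lambda>r. (g n r)\<^sup>2)"
    and lim: "(\<lambda>n. \<integral>\<^sup>+r. ennreal ((f r - g n r)\<^sup>2) \<partial>lborel) \<longlonglongrightarrow> 0"
  shows "integrable lborel (\<lambda>r. (f r)\<^sup>2)"
    and "(\<lambda>n. \<integral>r. (g n r)\<^sup>2 \<partial>lborel) \<longlonglongrightarrow> (\<integral>r. (f r)\<^sup>2 \<partial>lborel)"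
proof -
  let ?d = "\<lambda>n. \<integral>\<^sup>+r. ennreal ((f r - g n r)\<^sup>2) \<partial>lborel"
  obtain N where N: "?d N < 1"
    using order_tendstoD(2)[OF lim, of 1] by (auto simp: eventually_sequentially)
  have "(\<integral>\<^sup>+r. ennreal ((1 * (f r - g N r) + 1 * g N r)\<^sup>2) \<partial>lborel) \<le>
    ennreal (2 * 1\<^sup>2) * ?d N + ennreal (2 * 1\<^sup>2) * (\<integral>\<^sup>+r. ennreal ((g N r)\<^sup>2) \<partial>lborel)"
    by (rule nn_integral_square_combination_le) measurable
  also have "\<dots> < \<infinity>"
    using N g[of N] by (auto simp: nn_integral_eq_integral ennreal_mult_less_top intro: less_trans)
  finally have "(\<integral>\<^sup>+r. ennreal ((f r)\<^sup>2) \<partial>lborel) < \<infinity>" by simp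
  then show f: "integrable lborel (\<lambda>r. (f r)\<^sup>2)" by (intro integrableI_bounded) auto
  show "(\<lambda>n. \<integral>r. (g n r)\<^sup>2 \<partial>lborel) \<longlonglongrightarrow> (\<integral>r. (f r)\<^sup>2 \<partial>lborel)"
    unfolding LIMSEQ_iff
  proof (intro allI impI)
    fix e :: real assume e: "e > 0"
    define S where "S = (\<integral>r. (f r)\<^sup>2 \<partial>lborel)"
    have S: "0 \<le> S" by (simp add: S_def)
    (* the two terms of the Young inequality become e / 2 each; S + 1 avoids division by 0 *)
    define \<eta> where "\<eta> = e / (2 * (S + 1))"
    have \<eta>: "\<eta> > 0" "\<eta> * S < e / 2" using e S by (auto simp: \<eta>_def field_simps)
    define w where "w = 1 + 1 / \<eta>"
    define \<delta> where "\<delta> = e / (2 * w)"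
    have "w > 0" using \<eta>(1) by (simp add: w_def add_pos_pos)
    then have "\<delta> > 0" "w * \<delta> = e / 2" using e by (simp_all add: \<delta>_def)
    then have \<delta>: "\<delta> > 0" "(1 + 1 / \<eta>) * \<delta> = e / 2" by (simp_all add: w_def)
    have "eventually (\<lambda>n. ?d n < ennreal \<delta>) sequentially"
      using order_tendstoD(2)[OF lim, of "ennreal \<delta>"] \<delta> by simp
    then obtain no where no: "\<And>n. n \<ge> no \<Longrightarrow> ?d n < ennreal \<delta>" by (auto simp: eventually_sequentially)
    show "\<exists>no. \<forall>n\<ge>no. norm ((\<integral>r. (g n r)\<^sup>2 \<partial>lborel) - (\<integral>r. (f r)\<^sup>2 \<partial>lborel)) < e"
    proof (intro exI[of _ no] allI impI)
      fix n assume n: "n \<ge> no"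
      have dint: "integrable lborel (\<lambda>r. (f r - g n r)\<^sup>2)"
        using no[OF n] by (intro integrableI_bounded) (auto intro: less_trans)
      have d: "(\<integral>r. (f r - g n r)\<^sup>2 \<partial>lborel) < \<delta>"
        using no[OF n] by (subst (asm) nn_integral_eq_integral[OF dint]) (auto simp: ennreal_less_iff)
      have pt: "\<bar>(g n r)\<^sup>2 - (f r)\<^sup>2\<bar> \<le> (1 + 1 / \<eta>) * (f r - g n r)\<^sup>2 + \<eta> * (f r)\<^sup>2" for r
      proof -
        define x y where "x = f r - g n r" and "y = f r"
        have "0 \<le> (x / sqrt \<eta> - sqrt \<eta> * y)\<^sup>2" "0 \<le> (x / sqrt \<eta> + sqrt \<eta> * y)\<^sup>2" by simp_all
        then have "2 * x * y \<le> x\<^sup>2 / \<eta> + \<eta> * y\<^sup>2" "- (2 * x * y) \<le> x\<^sup>2 / \<eta> + \<eta> * y\<^sup>2"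
          using \<eta>(1) by (auto simp: power2_diff power2_sum power_divide power_mult_distrib)
        then have "\<bar>2 * x * y\<bar> \<le> x\<^sup>2 / \<eta> + \<eta> * y\<^sup>2" by linarith
        moreover have "(g n r)\<^sup>2 - (f r)\<^sup>2 = x\<^sup>2 - 2 * x * y" by (simp add: x_def y_def power2_eq_square algebra_simps)
        ultimately have "\<bar>(g n r)\<^sup>2 - (f r)\<^sup>2\<bar> \<le> x\<^sup>2 + (x\<^sup>2 / \<eta> + \<eta> * y\<^sup>2)"
          using zero_le_power2[of x] by linarith
        then show ?thesis by (simp add: x_def y_def algebra_simps)
      qed
      have "\<bar>(\<integral>r. (g n r)\<^sup>2 \<partial>lborel) - (\<integral>r. (f r)\<^sup>2 \<partial>lborel)\<bar> = \<bar>\<integral>r. (g n r)\<^sup>2 - (f r)\<^sup>2 \<partial>lborel\<bar>"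
        using g f by simp
      also have "\<dots> \<le> (\<integral>r. \<bar>(g n r)\<^sup>2 - (f r)\<^sup>2\<bar> \<partial>lborel)" by (rule integral_abs_bound)
      also have "\<dots> \<le> (\<integral>r. (1 + 1 / \<eta>) * (f r - g n r)\<^sup>2 + \<eta> * (f r)\<^sup>2 \<partial>lborel)"
        using g f dint pt by (intro integral_mono) auto
      also have "\<dots> = (1 + 1 / \<eta>) * (\<integral>r. (f r - g n r)\<^sup>2 \<partial>lborel) + \<eta> * S"
        using dint f by (simp add: S_def)
      also have "\<dots> \<le> (1 + 1 / \<eta>) * \<delta> + \<eta> * S"
        using d \<eta> by (intro add_mono mult_left_mono) auto
      also have "\<dots> < e" using \<delta> \<eta> by simp
      finally show "norm ((\<integral>r. (g n r)\<^sup>2 \<partial>lborel) - (\<integral>r. (f r)\<^sup>2 \<partial>lborel)) < e" by simp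
    qed
  qed
qed

text \<open>Characteristic functions at \<open>t\<close> differ by at most \<open>\<bar>t\<bar>\<close> times the mean distance, and \<open>x \<le> \<eta> + x\<^sup>2 / \<eta>\<close>
  bounds the latter by mean squares.\<close>
lemma (in prob_space) char_tendsto_L2:
  assumes Y[measurable]: "Y \<in> borel_measurable M" and Z[measurable]: "\<And>n::nat. Z n \<in> borel_measurable M"
    and lim: "(\<lambda>n. \<integral>\<^sup>+\<omega>. ennreal ((Y \<omega> - Z n \<omega>)\<^sup>2) \<partial>M) \<longlonglongrightarrow> 0"
  shows "(\<lambda>n. char (distr M borel (Z n)) t) \<longlonglongrightarrow> char (distr M borel Y) t"
  unfolding LIMSEQ_iff
proof (intro allI impI)
  fix e :: real assume e: "e > 0"
  define \<eta> where "\<eta> = e / (2 * (\<bar>t\<bar> + 1))"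
  have \<eta>: "\<eta> > 0" "\<bar>t\<bar> * (\<eta> + \<eta>) < e" using e by (auto simp: \<eta>_def field_simps add_pos_nonneg)
  have "eventually (\<lambda>n. (\<integral>\<^sup>+\<omega>. ennreal ((Y \<omega> - Z n \<omega>)\<^sup>2) \<partial>M) < ennreal (\<eta>\<^sup>2)) sequentially"
    using order_tendstoD(2)[OF lim, of "ennreal (\<eta>\<^sup>2)"] \<eta> by simp
  then obtain no where no: "\<And>n. n \<ge> no \<Longrightarrow> (\<integral>\<^sup>+\<omega>. ennreal ((Y \<omega> - Z n \<omega>)\<^sup>2) \<partial>M) < ennreal (\<eta>\<^sup>2)"
    by (auto simp: eventually_sequentially)
  show "\<exists>no. \<forall>n\<ge>no. norm (char (distr M borel (Z n)) t - char (distr M borel Y) t) < e"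
  proof (intro exI[of _ no] allI impI)
    fix n assume n: "n \<ge> no"
    have int: "integrable M (\<lambda>\<omega>. (Y \<omega> - Z n \<omega>)\<^sup>2)"
      using no[OF n] by (intro integrableI_bounded) (auto intro: less_trans)
    have d: "(\<integral>\<omega>. (Y \<omega> - Z n \<omega>)\<^sup>2 \<partial>M) \<le> \<eta>\<^sup>2"
      using no[OF n] by (subst (asm) nn_integral_eq_integral[OF int]) (auto simp: ennreal_less_iff)
    have iint: "integrable M (\<lambda>\<omega>. iexp (t * X \<omega>))" if "X \<in> borel_measurable M" for X
      using that by (intro integrable_iexp) auto
    have "norm (char (distr M borel (Z n)) t - char (distr M borel Y) t) =
      norm (\<integral>\<omega>. iexp (t * Z n \<omega>) - iexp (t * Y \<omega>) \<partial>M)"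
      using iint[OF Z] iint[OF Y] by (simp add: char_def integral_distr)
    also have "\<dots> \<le> (\<integral>\<omega>. norm (iexp (t * Z n \<omega>) - iexp (t * Y \<omega>)) \<partial>M)" by (rule integral_norm_bound)
    also have "\<dots> \<le> (\<integral>\<omega>. \<bar>t\<bar> * (\<eta> + (Y \<omega> - Z n \<omega>)\<^sup>2 / \<eta>) \<partial>M)"
    proof (rule integral_mono)
      show "integrable M (\<lambda>\<omega>. norm (iexp (t * Z n \<omega>) - iexp (t * Y \<omega>)))"
        by (intro integrable_norm Bochner_Integration.integrable_diff iint Y Z)
      show "integrable M (\<lambda>\<omega>. \<bar>t\<bar> * (\<eta> + (Y \<omega> - Z n \<omega>)\<^sup>2 / \<eta>))" using int by auto
      fix \<omega>
      have "norm (iexp (t * Z n \<omega>) - iexp (t * Y \<omega>)) \<le> \<bar>t * Z n \<omega> - t * Y \<omega>\<bar>"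
      proof -
        have "iexp (t * Z n \<omega>) - iexp (t * Y \<omega>) = iexp (t * Y \<omega>) * (iexp (t * Z n \<omega> - t * Y \<omega>) - 1)"
          by (simp add: right_diff_distrib exp_add[symmetric])
        then have "norm (iexp (t * Z n \<omega>) - iexp (t * Y \<omega>)) = norm (iexp (t * Z n \<omega> - t * Y \<omega>) - 1)"
          by (simp only: norm_mult norm_exp_i_times mult_1)
        also have "\<dots> \<le> \<bar>t * Z n \<omega> - t * Y \<omega>\<bar>"
          using iexp_approx1[of "t * Z n \<omega> - t * Y \<omega>" 0] by simp
        finally show ?thesis .
      qed
      also have "\<dots> = \<bar>t\<bar> * \<bar>Y \<omega> - Z n \<omega>\<bar>" by (simp add: right_diff_distrib[symmetric] abs_mult abs_minus_commute)
      also have "\<dots> \<le> \<bar>t\<bar> * (\<eta> + (Y \<omega> - Z n \<omega>)\<^sup>2 / \<eta>)"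
      proof (intro mult_left_mono)
        define x where "x = \<bar>Y \<omega> - Z n \<omega>\<bar>"
        have "x \<le> \<eta> + x\<^sup>2 / \<eta>"
        proof (cases "x \<le> \<eta>")
          case True
          then show ?thesis using \<eta> by (simp add: add_increasing2)
        next
          case False
          then have "x * \<eta> \<le> x * x" by (intro mult_left_mono) (auto simp: x_def)
          then have "x \<le> x\<^sup>2 / \<eta>" using \<eta>(1) by (simp add: pos_le_divide_eq power2_eq_square)
          then show ?thesis using \<eta>(1) by simp
        qed
        then show "\<bar>Y \<omega> - Z n \<omega>\<bar> \<le> \<eta> + (Y \<omega> - Z n \<omega>)\<^sup>2 / \<eta>" by (simp add: x_def)
      qed simp
      finally show "norm (iexp (t * Z n \<omega>) - iexp (t * Y \<omega>)) \<le> \<bar>t\<bar> * (\<eta> + (Y \<omega> - Z n \<omega>)\<^sup>2 / \<eta>)" .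
    qed
    also have "\<dots> = \<bar>t\<bar> * (\<eta> + (\<integral>\<omega>. (Y \<omega> - Z n \<omega>)\<^sup>2 \<partial>M) / \<eta>)"
      using int by (simp add: prob_space)
    also have "\<dots> \<le> \<bar>t\<bar> * (\<eta> + \<eta>\<^sup>2 / \<eta>)"
      using d \<eta>(1) by (intro mult_left_mono add_left_mono divide_right_mono) auto
    also have "\<dots> < e" using \<eta> by (simp add: power2_eq_square)
    finally show "norm (char (distr M borel (Z n)) t - char (distr M borel Y) t) < e" .
  qed
qed

text \<open>The isometry and the Gaussian law pass from step functions to the limit.\<close>
lemma wiener_integral_gaussian:
  assumes B: "brownian_motion P T B" and T: "T > 0" and f: "wiener_integral P T B f Y"
  shows "integrable lborel (\<lambda>r. (f r)\<^sup>2)" "gaussian_rv P Y (\<integral>r. (f r)\<^sup>2 \<partial>lborel)"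
proof -
  interpret prob_space P using B by (simp add: brownian_motion_def)
  obtain F c where F: "\<And>n. finite (F n) \<and> F n \<subseteq> {0..T}"
      "(\<lambda>n. \<integral>\<^sup>+r. ennreal ((f r - wiener_step (F n) (c n) r)\<^sup>2) \<partial>lborel) \<longlonglongrightarrow> 0"
      "(\<lambda>n::nat. \<integral>\<^sup>+\<omega>. ennreal ((Y \<omega> - (\<Sum>s\<in>F n. c n s * B s \<omega>))\<^sup>2) \<partial>P) \<longlonglongrightarrow> 0"
    using f unfolding wiener_integral_def by blast
  have [measurable]: "f \<in> borel_measurable borel" "Y \<in> borel_measurable P"
    using f by (auto simp: wiener_integral_def)
  have G: "gaussian_rv P (\<lambda>\<omega>. \<Sum>s\<in>F n. c n s * B s \<omega>) (\<integral>r. (wiener_step (F n) (c n) r)\<^sup>2 \<partial>lborel)" for n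
    using F(1)[of n] by (intro gaussian_wiener_step[OF B T]) auto
  note L = integral_square_tendsto[OF _ _ wiener_step_square_integrable F(2)]
  show "integrable lborel (\<lambda>r. (f r)\<^sup>2)" using F(1) by (intro L(1)) auto
  have v: "(\<lambda>n. \<integral>r. (wiener_step (F n) (c n) r)\<^sup>2 \<partial>lborel) \<longlonglongrightarrow> (\<integral>r. (f r)\<^sup>2 \<partial>lborel)"
    using F(1) by (intro L(2)) auto
  have "char (distr P borel Y) t = complex_of_real (exp (- ((\<integral>r. (f r)\<^sup>2 \<partial>lborel) * t\<^sup>2 / 2)))" for t
  proof (rule LIMSEQ_unique)
    show "(\<lambda>n. char (distr P borel (\<lambda>\<omega>. \<Sum>s\<in>F n. c n s * B s \<omega>)) t) \<longlonglongrightarrow> char (distr P borel Y) t"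
      using G F(3) by (intro char_tendsto_L2) (auto simp: gaussian_rv_def)
    show "(\<lambda>n. char (distr P borel (\<lambda>\<omega>. \<Sum>s\<in>F n. c n s * B s \<omega>)) t) \<longlonglongrightarrow> complex_of_real (exp (- ((\<integral>r. (f r)\<^sup>2 \<partial>lborel) * t\<^sup>2 / 2)))"
      using G unfolding gaussian_rv_def by (simp only:) (intro tendsto_of_real tendsto_exp tendsto_minus tendsto_divide tendsto_mult v tendsto_const, simp)
  qed
  then show "gaussian_rv P Y (\<integral>r. (f r)\<^sup>2 \<partial>lborel)" unfolding gaussian_rv_def by simp
qed

text \<open>A step function on a partition is a combination of the indicators of \<open>(0, s]\<close> for its points \<open>s\<close>: the
  coefficient \<open>d n s\<close> collects the interval that ends in \<open>s\<close> and the one that begins there.\<close>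
lemma has_ito_integral_wiener_integral:
  assumes I: "has_ito_integral P B t g Y" and t: "0 \<le> t" "t \<le> T"
  shows "wiener_integral P T B (\<lambda>r. indicator {0..<t} r * g r) Y"
proof -
  obtain ts c where ts: "\<And>n::nat. ts n \<in> partitions t"
      "(\<lambda>n. \<integral>\<^sup>+ r\<in>{0..<t}. ennreal ((g r - step_function (ts n) (c n) r)\<^sup>2) \<partial>lborel) \<longlonglongrightarrow> 0"
      "(\<lambda>n. \<integral>\<^sup>+ \<omega>. ennreal ((Y \<omega> - step_integral (ts n) (c n) (\<lambda>s. B s \<omega>))\<^sup>2) \<partial>P) \<longlonglongrightarrow> 0"
    using I unfolding has_ito_integral_def by blast
  define F where "F = (\<lambda>n. set (ts n))"
  define d where "d = (\<lambda>n s. \<Sum>l<length (ts n) - 1. c n l * ((if s = ts n ! Suc l then 1 else 0) - (if s = ts n ! l then 1 else 0)))"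
  have sum: "(\<Sum>s\<in>F n. d n s * h s) = (\<Sum>l<length (ts n) - 1. c n l * (h (ts n ! Suc l) - h (ts n ! l)))" for n and h :: "real \<Rightarrow> real"
  proof -
    have "(\<Sum>s\<in>F n. d n s * h s) = (\<Sum>l<length (ts n) - 1. \<Sum>s\<in>F n.
       c n l * ((if s = ts n ! Suc l then h s else 0) - (if s = ts n ! l then h s else 0)))"
      unfolding d_def sum_distrib_right by (subst sum.swap) (auto intro!: sum.cong)
    also have "\<dots> = (\<Sum>l<length (ts n) - 1. c n l * (h (ts n ! Suc l) - h (ts n ! l)))"
      by (rule sum.cong[OF refl]) (auto simp: sum_distrib_left[symmetric] sum_subtractf F_def)
    finally show ?thesis .
  qed
  have part: "0 \<le> ts n ! l" "ts n ! l \<le> t" if "l < length (ts n)" for n l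
    using partitions_nth_bounds[OF ts(1) that] by auto
  have step: "wiener_step (F n) (d n) r = step_function (ts n) (c n) r" for n r
    unfolding wiener_step_def sum step_function_def
  proof (rule sum.cong[OF refl])
    fix l assume "l \<in> {..<length (ts n) - 1}"
    then have "0 \<le> ts n ! l" "ts n ! l < ts n ! Suc l"
      using part[of l n] partitions_nth_less[OF ts(1), of l "Suc l" n] by auto
    then show "c n l * (indicator {0<..ts n ! Suc l} r - indicator {0<..ts n ! l} r) = c n l * indicator {ts n ! l<..ts n ! Suc l} r"
      by (auto simp: indicator_def)
  qed
  have supp: "step_function (ts n) (c n) r = 0" if "r \<notin> {0..t}" for n r
    unfolding step_function_def
  proof (intro sum.neutral ballI)
    fix l assume "l \<in> {..<length (ts n) - 1}"
    then have "0 \<le> ts n ! l" "ts n ! Suc l \<le> t" using part[of l n] part(2)[of "Suc l" n] by auto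
    then show "c n l * indicator {ts n ! l<..ts n ! Suc l} r = 0" using that by (auto simp: indicator_def)
  qed
  have gm: "(\<lambda>r. indicator {0..<t} r * g r) \<in> borel_measurable borel"
    using I by (simp add: has_ito_integral_def set_borel_measurable_def)
  have eq: "(\<integral>\<^sup>+r. ennreal ((indicator {0..<t} r * g r - wiener_step (F n) (d n) r)\<^sup>2) \<partial>lborel) =
    (\<integral>\<^sup>+ r\<in>{0..<t}. ennreal ((g r - step_function (ts n) (c n) r)\<^sup>2) \<partial>lborel)" for n
    using AE_lborel_singleton[of t]
    by (intro nn_integral_cong_AE, eventually_elim) (use supp in \<open>auto simp: step indicator_def\<close>)
  show ?thesis unfolding wiener_integral_def
  proof (intro conjI exI[of _ F] exI[of _ d] allI)
    show "F n \<subseteq> {0..T}" for n using part t by (fastforce simp: F_def in_set_conv_nth)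
    show "(\<lambda>n. \<integral>\<^sup>+ r. ennreal ((indicator {0..<t} r * g r - wiener_step (F n) (d n) r)\<^sup>2) \<partial>lborel) \<longlonglongrightarrow> 0"
      unfolding eq by (rule ts(2))
    show "(\<lambda>n. \<integral>\<^sup>+ \<omega>. ennreal ((Y \<omega> - (\<Sum>s\<in>F n. d n s * B s \<omega>))\<^sup>2) \<partial>P) \<longlonglongrightarrow> 0"
      unfolding sum using ts(3) by (simp add: step_integral_def)
  qed (use gm I in \<open>auto simp: has_ito_integral_def F_def\<close>)
qed

section \<open>Riemann--Stieltjes integrals and piecewise linear paths\<close>

lemma has_rs_integralD:
  assumes "has_rs_integral a b f g I" "\<epsilon> > 0"
  shows "\<exists>\<delta>>0. \<forall>D. D tagged_division_of {a..b} \<and> (\<lambda>x. ball x \<delta>) fine D \<longrightarrow>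
      \<bar>(\<Sum>(x, k)\<in>D. f x * (g (Sup k) - g (Inf k))) - I\<bar> < \<epsilon>"
  by (rule mp[OF spec[OF assms(1)[unfolded has_rs_integral_def]] assms(2)])

lemma has_rs_integral_unique:
  assumes "has_rs_integral a b f g I" "has_rs_integral a b f g J" 
  shows "I = J"
proof (rule ccontr)
  assume "I \<noteq> J"
  then have e: "\<bar>I - J\<bar> / 2 > 0" by simp
  obtain d1 where d1: "d1 > 0" "\<forall>D. D tagged_division_of {a..b} \<and> (\<lambda>x. ball x d1) fine D \<longrightarrow>
      \<bar>(\<Sum>(x, k)\<in>D. f x * (g (Sup k) - g (Inf k))) - I\<bar> < \<bar>I - J\<bar> / 2"
    using has_rs_integralD[OF assms(1) e] by blast
  obtain d2 where d2: "d2 > 0" "\<forall>D. D tagged_division_of {a..b} \<and> (\<lambda>x. ball x d2) fine D \<longrightarrow>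
      \<bar>(\<Sum>(x, k)\<in>D. f x * (g (Sup k) - g (Inf k))) - J\<bar> < \<bar>I - J\<bar> / 2"
    using has_rs_integralD[OF assms(2) e] by blast
  have "gauge (\<lambda>x::real. ball x (min d1 d2))" using d1(1) d2(1) by (auto simp: gauge_def)
  then obtain D where D: "D tagged_division_of cbox a b" "(\<lambda>x. ball x (min d1 d2)) fine D"
    using fine_division_exists by blast
  have sub: "k \<subseteq> ball x d1 \<and> k \<subseteq> ball x d2" if "(x, k) \<in> D" for x k
  proof -
    have "k \<subseteq> ball x (min d1 d2)" using D(2) that by (rule fineD)
    then show ?thesis by auto
  qed
  have fine: "(\<lambda>x. ball x d1) fine D" "(\<lambda>x. ball x d2) fine D" by (intro fineI; use sub in blast)+
  define S where "S = (\<Sum>(x, k)\<in>D. f x * (g (Sup k) - g (Inf k)))"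
  have TD: "D tagged_division_of {a..b}" using D(1) by (simp add: cbox_interval)
  have "\<bar>S - I\<bar> < \<bar>I - J\<bar> / 2" unfolding S_def by (rule mp[OF spec[OF d1(2)] conjI[OF TD fine(1)]])
  moreover have "\<bar>S - J\<bar> < \<bar>I - J\<bar> / 2" unfolding S_def by (rule mp[OF spec[OF d2(2)] conjI[OF TD fine(2)]])
  ultimately show False by (auto simp: abs_if split: if_splits)
qed

text \<open>On each interval of a fine division \<open>f\<close> varies by less than \<open>\<eta>\<close>, which costs at most \<open>\<eta> L\<close> times the
  length of the interval.\<close>
lemma has_rs_integral_density:
  fixes f g g' :: "real \<Rightarrow> real"
  assumes f: "continuous_on {a..b} f" and fg: "(\<lambda>u. f u * g' u) integrable_on {a..b}"
    and g': "g' integrable_on {a..b}" and L: "\<And>u. \<bar>g' u\<bar> \<le> L"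
    and g: "\<And>x y. a \<le> x \<Longrightarrow> x \<le> y \<Longrightarrow> y \<le> b \<Longrightarrow> g y - g x = integral {x..y} g'"
  shows "has_rs_integral a b f g (integral {a..b} (\<lambda>u. f u * g' u))"
  unfolding has_rs_integral_def
proof (intro allI impI)
  fix \<epsilon> :: real assume \<epsilon>: "\<epsilon> > 0"
  define C where "C = L * \<bar>b - a\<bar> + 1"
  have L0: "0 \<le> L" using L[of 0] by linarith
  have C: "C > 0" using L0 by (simp add: C_def add_nonneg_pos)
  define \<eta> where "\<eta> = \<epsilon> / C"
  have \<eta>: "\<eta> > 0" "\<eta> * (L * \<bar>b - a\<bar>) < \<epsilon>"
  proof -
    show "\<eta> > 0" using \<epsilon> C by (simp add: \<eta>_def)
    then have "\<eta> * (L * \<bar>b - a\<bar>) < \<eta> * C" by (simp add: C_def)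
    then show "\<eta> * (L * \<bar>b - a\<bar>) < \<epsilon>" using C by (simp add: \<eta>_def)
  qed
  have "uniformly_continuous_on {a..b} f" using f by (intro compact_uniformly_continuous) auto
  then obtain \<delta> where \<delta>: "\<delta> > 0" "\<And>x y. x \<in> {a..b} \<Longrightarrow> y \<in> {a..b} \<Longrightarrow> dist y x < \<delta> \<Longrightarrow> dist (f y) (f x) < \<eta>"
    unfolding uniformly_continuous_on_def using \<eta>(1) by meson
  show "\<exists>\<delta>>0. \<forall>D. D tagged_division_of {a..b} \<and> (\<lambda>x. ball x \<delta>) fine D \<longrightarrow>
    \<bar>(\<Sum>(x, k)\<in>D. f x * (g (Sup k) - g (Inf k))) - integral {a..b} (\<lambda>u. f u * g' u)\<bar> < \<epsilon>"
  proof (intro exI[of _ \<delta>] conjI allI impI)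
    fix D assume D: "D tagged_division_of {a..b} \<and> (\<lambda>x. ball x \<delta>) fine D"
    then have D1: "D tagged_division_of cbox a b" by (simp add: cbox_interval)
    note TD = tagged_division_ofD[OF D1]
    have I: "integral {a..b} (\<lambda>u. f u * g' u) = (\<Sum>(x, k)\<in>D. integral k (\<lambda>u. f u * g' u))"
      using integral_combine_tagged_division_topdown[OF _ D1, of "\<lambda>u. f u * g' u"] fg by (simp add: cbox_interval)
    have term_le: "\<bar>f x * (g (Sup k) - g (Inf k)) - integral k (\<lambda>u. f u * g' u)\<bar> \<le> \<eta> * L * measure lborel k"
      if xk: "(x, k) \<in> D" for x k
    proof -
      obtain c d where k: "k = {c..d}" using TD(4)[OF xk] by (auto simp: cbox_interval)
      have sub: "{c..d} \<subseteq> {a..b}" "x \<in> {c..d}" using TD(2,3)[OF xk] by (auto simp: k cbox_interval)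
      then have cd: "c \<le> d" "a \<le> c" "d \<le> b" by auto
      have i1: "g' integrable_on {c..d}" "(\<lambda>u. f u * g' u) integrable_on {c..d}"
        using integrable_on_subinterval[OF g' sub(1)] integrable_on_subinterval[OF fg sub(1)] by auto
      have i3: "(\<lambda>u. f x * g' u) integrable_on {c..d}" using integrable_cmul[OF i1(1), of "f x"] by simp
      have "f x * (g d - g c) - integral {c..d} (\<lambda>u. f u * g' u) = integral {c..d} (\<lambda>u. f x * g' u - f u * g' u)"
        using i1 i3 cd g[of c d] by (subst Henstock_Kurzweil_Integration.integral_diff) auto
      also have "norm \<dots> \<le> integral {c..d} (\<lambda>u. \<eta> * L)"
      proof (rule Henstock_Kurzweil_Integration.integral_norm_bound_integral)
        fix u assume u: "u \<in> {c..d}"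
        have "k \<subseteq> ball x \<delta>" using D xk by (auto simp: fine_def)
        then have "dist u x < \<delta>" using u by (auto simp: k dist_commute)
        then have "dist (f u) (f x) < \<eta>" using sub u by (intro \<delta>(2)) auto
        then have "\<bar>f x - f u\<bar> * \<bar>g' u\<bar> \<le> \<eta> * L" using L[of u] \<eta>(1) by (intro mult_mono) (auto simp: dist_real_def)
        then show "norm (f x * g' u - f u * g' u) \<le> \<eta> * L" by (simp add: left_diff_distrib[symmetric] abs_mult)
      qed (use i1 i3 in \<open>auto intro!: Henstock_Kurzweil_Integration.integrable_diff\<close>)
      also have "\<dots> = \<eta> * L * measure lborel k" using cd by (simp add: k)
      finally show ?thesis using cd by (simp add: k)
    qed
    have "\<bar>(\<Sum>(x, k)\<in>D. f x * (g (Sup k) - g (Inf k))) - integral {a..b} (\<lambda>u. f u * g' u)\<bar> \<le>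
      (\<Sum>(x, k)\<in>D. \<bar>f x * (g (Sup k) - g (Inf k)) - integral k (\<lambda>u. f u * g' u)\<bar>)"
      unfolding I sum_subtractf[symmetric] by (rule order_trans[OF sum_abs]) (auto intro!: sum_mono simp: split_beta)
    also have "\<dots> \<le> (\<Sum>(x, k)\<in>D. \<eta> * L * measure lborel k)"
      using term_le by (intro sum_mono) auto
    also have "\<dots> = \<eta> * L * (\<Sum>(x, k)\<in>D. measure lborel k)" by (simp add: sum_distrib_left split_beta)
    also have "(\<Sum>(x, k)\<in>D. measure lborel k) = measure lborel (cbox a b)"
      by (rule additive_content_tagged_division[OF D1])
    also have "\<dots> \<le> \<bar>b - a\<bar>" by (simp add: cbox_interval)
    finally have "\<bar>(\<Sum>(x, k)\<in>D. f x * (g (Sup k) - g (Inf k))) - integral {a..b} (\<lambda>u. f u * g' u)\<bar> \<le> \<eta> * L * \<bar>b - a\<bar>"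
      using \<eta>(1) L0 by (simp add: mult_left_mono)
    then show "\<bar>(\<Sum>(x, k)\<in>D. f x * (g (Sup k) - g (Inf k))) - integral {a..b} (\<lambda>u. f u * g' u)\<bar> < \<epsilon>"
      using \<eta>(2) by (simp add: mult.assoc)
  qed (fact \<delta>)
qed

lemma integrable_bounded_on_interval:
  fixes h :: "real \<Rightarrow> real"
  assumes [measurable]: "h \<in> borel_measurable borel" and L: "\<And>u. u \<in> A \<Longrightarrow> \<bar>h u\<bar> \<le> L" and A: "A \<in> sets borel" "A \<subseteq> {a..b}"
  shows "integrable lborel (\<lambda>u. indicator A u * h u)"
proof (rule Bochner_Integration.integrable_bound)
  show "integrable lborel (\<lambda>u. L * indicator {a..b} u)"
    by (intro integrable_mult_right integrable_real_indicator) (auto simp: emeasure_lborel_Icc_eq)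
  have [measurable]: "A \<in> sets borel" by fact
  show "(\<lambda>u. indicator A u * h u) \<in> borel_measurable lborel" by measurable
  show "AE u in lborel. norm (indicator A u * h u) \<le> norm (L * indicator {a..b} u)"
  proof (intro AE_I2)
    fix u
    show "norm (indicator A u * h u) \<le> norm (L * indicator {a..b} u)"
      using L[of u] A(2) by (cases "u \<in> A") (auto simp: indicator_def)
  qed
qed

lemma rs_integral_density:
  fixes f g g' :: "real \<Rightarrow> real"
  assumes ab: "a \<le> b" and f: "continuous_on {a..b} f" and [measurable]: "g' \<in> borel_measurable borel"
    and L: "\<And>u. \<bar>g' u\<bar> \<le> L"
    and g: "\<And>x. a \<le> x \<Longrightarrow> x \<le> b \<Longrightarrow> g x - g a = (\<integral>u. indicator {a<..x} u * g' u \<partial>lborel)"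
  shows "rs_integral a b f g = (\<integral>u. indicator {a<..b} u * (f u * g' u) \<partial>lborel)"
proof -
  define f0 where "f0 = (\<lambda>u. indicator {a..b} u * f u)"
  have [measurable]: "f0 \<in> borel_measurable borel"
    using borel_measurable_continuous_on_indicator[OF _ f] by (simp add: f0_def)
  have "compact (f ` {a..b})" using f by (intro compact_continuous_image) auto
  then obtain B where B: "\<And>u. u \<in> {a..b} \<Longrightarrow> \<bar>f u\<bar> \<le> B" by (force dest!: compact_imp_bounded simp: bounded_iff)
  have L0: "0 \<le> L" using L[of 0] by linarith
  have i1: "integrable lborel (\<lambda>u. indicator A u * g' u)" if "A \<in> sets borel" "A \<subseteq> {a..b}" for A
    using L that by (intro integrable_bounded_on_interval[of g' A L a b]) auto
  have i2: "integrable lborel (\<lambda>u. indicator {a..b} u * (f0 u * g' u))"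
  proof (rule integrable_bounded_on_interval[of _ _ "B * L" a b])
    show "\<bar>f0 u * g' u\<bar> \<le> B * L" if "u \<in> {a..b}" for u
      using B[OF that] L[of u] L0 that by (auto simp: f0_def abs_mult intro!: mult_mono)
  qed auto
  have int0: "integral {x..y} h = (\<integral>u. indicator {x<..y} u * h u \<partial>lborel)" if "integrable lborel (\<lambda>u. indicator {x..y} u * h u)"
    for x y and h :: "real \<Rightarrow> real"
  proof -
    have "integral {x..y} h = (LINT u:{x..y}|lborel. h u)"
      using that by (intro set_borel_integral_eq_integral(2)[symmetric]) (simp add: set_integrable_def)
    also have "\<dots> = (\<integral>u. indicator {x<..y} u * h u \<partial>lborel)"
      unfolding set_lebesgue_integral_def real_scaleR_def
    proof (rule integral_cong_AE)
      show "(\<lambda>u. indicator {x..y} u * h u) \<in> borel_measurable lborel" using that by auto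
      then have "(\<lambda>u. indicator {x<..y} u * (indicator {x..y} u * h u)) \<in> borel_measurable lborel" by measurable
      moreover have "(\<lambda>u. indicator {x<..y} u * (indicator {x..y} u * h u)) = (\<lambda>u. indicator {x<..y} u * h u)"
        by (auto simp: indicator_def)
      ultimately show "(\<lambda>u. indicator {x<..y} u * h u) \<in> borel_measurable lborel" by simp
      show "AE u in lborel. indicator {x..y} u * h u = indicator {x<..y} u * h u"
        using AE_lborel_singleton[of x] by eventually_elim (auto simp: indicator_def)
    qed
    finally show ?thesis .
  qed
  have HKg: "g' integrable_on {a..b}"
    using set_borel_integral_eq_integral(1)[of "{a..b}" g'] i1[of "{a..b}"] by (simp add: set_integrable_def)
  have HKf: "(\<lambda>u. f u * g' u) integrable_on {a..b}"
  proof -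
    have "(\<lambda>u. f0 u * g' u) integrable_on {a..b}"
      using set_borel_integral_eq_integral(1)[of "{a..b}" "\<lambda>u. f0 u * g' u"] i2 by (simp add: set_integrable_def)
    then show ?thesis by (rule integrable_eq) (auto simp: f0_def)
  qed
  have "has_rs_integral a b f g (integral {a..b} (\<lambda>u. f u * g' u))"
  proof (rule has_rs_integral_density[OF f HKf HKg L])
    fix x y assume xy: "a \<le> x" "x \<le> y" "y \<le> b"
    have "g y - g x = (g y - g a) - (g x - g a)" by simp
    also have "\<dots> = (\<integral>u. indicator {a<..y} u * g' u \<partial>lborel) - (\<integral>u. indicator {a<..x} u * g' u \<partial>lborel)"
      using xy by (simp add: g)
    also have "\<dots> = (\<integral>u. indicator {a<..y} u * g' u - indicator {a<..x} u * g' u \<partial>lborel)"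
      using xy by (intro Bochner_Integration.integral_diff[symmetric] i1) auto
    also have "\<dots> = (\<integral>u. indicator {x<..y} u * g' u \<partial>lborel)"
      using xy by (intro Bochner_Integration.integral_cong) (auto simp: indicator_def)
    also have "\<dots> = integral {x..y} g'" using xy by (intro int0[symmetric] i1) auto
    finally show "g y - g x = integral {x..y} g'" .
  qed
  then have "rs_integral a b f g = integral {a..b} (\<lambda>u. f u * g' u)"
    unfolding rs_integral_def using has_rs_integral_unique by blast
  also have "\<dots> = integral {a..b} (\<lambda>u. f0 u * g' u)"
    by (rule Henstock_Kurzweil_Integration.integral_cong) (auto simp: f0_def)
  also have "\<dots> = (\<integral>u. indicator {a<..b} u * (f0 u * g' u) \<partial>lborel)" by (rule int0[OF i2])
  also have "\<dots> = (\<integral>u. indicator {a<..b} u * (f u * g' u) \<partial>lborel)"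
    by (intro Bochner_Integration.integral_cong) (auto simp: f0_def indicator_def)
  finally show ?thesis .
qed

text \<open>Each interval contributes its increment, weighted by the fraction of it that lies before \<open>t\<close>.\<close>
lemma pl_interpolation_eq:
  assumes "sorted_wrt (<) ts" "ts \<noteq> []" "hd ts \<le> t"
  shows "pl_interpolation ts x t = x (hd ts) +
    (\<Sum>l<length ts - 1. ((min (ts ! Suc l) t - min (ts ! l) t) / (ts ! Suc l - ts ! l)) *\<^sub>R (x (ts ! Suc l) - x (ts ! l)))"
  using assms
proof (induction ts x t rule: pl_interpolation.induct)
  case (1 a b ts x t)
  let ?F = "\<lambda>ts l. ((min (ts ! Suc l) t - min (ts ! l) t) / (ts ! Suc l - ts ! l)) *\<^sub>R (x (ts ! Suc l) - x (ts ! l))"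
  have split: "(\<Sum>l<length (a # b # ts) - 1. ?F (a # b # ts) l) = ?F (a # b # ts) 0 + (\<Sum>l<length (b # ts) - 1. ?F (b # ts) l)"
    by (simp add: sum.lessThan_Suc_shift del: sum.lessThan_Suc)
  have ab: "a < b" "a \<le> t" using 1 by auto
  show ?case
  proof (cases "t \<le> b")
    case True
    have "?F (b # ts) l = 0" if "l < length (b # ts) - 1" for l
    proof -
      have "b \<le> (b # ts) ! l" using 1(2) that by (cases l) (auto simp: less_imp_le)
      moreover have "b \<le> (b # ts) ! Suc l" using 1(2) that by (auto simp: less_imp_le)
      ultimately show ?thesis using True by simp
    qed
    then have "(\<Sum>l<length (b # ts) - 1. ?F (b # ts) l) = 0" by (intro sum.neutral) auto
    then show ?thesis unfolding split using True ab by simp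
  next
    case False
    then have "pl_interpolation (b # ts) x t = x b + (\<Sum>l<length (b # ts) - 1. ?F (b # ts) l)"
      using 1 by simp
    then show ?thesis unfolding split using False ab by simp
  qed
qed auto

definition grid_list :: "real \<Rightarrow> nat \<Rightarrow> real list" where
  "grid_list T n = map (grid T n) [0..<Suc n]"

lemma grid_list_partition:
  assumes "T > 0" "n > 0"
  shows "grid_list T n \<in> partitions T"
  unfolding partitions_def
proof (intro CollectI conjI)
  show "grid_list T n \<noteq> []" by (simp add: grid_list_def)
  show "sorted_wrt (<) (grid_list T n)"
    unfolding grid_list_def sorted_wrt_map using assms
    by (intro sorted_wrt_mono_rel[OF _ sorted_wrt_upt]) (auto intro: grid_strict_mono)
  show "hd (grid_list T n) = 0" by (simp add: grid_list_def hd_map del: upt_Suc) 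
  show "last (grid_list T n) = T" using assms by (simp add: grid_list_def)
qed

text \<open>The velocity of the piecewise linear interpolation of \<open>x\<close> along the grid.\<close>
definition slope :: "real \<Rightarrow> nat \<Rightarrow> (real \<Rightarrow> real) \<Rightarrow> real \<Rightarrow> real" where
  "slope T n x u = (\<Sum>l<n. indicator (cell T n l) u * ((x (grid T n (Suc l)) - x (grid T n l)) * (real n / T)))"

lemma slope_measurable [measurable]: "slope T n x \<in> borel_measurable borel"
  unfolding slope_def by measurable

lemma slope_le: "T > 0 \<Longrightarrow> \<bar>slope T n x u\<bar> \<le> (\<Sum>l<n. \<bar>(x (grid T n (Suc l)) - x (grid T n l)) * (real n / T)\<bar>)"
  unfolding slope_def by (intro order_trans[OF sum_abs] sum_mono) (auto simp: indicator_def)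

lemma slope_eq_0: "T > 0 \<Longrightarrow> u \<notin> {0<..T} \<Longrightarrow> slope T n x u = 0"
  unfolding slope_def
proof (intro sum.neutral ballI)
  fix l assume "T > 0" "u \<notin> {0<..T}" "l \<in> {..<n}"
  then have "u \<notin> cell T n l" using cell_subset[of T l n] by auto
  then show "indicator (cell T n l) u * ((x (grid T n (Suc l)) - x (grid T n l)) * (real n / T)) = 0" by simp
qed

lemma pl_interpolation_grid:
  fixes X :: "real \<Rightarrow> real ^ 'd"
  assumes T: "T > 0" and n: "n > 0" and t: "0 \<le> t"
  shows "pl_interpolation (grid_list T n) X t $ i - X 0 $ i = (\<integral>u. indicator {0<..t} u * slope T n (\<lambda>t. X t $ i) u \<partial>lborel)"
proof -
  let ?g = "grid T n"
  have part: "grid_list T n \<in> partitions T" by (rule grid_list_partition[OF T n])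
  have nth: "grid_list T n ! l = ?g l" if "l \<le> n" for l using that by (simp add: grid_list_def del: upt_Suc)
  have cellint: "(\<integral>u. indicator {0<..t} u * indicator (cell T n l) u \<partial>lborel) = min (?g (Suc l)) t - min (?g l) t"
    "integrable lborel (\<lambda>u. indicator {0<..t} u * indicator (cell T n l) u :: real)" if "l < n" for l
  proof -
    have g: "0 \<le> ?g l" "?g l \<le> ?g (Suc l)" using grid_mono[OF T, of 0 l n] grid_mono[OF T, of l "Suc l" n] by auto
    have eq: "(\<lambda>u. indicator {0<..t} u * indicator (cell T n l) u :: real) = indicator {min (?g l) t<..min (?g (Suc l)) t}"
      using g by (auto simp: indicator_def cell_def fun_eq_iff)
    show "(\<integral>u. indicator {0<..t} u * indicator (cell T n l) u \<partial>lborel) = min (?g (Suc l)) t - min (?g l) t"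
      unfolding eq using g by simp
    have "emeasure lborel {min (?g l) t<..min (?g (Suc l)) t} < \<infinity>" using g by (subst emeasure_lborel_Ioc) auto
    then show "integrable lborel (\<lambda>u. indicator {0<..t} u * indicator (cell T n l) u :: real)"
      unfolding eq by (intro integrable_real_indicator) auto
  qed
  have "pl_interpolation (grid_list T n) X t = X 0 +
    (\<Sum>l<n. ((min (?g (Suc l)) t - min (?g l) t) / (?g (Suc l) - ?g l)) *\<^sub>R (X (?g (Suc l)) - X (?g l)))"
    using part t unfolding partitions_def
    by (subst pl_interpolation_eq) (auto simp: nth grid_list_def[of T n, THEN arg_cong[of _ _ length]] intro!: sum.cong)
  then have "pl_interpolation (grid_list T n) X t $ i - X 0 $ i =
    (\<Sum>l<n. (min (?g (Suc l)) t - min (?g l) t) * ((X (?g (Suc l)) $ i - X (?g l) $ i) * (real n / T)))"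
    using n by (simp add: grid_Suc_diff sum_component mult_ac)
  also have "\<dots> = (\<Sum>l<n. (\<integral>u. (indicator {0<..t} u * indicator (cell T n l) u) * ((X (?g (Suc l)) $ i - X (?g l) $ i) * (real n / T)) \<partial>lborel))"
    using cellint by (intro sum.cong refl) simp
  also have "\<dots> = (\<integral>u. (\<Sum>l<n. (indicator {0<..t} u * indicator (cell T n l) u) * ((X (?g (Suc l)) $ i - X (?g l) $ i) * (real n / T))) \<partial>lborel)"
    using cellint by (subst Bochner_Integration.integral_sum) auto
  also have "\<dots> = (\<integral>u. indicator {0<..t} u * slope T n (\<lambda>t. X t $ i) u \<partial>lborel)"
    by (simp add: slope_def sum_distrib_left mult.assoc)
  finally show ?thesis .
qed

section \<open>Iterated integrals as integrals over a simplex\<close>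

text \<open>If the last variable of a point of the simplex equals \<open>s\<close>, then the others range over this set with
  \<open>t = s\<close>.\<close>
definition open_time_simplex :: "nat \<Rightarrow> real \<Rightarrow> (nat \<Rightarrow> real) set" where
  "open_time_simplex m t = {u. (\<forall>j\<in>{1..m}. 0 \<le> u j \<and> u j < t) \<and> strict_mono_on {1..m} u}"

lemma strict_mono_on_Suc:
  "strict_mono_on {1..Suc m} u \<longleftrightarrow> strict_mono_on {1..m} u \<and> (\<forall>j\<in>{1..m}. u j < u (Suc m))"
  unfolding strict_mono_on_def by (auto simp: le_Suc_eq)

lemma time_simplex_Suc:
  "u \<in> time_simplex (Suc m) t \<longleftrightarrow> u (Suc m) \<in> {0..t} \<and> u \<in> open_time_simplex m (u (Suc m))"
  "u \<in> open_time_simplex (Suc m) t \<longleftrightarrow> u (Suc m) \<in> {0..<t} \<and> u \<in> open_time_simplex m (u (Suc m))"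
proof -
  have ins: "{1..Suc m} = insert (Suc m) {1..m}" by auto
  have bounds: "u j \<le> t" "u (Suc m) < t \<Longrightarrow> u j < t"
    if "\<forall>j\<in>{1..m}. 0 \<le> u j \<and> u j < u (Suc m)" "u (Suc m) \<le> t" "j \<in> {1..m}" for j t
    using bspec[OF that(1,3)] that(2) by auto
  show "u \<in> time_simplex (Suc m) t \<longleftrightarrow> u (Suc m) \<in> {0..t} \<and> u \<in> open_time_simplex m (u (Suc m))"
    unfolding time_simplex_def open_time_simplex_def mem_Collect_eq strict_mono_on_Suc
    unfolding ins ball_simps atLeastAtMost_iff[of "u (Suc m)"] using bounds(1) by blast
  show "u \<in> open_time_simplex (Suc m) t \<longleftrightarrow> u (Suc m) \<in> {0..<t} \<and> u \<in> open_time_simplex m (u (Suc m))"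
    unfolding open_time_simplex_def mem_Collect_eq strict_mono_on_Suc
    unfolding ins ball_simps atLeastLessThan_iff[of "u (Suc m)"] using bounds(2) less_imp_le by blast
qed

lemma open_time_simplex_upd: "u(Suc m := s) \<in> open_time_simplex m t \<longleftrightarrow> u \<in> open_time_simplex m t"
  by (auto simp: open_time_simplex_def strict_mono_on_def)

lemma PiM_component_measurable:
  "i \<in> I \<Longrightarrow> (\<lambda>u. u i) \<in> borel_measurable (Pi\<^sub>M I (\<lambda>_. lborel))"
  using measurable_component_singleton[of i I "\<lambda>_. lborel"] by simp

lemma time_simplex_pred_measurable:
  "Measurable.pred (Pi\<^sub>M {1..m} (\<lambda>_. lborel)) (\<lambda>u. u \<in> time_simplex m t)"
  "Measurable.pred (Pi\<^sub>M {1..m} (\<lambda>_. lborel)) (\<lambda>u. u \<in> open_time_simplex m t)"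
proof -
  have [measurable]: "(\<lambda>u. u i) \<in> borel_measurable (Pi\<^sub>M {1..m} (\<lambda>_. lborel))" if "i \<in> {1..m}" for i
    using that by (rule PiM_component_measurable)
  have mono: "Measurable.pred (Pi\<^sub>M {1..m} (\<lambda>_. lborel :: real measure)) (\<lambda>u. strict_mono_on {1..m} u)"
  proof -
    have "(\<lambda>u. strict_mono_on {1..m} u) = (\<lambda>u::nat\<Rightarrow>real. \<forall>r\<in>{1..m}. \<forall>s\<in>{1..m}. r < s \<longrightarrow> u r < u s)"
      by (auto simp: strict_mono_on_def fun_eq_iff)
    then show ?thesis by (simp only:) measurable
  qed
  show "Measurable.pred (Pi\<^sub>M {1..m} (\<lambda>_. lborel)) (\<lambda>u. u \<in> time_simplex m t)"
    using mono unfolding time_simplex_def mem_Collect_eq by measurable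
  show "Measurable.pred (Pi\<^sub>M {1..m} (\<lambda>_. lborel)) (\<lambda>u. u \<in> open_time_simplex m t)"
    using mono unfolding open_time_simplex_def mem_Collect_eq by measurable
qed

lemma emeasure_time_box:
  fixes m :: nat and T :: real
  shows "emeasure (Pi\<^sub>M {1..m} (\<lambda>_. lborel)) (PiE {1..m} (\<lambda>_. {0..T})) < \<infinity>"
proof -
  have "emeasure (Pi\<^sub>M {1..m} (\<lambda>_. lborel)) (PiE {1..m} (\<lambda>_. {0..T})) = (\<Prod>j\<in>{1..m}. emeasure lborel {0..T})"
    by (rule lborel_product.emeasure_PiM[of "{1..m}" "\<lambda>_. {0..T}"]) auto
  also have "\<dots> < \<infinity>" by (simp add: emeasure_lborel_Icc_eq power_less_top_ennreal)
  finally show ?thesis .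
qed

lemma time_simplex_integrable:
  fixes f :: "(nat \<Rightarrow> real) \<Rightarrow> real"
  assumes S: "Measurable.pred (Pi\<^sub>M {1..m} (\<lambda>_. lborel)) (\<lambda>u. u \<in> S)" "\<And>u j. u \<in> S \<Longrightarrow> j \<in> {1..m} \<Longrightarrow> u j \<in> {0..T}"
    and f[measurable]: "f \<in> borel_measurable (Pi\<^sub>M {1..m} (\<lambda>_. lborel))"
    and le: "\<And>u. u \<in> S \<Longrightarrow> \<bar>f u\<bar> \<le> C"
  shows "integrable (Pi\<^sub>M {1..m} (\<lambda>_. lborel)) (\<lambda>u. indicator S u * f u)"
proof (rule Bochner_Integration.integrable_bound)
  let ?B = "PiE {1..m} (\<lambda>_. {0..T})"
  show "integrable (Pi\<^sub>M {1..m} (\<lambda>_. lborel)) (\<lambda>u. C * indicator ?B u)"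
    using emeasure_time_box[of m T] by (intro integrable_mult_right integrable_real_indicator) auto
  show "(\<lambda>u. indicator S u * f u) \<in> borel_measurable (Pi\<^sub>M {1..m} (\<lambda>_. lborel))"
    using S(1) by measurable
  show "AE u in Pi\<^sub>M {1..m} (\<lambda>_. lborel). norm (indicator S u * f u) \<le> norm (C * indicator ?B u)"
  proof (intro AE_I2)
    fix u assume u: "u \<in> space (Pi\<^sub>M {1..m} (\<lambda>_. lborel :: real measure))"
    show "norm (indicator S u * f u) \<le> norm (C * indicator ?B u)"
    proof (cases "u \<in> S")
      case True
      then have "u \<in> ?B" using S(2) u by (auto simp: space_PiM PiE_def)
      then show ?thesis using True le[of u] by (auto simp: indicator_def)
    qed simp
  qed
qed

text \<open>Fubini's theorem with the new variable outermost, as in the recursion for iterated integrals.\<close>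
lemma product_integral_insert_outer:
  fixes f :: "(nat \<Rightarrow> real) \<Rightarrow> real"
  assumes J: "finite J" "i \<notin> J" and f: "integrable (Pi\<^sub>M (insert i J) (\<lambda>_. lborel)) f"
  shows "integral\<^sup>L (Pi\<^sub>M (insert i J) (\<lambda>_. lborel)) f =
    (\<integral>s. (\<integral>x. f (x(i := s)) \<partial>Pi\<^sub>M J (\<lambda>_. lborel)) \<partial>lborel)"
proof -
  have ins: "insert i J = {i} \<union> J" by auto
  have "integral\<^sup>L (Pi\<^sub>M (insert i J) (\<lambda>_. lborel)) f =
    (\<integral>x. (\<integral>y. f (merge {i} J (x, y)) \<partial>Pi\<^sub>M J (\<lambda>_. lborel)) \<partial>Pi\<^sub>M {i} (\<lambda>_. lborel))"
    unfolding ins using J f by (intro lborel_product.product_integral_fold) auto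
  also have "\<dots> = (\<integral>x. (\<integral>y. f (y(i := x i)) \<partial>Pi\<^sub>M J (\<lambda>_. lborel)) \<partial>Pi\<^sub>M {i} (\<lambda>_. lborel))"
  proof (intro Bochner_Integration.integral_cong refl)
    fix x y :: "nat \<Rightarrow> real" assume "y \<in> space (Pi\<^sub>M J (\<lambda>_. lborel :: real measure))"
    then have "merge {i} J (x, y) = y(i := x i)"
      using J by (auto simp: merge_def fun_eq_iff space_PiM PiE_def extensional_def)
    then show "f (merge {i} J (x, y)) = f (y(i := x i))" by simp
  qed
  also have "\<dots> = (\<integral>s. (\<integral>x. f (x(i := s)) \<partial>Pi\<^sub>M J (\<lambda>_. lborel)) \<partial>lborel)"
  proof (rule lborel_product.product_integral_singleton)
    have [measurable]: "f \<in> borel_measurable (Pi\<^sub>M (insert i J) (\<lambda>_. lborel))" using f by auto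
    have "(\<lambda>(s, y). f (y(i := s))) \<in> borel_measurable (lborel \<Otimes>\<^sub>M Pi\<^sub>M J (\<lambda>_. lborel))"
      by measurable
    then show "(\<lambda>s. \<integral>x. f (x(i := s)) \<partial>Pi\<^sub>M J (\<lambda>_. lborel)) \<in> borel_measurable lborel"
      using J(1) by (intro sigma_finite_measure.borel_measurable_lebesgue_integral lborel_product.sigma_finite) auto
  qed
  finally show ?thesis .
qed

lemma continuous_on_indefinite_integral:
  fixes h :: "real \<Rightarrow> real"
  assumes h: "integrable lborel h"
  shows "continuous_on A (\<lambda>t. \<integral>u. indicator {a<..t} u * h u \<partial>lborel)"
proof (rule continuous_at_imp_continuous_on, intro ballI)
  fix t :: real
  have [measurable]: "h \<in> borel_measurable borel" using h by auto
  show "isCont (\<lambda>t. \<integral>u. indicator {a<..t} u * h u \<partial>lborel) t"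
    unfolding continuous_at_sequentially comp_def
  proof (intro allI impI)
    fix s :: "nat \<Rightarrow> real" assume s: "s \<longlonglongrightarrow> t"
    show "(\<lambda>n. \<integral>u. indicator {a<..s n} u * h u \<partial>lborel) \<longlonglongrightarrow> (\<integral>u. indicator {a<..t} u * h u \<partial>lborel)"
    proof (rule integral_dominated_convergence[where w="\<lambda>u. \<bar>h u\<bar>"])
      show "integrable lborel (\<lambda>u. \<bar>h u\<bar>)" using h by simp
      show "AE u in lborel. norm (indicator {a<..s n} u * h u) \<le> \<bar>h u\<bar>" for n
        by (intro AE_I2) (auto simp: indicator_def)
      show "AE u in lborel. (\<lambda>n. indicator {a<..s n} u * h u) \<longlonglongrightarrow> indicator {a<..t} u * h u"
        using AE_lborel_singleton[of t]
      proof eventually_elim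
        case (elim u)
        have "eventually (\<lambda>n. indicator {a<..s n} u * h u = indicator {a<..t} u * h u) sequentially"
        proof (cases "u < t")
          case True
          show ?thesis using order_tendstoD(1)[OF s True]
            by (rule eventually_mono) (use True in \<open>auto simp: indicator_def\<close>)
        next
          case False
          then have tu: "t < u" using elim by simp
          show ?thesis using order_tendstoD(2)[OF s tu]
            by (rule eventually_mono) (use tu in \<open>auto simp: indicator_def\<close>)
        qed
        then show ?case by (rule tendsto_eventually)
      qed
    qed measurable
  qed
qed

text \<open>Induction on the length of the word. The outermost Riemann--Stieltjes integral against \<open>\<gamma>\<close> is a Lebesgue
  integral against the density \<open>\<phi>\<close>, provided that its integrand is continuous; so continuity is part of the
  induction. The simplices that arise differ from \<open>time_simplex\<close> by faces only, which are null sets.\<close>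
lemma iterated_integral_eq_simplex_integral:
  fixes \<gamma> :: "real \<Rightarrow> real ^ 'd::finite" and \<phi> :: "'d \<Rightarrow> real \<Rightarrow> real"
  assumes [measurable]: "\<And>c. \<phi> c \<in> borel_measurable borel" and L: "\<And>c u. \<bar>\<phi> c u\<bar> \<le> L"
    and \<phi>0: "\<And>c. \<phi> c 0 = 0"
    and \<gamma>: "\<And>c t. 0 \<le> t \<Longrightarrow> \<gamma> t $ c - \<gamma> 0 $ c = (\<integral>u. indicator {0<..t} u * \<phi> c u \<partial>lborel)"
    and t0: "0 \<le> t"
  shows "iterated_integral_rev \<gamma> 0 (rev (index_word k i)) t =
      (\<integral>u. indicator (time_simplex k t) u * (\<Prod>j\<in>{1..k}. \<phi> (i j) (u j)) \<partial>Pi\<^sub>M {1..k} (\<lambda>_. lborel))"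
proof -
  define T where "T = t"
  have t: "0 \<le> t" "t \<le> T" using t0 by (simp_all add: T_def)
  have L0: "0 \<le> L" using L[of undefined 0] by linarith
  let ?J = "\<lambda>k t. \<integral>u. indicator (open_time_simplex k t) u * (\<Prod>j\<in>{1..k}. \<phi> (i j) (u j)) \<partial>Pi\<^sub>M {1..k} (\<lambda>_. lborel)"
  have prodm: "(\<lambda>u. \<Prod>j\<in>{1..k}. \<phi> (i j) (u j)) \<in> borel_measurable (Pi\<^sub>M {1..k} (\<lambda>_. lborel))" for k
    by (intro borel_measurable_prod measurable_compose[OF PiM_component_measurable]) auto
  have prodle: "\<bar>\<Prod>j\<in>{1..k}. \<phi> (i j) (u j)\<bar> \<le> L ^ k" for k u
  proof -
    have "(\<Prod>j\<in>{1..k}. \<bar>\<phi> (i j) (u j)\<bar>) \<le> (\<Prod>j\<in>{1..k}. L)" using L by (intro prod_mono) auto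
    then show ?thesis by (simp add: abs_prod)
  qed
  have fubini: "(\<integral>u. indicator S u * (\<Prod>j\<in>{1..Suc k}. \<phi> (i j) (u j)) \<partial>Pi\<^sub>M {1..Suc k} (\<lambda>_. lborel)) =
      (\<integral>s. indicator A s * (?J k s * \<phi> (i (Suc k)) s) \<partial>lborel)"
    if S: "Measurable.pred (Pi\<^sub>M {1..Suc k} (\<lambda>_. lborel)) (\<lambda>u. u \<in> S)" "\<And>u j. u \<in> S \<Longrightarrow> j \<in> {1..Suc k} \<Longrightarrow> u j \<in> {0..T}"
      "\<And>u. u \<in> S \<longleftrightarrow> u (Suc k) \<in> A \<and> u \<in> open_time_simplex k (u (Suc k))" for S A k T
  proof -
    have ins: "{1..Suc k} = insert (Suc k) {1..k}" by auto
    have "integrable (Pi\<^sub>M {1..Suc k} (\<lambda>_. lborel)) (\<lambda>u. indicator S u * (\<Prod>j\<in>{1..Suc k}. \<phi> (i j) (u j)))"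
    proof (rule time_simplex_integrable[where T=T and C="L ^ Suc k"])
      show "\<And>u j. u \<in> S \<Longrightarrow> j \<in> {1..Suc k} \<Longrightarrow> u j \<in> {0..T}" by (rule S(2))
    qed (rule S(1) prodm prodle)+
    then have int: "integrable (Pi\<^sub>M (insert (Suc k) {1..k}) (\<lambda>_. lborel)) (\<lambda>u. indicator S u * (\<Prod>j\<in>{1..Suc k}. \<phi> (i j) (u j)))"
      unfolding ins .
    have "(\<integral>u. indicator S u * (\<Prod>j\<in>{1..Suc k}. \<phi> (i j) (u j)) \<partial>Pi\<^sub>M (insert (Suc k) {1..k}) (\<lambda>_. lborel)) =
      (\<integral>s. (\<integral>x. indicator S (x(Suc k := s)) * (\<Prod>j\<in>{1..Suc k}. \<phi> (i j) ((x(Suc k := s)) j)) \<partial>Pi\<^sub>M {1..k} (\<lambda>_. lborel)) \<partial>lborel)"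
      by (rule product_integral_insert_outer[OF _ _ int]) auto
    also have "\<dots> = (\<integral>s. indicator A s * (?J k s * \<phi> (i (Suc k)) s) \<partial>lborel)"
    proof (rule Bochner_Integration.integral_cong[OF refl])
      fix s
      have "(\<integral>x. indicator S (x(Suc k := s)) * (\<Prod>j\<in>{1..Suc k}. \<phi> (i j) ((x(Suc k := s)) j)) \<partial>Pi\<^sub>M {1..k} (\<lambda>_. lborel)) =
        (\<integral>x. indicator A s * \<phi> (i (Suc k)) s * (indicator (open_time_simplex k s) x * (\<Prod>j\<in>{1..k}. \<phi> (i j) (x j))) \<partial>Pi\<^sub>M {1..k} (\<lambda>_. lborel))"
      proof (rule Bochner_Integration.integral_cong[OF refl])
        fix x
        have "indicator S (x(Suc k := s)) = (indicator A s * indicator (open_time_simplex k s) x :: real)"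
          by (auto simp: indicator_def S(3) open_time_simplex_upd)
        moreover have "(\<Prod>j\<in>{1..Suc k}. \<phi> (i j) ((x(Suc k := s)) j)) = \<phi> (i (Suc k)) s * (\<Prod>j\<in>{1..k}. \<phi> (i j) (x j))"
          unfolding ins by (subst prod.insert) (auto intro!: prod.cong)
        ultimately show "indicator S (x(Suc k := s)) * (\<Prod>j\<in>{1..Suc k}. \<phi> (i j) ((x(Suc k := s)) j)) =
          indicator A s * \<phi> (i (Suc k)) s * (indicator (open_time_simplex k s) x * (\<Prod>j\<in>{1..k}. \<phi> (i j) (x j)))"
          by (simp add: mult_ac)
      qed
      also have "\<dots> = indicator A s * (?J k s * \<phi> (i (Suc k)) s)"
        by (subst integral_mult_right_zero) (simp only: mult_ac)
      finally show "(\<integral>x. indicator S (x(Suc k := s)) * (\<Prod>j\<in>{1..Suc k}. \<phi> (i j) ((x(Suc k := s)) j)) \<partial>Pi\<^sub>M {1..k} (\<lambda>_. lborel)) =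
        indicator A s * (?J k s * \<phi> (i (Suc k)) s)" .
    qed
    finally show ?thesis unfolding ins .
  qed
  have closed: "(\<integral>u. indicator (time_simplex (Suc k) t) u * (\<Prod>j\<in>{1..Suc k}. \<phi> (i j) (u j)) \<partial>Pi\<^sub>M {1..Suc k} (\<lambda>_. lborel)) =
      (\<integral>s. indicator {0..t} s * (?J k s * \<phi> (i (Suc k)) s) \<partial>lborel)" for k t
  proof (rule fubini[where T=t])
    show "u j \<in> {0..t}" if "u \<in> time_simplex (Suc k) t" "j \<in> {1..Suc k}" for u j
      using that by (auto simp: time_simplex_def)
  qed (rule time_simplex_pred_measurable time_simplex_Suc)+
  have opn: "?J (Suc k) t = (\<integral>s. indicator {0..<t} s * (?J k s * \<phi> (i (Suc k)) s) \<partial>lborel)" for k t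
  proof (rule fubini[where T=t])
    show "u j \<in> {0..t}" if "u \<in> open_time_simplex (Suc k) t" "j \<in> {1..Suc k}" for u j
      using that by (auto simp: open_time_simplex_def less_imp_le)
  qed (rule time_simplex_pred_measurable time_simplex_Suc)+
  have index_word_Suc: "rev (index_word (Suc k) i) = i (Suc k) # rev (index_word k i)" for k
    by (simp add: index_word_def)
  have step: "iterated_integral_rev \<gamma> 0 (rev (index_word (Suc k) i)) t = (\<integral>s. indicator {0<..t} s * (?J k s * \<phi> (i (Suc k)) s) \<partial>lborel)
     \<and> (\<integral>s. indicator {0<..t} s * (?J k s * \<phi> (i (Suc k)) s) \<partial>lborel) = ?J (Suc k) t
     \<and> (\<integral>s. indicator {0<..t} s * (?J k s * \<phi> (i (Suc k)) s) \<partial>lborel) =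
        (\<integral>u. indicator (time_simplex (Suc k) t) u * (\<Prod>j\<in>{1..Suc k}. \<phi> (i j) (u j)) \<partial>Pi\<^sub>M {1..Suc k} (\<lambda>_. lborel))"
    if IH: "\<forall>t\<in>{0..T}. iterated_integral_rev \<gamma> 0 (rev (index_word k i)) t = ?J k t"
      and cont: "continuous_on {0..T} (?J k)" and t: "t \<in> {0..T}" for k t
  proof (intro conjI)
    define I where "I = (\<lambda>u. iterated_integral_rev \<gamma> 0 (rev (index_word k i)) u)"
    have IJ: "I u = ?J k u" if "u \<in> {0..t}" for u using bspec[OF IH, of u] t that by (simp add: I_def)
    have contI: "continuous_on {0..t} I"
      using continuous_on_subset[OF cont, of "{0..t}"] t IJ by (subst continuous_on_cong[OF refl IJ]) auto
    have "iterated_integral_rev \<gamma> 0 (rev (index_word (Suc k) i)) t = rs_integral 0 t I (\<lambda>u. \<gamma> u $ i (Suc k))"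
      unfolding index_word_Suc I_def by simp
    also have "\<dots> = (\<integral>s. indicator {0<..t} s * (I s * \<phi> (i (Suc k)) s) \<partial>lborel)"
      using t \<gamma> by (intro rs_integral_density[OF _ contI _ L]) auto
    also have "\<dots> = (\<integral>s. indicator {0<..t} s * (?J k s * \<phi> (i (Suc k)) s) \<partial>lborel)"
      by (intro Bochner_Integration.integral_cong refl) (auto simp: indicator_def IJ)
    finally show "iterated_integral_rev \<gamma> 0 (rev (index_word (Suc k) i)) t = (\<integral>s. indicator {0<..t} s * (?J k s * \<phi> (i (Suc k)) s) \<partial>lborel)" .
    have Jm [measurable]: "(\<lambda>s. indicator {0..t} s * ?J k s) \<in> borel_measurable borel"
      using borel_measurable_continuous_on_indicator[of "{0..t}" "?J k"] continuous_on_subset[OF cont, of "{0..t}"] t by simp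
    have eq: "indicator {0<..t} s * (?J k s * \<phi> (i (Suc k)) s) = indicator {0<..t} s * ((indicator {0..t} s * ?J k s) * \<phi> (i (Suc k)) s)" for s
      by (auto simp: indicator_def)
    have eq2: "indicator {0..<t} s * (?J k s * \<phi> (i (Suc k)) s) = indicator {0..<t} s * ((indicator {0..t} s * ?J k s) * \<phi> (i (Suc k)) s)" for s
      by (auto simp: indicator_def)
    show "(\<integral>s. indicator {0<..t} s * (?J k s * \<phi> (i (Suc k)) s) \<partial>lborel) = ?J (Suc k) t"
      unfolding opn eq eq2
    proof (rule integral_cong_AE)
      show "AE s in lborel. indicator {0<..t} s * ((indicator {0..t} s * ?J k s) * \<phi> (i (Suc k)) s) =
          indicator {0..<t} s * ((indicator {0..t} s * ?J k s) * \<phi> (i (Suc k)) s)"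
        using AE_lborel_singleton[of t] AE_lborel_singleton[of 0] by eventually_elim (auto simp: indicator_def)
    qed measurable
    show "(\<integral>s. indicator {0<..t} s * (?J k s * \<phi> (i (Suc k)) s) \<partial>lborel) =
        (\<integral>u. indicator (time_simplex (Suc k) t) u * (\<Prod>j\<in>{1..Suc k}. \<phi> (i j) (u j)) \<partial>Pi\<^sub>M {1..Suc k} (\<lambda>_. lborel))"
      unfolding closed
    proof (rule Bochner_Integration.integral_cong[OF refl])
      fix s show "indicator {0<..t} s * (?J k s * \<phi> (i (Suc k)) s) = indicator {0..t} s * (?J k s * \<phi> (i (Suc k)) s)"
        by (cases "s = 0") (auto simp: indicator_def \<phi>0)
    qed
  qed
  have main: "(\<forall>t\<in>{0..T}. iterated_integral_rev \<gamma> 0 (rev (index_word k i)) t = ?J k t) \<and> continuous_on {0..T} (?J k)" for k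
  proof (induction k)
    case 0
    have "open_time_simplex 0 t = UNIV" for t by (auto simp: open_time_simplex_def strict_mono_on_def)
    then have "?J 0 t = 1" for t by (simp add: PiM_empty lebesgue_integral_count_space_finite)
    then show ?case by (simp add: index_word_def)
  next
    case (Suc k)
    then have IH: "\<forall>t\<in>{0..T}. iterated_integral_rev \<gamma> 0 (rev (index_word k i)) t = ?J k t"
      and cont: "continuous_on {0..T} (?J k)" by auto
    note st = step[OF IH cont]
    define h where "h = (\<lambda>s. indicator {0..T} s * (?J k s * \<phi> (i (Suc k)) s))"
    have "bounded (?J k ` {0..T})" using cont by (intro compact_imp_bounded compact_continuous_image) auto
    then obtain C where "\<forall>x\<in>?J k ` {0..T}. norm x \<le> C" unfolding bounded_iff by blast
    then have C: "\<And>u. u \<in> {0..T} \<Longrightarrow> \<bar>?J k u\<bar> \<le> C" by simp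
    have [measurable]: "(\<lambda>s. indicator {0..T} s * ?J k s) \<in> borel_measurable borel"
      using borel_measurable_continuous_on_indicator[of "{0..T}" "?J k"] cont by simp
    have "integrable lborel (\<lambda>s. indicator {0..T} s * ((indicator {0..T} s * ?J k s) * \<phi> (i (Suc k)) s))"
    proof (rule integrable_bounded_on_interval[of _ _ "C * L" 0 T])
      show "\<bar>(indicator {0..T} u * ?J k u) * \<phi> (i (Suc k)) u\<bar> \<le> C * L" if "u \<in> {0..T}" for u
        using C[OF that] L[of "i (Suc k)" u] L0 that by (auto simp: abs_mult intro!: mult_mono)
      show "(\<lambda>s. (indicator {0..T} s * ?J k s) * \<phi> (i (Suc k)) s) \<in> borel_measurable borel" by measurable
    qed auto
    moreover have "(\<lambda>s. indicator {0..T} s * ((indicator {0..T} s * ?J k s) * \<phi> (i (Suc k)) s)) = h"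
      by (auto simp: h_def indicator_def)
    ultimately have h: "integrable lborel h" by simp
    have Jh: "?J (Suc k) t = (\<integral>s. indicator {0<..t} s * h s \<partial>lborel)" if "t \<in> {0..T}" for t
    proof -
      have "?J (Suc k) t = (\<integral>s. indicator {0<..t} s * (?J k s * \<phi> (i (Suc k)) s) \<partial>lborel)" using st[OF that] by simp
      also have "\<dots> = (\<integral>s. indicator {0<..t} s * h s \<partial>lborel)"
        using that by (intro Bochner_Integration.integral_cong refl) (auto simp: h_def indicator_def)
      finally show ?thesis .
    qed
    have "continuous_on {0..T} (?J (Suc k))"
      using continuous_on_indefinite_integral[OF h, of "{0..T}" 0] by (subst continuous_on_cong[OF refl Jh]) auto
    then show ?case using st by auto
  qed
  show ?thesis
  proof (cases k)
    case 0
    then show ?thesis using main[of 0] t by (simp add: time_simplex_def open_time_simplex_def)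
  next
    case (Suc m)
    then show ?thesis using step[of m t] main[of m] t by auto
  qed
qed

section \<open>Convergence of integrals of products over a pairing\<close>

lemma tendsto_zero_mult_power:
  fixes c :: "nat \<Rightarrow> ennreal"
  assumes c: "c \<longlonglongrightarrow> 0" and N: "N < \<infinity>"
  shows "(\<lambda>n. of_nat p * (c n * (c n + 2 * N) ^ q)) \<longlonglongrightarrow> 0"
proof -
  have fin: "of_nat p * (1 + 2 * N) ^ q < \<infinity>"
    using N by (auto simp: ennreal_mult_less_top power_less_top_ennreal of_nat_less_top)
  have lim: "(\<lambda>n. (of_nat p * (1 + 2 * N) ^ q) * c n) \<longlonglongrightarrow> (of_nat p * (1 + 2 * N) ^ q) * 0"
    using fin c by (intro ennreal_tendsto_cmult) auto
  have "eventually (\<lambda>n. c n < 1) sequentially" using order_tendstoD(2)[OF c, of 1] by simp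
  then have "eventually (\<lambda>n. of_nat p * (c n * (c n + 2 * N) ^ q) \<le> (of_nat p * (1 + 2 * N) ^ q) * c n) sequentially"
  proof eventually_elim
    case (elim n)
    have "c n * (c n + 2 * N) ^ q \<le> c n * (1 + 2 * N) ^ q"
      using elim by (intro mult_left_mono power_mono add_right_mono) auto
    then show ?case by (simp add: mult_left_mono mult.assoc mult.commute[of "c n"])
  qed
  from tendsto_sandwich[OF _ this tendsto_const] lim show ?thesis by simp
qed

text \<open>The indicator is at most 1. After the factors have been exchanged one at a time, each term factorises over
  the pairs: one factor is the \<open>L\<^sup>1\<close> error and the others stay bounded.\<close>
lemma tendsto_integral_prod_pairing:
  fixes f :: "real \<Rightarrow> real \<Rightarrow> real" and A :: "nat set"
  assumes A: "finite A" and \<pi>: "\<pi> \<in> pairings_on A"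
    and S: "Measurable.pred (Pi\<^sub>M A (\<lambda>_. lborel)) (\<lambda>u. u \<in> S)"
    and f[measurable]: "case_prod f \<in> borel_measurable (borel \<Otimes>\<^sub>M borel)"
    and g[measurable]: "\<And>n::nat. case_prod (g n) \<in> borel_measurable (borel \<Otimes>\<^sub>M borel)"
    and fin: "(\<integral>\<^sup>+x. \<integral>\<^sup>+y. ennreal \<bar>f x y\<bar> \<partial>lborel \<partial>lborel) < \<infinity>"
    and lim: "(\<lambda>n. \<integral>\<^sup>+x. \<integral>\<^sup>+y. ennreal \<bar>g n x y - f x y\<bar> \<partial>lborel \<partial>lborel) \<longlonglongrightarrow> 0"
  shows "integrable (Pi\<^sub>M A (\<lambda>_. lborel)) (\<lambda>u. indicator S u * (\<Prod>(l, j)\<in>\<pi>. f (u l) (u j)))"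
    and "(\<lambda>n. \<integral>u. indicator S u * (\<Prod>(l, j)\<in>\<pi>. g n (u l) (u j)) \<partial>Pi\<^sub>M A (\<lambda>_. lborel)) \<longlonglongrightarrow>
      (\<integral>u. indicator S u * (\<Prod>(l, j)\<in>\<pi>. f (u l) (u j)) \<partial>Pi\<^sub>M A (\<lambda>_. lborel))"
proof -
  let ?M = "Pi\<^sub>M A (\<lambda>_. lborel :: real measure)"
  define N where "N = (\<integral>\<^sup>+x. \<integral>\<^sup>+y. ennreal \<bar>f x y\<bar> \<partial>lborel \<partial>lborel)"
  define c where "c = (\<lambda>n. \<integral>\<^sup>+x. \<integral>\<^sup>+y. ennreal \<bar>g n x y - f x y\<bar> \<partial>lborel \<partial>lborel)"
  have fin\<pi>: "finite \<pi>" using \<pi> A finite_subset[of \<pi> "A \<times> A"] by (auto simp: pairings_on_def)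
  have comp: "(\<lambda>u. h (u (fst p)) (u (snd p))) \<in> borel_measurable ?M"
    if "p \<in> \<pi>" "case_prod h \<in> borel_measurable (borel \<Otimes>\<^sub>M borel)" for p and h :: "real \<Rightarrow> real \<Rightarrow> real"
  proof -
    have "(\<lambda>u. (u (fst p), u (snd p))) \<in> ?M \<rightarrow>\<^sub>M borel \<Otimes>\<^sub>M borel"
      using pairings_onD[OF \<pi> that(1)] by (intro measurable_Pair PiM_component_measurable)
    from measurable_compose[OF this that(2)] show ?thesis by simp
  qed
  define F where "F = (\<lambda>h u. indicator S u * (\<Prod>p\<in>\<pi>. h (u (fst p)) (u (snd p)) :: real))"
  have Fm: "F h \<in> borel_measurable ?M" if "case_prod h \<in> borel_measurable (borel \<Otimes>\<^sub>M borel)" for h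
    unfolding F_def using S comp[OF _ that] by (intro borel_measurable_times borel_measurable_prod) auto
  have Fint: "integrable ?M (F f)"
  proof (rule integrableI_bounded[OF Fm[OF f]])
    have "(\<integral>\<^sup>+u. ennreal (norm (F f u)) \<partial>?M) \<le> (\<integral>\<^sup>+u. (\<Prod>p\<in>\<pi>. ennreal \<bar>f (u (fst p)) (u (snd p))\<bar>) \<partial>?M)"
      by (intro nn_integral_mono) (auto simp: F_def indicator_def abs_prod prod_ennreal)
    also have "\<dots> = (\<Prod>p\<in>\<pi>. N)"
      unfolding N_def by (rule nn_integral_prod_pairing[OF A \<pi>, of "\<lambda>_ x y. ennreal \<bar>f x y\<bar>"]) measurable
    also have "\<dots> < \<infinity>" using fin by (simp add: N_def power_less_top_ennreal)
    finally show "(\<integral>\<^sup>+u. ennreal (norm (F f u)) \<partial>?M) < \<infinity>" .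
  qed
  have split: "F h = (\<lambda>u. indicator S u * (\<Prod>(l, j)\<in>\<pi>. h (u l) (u j)))" for h by (simp add: F_def split_beta)
  show "integrable ?M (\<lambda>u. indicator S u * (\<Prod>(l, j)\<in>\<pi>. f (u l) (u j)))" using Fint unfolding split .
  (* c n + 2 N bounds the L1 norm of |f| + |g n| *)
  have bound: "ennreal \<bar>(\<integral>u. F f u \<partial>?M) - (\<integral>u. F (g n) u \<partial>?M)\<bar> \<le> of_nat (card \<pi>) * (c n * (c n + 2 * N) ^ (card \<pi> - 1))" for n
  proof -
    let ?h = "\<lambda>p q x y. if q = p then ennreal \<bar>g n x y - f x y\<bar> else ennreal (\<bar>f x y\<bar> + \<bar>g n x y\<bar>)"
    have "ennreal \<bar>(\<integral>u. F f u \<partial>?M) - (\<integral>u. F (g n) u \<partial>?M)\<bar> \<le> (\<integral>\<^sup>+u. ennreal \<bar>F f u - F (g n) u\<bar> \<partial>?M)"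
      by (rule nn_integral_abs_diff_integral_le[OF Fint Fm[OF g]])
    also have "\<dots> \<le> (\<integral>\<^sup>+u. (\<Sum>p\<in>\<pi>. \<Prod>q\<in>\<pi>. ?h p q (u (fst q)) (u (snd q))) \<partial>?M)"
    proof (intro nn_integral_mono)
      fix u :: "nat \<Rightarrow> real"
      let ?f = "\<lambda>p. f (u (fst p)) (u (snd p))" and ?g = "\<lambda>p. g n (u (fst p)) (u (snd p))"
      have "\<bar>F f u - F (g n) u\<bar> \<le> \<bar>(\<Prod>p\<in>\<pi>. ?f p) - (\<Prod>p\<in>\<pi>. ?g p)\<bar>" by (simp add: F_def indicator_def)
      also have "\<dots> \<le> (\<Sum>p\<in>\<pi>. \<bar>?f p - ?g p\<bar> * (\<Prod>q\<in>\<pi> - {p}. \<bar>?f q\<bar> + \<bar>?g q\<bar>))" by (rule abs_prod_diff_le[OF fin\<pi>])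
      finally have "ennreal \<bar>F f u - F (g n) u\<bar> \<le> ennreal (\<Sum>p\<in>\<pi>. \<bar>?f p - ?g p\<bar> * (\<Prod>q\<in>\<pi> - {p}. \<bar>?f q\<bar> + \<bar>?g q\<bar>))"
        by (rule ennreal_leI)
      also have "\<dots> = (\<Sum>p\<in>\<pi>. ennreal (\<bar>?f p - ?g p\<bar> * (\<Prod>q\<in>\<pi> - {p}. \<bar>?f q\<bar> + \<bar>?g q\<bar>)))"
        by (intro sum_ennreal[symmetric] mult_nonneg_nonneg prod_nonneg) auto
      also have "\<dots> = (\<Sum>p\<in>\<pi>. \<Prod>q\<in>\<pi>. ?h p q (u (fst q)) (u (snd q)))"
      proof (rule sum.cong[OF refl])
        fix p assume p: "p \<in> \<pi>"
        have "(\<Prod>q\<in>\<pi>. ?h p q (u (fst q)) (u (snd q))) = ennreal \<bar>?g p - ?f p\<bar> * (\<Prod>q\<in>\<pi> - {p}. ennreal (\<bar>?f q\<bar> + \<bar>?g q\<bar>))"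
          by (subst prod.remove[OF fin\<pi> p]) (auto intro!: arg_cong2[where f="(*)"] prod.cong)
        also have "\<dots> = ennreal (\<bar>?f p - ?g p\<bar> * (\<Prod>q\<in>\<pi> - {p}. \<bar>?f q\<bar> + \<bar>?g q\<bar>))"
          by (subst prod_ennreal) (auto simp: ennreal_mult prod_nonneg abs_minus_commute simp del: ennreal_plus)
        finally show "ennreal (\<bar>?f p - ?g p\<bar> * (\<Prod>q\<in>\<pi> - {p}. \<bar>?f q\<bar> + \<bar>?g q\<bar>)) = (\<Prod>q\<in>\<pi>. ?h p q (u (fst q)) (u (snd q)))" ..
      qed
      finally show "ennreal \<bar>F f u - F (g n) u\<bar> \<le> (\<Sum>p\<in>\<pi>. \<Prod>q\<in>\<pi>. ?h p q (u (fst q)) (u (snd q)))" .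
    qed
    also have "\<dots> = (\<Sum>p\<in>\<pi>. \<integral>\<^sup>+u. (\<Prod>q\<in>\<pi>. ?h p q (u (fst q)) (u (snd q))) \<partial>?M)"
    proof (rule nn_integral_sum, rule borel_measurable_prod_ennreal)
      fix p q assume "q \<in> \<pi>"
      show "(\<lambda>u. ?h p q (u (fst q)) (u (snd q))) \<in> borel_measurable ?M"
        using comp[OF \<open>q \<in> \<pi>\<close> f] comp[OF \<open>q \<in> \<pi>\<close> g[of n]] by (cases "q = p") (simp_all del: ennreal_plus)
    qed
    also have "\<dots> = (\<Sum>p\<in>\<pi>. \<Prod>q\<in>\<pi>. \<integral>\<^sup>+x. \<integral>\<^sup>+y. ?h p q x y \<partial>lborel \<partial>lborel)"
    proof (rule sum.cong[OF refl], rule nn_integral_prod_pairing[OF A \<pi>])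
      show "(\<lambda>(x, y). ?h p q x y) \<in> borel_measurable (borel \<Otimes>\<^sub>M borel)" for p q :: "nat \<times> nat"
        by (cases "q = p") (simp_all del: ennreal_plus)
    qed
    also have "\<dots> \<le> (\<Sum>p\<in>\<pi>. c n * (c n + 2 * N) ^ (card \<pi> - 1))"
    proof (rule sum_mono)
      fix p assume p: "p \<in> \<pi>"
      have le: "(\<integral>\<^sup>+x. \<integral>\<^sup>+y. ennreal (\<bar>f x y\<bar> + \<bar>g n x y\<bar>) \<partial>lborel \<partial>lborel) \<le> c n + 2 * N"
      proof -
        have "(\<integral>\<^sup>+x. \<integral>\<^sup>+y. ennreal (\<bar>f x y\<bar> + \<bar>g n x y\<bar>) \<partial>lborel \<partial>lborel) \<le>
          (\<integral>\<^sup>+x. \<integral>\<^sup>+y. ennreal \<bar>g n x y - f x y\<bar> + 2 * ennreal \<bar>f x y\<bar> \<partial>lborel \<partial>lborel)"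
        proof (intro nn_integral_mono)
          fix x y
          have "ennreal (\<bar>f x y\<bar> + \<bar>g n x y\<bar>) \<le> ennreal (\<bar>g n x y - f x y\<bar> + 2 * \<bar>f x y\<bar>)"
            by (rule ennreal_leI) linarith
          also have "\<dots> = ennreal \<bar>g n x y - f x y\<bar> + 2 * ennreal \<bar>f x y\<bar>"
            by (simp add: ennreal_mult)
          finally show "ennreal (\<bar>f x y\<bar> + \<bar>g n x y\<bar>) \<le> ennreal \<bar>g n x y - f x y\<bar> + 2 * ennreal \<bar>f x y\<bar>" .
        qed
        also have "\<dots> = c n + 2 * N"
          by (simp add: nn_integral_add nn_integral_cmult c_def N_def)
        finally show ?thesis .
      qed
      have "(\<Prod>q\<in>\<pi>. \<integral>\<^sup>+x. \<integral>\<^sup>+y. ?h p q x y \<partial>lborel \<partial>lborel) =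
        c n * (\<Prod>q\<in>\<pi> - {p}. \<integral>\<^sup>+x. \<integral>\<^sup>+y. ennreal (\<bar>f x y\<bar> + \<bar>g n x y\<bar>) \<partial>lborel \<partial>lborel)"
        unfolding c_def by (subst prod.remove[OF fin\<pi> p]) (auto intro!: arg_cong2[where f="(*)"] prod.cong)
      also have "\<dots> \<le> c n * (\<Prod>q\<in>\<pi> - {p}. c n + 2 * N)"
        by (simp only: prod_constant) (intro mult_left_mono power_mono le zero_le)
      also have "\<dots> = c n * (c n + 2 * N) ^ (card \<pi> - 1)" using fin\<pi> p by simp
      finally show "(\<Prod>q\<in>\<pi>. \<integral>\<^sup>+x. \<integral>\<^sup>+y. ?h p q x y \<partial>lborel \<partial>lborel) \<le> c n * (c n + 2 * N) ^ (card \<pi> - 1)" .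
    qed
    also have "\<dots> = of_nat (card \<pi>) * (c n * (c n + 2 * N) ^ (card \<pi> - 1))" by simp
    finally show ?thesis .
  qed
  then have upper: "\<forall>n. ennreal \<bar>(\<integral>u. F f u \<partial>?M) - (\<integral>u. F (g n) u \<partial>?M)\<bar> \<le> of_nat (card \<pi>) * (c n * (c n + 2 * N) ^ (card \<pi> - 1))"
    by blast
  have lower: "\<forall>n. 0 \<le> ennreal \<bar>(\<integral>u. F f u \<partial>?M) - (\<integral>u. F (g n) u \<partial>?M)\<bar>" by simp
  have null: "(\<lambda>n. of_nat (card \<pi>) * (c n * (c n + 2 * N) ^ (card \<pi> - 1))) \<longlonglongrightarrow> 0"
    using lim fin unfolding c_def N_def by (intro tendsto_zero_mult_power)
  have "(\<lambda>n. ennreal \<bar>(\<integral>u. F f u \<partial>?M) - (\<integral>u. F (g n) u \<partial>?M)\<bar>) \<longlonglongrightarrow> 0"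
    by (rule tendsto_sandwich[OF always_eventually[OF lower] always_eventually[OF upper] tendsto_const null])
  then have "(\<lambda>n. ennreal \<bar>(\<integral>u. F f u \<partial>?M) - (\<integral>u. F (g n) u \<partial>?M)\<bar>) \<longlonglongrightarrow> ennreal 0" by simp
  then have "(\<lambda>n. \<bar>(\<integral>u. F f u \<partial>?M) - (\<integral>u. F (g n) u \<partial>?M)\<bar>) \<longlonglongrightarrow> 0"
    by (rule tendsto_ennrealD) auto
  then have "(\<lambda>n. (\<integral>u. F f u \<partial>?M) - (\<integral>u. F (g n) u \<partial>?M)) \<longlonglongrightarrow> 0" by (rule tendsto_rabs_zero_cancel)
  then have "(\<lambda>n. (\<integral>u. F f u \<partial>?M) - ((\<integral>u. F f u \<partial>?M) - (\<integral>u. F (g n) u \<partial>?M))) \<longlonglongrightarrow> (\<integral>u. F f u \<partial>?M) - 0"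
    by (intro tendsto_diff tendsto_const)
  then show "(\<lambda>n. \<integral>u. indicator S u * (\<Prod>(l, j)\<in>\<pi>. g n (u l) (u j)) \<partial>?M) \<longlonglongrightarrow>
      (\<integral>u. indicator S u * (\<Prod>(l, j)\<in>\<pi>. f (u l) (u j)) \<partial>?M)"
    unfolding split by simp
qed

section \<open>The law of the interpolated process\<close>

text \<open>The scalar process \<open>V\<close> with kernel \<open>K\<close> is driven by \<open>B\<close> on \<open>P\<close>; the process \<open>W\<close> on \<open>M\<close> is known only
  through the independence and the law of its coordinates.\<close>
locale kernel_gaussian_process =
  fixes T :: real and K :: "real \<Rightarrow> real \<Rightarrow> real"
    and P :: "'b measure" and B V :: "real \<Rightarrow> 'b \<Rightarrow> real"
    and M :: "'a measure" and W :: "real \<Rightarrow> 'a \<Rightarrow> real ^ 'd::finite"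
  assumes T: "T > 0" and K: "strictly_regular_kernel T K"
    and V: "kernel_process P T K B V" and W: "iid_copies M T W P V"
begin

sublocale M: prob_space M using W by (simp add: iid_copies_def)

lemma brownian: "brownian_motion P T B" using V by (simp add: kernel_process_def)

sublocale P: prob_space P using brownian by (simp add: brownian_motion_def)

definition k :: "real \<Rightarrow> real \<Rightarrow> real" where "k = triangle_deriv T K"

sublocale integrated_kernel T k
proof
  show "T > 0" by (rule T)
  show "case_prod k \<in> borel_measurable (borel \<Otimes>\<^sub>M borel)" unfolding k_def by (rule triangle_deriv_measurable[OF K])
  show "k u r = 0" if "u \<notin> {0<..T} \<or> r \<notin> {0..<T}" for u r using that by (auto simp: k_def triangle_deriv_def)
  show "(\<integral>\<^sup>+r. (\<integral>\<^sup>+u. ennreal \<bar>k u r\<bar> \<partial>lborel)\<^sup>2 \<partial>lborel) < \<infinity>" unfolding k_def by (rule triangle_deriv_L2[OF K])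
  show "integrable lborel (\<lambda>u. k u r)" for r
  proof (cases "0 \<le> r \<and> r < T")
    case True then show ?thesis unfolding k_def by (intro triangle_deriv_FTC(2)[OF K]) auto
  next
    case False
    then have "k u r = 0" for u by (auto simp: k_def triangle_deriv_def)
    then show ?thesis by simp
  qed
qed

text \<open>The primitive of the derivative: it equals \<open>K\<close> on the triangle and 0 elsewhere, so it is the integrand
  of the Wiener integral \<open>V t\<close> over all of \<open>[0, T]\<close>.\<close>
definition extended_kernel :: "real \<Rightarrow> real \<Rightarrow> real" where
  "extended_kernel t r = (\<integral>u. indicator {0<..t} u * k u r \<partial>lborel)"

lemma extended_kernel_eq: "t \<in> {0..T} \<Longrightarrow> extended_kernel t r = indicator {0..<t} r * K t r"
proof (cases "0 \<le> r \<and> r < T")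
  case True
  assume "t \<in> {0..T}"
  then show ?thesis using triangle_deriv_FTC(3)[OF K, of r t] True by (auto simp: extended_kernel_def k_def indicator_def)
next
  case False
  assume t: "t \<in> {0..T}"
  have "k u r = 0" for u using False by (auto simp: k_def triangle_deriv_def)
  then show ?thesis using False t by (auto simp: extended_kernel_def indicator_def)
qed

lemma wiener_integral_V: "t \<in> {0..T} \<Longrightarrow> wiener_integral P T B (extended_kernel t) (V t)"
proof -
  assume t: "t \<in> {0..T}"
  then have "has_ito_integral P B t (K t) (V t)" using V by (simp add: kernel_process_def)
  then have "wiener_integral P T B (\<lambda>r. indicator {0..<t} r * K t r) (V t)"
    using t by (intro has_ito_integral_wiener_integral) auto
  moreover have "extended_kernel t = (\<lambda>r. indicator {0..<t} r * K t r)" using extended_kernel_eq[OF t] by auto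
  ultimately show ?thesis by simp
qed

lemma B_measurable: "s \<in> {0..T} \<Longrightarrow> B s \<in> borel_measurable P"
  using brownian by (simp add: brownian_motion_def)

lemma grid_in_interval: "n > 0 \<Longrightarrow> l \<le> n \<Longrightarrow> grid T n l \<in> {0..T}"
  using grid_mono[OF T, of 0 l n] grid_mono[OF T, of l n n] by auto

lemma slope_extended_kernel: "n > 0 \<Longrightarrow> slope T n (\<lambda>t. extended_kernel t r) u = avg_kernel n u r"
proof -
  assume n: "n > 0"
  have "(\<integral>v. indicator (cell T n l) v * k v r \<partial>lborel) = extended_kernel (grid T n (Suc l)) r - extended_kernel (grid T n l) r" for l
  proof -
    have g: "0 \<le> grid T n l" "grid T n l \<le> grid T n (Suc l)" using grid_mono[OF T, of 0 l n] grid_mono[OF T, of l "Suc l" n] by auto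
    have int: "integrable lborel (\<lambda>v. indicator {0<..t} v * k v r)" for t
      using integrable_mult_indicator[OF _ k_integrable[of r], of "{0<..t}"] by simp
    have "extended_kernel (grid T n (Suc l)) r - extended_kernel (grid T n l) r =
      (\<integral>v. indicator {0<..grid T n (Suc l)} v * k v r - indicator {0<..grid T n l} v * k v r \<partial>lborel)"
      unfolding extended_kernel_def by (rule Bochner_Integration.integral_diff[symmetric, OF int int])
    also have "\<dots> = (\<integral>v. indicator (cell T n l) v * k v r \<partial>lborel)"
      using g by (intro Bochner_Integration.integral_cong refl) (auto simp: indicator_def cell_def)
    finally show ?thesis ..
  qed
  then show ?thesis by (simp add: slope_def avg_kernel_def cell_average_def)
qed

lemma V_measurable: "t \<in> {0..T} \<Longrightarrow> V t \<in> borel_measurable P"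
  using wiener_integral_V by (auto simp: wiener_integral_def)

abbreviation "path_space \<equiv> Pi\<^sub>M {0..T} (\<lambda>_. borel :: real measure)"

text \<open>Functionals of a path on \<open>[0, T]\<close> that are measurable and commute with the Wiener integral: applied to
  the paths of \<open>V\<close> they yield the Wiener integral of what they yield on \<open>K(\<cdot>,r)\<close>. The class contains the
  evaluations and is closed under linear combinations. The invariance under restriction makes these
  functionals accessible to the laws on path space, through which alone \<open>W\<close> is known.\<close>
definition path_linear :: "((real \<Rightarrow> real) \<Rightarrow> real) \<Rightarrow> bool" where
  "path_linear L \<longleftrightarrow> (\<forall>x. L (\<lambda>t\<in>{0..T}. x t) = L x) \<and> L \<in> borel_measurable path_space \<and>
    wiener_integral P T B (\<lambda>r. L (\<lambda>t. extended_kernel t r)) (\<lambda>\<omega>. L (\<lambda>t. V t \<omega>))"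

lemma path_linear_eval: "t \<in> {0..T} \<Longrightarrow> path_linear (\<lambda>x. x t)"
  unfolding path_linear_def using wiener_integral_V[of t] measurable_component_singleton[of t "{0..T}" "\<lambda>_. borel"] by simp

lemma path_linear_combination:
  "path_linear L \<Longrightarrow> path_linear L' \<Longrightarrow> path_linear (\<lambda>x. a * L x + b * L' x)"
  unfolding path_linear_def by (auto intro!: wiener_integral_combination B_measurable)

lemma path_linear_sum:
  assumes "finite J" "\<And>j. j \<in> J \<Longrightarrow> path_linear (L j)"
  shows "path_linear (\<lambda>x. \<Sum>j\<in>J. a j * L j x)"
  using assms unfolding path_linear_def by (auto intro!: wiener_integral_sum B_measurable borel_measurable_sum borel_measurable_times)

lemma path_linear_slope:
  assumes n: "n > 0"
  shows "path_linear (\<lambda>x. slope T n x u)"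
proof -
  have "path_linear (\<lambda>x. \<Sum>l<n. (indicator (cell T n l) u * (real n / T)) * (1 * x (grid T n (Suc l)) + (-1) * x (grid T n l)))"
    using grid_in_interval[OF n] by (intro path_linear_sum path_linear_combination path_linear_eval) auto
  moreover have "(\<lambda>x. \<Sum>l<n. (indicator (cell T n l) u * (real n / T)) * (1 * x (grid T n (Suc l)) + (-1) * x (grid T n l))) = (\<lambda>x. slope T n x u)"
    unfolding slope_def by (intro ext sum.cong refl) (simp add: algebra_simps)
  ultimately show ?thesis by simp
qed

lemma W_path_measurable: "(\<lambda>\<omega>. \<lambda>t\<in>{0..T}. W t \<omega> $ c) \<in> M \<rightarrow>\<^sub>M path_space"
  using W by (auto simp: iid_copies_def M.indep_vars_def)

lemma path_linear_W_measurable: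
  assumes L: "path_linear L"
  shows "(\<lambda>\<omega>. L (\<lambda>t. W t \<omega> $ c)) \<in> borel_measurable M"
  using measurable_compose[OF W_path_measurable, of L borel c] L by (simp add: path_linear_def)

text \<open>A coordinate of \<open>W\<close> has the law of \<open>V\<close> on path space, so the variable has the law of a Wiener integral.\<close>
lemma gaussian_path_linear_W:
  assumes L: "path_linear L"
  shows "gaussian_rv M (\<lambda>\<omega>. L (\<lambda>t. W t \<omega> $ c)) (\<integral>r. (L (\<lambda>t. extended_kernel t r))\<^sup>2 \<partial>lborel)"
proof -
  have Lm: "L \<in> borel_measurable path_space" and restr: "\<And>x. L (\<lambda>t\<in>{0..T}. x t) = L x"
    using L by (auto simp: path_linear_def)
  have Vm: "(\<lambda>\<omega>. \<lambda>t\<in>{0..T}. V t \<omega>) \<in> P \<rightarrow>\<^sub>M path_space"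
    using V_measurable by (intro measurable_restrict) auto
  have "distr M borel (\<lambda>\<omega>. L (\<lambda>t. W t \<omega> $ c)) = distr (distr M path_space (\<lambda>\<omega>. \<lambda>t\<in>{0..T}. W t \<omega> $ c)) borel L"
    by (subst distr_distr[OF Lm W_path_measurable]) (simp add: comp_def restr)
  also have "\<dots> = distr (distr P path_space (\<lambda>\<omega>. \<lambda>t\<in>{0..T}. V t \<omega>)) borel L"
    using W by (simp add: iid_copies_def)
  also have "\<dots> = distr P borel (\<lambda>\<omega>. L (\<lambda>t. V t \<omega>))"
    by (subst distr_distr[OF Lm Vm]) (simp add: comp_def restr)
  finally have eq: "distr M borel (\<lambda>\<omega>. L (\<lambda>t. W t \<omega> $ c)) = distr P borel (\<lambda>\<omega>. L (\<lambda>t. V t \<omega>))" .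
  have "gaussian_rv P (\<lambda>\<omega>. L (\<lambda>t. V t \<omega>)) (\<integral>r. (L (\<lambda>t. extended_kernel t r))\<^sup>2 \<partial>lborel)"
    using L unfolding path_linear_def by (intro wiener_integral_gaussian(2)[OF brownian T]) auto
  then show ?thesis using path_linear_W_measurable[OF L] unfolding gaussian_rv_def eq by auto
qed

text \<open>A combination of slopes is grouped by coordinates. The groups are independent and each has the law of a
  Wiener integral, so their variances add up and no covariances between different coordinates occur.\<close>
lemma gaussian_family_slopes:
  fixes i :: "nat \<Rightarrow> 'd" and u :: "nat \<Rightarrow> real"
  assumes n: "n > 0" and J: "finite J"
  shows "gaussian_family M J (\<lambda>j \<omega>. slope T n (\<lambda>t. W t \<omega> $ i j) (u j))
    (\<lambda>l j. if i l = i j then cov_kernel (avg_kernel n) (u l) (u j) else 0)"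
  unfolding gaussian_family_def
proof (intro conjI allI)
  show "finite J" by fact
  show "(if i l = i j then cov_kernel (avg_kernel n) (u l) (u j) else 0) = (if i j = i l then cov_kernel (avg_kernel n) (u j) (u l) else 0)" for l j
    by (simp add: cov_kernel_def mult.commute)
  fix a :: "nat \<Rightarrow> real"
  (* the indices that refer to the coordinate c *)
  define J' where "J' = (\<lambda>c. {j\<in>J. i j = c})"
  define L where "L = (\<lambda>c x. \<Sum>j\<in>J' c. a j * slope T n x (u j))"
  define Y where "Y = (\<lambda>c \<omega>. L c (\<lambda>t. W t \<omega> $ c))"
  have fJ': "finite (J' c)" for c using J by (simp add: J'_def)
  have lin: "path_linear (L c)" for c
    unfolding L_def by (intro path_linear_sum path_linear_slope n fJ')
  have sum: "(\<Sum>j\<in>J. a j * slope T n (\<lambda>t. W t \<omega> $ i j) (u j)) = (\<Sum>c\<in>UNIV. Y c \<omega>)" for \<omega>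
  proof -
    have "(\<Sum>c\<in>UNIV. Y c \<omega>) = (\<Sum>c\<in>UNIV. \<Sum>j\<in>J' c. a j * slope T n (\<lambda>t. W t \<omega> $ i j) (u j))"
      unfolding Y_def L_def by (intro sum.cong refl) (auto simp: J'_def)
    also have "\<dots> = (\<Sum>j\<in>J. a j * slope T n (\<lambda>t. W t \<omega> $ i j) (u j))"
      unfolding J'_def using J by (intro sum.group) auto
    finally show ?thesis ..
  qed
  have G: "gaussian_rv M (Y c) (\<integral>r. (\<Sum>j\<in>J' c. a j * avg_kernel n (u j) r)\<^sup>2 \<partial>lborel)" for c
    unfolding Y_def using gaussian_path_linear_W[OF lin[of c], of c] by (simp add: L_def slope_extended_kernel[OF n])
  have [measurable]: "Y c \<in> borel_measurable M" for c using G[of c] by (simp add: gaussian_rv_def)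
  have "M.indep_vars (\<lambda>_. path_space) (\<lambda>c \<omega>. \<lambda>t\<in>{0..T}. W t \<omega> $ c) UNIV"
    using W by (simp add: iid_copies_def)
  then have "M.indep_vars (\<lambda>_. borel) (\<lambda>c \<omega>. L c (\<lambda>t\<in>{0..T}. W t \<omega> $ c)) UNIV"
    by (rule M.indep_vars_compose2) (use lin in \<open>simp add: path_linear_def\<close>)
  moreover have "L c (\<lambda>t\<in>{0..T}. x t) = L c x" for c x using lin[of c] by (simp add: path_linear_def)
  ultimately have indep: "M.indep_vars (\<lambda>_. borel) Y UNIV" by (simp add: Y_def)
  define v where "v = (\<Sum>c\<in>UNIV. \<integral>r. (\<Sum>j\<in>J' c. a j * avg_kernel n (u j) r)\<^sup>2 \<partial>lborel)"
  have "char (distr M borel (\<lambda>\<omega>. \<Sum>c\<in>UNIV. Y c \<omega>)) t = complex_of_real (exp (- (v * t\<^sup>2 / 2)))" for t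
  proof -
    have "char (distr M borel (\<lambda>\<omega>. \<Sum>c\<in>UNIV. Y c \<omega>)) t = (\<Prod>c\<in>UNIV. char (distr M borel (Y c)) t)"
      by (rule M.char_distr_sum[OF indep])
    also have "\<dots> = complex_of_real (\<Prod>c\<in>UNIV. exp (- ((\<integral>r. (\<Sum>j\<in>J' c. a j * avg_kernel n (u j) r)\<^sup>2 \<partial>lborel) * t\<^sup>2 / 2)))"
      using G by (simp add: gaussian_rv_def)
    also have "(\<Prod>c\<in>UNIV. exp (- ((\<integral>r. (\<Sum>j\<in>J' c. a j * avg_kernel n (u j) r)\<^sup>2 \<partial>lborel) * t\<^sup>2 / 2))) = exp (- (v * t\<^sup>2 / 2))"
      by (simp add: exp_sum[symmetric] v_def sum_negf sum_divide_distrib[symmetric] sum_distrib_right[symmetric])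
    finally show ?thesis .
  qed
  moreover have "0 \<le> v" unfolding v_def by (intro sum_nonneg) auto
  ultimately have Gv: "gaussian_rv M (\<lambda>\<omega>. \<Sum>c\<in>UNIV. Y c \<omega>) v" by (simp add: gaussian_rv_def)
  have int: "integrable lborel (\<lambda>r. avg_kernel n (u l) r * avg_kernel n (u j) r)" for l j
    by (rule avg_kernel_product_integrable[OF n])
  have "v = (\<Sum>l\<in>J. \<Sum>j\<in>J. a l * a j * (if i l = i j then cov_kernel (avg_kernel n) (u l) (u j) else 0))"
  proof -
    have "(\<integral>r. (\<Sum>j\<in>J' c. a j * avg_kernel n (u j) r)\<^sup>2 \<partial>lborel) =
      (\<Sum>l\<in>J' c. \<Sum>j\<in>J. a l * a j * (if i l = i j then cov_kernel (avg_kernel n) (u l) (u j) else 0))" for c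
    proof -
      have "(\<integral>r. (\<Sum>j\<in>J' c. a j * avg_kernel n (u j) r)\<^sup>2 \<partial>lborel) =
        (\<integral>r. (\<Sum>l\<in>J' c. \<Sum>j\<in>J' c. (a l * a j) * (avg_kernel n (u l) r * avg_kernel n (u j) r)) \<partial>lborel)"
        by (simp add: power2_eq_square sum_product mult_ac)
      also have "\<dots> = (\<Sum>l\<in>J' c. \<Sum>j\<in>J' c. a l * a j * cov_kernel (avg_kernel n) (u l) (u j))"
        using int by (subst Bochner_Integration.integral_sum, simp)+ (simp add: cov_kernel_def)
      also have "\<dots> = (\<Sum>l\<in>J' c. \<Sum>j\<in>J. a l * a j * (if i l = i j then cov_kernel (avg_kernel n) (u l) (u j) else 0))"
        using J by (intro sum.cong refl sum.mono_neutral_cong_left) (auto simp: J'_def)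
      finally show ?thesis .
    qed
    then show ?thesis unfolding v_def J'_def using J by (simp only:) (intro sum.group, auto)
  qed
  with Gv show "gaussian_rv M (\<lambda>\<omega>. \<Sum>j\<in>J. a j * slope T n (\<lambda>t. W t \<omega> $ i j) (u j))
    (\<Sum>l\<in>J. \<Sum>j\<in>J. a l * a j * (if i l = i j then cov_kernel (avg_kernel n) (u l) (u j) else 0))"
    unfolding sum by simp
qed

text \<open>Wick's formula; pairings that join different coordinates contribute a factor 0.\<close>
lemma expectation_slopes:
  assumes n: "n > 0"
  shows "(\<integral>\<omega>. (\<Prod>j\<in>{1..m}. slope T n (\<lambda>t. W t \<omega> $ i j) (u j)) \<partial>M) =
    (\<Sum>\<pi>\<in>compatible_pairings m i. \<Prod>(l, j)\<in>\<pi>. cov_kernel (avg_kernel n) (u l) (u j))"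
proof -
  have fin: "finite (pairings m)" unfolding pairings_eq by (rule finite_pairings_on) simp
  have "(\<integral>\<omega>. (\<Prod>j\<in>{1..m}. slope T n (\<lambda>t. W t \<omega> $ i j) (u j)) \<partial>M) =
    (\<Sum>\<pi>\<in>pairings m. \<Prod>(l, j)\<in>\<pi>. if i l = i j then cov_kernel (avg_kernel n) (u l) (u j) else 0)"
    unfolding pairings_eq by (rule M.wick_formula[OF gaussian_family_slopes[OF n]]) simp
  also have "\<dots> = (\<Sum>\<pi>\<in>compatible_pairings m i. \<Prod>(l, j)\<in>\<pi>. cov_kernel (avg_kernel n) (u l) (u j))"
  proof (rule sum.mono_neutral_cong_right[OF fin])
    show "compatible_pairings m i \<subseteq> pairings m" by (auto simp: compatible_pairings_def)
    show "\<forall>\<pi>\<in>pairings m - compatible_pairings m i. (\<Prod>(l, j)\<in>\<pi>. if i l = i j then cov_kernel (avg_kernel n) (u l) (u j) else 0) = 0"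
    proof
      fix \<pi> assume \<pi>: "\<pi> \<in> pairings m - compatible_pairings m i"
      then obtain l j where lj: "(l, j) \<in> \<pi>" "i l \<noteq> i j" by (auto simp: compatible_pairings_def)
      moreover have "finite \<pi>" using \<pi> finite_subset[of \<pi> "{1..m} \<times> {1..m}"] by (auto simp: pairings_def)
      ultimately show "(\<Prod>(l, j)\<in>\<pi>. if i l = i j then cov_kernel (avg_kernel n) (u l) (u j) else 0) = 0"
        by (intro prod_zero bexI[of _ "(l, j)"]) auto
    qed
    show "(\<Prod>(l, j)\<in>\<pi>. if i l = i j then cov_kernel (avg_kernel n) (u l) (u j) else 0) =
      (\<Prod>(l, j)\<in>\<pi>. cov_kernel (avg_kernel n) (u l) (u j))" if "\<pi> \<in> compatible_pairings m i" for \<pi>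
      using that by (intro prod.cong refl) (auto simp: compatible_pairings_def)
  qed
  finally show ?thesis .
qed

end

section \<open>Expected signatures of the interpolations\<close>

context kernel_gaussian_process begin

lemma cov_kernel_avg_tendsto:
  assumes \<pi>: "\<pi> \<in> pairings_on {1..m}"
  shows "integrable (Pi\<^sub>M {1..m} (\<lambda>_. lborel)) (\<lambda>u. indicator (time_simplex m T) u * (\<Prod>(l, j)\<in>\<pi>. cov_kernel k (u l) (u j)))"
    and "(\<lambda>n. \<integral>u. indicator (time_simplex m T) u * (\<Prod>(l, j)\<in>\<pi>. cov_kernel (avg_kernel (Suc n)) (u l) (u j)) \<partial>Pi\<^sub>M {1..m} (\<lambda>_. lborel)) \<longlonglongrightarrow>
      (\<integral>u. indicator (time_simplex m T) u * (\<Prod>(l, j)\<in>\<pi>. cov_kernel k (u l) (u j)) \<partial>Pi\<^sub>M {1..m} (\<lambda>_. lborel))"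
proof -
  have "(\<integral>\<^sup>+u. \<integral>\<^sup>+v. ennreal \<bar>cov_kernel k u v\<bar> \<partial>lborel \<partial>lborel) \<le> (\<integral>\<^sup>+r. (k_norm r)\<^sup>2 \<partial>lborel)"
    by (rule nn_integral_cov_kernel_le[OF k_measurable]) (simp add: k_norm_def)
  also have "\<dots> < \<infinity>" using k_L2 by (simp add: k_norm_def)
  finally have fin: "(\<integral>\<^sup>+u. \<integral>\<^sup>+v. ennreal \<bar>cov_kernel k u v\<bar> \<partial>lborel \<partial>lborel) < \<infinity>" .
  note L = tendsto_integral_prod_pairing[OF _ \<pi> time_simplex_pred_measurable(1) cov_kernel_measurable[OF k_measurable]
      cov_kernel_measurable[OF avg_kernel_measurable] fin cov_kernel_L1]
  show "integrable (Pi\<^sub>M {1..m} (\<lambda>_. lborel)) (\<lambda>u. indicator (time_simplex m T) u * (\<Prod>(l, j)\<in>\<pi>. cov_kernel k (u l) (u j)))"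
    by (rule L(1)) simp
  show "(\<lambda>n. \<integral>u. indicator (time_simplex m T) u * (\<Prod>(l, j)\<in>\<pi>. cov_kernel (avg_kernel (Suc n)) (u l) (u j)) \<partial>Pi\<^sub>M {1..m} (\<lambda>_. lborel)) \<longlonglongrightarrow>
      (\<integral>u. indicator (time_simplex m T) u * (\<Prod>(l, j)\<in>\<pi>. cov_kernel k (u l) (u j)) \<partial>Pi\<^sub>M {1..m} (\<lambda>_. lborel))"
    by (rule L(2)) simp
qed

definition approx_signature :: "nat \<Rightarrow> nat \<Rightarrow> (nat \<Rightarrow> 'd) \<Rightarrow> 'a \<Rightarrow> real" where
  "approx_signature n m i \<omega> = path_signature (pl_interpolation (grid_list T n) (\<lambda>t. W t \<omega>)) 0 T (index_word m i)"

text \<open>A single random bound for the velocities at all times in all coordinates. The slope is constant on each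
  cell, which is represented by its right endpoint.\<close>
definition slope_bound :: "nat \<Rightarrow> 'a \<Rightarrow> real" where
  "slope_bound n \<omega> = (\<Sum>c\<in>UNIV. \<Sum>l<n. \<bar>slope T n (\<lambda>t. W t \<omega> $ c) (grid T n (Suc l))\<bar>)"

lemma slope_at_cell:
  assumes "l < n"
  shows "slope T n x (grid T n (Suc l)) = (x (grid T n (Suc l)) - x (grid T n l)) * (real n / T)"
proof -
  have "grid T n (Suc l) \<in> cell T n l" using grid_strict_mono[OF T, of n l "Suc l"] assms by (auto simp: cell_def)
  then have ind: "indicator (cell T n m) (grid T n (Suc l)) = (if m = l then 1 else 0 :: real)" for m
    using cell_disjoint[OF T] by (auto simp: indicator_def)
  have "slope T n x (grid T n (Suc l)) = (\<Sum>m<n. if m = l then (x (grid T n (Suc l)) - x (grid T n l)) * (real n / T) else 0)"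
    unfolding slope_def by (intro sum.cong refl) (simp add: ind)
  then show ?thesis using assms by simp
qed

lemma slope_le_bound: "\<bar>slope T n (\<lambda>t. W t \<omega> $ c) u\<bar> \<le> slope_bound n \<omega>"
proof -
  have "\<bar>slope T n (\<lambda>t. W t \<omega> $ c) u\<bar> \<le> (\<Sum>l<n. \<bar>slope T n (\<lambda>t. W t \<omega> $ c) (grid T n (Suc l))\<bar>)"
    using slope_le[OF T, of n "\<lambda>t. W t \<omega> $ c" u] by (simp add: slope_at_cell)
  also have "\<dots> \<le> slope_bound n \<omega>"
    unfolding slope_bound_def
    by (rule member_le_sum[of c UNIV "\<lambda>c. \<Sum>l<n. \<bar>slope T n (\<lambda>t. W t \<omega> $ c) (grid T n (Suc l))\<bar>"]) (auto intro: sum_nonneg)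
  finally show ?thesis .
qed

lemma approx_signature_eq:
  assumes n: "n > 0"
  shows "approx_signature n m i \<omega> =
    (\<integral>u. indicator (time_simplex m T) u * (\<Prod>j\<in>{1..m}. slope T n (\<lambda>t. W t \<omega> $ i j) (u j)) \<partial>Pi\<^sub>M {1..m} (\<lambda>_. lborel))"
proof -
  let ?\<gamma> = "pl_interpolation (grid_list T n) (\<lambda>t. W t \<omega>)"
  have "?\<gamma> 0 $ c = W 0 \<omega> $ c" for c
    using pl_interpolation_grid[OF T n, of 0 "\<lambda>t. W t \<omega>" c] by simp
  then have \<gamma>: "?\<gamma> t $ c - ?\<gamma> 0 $ c = (\<integral>u. indicator {0<..t} u * slope T n (\<lambda>t. W t \<omega> $ c) u \<partial>lborel)" if "0 \<le> t" for c t
    using pl_interpolation_grid[OF T n that, of "\<lambda>t. W t \<omega>" c] by simp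
  show ?thesis unfolding approx_signature_def path_signature_def
    by (rule iterated_integral_eq_simplex_integral[where \<phi>="\<lambda>c. slope T n (\<lambda>t. W t \<omega> $ c)", OF slope_measurable slope_le_bound slope_eq_0[OF T] \<gamma>])
      (use T in auto)
qed

text \<open>The power \<open>m\<close> of a sum of \<open>N\<close> terms is at most \<open>N\<^sup>m\<close> times that of the largest term, and Gaussian
  variables have moments of all orders.\<close>
lemma slope_bound_integrable: "integrable M (\<lambda>\<omega>. slope_bound n \<omega> ^ m)"
proof (cases "n = 0")
  case True
  then show ?thesis by (simp add: slope_bound_def)
next
  case False
  then have n: "n > 0" by simp
  define I where "I = (UNIV :: 'd set) \<times> {..<n}"
  define x where "x = (\<lambda>p \<omega>. slope T n (\<lambda>t. W t \<omega> $ fst p) (grid T n (Suc (snd p))))"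
  have I: "finite I" "I \<noteq> {}" using n by (auto simp: I_def)
  have sb: "slope_bound n \<omega> = (\<Sum>p\<in>I. \<bar>x p \<omega>\<bar>)" for \<omega>
    unfolding slope_bound_def I_def x_def by (simp add: sum.cartesian_product split_beta)
  have G: "gaussian_rv M (x p) (\<integral>r. (slope T n (\<lambda>t. extended_kernel t r) (grid T n (Suc (snd p))))\<^sup>2 \<partial>lborel)" for p
    unfolding x_def by (rule gaussian_path_linear_W[OF path_linear_slope[OF n]])
  have [measurable]: "x p \<in> borel_measurable M" for p using G[of p] by (simp add: gaussian_rv_def)
  show ?thesis
  proof (rule Bochner_Integration.integrable_bound)
    show "integrable M (\<lambda>\<omega>. real (card I) ^ m * (\<Sum>p\<in>I. \<bar>x p \<omega> ^ m\<bar>))"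
      using M.gaussian_rv_moments(1)[OF G] by auto
    show "(\<lambda>\<omega>. slope_bound n \<omega> ^ m) \<in> borel_measurable M" unfolding sb by measurable
    show "AE \<omega> in M. norm (slope_bound n \<omega> ^ m) \<le> norm (real (card I) ^ m * (\<Sum>p\<in>I. \<bar>x p \<omega> ^ m\<bar>))"
    proof (intro AE_I2)
      fix \<omega>
      have "Max ((\<lambda>p. \<bar>x p \<omega>\<bar>) ` I) \<in> (\<lambda>p. \<bar>x p \<omega>\<bar>) ` I" using I by (intro Max_in) auto
      then obtain q where q: "q \<in> I" "\<bar>x q \<omega>\<bar> = Max ((\<lambda>p. \<bar>x p \<omega>\<bar>) ` I)" by auto
      have "slope_bound n \<omega> \<le> real (card I) * \<bar>x q \<omega>\<bar>"
        unfolding sb q(2) using I by (intro sum_bounded_above) auto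
      moreover have "0 \<le> slope_bound n \<omega>" unfolding sb by (intro sum_nonneg) auto
      ultimately have "slope_bound n \<omega> ^ m \<le> (real (card I) * \<bar>x q \<omega>\<bar>) ^ m" by (intro power_mono)
      also have "\<dots> = real (card I) ^ m * \<bar>x q \<omega> ^ m\<bar>" by (simp add: power_mult_distrib power_abs)
      also have "\<dots> \<le> real (card I) ^ m * (\<Sum>p\<in>I. \<bar>x p \<omega> ^ m\<bar>)"
        using q(1) I by (intro mult_left_mono member_le_sum) auto
      finally show "norm (slope_bound n \<omega> ^ m) \<le> norm (real (card I) ^ m * (\<Sum>p\<in>I. \<bar>x p \<omega> ^ m\<bar>))"
        using \<open>0 \<le> slope_bound n \<omega>\<close> by simp
    qed
  qed
qed

text \<open>Fubini's theorem, dominated by a power of the slope bound on the box \<open>[0, T]\<^sup>m\<close>, followed by Wick's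
  formula at each point of the simplex.\<close>
lemma expected_approx_signature:
  assumes n: "n > 0"
  shows "integrable M (approx_signature n m i)"
    and "(\<integral>\<omega>. approx_signature n m i \<omega> \<partial>M) =
      (\<integral>u. indicator (time_simplex m T) u * (\<Sum>\<pi>\<in>compatible_pairings m i. \<Prod>(l, j)\<in>\<pi>. cov_kernel (avg_kernel n) (u l) (u j)) \<partial>Pi\<^sub>M {1..m} (\<lambda>_. lborel))"
proof -
  let ?N = "Pi\<^sub>M {1..m} (\<lambda>_. lborel :: real measure)"
  interpret N: sigma_finite_measure ?N by (rule lborel_product.sigma_finite) simp
  interpret MN: pair_sigma_finite M ?N ..
  define F where "F = (\<lambda>\<omega> u. indicator (time_simplex m T) u * (\<Prod>j\<in>{1..m}. slope T n (\<lambda>t. W t \<omega> $ i j) (u j)))"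
  have Wm: "(\<lambda>\<omega>. W (grid T n l) \<omega> $ c) \<in> borel_measurable M" if "l \<le> n" for l c
    using path_linear_W_measurable[OF path_linear_eval[OF grid_in_interval[OF n that]]] .
  have slm: "(\<lambda>p. slope T n (\<lambda>t. W t (fst p) $ c) (snd p j)) \<in> borel_measurable (M \<Otimes>\<^sub>M ?N)" if j: "j \<in> {1..m}" for j c
  proof -
    have "(\<lambda>p. snd p j) \<in> borel_measurable (M \<Otimes>\<^sub>M ?N)"
      by (rule measurable_compose[OF measurable_snd PiM_component_measurable[OF j]])
    then have "(\<lambda>p. indicator (cell T n l) (snd p j) :: real) \<in> borel_measurable (M \<Otimes>\<^sub>M ?N)" for l
      by (rule measurable_compose) measurable
    then show ?thesis unfolding slope_def
      by (intro borel_measurable_sum borel_measurable_times borel_measurable_diff borel_measurable_const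
          measurable_compose[OF measurable_fst Wm]) auto
  qed
  have indm: "(\<lambda>u. indicator (time_simplex m T) u :: real) \<in> borel_measurable ?N"
    using time_simplex_pred_measurable(1)[of m T] by measurable
  have Fm: "case_prod F \<in> borel_measurable (M \<Otimes>\<^sub>M ?N)"
    unfolding F_def split_beta
    by (intro borel_measurable_times borel_measurable_prod slm measurable_compose[OF measurable_snd indm]) auto
  have Fle: "\<bar>F \<omega> u\<bar> \<le> slope_bound n \<omega> ^ m * indicator (PiE {1..m} (\<lambda>_. {0..T})) u" if u: "u \<in> space ?N" for \<omega> u
  proof (cases "u \<in> time_simplex m T")
    case True
    then have "u \<in> PiE {1..m} (\<lambda>_. {0..T})" using u by (auto simp: time_simplex_def space_PiM PiE_def)
    moreover have "(\<Prod>j\<in>{1..m}. \<bar>slope T n (\<lambda>t. W t \<omega> $ i j) (u j)\<bar>) \<le> (\<Prod>j\<in>{1..m}. slope_bound n \<omega>)"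
      using slope_le_bound by (intro prod_mono) auto
    ultimately show ?thesis using True by (simp add: F_def abs_prod)
  next
    case False
    have "0 \<le> slope_bound n \<omega>" unfolding slope_bound_def by (intro sum_nonneg) auto
    then show ?thesis using False by (simp add: F_def)
  qed
  have Fint: "integrable (M \<Otimes>\<^sub>M ?N) (case_prod F)"
  proof (rule Bochner_Integration.integrable_bound[OF _ Fm])
    let ?box = "PiE {1..m} (\<lambda>_. {0..T})"
    have box: "?box \<in> sets ?N" by (intro sets_PiM_I_finite) auto
    then have ibox: "integrable ?N (indicator ?box :: _ \<Rightarrow> real)"
      using emeasure_time_box[of m T] T by (intro integrable_real_indicator) auto
    have sbm: "(\<lambda>\<omega>. slope_bound n \<omega> ^ m) \<in> borel_measurable M" using slope_bound_integrable by (rule borel_measurable_integrable)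
    have sb0: "0 \<le> slope_bound n \<omega>" for \<omega> unfolding slope_bound_def by (intro sum_nonneg) auto
    define G where "G = (\<lambda>p. slope_bound n (fst p) ^ m * indicator ?box (snd p) :: real)"
    show "integrable (M \<Otimes>\<^sub>M ?N) G"
    proof (rule MN.Fubini_integrable)
      show "G \<in> borel_measurable (M \<Otimes>\<^sub>M ?N)"
        unfolding G_def
        by (intro borel_measurable_times measurable_compose[OF measurable_fst sbm] measurable_compose[OF measurable_snd] borel_measurable_indicator box)
      have "(\<lambda>\<omega>. \<integral>u. norm (G (\<omega>, u)) \<partial>?N) = (\<lambda>\<omega>. slope_bound n \<omega> ^ m * (\<integral>u. indicator ?box u \<partial>?N))"
        using sb0 by (simp add: G_def abs_mult)
      then show "integrable M (\<lambda>\<omega>. \<integral>u. norm (G (\<omega>, u)) \<partial>?N)"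
        by (simp only:) (intro integrable_mult_left impI slope_bound_integrable)
      show "AE \<omega> in M. integrable ?N (\<lambda>u. G (\<omega>, u))"
        using ibox by (simp add: G_def)
    qed
    show "AE p in M \<Otimes>\<^sub>M ?N. norm (case_prod F p) \<le> norm (G p)"
      using Fle sb0 by (intro AE_I2) (auto simp: space_pair_measure G_def abs_mult)
  qed
  have sig: "approx_signature n m i = (\<lambda>\<omega>. \<integral>u. F \<omega> u \<partial>?N)"
    unfolding F_def by (rule ext) (rule approx_signature_eq[OF n])
  show "integrable M (approx_signature n m i)" unfolding sig using MN.integrable_fst[OF Fint] .
  have "(\<integral>\<omega>. approx_signature n m i \<omega> \<partial>M) = (\<integral>u. (\<integral>\<omega>. F \<omega> u \<partial>M) \<partial>?N)"
    unfolding sig using MN.Fubini_integral[OF Fint] by simp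
  also have "\<dots> = (\<integral>u. indicator (time_simplex m T) u * (\<Sum>\<pi>\<in>compatible_pairings m i. \<Prod>(l, j)\<in>\<pi>. cov_kernel (avg_kernel n) (u l) (u j)) \<partial>?N)"
    unfolding F_def integral_mult_right_zero expectation_slopes[OF n] ..
  finally show "(\<integral>\<omega>. approx_signature n m i \<omega> \<partial>M) =
      (\<integral>u. indicator (time_simplex m T) u * (\<Sum>\<pi>\<in>compatible_pairings m i. \<Prod>(l, j)\<in>\<pi>. cov_kernel (avg_kernel n) (u l) (u j)) \<partial>?N)" .
qed

lemma expected_approx_signature_tendsto:
  "(\<lambda>n. \<integral>\<omega>. approx_signature (Suc n) m i \<omega> \<partial>M) \<longlonglongrightarrow>
    (\<Sum>\<pi>\<in>compatible_pairings m i. \<integral>u. indicator (time_simplex m T) u * (\<Prod>(l, j)\<in>\<pi>. cov_kernel k (u l) (u j)) \<partial>Pi\<^sub>M {1..m} (\<lambda>_. lborel))"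
proof -
  let ?N = "Pi\<^sub>M {1..m} (\<lambda>_. lborel :: real measure)"
  have sub: "\<pi> \<in> pairings_on {1..m}" if "\<pi> \<in> compatible_pairings m i" for \<pi>
    using that by (simp add: compatible_pairings_def pairings_eq)
  have int: "integrable ?N (\<lambda>u. indicator (time_simplex m T) u * (\<Prod>(l, j)\<in>\<pi>. cov_kernel (avg_kernel (Suc n)) (u l) (u j)))"
    if "\<pi> \<in> compatible_pairings m i" for \<pi> n
  proof -
    have "(\<integral>\<^sup>+u. \<integral>\<^sup>+v. ennreal \<bar>cov_kernel (avg_kernel (Suc n)) u v\<bar> \<partial>lborel \<partial>lborel) \<le> (\<integral>\<^sup>+r. (k_norm r)\<^sup>2 \<partial>lborel)"
      by (rule nn_integral_cov_kernel_le[OF avg_kernel_measurable avg_kernel_norm_le]) simp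
    also have "\<dots> < \<infinity>" using k_L2 by (simp add: k_norm_def)
    finally show ?thesis
      by (intro tendsto_integral_prod_pairing(1)[OF _ sub[OF that] time_simplex_pred_measurable(1) cov_kernel_measurable[OF avg_kernel_measurable],
            of "\<lambda>_. cov_kernel (avg_kernel (Suc n))"] cov_kernel_measurable[OF avg_kernel_measurable]) auto
  qed
  have "(\<integral>\<omega>. approx_signature (Suc n) m i \<omega> \<partial>M) =
    (\<Sum>\<pi>\<in>compatible_pairings m i. \<integral>u. indicator (time_simplex m T) u * (\<Prod>(l, j)\<in>\<pi>. cov_kernel (avg_kernel (Suc n)) (u l) (u j)) \<partial>?N)" for n
    unfolding expected_approx_signature(2)[OF zero_less_Suc] sum_distrib_left
    by (rule Bochner_Integration.integral_sum[OF int])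
  then show ?thesis
    by (simp only:) (intro tendsto_sum cov_kernel_avg_tendsto(2) sub)
qed

text \<open>By the isometry this bounds the mean square error of the interpolation in each coordinate at all times.\<close>
definition L2_error :: "nat \<Rightarrow> ennreal" where
  "L2_error n = (\<integral>\<^sup>+r. (\<integral>\<^sup>+u. ennreal \<bar>avg_kernel (Suc n) u r - k u r\<bar> \<partial>lborel)\<^sup>2 \<partial>lborel)"

lemma L2_error_tendsto: "L2_error \<longlonglongrightarrow> 0"
proof -
  define e where "e = (\<lambda>n r. \<integral>\<^sup>+u. ennreal \<bar>avg_kernel (Suc n) u r - k u r\<bar> \<partial>lborel)"
  have [measurable]: "e n \<in> borel_measurable borel" for n unfolding e_def by measurable
  have "(\<lambda>n. \<integral>\<^sup>+r. (e n r)\<^sup>2 \<partial>lborel) \<longlonglongrightarrow> (\<integral>\<^sup>+r. 0 \<partial>(lborel :: real measure))"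
  proof (rule nn_integral_dominated_convergence[where w="\<lambda>r. 4 * (k_norm r)\<^sup>2"])
    show "AE r in lborel. (e n r)\<^sup>2 \<le> 4 * (k_norm r)\<^sup>2" for n
    proof (intro AE_I2)
      fix r
      have "e n r \<le> 2 * k_norm r" unfolding e_def by (rule avg_kernel_error_le) simp
      then have "(e n r)\<^sup>2 \<le> (2 * k_norm r)\<^sup>2" by (intro power_mono) auto
      then show "(e n r)\<^sup>2 \<le> 4 * (k_norm r)\<^sup>2" by (simp add: power_mult_distrib)
    qed
    show "(\<integral>\<^sup>+r. 4 * (k_norm r)\<^sup>2 \<partial>lborel) < \<infinity>"
      using k_L2 by (simp add: nn_integral_cmult k_norm_def[symmetric] ennreal_mult_less_top)
    show "AE r in lborel. (\<lambda>n. (e n r)\<^sup>2) \<longlonglongrightarrow> 0"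
    proof (intro AE_I2)
      fix r
      have lim: "(\<lambda>n. e n r) \<longlonglongrightarrow> 0" unfolding e_def by (rule avg_kernel_error_tendsto)
      have "eventually (\<lambda>n. e n r < 1) sequentially" using order_tendstoD(2)[OF lim, of 1] by simp
      then have "eventually (\<lambda>n. (e n r)\<^sup>2 \<le> e n r) sequentially"
      proof eventually_elim
        case (elim n)
        then have "e n r * e n r \<le> 1 * e n r" by (intro mult_right_mono) auto
        then show ?case by (simp add: power2_eq_square)
      qed
      from tendsto_sandwich[OF _ this tendsto_const lim] show "(\<lambda>n. (e n r)\<^sup>2) \<longlonglongrightarrow> 0" by simp
    qed
  qed measurable
  then show ?thesis by (simp add: L2_error_def[abs_def] e_def)
qed

text \<open>The error of the interpolation at time \<open>t\<close> as a functional of the path.\<close>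
definition interpolation_error :: "nat \<Rightarrow> real \<Rightarrow> (real \<Rightarrow> real) \<Rightarrow> real" where
  "interpolation_error n t x = x 0 + (\<integral>u. indicator {0<..t} u * slope T n x u \<partial>lborel) - x t"

lemma interpolation_error_eq:
  assumes "n > 0" "0 \<le> t"
  shows "interpolation_error n t (\<lambda>t. X t $ c) = (pl_interpolation (grid_list T n) X t - X t) $ c"
  using pl_interpolation_grid[OF T assms, of X c] by (simp add: interpolation_error_def)

lemma path_linear_interpolation_error:
  assumes n: "n > 0" and t: "t \<in> {0..T}"
  shows "path_linear (interpolation_error n t)"
proof -
  define s where "s = (\<lambda>l. \<integral>u. indicator {0<..t} u * indicator (cell T n l) u \<partial>lborel :: real)"
  have sint: "integrable lborel (\<lambda>u. indicator {0<..t} u * indicator (cell T n l) u :: real)" for l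
    by (rule integrable_bounded_on_interval[of _ _ 1 0 t]) (auto simp: indicator_def)
  have slope_int: "(\<integral>u. indicator {0<..t} u * slope T n x u \<partial>lborel) =
    (\<Sum>l<n. (s l * (real n / T)) * (1 * x (grid T n (Suc l)) + (-1) * x (grid T n l)))" for x
  proof -
    have "(\<integral>u. indicator {0<..t} u * slope T n x u \<partial>lborel) =
      (\<integral>u. (\<Sum>l<n. ((x (grid T n (Suc l)) - x (grid T n l)) * (real n / T)) * (indicator {0<..t} u * indicator (cell T n l) u)) \<partial>lborel)"
      by (simp only: slope_def sum_distrib_left mult_ac)
    also have "\<dots> = (\<Sum>l<n. ((x (grid T n (Suc l)) - x (grid T n l)) * (real n / T)) * s l)"
      unfolding s_def using sint by (subst Bochner_Integration.integral_sum) auto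
    finally show ?thesis by (simp add: mult_ac)
  qed
  have "path_linear (\<lambda>x. 1 * (1 * x 0 + 1 * (\<Sum>l<n. (s l * (real n / T)) * (1 * x (grid T n (Suc l)) + (-1) * x (grid T n l)))) + (-1) * x t)"
    using t grid_in_interval[OF n] T by (intro path_linear_sum path_linear_combination path_linear_eval) auto
  moreover have "(\<lambda>x. 1 * (1 * x 0 + 1 * (\<Sum>l<n. (s l * (real n / T)) * (1 * x (grid T n (Suc l)) + (-1) * x (grid T n l)))) + (-1) * x t) =
      interpolation_error n t"
    unfolding interpolation_error_def slope_int by simp
  ultimately show ?thesis by simp
qed

text \<open>The error is the Wiener integral of \<open>\<integral> (avg_kernel u r - k u r) du\<close> over \<open>0 < u \<le> t\<close>, and this
  integrand is at most the \<open>L\<^sup>1\<close> error of the averages.\<close>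
lemma interpolation_error_component:
  assumes t: "t \<in> {0..T}"
  shows "(\<integral>\<^sup>+\<omega>. ennreal (((pl_interpolation (grid_list T (Suc n)) (\<lambda>t. W t \<omega>) t - W t \<omega>) $ c)\<^sup>2) \<partial>M) \<le> L2_error n"
proof -
  let ?n = "Suc n"
  define L where "L = interpolation_error ?n t"
  have L: "path_linear L" unfolding L_def by (rule path_linear_interpolation_error[OF zero_less_Suc t])
  have Leq: "L x = x 0 + (\<integral>u. indicator {0<..t} u * slope T ?n x u \<partial>lborel) - x t" for x
    by (simp add: L_def interpolation_error_def)
  have LW: "L (\<lambda>t. W t \<omega> $ c) = (pl_interpolation (grid_list T ?n) (\<lambda>t. W t \<omega>) t - W t \<omega>) $ c" for \<omega>
    unfolding L_def using t by (intro interpolation_error_eq) auto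
  have G: "gaussian_rv M (\<lambda>\<omega>. L (\<lambda>t. W t \<omega> $ c)) (\<integral>r. (L (\<lambda>t. extended_kernel t r))\<^sup>2 \<partial>lborel)"
    by (rule gaussian_path_linear_W[OF L])
  have L2: "integrable lborel (\<lambda>r. (L (\<lambda>t. extended_kernel t r))\<^sup>2)"
    using L unfolding path_linear_def by (intro wiener_integral_gaussian(1)[OF brownian T]) auto
  have LK: "\<bar>L (\<lambda>t. extended_kernel t r)\<bar> = \<bar>\<integral>u. indicator {0<..t} u * (avg_kernel ?n u r - k u r) \<partial>lborel\<bar>" for r
  proof -
    have "integrable lborel (\<lambda>u. avg_kernel ?n u r)"
      using avg_kernel_norm_le[of ?n r] k_integrable[of r]
      by (intro integrableI_bounded) (auto simp: k_norm_def integrable_iff_bounded intro: le_less_trans)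
    from integrable_mult_indicator[OF _ this, of "{0<..t}"] integrable_mult_indicator[OF _ k_integrable[of r], of "{0<..t}"]
    have int: "integrable lborel (\<lambda>u. indicator {0<..t} u * avg_kernel ?n u r)" "integrable lborel (\<lambda>u. indicator {0<..t} u * k u r)"
      by auto
    have "L (\<lambda>t. extended_kernel t r) = (\<integral>u. indicator {0<..t} u * avg_kernel ?n u r \<partial>lborel) - (\<integral>u. indicator {0<..t} u * k u r \<partial>lborel)"
      unfolding Leq slope_extended_kernel[OF zero_less_Suc] by (simp add: extended_kernel_def)
    also have "\<dots> = (\<integral>u. indicator {0<..t} u * (avg_kernel ?n u r - k u r) \<partial>lborel)"
      using int by (simp add: right_diff_distrib)
    finally show ?thesis by simp
  qed
  have "(\<integral>\<^sup>+\<omega>. ennreal (((pl_interpolation (grid_list T ?n) (\<lambda>t. W t \<omega>) t - W t \<omega>) $ c)\<^sup>2) \<partial>M) =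
    (\<integral>\<^sup>+\<omega>. ennreal ((L (\<lambda>t. W t \<omega> $ c))\<^sup>2) \<partial>M)" unfolding LW ..
  also have "\<dots> = ennreal (\<integral>\<omega>. (L (\<lambda>t. W t \<omega> $ c))\<^sup>2 \<partial>M)"
    using M.gaussian_rv_moments(1)[OF G, of 2] by (intro nn_integral_eq_integral) auto
  also have "\<dots> = ennreal (\<integral>r. (L (\<lambda>t. extended_kernel t r))\<^sup>2 \<partial>lborel)" by (simp add: M.gaussian_rv_variance[OF G])
  also have "\<dots> = (\<integral>\<^sup>+r. ennreal ((L (\<lambda>t. extended_kernel t r))\<^sup>2) \<partial>lborel)"
    using L2 by (intro nn_integral_eq_integral[symmetric]) auto
  also have "\<dots> \<le> L2_error n"
    unfolding L2_error_def
  proof (intro nn_integral_mono)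
    fix r
    have "ennreal \<bar>L (\<lambda>t. extended_kernel t r)\<bar> \<le> (\<integral>\<^sup>+u. ennreal \<bar>indicator {0<..t} u * (avg_kernel ?n u r - k u r)\<bar> \<partial>lborel)"
      unfolding LK using nn_integral_abs_diff_integral_le[of lborel "\<lambda>_. 0" "\<lambda>u. indicator {0<..t} u * (avg_kernel ?n u r - k u r)"] by simp
    also have "\<dots> \<le> (\<integral>\<^sup>+u. ennreal \<bar>avg_kernel ?n u r - k u r\<bar> \<partial>lborel)"
      by (intro nn_integral_mono) (auto simp: indicator_def)
    finally have "(ennreal \<bar>L (\<lambda>t. extended_kernel t r)\<bar>)\<^sup>2 \<le> (\<integral>\<^sup>+u. ennreal \<bar>avg_kernel ?n u r - k u r\<bar> \<partial>lborel)\<^sup>2"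
      by (rule power_mono) simp
    then show "ennreal ((L (\<lambda>t. extended_kernel t r))\<^sup>2) \<le> (\<integral>\<^sup>+u. ennreal \<bar>avg_kernel ?n u r - k u r\<bar> \<partial>lborel)\<^sup>2"
      by (simp add: ennreal_power)
  qed
  finally show ?thesis .
qed

lemma interpolation_error_le:
  assumes t: "t \<in> {0..T}"
  shows "(\<integral>\<^sup>+\<omega>. ennreal ((norm (pl_interpolation (grid_list T (Suc n)) (\<lambda>t. W t \<omega>) t - W t \<omega>))\<^sup>2) \<partial>M) \<le> of_nat CARD('d) * L2_error n"
proof -
  let ?d = "\<lambda>\<omega>. pl_interpolation (grid_list T (Suc n)) (\<lambda>t. W t \<omega>) t - W t \<omega>"
  have "(norm x)\<^sup>2 = (\<Sum>c\<in>UNIV. (x $ c)\<^sup>2)" for x :: "real ^ 'd"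
    by (simp add: norm_vec_def L2_set_def sum_nonneg)
  then have "(\<integral>\<^sup>+\<omega>. ennreal ((norm (?d \<omega>))\<^sup>2) \<partial>M) = (\<integral>\<^sup>+\<omega>. (\<Sum>c\<in>UNIV. ennreal ((?d \<omega> $ c)\<^sup>2)) \<partial>M)"
    by (simp only: sum_ennreal zero_le_power2)
  also have "\<dots> = (\<Sum>c\<in>UNIV. \<integral>\<^sup>+\<omega>. ennreal ((?d \<omega> $ c)\<^sup>2) \<partial>M)"
  proof (rule nn_integral_sum)
    fix c
    have "(\<lambda>\<omega>. interpolation_error (Suc n) t (\<lambda>t. W t \<omega> $ c)) \<in> borel_measurable M"
      by (rule path_linear_W_measurable[OF path_linear_interpolation_error[OF zero_less_Suc t]])
    moreover have "interpolation_error (Suc n) t (\<lambda>t. W t \<omega> $ c) = ?d \<omega> $ c" for \<omega>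
      using t by (intro interpolation_error_eq) auto
    ultimately have "(\<lambda>\<omega>. ?d \<omega> $ c) \<in> borel_measurable M" by simp
    then show "(\<lambda>\<omega>. ennreal ((?d \<omega> $ c)\<^sup>2)) \<in> borel_measurable M" by measurable
  qed
  also have "\<dots> \<le> (\<Sum>c\<in>(UNIV :: 'd set). L2_error n)"
    by (intro sum_mono interpolation_error_component[OF t])
  finally show ?thesis by simp
qed

end

section \<open>Passage to the limit\<close>

lemma ennreal_powr_one: "ennreal_powr x 1 = x"
  by (cases x) (auto simp: ennreal_powr_def)

lemma ennreal_powr_mono:
  assumes "x \<le> y" "0 \<le> a"
  shows "ennreal_powr x a \<le> ennreal_powr y a"
proof (cases "y = \<infinity>")
  case False
  then have fin: "y < top" "x \<noteq> \<infinity>" using assms(1) by (auto simp: less_top top_unique)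
  have "enn2real x powr a \<le> enn2real y powr a"
    using assms(2) by (intro powr_mono2 enn2real_mono assms(1) fin(1)) auto
  then show ?thesis using False fin(2) by (simp add: ennreal_powr_def ennreal_leI)
qed (simp add: ennreal_powr_def)

lemma tendsto_ennreal_powr_zero:
  assumes x: "x \<longlonglongrightarrow> 0" and a: "a > 0"
  shows "(\<lambda>n. ennreal_powr (x n) a) \<longlonglongrightarrow> 0"
proof -
  have "(\<lambda>n. enn2real (x n)) \<longlonglongrightarrow> enn2real (ennreal 0)" by (rule tendsto_enn2real) (use x in auto)
  then have "(\<lambda>n. enn2real (x n) powr a) \<longlonglongrightarrow> 0" using a by (intro tendsto_zero_powrI[where b=a]) auto
  then have "(\<lambda>n. ennreal (enn2real (x n) powr a)) \<longlonglongrightarrow> ennreal 0" by (rule tendsto_ennrealI)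
  moreover have "eventually (\<lambda>n. ennreal (enn2real (x n) powr a) = ennreal_powr (x n) a) sequentially"
    using order_tendstoD(2)[OF x, of 1] by (auto elim!: eventually_mono simp: ennreal_powr_def)
  ultimately show ?thesis by (simp add: tendsto_cong)
qed

lemma Lr_norm_one: "Lr_norm M 1 f = (\<integral>\<^sup>+\<omega>. f \<omega> \<partial>M)"
  by (simp add: Lr_norm_def ennreal_powr_one)

lemma Lr_norm_two:
  assumes "\<And>\<omega>. 0 \<le> f \<omega>"
  shows "Lr_norm M 2 (\<lambda>\<omega>. ennreal (f \<omega>)) = ennreal_powr (\<integral>\<^sup>+\<omega>. ennreal ((f \<omega>)\<^sup>2) \<partial>M) (1 / 2)"
  using assms by (simp add: Lr_norm_def ennreal_powr_def)

lemma coefficient_le_level_norm: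
  fixes a :: "'d::finite list \<Rightarrow> real"
  shows "\<bar>a w\<bar> \<le> level_norm (length w) a"
proof -
  have "finite {v :: 'd list. length v = length w}"
    using finite_lists_length_eq[of "UNIV :: 'd set" "length w"] by simp
  then have "(a w)\<^sup>2 \<le> (\<Sum>v | length v = length w. (a v)\<^sup>2)"
    by (intro member_le_sum) auto
  then have "sqrt ((a w)\<^sup>2) \<le> sqrt (\<Sum>v | length v = length w. (a v)\<^sup>2)" by (rule real_sqrt_le_mono)
  then show ?thesis by (simp add: level_norm_def)
qed

text \<open>The partition \<open>{0, T}\<close> contributes the norm of the whole level, in which the two powers cancel.\<close>
lemma coefficient_le_rho_pvar:
  assumes "T > 0" "p > 0" "w \<noteq> []" "length w \<le> N"
  shows "ennreal \<bar>x 0 T w - y 0 T w\<bar> \<le> rho_pvar T p N x y"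
proof -
  let ?a = "\<lambda>w. x 0 T w - y 0 T w"
  let ?F = "\<lambda>k ts. ennreal ((\<Sum>l<length ts - 1.
         level_norm k (\<lambda>w. x (ts ! l) (ts ! Suc l) w - y (ts ! l) (ts ! Suc l) w)
           powr (p / real k)) powr (real k / p))"
  have k: "length w \<in> {1..N}" using assms by (cases w) auto
  have nn: "0 \<le> level_norm (length w) ?a" by (simp add: level_norm_def sum_nonneg)
  have "\<bar>?a w\<bar> \<le> level_norm (length w) ?a" by (rule coefficient_le_level_norm)
  also have "\<dots> = (level_norm (length w) ?a powr (p / real (length w))) powr (real (length w) / p)"
    using assms nn by (simp add: powr_powr)
  finally have "ennreal \<bar>?a w\<bar> \<le> ?F (length w) [0, T]" by (simp add: ennreal_leI)
  also have "\<dots> \<le> (SUP ts\<in>partitions T. ?F (length w) ts)"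
    using assms(1) by (intro SUP_upper) (simp add: partitions_def)
  also have "\<dots> \<le> rho_pvar T p N x y"
    unfolding rho_pvar_def using k by (intro SUP_upper2[of "length w"] order_refl)
  finally show ?thesis .
qed

text \<open>A compatible pairing pairs the positions of each letter among themselves, so it makes their number even.\<close>
lemma compatible_pairings_empty:
  assumes "\<nexists>n. m = 2 * n \<and> i \<in> even_indices (2 * n)"
  shows "compatible_pairings m i = {}"
proof (rule ccontr)
  assume "compatible_pairings m i \<noteq> {}"
  then obtain \<pi> where \<pi>: "\<pi> \<in> pairings_on {1..m}" "\<And>l j. (l, j) \<in> \<pi> \<Longrightarrow> i l = i j"
    by (auto simp: compatible_pairings_def pairings_eq)
  from even_card_pairings_on[OF _ \<pi>(1)] obtain n where n: "m = 2 * n" by auto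
  moreover have "i \<in> even_indices m"
    using even_card_pairing_class[OF _ \<pi>] by (simp add: even_indices_def)
  ultimately show False using assms by auto
qed

context kernel_gaussian_process begin

lemma cov_kernel_eq:
  assumes "a \<in> {0..T}" "b \<in> {0..T}"
  shows "cov_kernel k a b = (LBINT r=0..min b a. kernel_deriv T K b r * kernel_deriv T K a r)"
proof -
  have "cov_kernel k a b = (\<integral>r. indicator {0<..<min b a} r * (k b r * k a r) \<partial>lborel)"
    unfolding cov_kernel_def
  proof (rule integral_cong_AE)
    (* the derivative may be nonzero at r = 0, which the interval integral leaves out *)
    have "AE r in lborel. r \<noteq> (0::real)" by (rule AE_lborel_singleton)
    then show "AE r in lborel. k a r * k b r = indicator {0<..<min b a} r * (k b r * k a r)"
      by eventually_elim (auto simp: k_def triangle_deriv_def indicator_def)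
  qed measurable
  also have "\<dots> = (LBINT r:{0<..<min b a}. kernel_deriv T K b r * kernel_deriv T K a r)"
    unfolding set_lebesgue_integral_def using assms
    by (intro Bochner_Integration.integral_cong refl) (auto simp: k_def triangle_deriv_def indicator_def)
  also have "\<dots> = (LBINT r=0..min b a. kernel_deriv T K b r * kernel_deriv T K a r)"
  proof -
    have "min (ereal b) (ereal a) = ereal (min b a)" by (simp add: min_def)
    then show ?thesis using assms by (simp add: interval_integral_Ioo zero_ereal_def del: ereal_min)
  qed
  finally show ?thesis .
qed

text \<open>The estimate in \<open>gaussian_signature\<close> is applied with \<open>r = 1\<close> and \<open>\<gamma> = 2\<close>: the latter is admissible for
  every \<open>\<rho> < 2\<close>, and \<open>1 - \<rho> / 2\<close> is positive.\<close>
lemma approx_signature_L1: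
  assumes S: "gaussian_signature M T W S" and m: "m \<ge> 1"
  shows "(\<lambda>n. \<integral>\<^sup>+\<omega>. ennreal \<bar>approx_signature (Suc n) m i \<omega> - S \<omega> 0 T (index_word m i)\<bar> \<partial>M) \<longlonglongrightarrow> 0"
proof -
  obtain \<rho> where \<rho>: "1 \<le> \<rho>" "\<rho> < 2" and conv: "\<forall>\<gamma> q N. \<gamma> > \<rho> \<and> 1 / \<gamma> + 1 / \<rho> > 1 \<and> q > 2 * \<gamma> \<longrightarrow>
        (\<exists>C. \<forall>r\<ge>1. \<forall>ts\<in>partitions T.
          Lr_norm M r (\<lambda>\<omega>. rho_pvar T q N
              (path_signature (pl_interpolation ts (\<lambda>t. W t \<omega>))) (S \<omega>))
          \<le> ennreal (C * r powr (real N / 2)) *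
            ennreal_powr (SUP t\<in>{0..T}. Lr_norm M 2 (\<lambda>\<omega>.
              ennreal (norm (pl_interpolation ts (\<lambda>t. W t \<omega>) t - W t \<omega>)))) (1 - \<rho> / \<gamma>))"
    using S by (auto simp: gaussian_signature_def)
  (* q = 5 exceeds twice gamma = 2 *)
  have "2 > \<rho> \<and> 1 / 2 + 1 / \<rho> > 1 \<and> (5::real) > 2 * 2" using \<rho> by (simp add: field_simps)
  with conv obtain C where C: "\<forall>r\<ge>1. \<forall>ts\<in>partitions T.
          Lr_norm M r (\<lambda>\<omega>. rho_pvar T 5 m
              (path_signature (pl_interpolation ts (\<lambda>t. W t \<omega>))) (S \<omega>))
          \<le> ennreal (C * r powr (real m / 2)) *
            ennreal_powr (SUP t\<in>{0..T}. Lr_norm M 2 (\<lambda>\<omega>.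
              ennreal (norm (pl_interpolation ts (\<lambda>t. W t \<omega>) t - W t \<omega>)))) (1 - \<rho> / 2)"
    by blast
  define b where "b = (\<lambda>n. ennreal_powr (of_nat CARD('d) * L2_error n) (1 / 2))"
  define w where "w = index_word m i"
  have w: "w \<noteq> []" "length w \<le> m" using m by (auto simp: w_def index_word_def)
  have upper: "\<forall>n. (\<integral>\<^sup>+\<omega>. ennreal \<bar>approx_signature (Suc n) m i \<omega> - S \<omega> 0 T w\<bar> \<partial>M) \<le> ennreal C * ennreal_powr (b n) (1 - \<rho> / 2)"
  proof
    fix n
    let ?ts = "grid_list T (Suc n)"
    have "(\<integral>\<^sup>+\<omega>. ennreal \<bar>approx_signature (Suc n) m i \<omega> - S \<omega> 0 T w\<bar> \<partial>M) \<le>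
      Lr_norm M 1 (\<lambda>\<omega>. rho_pvar T 5 m (path_signature (pl_interpolation ?ts (\<lambda>t. W t \<omega>))) (S \<omega>))"
      unfolding Lr_norm_one approx_signature_def w_def[symmetric]
      by (intro nn_integral_mono coefficient_le_rho_pvar T w) simp
    also have "\<dots> \<le> ennreal (C * 1 powr (real m / 2)) *
            ennreal_powr (SUP t\<in>{0..T}. Lr_norm M 2 (\<lambda>\<omega>.
              ennreal (norm (pl_interpolation ?ts (\<lambda>t. W t \<omega>) t - W t \<omega>)))) (1 - \<rho> / 2)"
      using C[rule_format, of 1 ?ts] grid_list_partition[OF T, of "Suc n"] by simp
    also have "\<dots> \<le> ennreal (C * 1 powr (real m / 2)) * ennreal_powr (b n) (1 - \<rho> / 2)"
    proof (intro mult_left_mono ennreal_powr_mono SUP_least)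
      fix t assume "t \<in> {0..T}"
      then show "Lr_norm M 2 (\<lambda>\<omega>. ennreal (norm (pl_interpolation ?ts (\<lambda>t. W t \<omega>) t - W t \<omega>))) \<le> b n"
        unfolding b_def by (subst Lr_norm_two) (auto intro!: ennreal_powr_mono interpolation_error_le)
    qed (use \<rho> in auto)
    finally show "(\<integral>\<^sup>+\<omega>. ennreal \<bar>approx_signature (Suc n) m i \<omega> - S \<omega> 0 T w\<bar> \<partial>M) \<le> ennreal C * ennreal_powr (b n) (1 - \<rho> / 2)"
      by simp
  qed
  have "(\<lambda>n. of_nat CARD('d) * L2_error n) \<longlonglongrightarrow> of_nat CARD('d) * 0"
    by (intro ennreal_tendsto_cmult L2_error_tendsto) (simp add: of_nat_less_top)
  then have "b \<longlonglongrightarrow> 0" unfolding b_def by (intro tendsto_ennreal_powr_zero) simp_all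
  then have "(\<lambda>n. ennreal_powr (b n) (1 - \<rho> / 2)) \<longlonglongrightarrow> 0" using \<rho> by (intro tendsto_ennreal_powr_zero) auto
  then have "(\<lambda>n. ennreal C * ennreal_powr (b n) (1 - \<rho> / 2)) \<longlonglongrightarrow> ennreal C * 0" by (intro ennreal_tendsto_cmult) simp
  then have null: "(\<lambda>n. ennreal C * ennreal_powr (b n) (1 - \<rho> / 2)) \<longlonglongrightarrow> 0" by simp
  have lower: "\<forall>n. 0 \<le> (\<integral>\<^sup>+\<omega>. ennreal \<bar>approx_signature (Suc n) m i \<omega> - S \<omega> 0 T w\<bar> \<partial>M)" by simp
  show ?thesis unfolding w_def[symmetric]
    by (rule tendsto_sandwich[OF always_eventually[OF lower] always_eventually[OF upper] tendsto_const null])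
qed

text \<open>The coefficient is the limit in \<open>L\<^sup>1\<close> of the coefficients of the interpolations, so it is integrable and
  its expectation is the limit of theirs.\<close>
lemma expected_signature_formula:
  assumes S: "gaussian_signature M T W S" and m: "m \<ge> 1"
  shows "integrable M (\<lambda>\<omega>. S \<omega> 0 T (index_word m i))"
    and "expected_signature M T S (index_word m i) =
      (\<Sum>\<pi>\<in>compatible_pairings m i. LINT u:time_simplex m T|Pi\<^sub>M {1..m} (\<lambda>_. lborel).
        \<Prod>(l, j)\<in>\<pi>. LBINT r=0..min (u j) (u l). kernel_deriv T K (u j) r * kernel_deriv T K (u l) r)"
proof -
  define s where "s = (\<lambda>\<omega>. S \<omega> 0 T (index_word m i))"
  have sm: "s \<in> borel_measurable M" unfolding s_def
    using S T by (auto simp: gaussian_signature_def)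
  have ai: "integrable M (approx_signature (Suc n) m i)" for n by (rule expected_approx_signature(1)[OF zero_less_Suc])
  have L1: "(\<lambda>n. \<integral>\<^sup>+\<omega>. ennreal \<bar>approx_signature (Suc n) m i \<omega> - s \<omega>\<bar> \<partial>M) \<longlonglongrightarrow> 0"
    unfolding s_def by (rule approx_signature_L1[OF S m])
  have "eventually (\<lambda>n. (\<integral>\<^sup>+\<omega>. ennreal \<bar>approx_signature (Suc n) m i \<omega> - s \<omega>\<bar> \<partial>M) < 1) sequentially"
    by (rule order_tendstoD(2)[OF L1]) simp
  then obtain n where n: "(\<integral>\<^sup>+\<omega>. ennreal \<bar>approx_signature (Suc n) m i \<omega> - s \<omega>\<bar> \<partial>M) < 1"
    by (auto simp: eventually_sequentially)
  have "integrable M (\<lambda>\<omega>. approx_signature (Suc n) m i \<omega> - s \<omega>)"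
  proof (rule integrableI_bounded)
    show "(\<lambda>\<omega>. approx_signature (Suc n) m i \<omega> - s \<omega>) \<in> borel_measurable M"
      using ai[of n] sm by (intro borel_measurable_diff) auto
    show "(\<integral>\<^sup>+\<omega>. ennreal (norm (approx_signature (Suc n) m i \<omega> - s \<omega>)) \<partial>M) < \<infinity>"
      using less_trans[OF n ennreal_one_less_top] by simp
  qed
  from Bochner_Integration.integrable_diff[OF ai[of n] this] show int: "integrable M (\<lambda>\<omega>. S \<omega> 0 T (index_word m i))"
    by (simp add: s_def)
  have upper: "\<forall>n. ennreal \<bar>(\<integral>\<omega>. approx_signature (Suc n) m i \<omega> \<partial>M) - (\<integral>\<omega>. s \<omega> \<partial>M)\<bar> \<le> (\<integral>\<^sup>+\<omega>. ennreal \<bar>approx_signature (Suc n) m i \<omega> - s \<omega>\<bar> \<partial>M)"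
    by (intro allI nn_integral_abs_diff_integral_le ai sm)
  have lower: "\<forall>n. 0 \<le> ennreal \<bar>(\<integral>\<omega>. approx_signature (Suc n) m i \<omega> \<partial>M) - (\<integral>\<omega>. s \<omega> \<partial>M)\<bar>" by simp
  have "(\<lambda>n. ennreal \<bar>(\<integral>\<omega>. approx_signature (Suc n) m i \<omega> \<partial>M) - (\<integral>\<omega>. s \<omega> \<partial>M)\<bar>) \<longlonglongrightarrow> 0"
    by (rule tendsto_sandwich[OF always_eventually[OF lower] always_eventually[OF upper] tendsto_const L1])
  then have "(\<lambda>n. ennreal \<bar>(\<integral>\<omega>. approx_signature (Suc n) m i \<omega> \<partial>M) - (\<integral>\<omega>. s \<omega> \<partial>M)\<bar>) \<longlonglongrightarrow> ennreal 0" by simp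
  then have "(\<lambda>n. \<bar>(\<integral>\<omega>. approx_signature (Suc n) m i \<omega> \<partial>M) - (\<integral>\<omega>. s \<omega> \<partial>M)\<bar>) \<longlonglongrightarrow> 0"
    by (rule tendsto_ennrealD) auto
  then have "(\<lambda>n. (\<integral>\<omega>. approx_signature (Suc n) m i \<omega> \<partial>M) - (\<integral>\<omega>. s \<omega> \<partial>M)) \<longlonglongrightarrow> 0" by (rule tendsto_rabs_zero_cancel)
  then have "(\<lambda>n. \<integral>\<omega>. approx_signature (Suc n) m i \<omega> \<partial>M) \<longlonglongrightarrow> (\<integral>\<omega>. s \<omega> \<partial>M)" by (simp only: Lim_null[symmetric])
  then have "(\<integral>\<omega>. s \<omega> \<partial>M) =
    (\<Sum>\<pi>\<in>compatible_pairings m i. \<integral>u. indicator (time_simplex m T) u * (\<Prod>(l, j)\<in>\<pi>. cov_kernel k (u l) (u j)) \<partial>Pi\<^sub>M {1..m} (\<lambda>_. lborel))"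
    using expected_approx_signature_tendsto by (rule LIMSEQ_unique)
  also have "\<dots> = (\<Sum>\<pi>\<in>compatible_pairings m i. LINT u:time_simplex m T|Pi\<^sub>M {1..m} (\<lambda>_. lborel).
        \<Prod>(l, j)\<in>\<pi>. LBINT r=0..min (u j) (u l). kernel_deriv T K (u j) r * kernel_deriv T K (u l) r)"
    unfolding set_lebesgue_integral_def
  proof (rule sum.cong[OF refl], rule Bochner_Integration.integral_cong[OF refl])
    fix \<pi> :: "(nat \<times> nat) set" and u :: "nat \<Rightarrow> real"
    assume \<pi>: "\<pi> \<in> compatible_pairings m i"
    show "indicator (time_simplex m T) u * (\<Prod>(l, j)\<in>\<pi>. cov_kernel k (u l) (u j)) =
      indicator (time_simplex m T) u *\<^sub>R (\<Prod>(l, j)\<in>\<pi>. LBINT r=0..min (u j) (u l). kernel_deriv T K (u j) r * kernel_deriv T K (u l) r)"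
    proof (cases "u \<in> time_simplex m T")
      case True
      have "(\<Prod>(l, j)\<in>\<pi>. cov_kernel k (u l) (u j)) =
        (\<Prod>(l, j)\<in>\<pi>. LBINT r=0..min (u j) (u l). kernel_deriv T K (u j) r * kernel_deriv T K (u l) r)"
      proof (rule prod.cong[OF refl])
        fix p assume "p \<in> \<pi>"
        moreover obtain l j where p: "p = (l, j)" by fastforce
        ultimately have "l \<in> {1..m}" "j \<in> {1..m}" using \<pi> by (auto simp: compatible_pairings_def pairings_def)
        then have "u l \<in> {0..T}" "u j \<in> {0..T}" using True by (auto simp: time_simplex_def)
        from cov_kernel_eq[OF this] show "(case p of (l, j) \<Rightarrow> cov_kernel k (u l) (u j)) =
          (case p of (l, j) \<Rightarrow> LBINT r=0..min (u j) (u l). kernel_deriv T K (u j) r * kernel_deriv T K (u l) r)"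
          by (simp add: p)
      qed
      then show ?thesis by simp
    qed simp
  qed
  finally show "expected_signature M T S (index_word m i) =
      (\<Sum>\<pi>\<in>compatible_pairings m i. LINT u:time_simplex m T|Pi\<^sub>M {1..m} (\<lambda>_. lborel).
        \<Prod>(l, j)\<in>\<pi>. LBINT r=0..min (u j) (u l). kernel_deriv T K (u j) r * kernel_deriv T K (u l) r)"
    by (simp add: expected_signature_def s_def)
qed

end

theorem theorem2:
  fixes T :: real
    and K :: "real \<Rightarrow> real \<Rightarrow> real"
    and P :: "'b measure" and B V :: "real \<Rightarrow> 'b \<Rightarrow> real"
    and M :: "'a measure" and W :: "real \<Rightarrow> 'a \<Rightarrow> real ^ 'd::finite"
    and S :: "'a \<Rightarrow> real \<Rightarrow> real \<Rightarrow> 'd list \<Rightarrow> real"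
    and k :: nat and i :: "nat \<Rightarrow> 'd"
  assumes "T > 0"
    and "strictly_regular_kernel T K"
    and "kernel_process P T K B V"
    and "iid_copies M T W P V"
    and "gaussian_signature M T W S"
    and "k \<ge> 1"
  shows "integrable M (\<lambda>\<omega>. S \<omega> 0 T (index_word k i)) \<and>
    (\<forall>n. k = 2 * n \<and> i \<in> even_indices (2 * n) \<longrightarrow>
      expected_signature M T S (index_word k i) =
        (\<Sum>\<pi>\<in>compatible_pairings (2 * n) i.
          LINT u:time_simplex (2 * n) T|Pi\<^sub>M {1..2 * n} (\<lambda>_. lborel).
            \<Prod>(l, j)\<in>\<pi>. LBINT r=0..min (u j) (u l).
              kernel_deriv T K (u j) r * kernel_deriv T K (u l) r)) \<and>
    ((\<nexists>n. k = 2 * n \<and> i \<in> even_indices (2 * n)) \<longrightarrow>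
      expected_signature M T S (index_word k i) = 0)"
proof -
  have process: "kernel_gaussian_process T K P B V M W"
    using assms(1-4) by unfold_locales
  note formula = kernel_gaussian_process.expected_signature_formula[OF process assms(5,6)]
  show ?thesis
  proof (intro conjI allI impI)
    show "integrable M (\<lambda>\<omega>. S \<omega> 0 T (index_word k i))" by (rule formula(1))
  next
    fix n assume "k = 2 * n \<and> i \<in> even_indices (2 * n)"
    then have k: "k = 2 * n" by simp
    show "expected_signature M T S (index_word k i) =
        (\<Sum>\<pi>\<in>compatible_pairings (2 * n) i.
          LINT u:time_simplex (2 * n) T|Pi\<^sub>M {1..2 * n} (\<lambda>_. lborel).
            \<Prod>(l, j)\<in>\<pi>. LBINT r=0..min (u j) (u l).
              kernel_deriv T K (u j) r * kernel_deriv T K (u l) r)"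
      using formula(2)[of i] unfolding k .
  next
    assume "\<nexists>n. k = 2 * n \<and> i \<in> even_indices (2 * n)"
    from compatible_pairings_empty[OF this] show "expected_signature M T S (index_word k i) = 0"
      unfolding formula(2) by simp
  qed
qed

end
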